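(* Let $r\le s\le t\le T$ and $y\in\mathbb R^n$. Let $\Theta$ satisfy the hypothesis recalled in the context and have the Feller property, let $\Gamma$ be a multivalued Borel mapping, let $\mathcal Q=\{Q^\gamma_{r,y}:\gamma\in\Theta(\Gamma)^r_T\}$ be the stable set of probability measures generated by $\Theta(\Gamma)$ and let $(\alpha_{s,t})$ be a Feller penalty on $\mathcal Q$. Let $(\hat{\mathcal H}^r_t)_t$ be either $(\hat{\mathcal W}^r_t)_t$ or $(\hat{\mathcal L}_t)_t$. For $Y\in\hat{\mathcal H}^r_t$ let $$\Pi^{r,y}_{s,t}(Y)=\sup_{Q^\gamma_{r,y}\in\mathcal Q}\big(T^\gamma_s(Y)-\alpha_{s,t}(Q^\gamma_{r,y})\big).$$ 1. For all $Y\in\hat{\mathcal H}^r_t$, $\Pi^{r,y}_{s,t}(Y)$ belongs to $\hat{\mathcal H}^r_s$. Moreover for all $s\in[r,t]$ there is a sequence $Q_m=Q^{\gamma_m}_{r,y}$ in $\mathcal Q$, $\gamma_m\in\Theta(\Gamma)^r_t$, such that $T^{\gamma_m}_s(Y)-\alpha_{s,t}(Q^{\gamma_m}_{r,y})$ belongs to $\hat{\mathcal H}^r_s$ and such that $\Pi^{r,y}_{s,t}(Y)$ is the increasing limit $$\Pi^{r,y}_{s,t}(Y)=\lim_{m\to\infty}\big[T^{\gamma_m}_s(Y)-\alpha_{s,t}(Q^{\gamma_m}_{r,y})\big].$$ 2. $\Pi^{r,y}_{s,t}$ is a convex monotone map, continuous from below, on $\hat{\mathcal H}^r_t$ with values in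 $\hat{\mathcal H}^r_s$. 3. For all $r\le s\le t\le u$ $(\le T)$ and all $Y\in\hat{\mathcal H}^r_u$, $\Pi^{r,y}_{s,u}(Y)=\Pi^{r,y}_{s,t}\big(\Pi^{r,y}_{t,u}(Y)\big)$. 4. In the case $\hat{\mathcal H}^r_t=\hat{\mathcal L}_t$, the sequence $(\gamma_m)$ of 1. can be chosen independently of $r$.
   Context: Fix $n\ge1$ and a finite horizon $T>0$. For $0\le r\le t\le T$, $\Omega^r_t$ denotes either (for all $r,t$) the space $C([r,t],\mathbb R^n)$ of continuous paths with the topology of uniform convergence, or (for all $r,t$) the space $D([r,t],\mathbb R^n)$ of càdlàg paths with the Skorokhod topology; $\Omega^r=\Omega^r_T$; $X_u(\omega)=\omega(u)$; $\mathcal B^r_t$ is the $\sigma$-algebra generated by $X_u$, $r\le u\le t$. Functions of the path on a smaller interval are regarded as functions on larger path spaces through restriction of paths. A martingale problem is a family $Z=(Z^k)_{k\in I}$ of real processes $Z^k=(Z^k_{r,t})_{0\le r\le t\le T}$ on path space. It is additive if $Z^k_{r,s}$ is $\mathcal B^r_s$-measurable, right continuous in $s$, and $Z^k_{r,t}=Z^k_{r,s}+Z^k_{s,t}$ for $r\le s\le t$; it is bounded if every $Z^k_{r,t}$ is bounded. A probability measure $Q$ on $(\Omega^r_t,\mathcal B^r_t)$ is a solution to $Z$ starting from $y$ at time $r$ if $Q(X_r=y)=1$ and for every $k$, $(Z^k_{r,u})_{r\le u\le t}$ is a $Q$-martingale for $(\mathcal B^r_u)_u$. Hypothesis on $\Theta$: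 $\Theta$ is a set of Borel maps on $\mathbb R_+\times\mathbb R^n$ with values in a topological space $E$; to each $\theta\in\Theta$ is associated an additive bounded martingale problem $Z^\theta=(Z^{\theta,k})_{k\in I}$ (same $I$ for all $\theta$) such that (1) for all $\theta\in\Theta$, $0\le r<t\le T$, $y\in\mathbb R^n$ there is a unique solution $Q^\theta_{r,y}$ on $(\Omega^r_t,\mathcal B^r_t)$ to $Z^\theta$ starting from $y$ at time $r$; (2) for all $\theta\in\Theta$ and $r<T$, $y\mapsto Q^\theta_{r,y}$ is weakly continuous. $\Theta$ has the Feller property if for all $\theta\in\Theta$, $s\le t$ and $f$ continuous bounded on $\mathbb R^n$, $x\mapsto Q^\theta_{s,x}(f(X_t))$ is continuous. A multivalued Borel mapping $\Gamma$ from $\mathbb R_+\times\mathbb R^n$ into $E$ assigns to each $(t,x)$, in a Borel measurable way, a subset $\Gamma(t,x)$ of $E$ containing $0$; $\Theta(\Gamma)=\{\theta\in\Theta:\theta(t,x)\in\Gamma(t,x)\ \forall(t,x)\}$. $\Theta(\Gamma)^r_t$ is the set of predictable $E$-valued processes $\gamma$ on $\Omega^r$ (for the filtration $(\mathcal B^r_u)_u$) for which there are a finite subdivision $r=s_0<\dots<s_N=t$, finite sets $I_i$ with $I_0=\{1\}$, finite partitions $(A_{i,j})_{j\in I_i}$ of $\Omega^r$ into $\mathcal B^r_{s_i}$-measurable sets, and $\theta_{i,j}\in\Theta(\Gamma)$ with $\gamma(u,\omega)=\sum_{j\in I_i}\theta_{i,j}(u,X_u(\omega))1_{A_{i,j}}(\omega)$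 for $s_i\le u<s_{i+1}$ (only values on $[s,t[$ matter for $T_s$ of $\mathcal B^r_t$-measurable functions and for $\alpha_{s,t}$). $Z^\gamma$ is the additive family determined by $Z^{\gamma,k}_{s_i,u}=\sum_{j\in I_i}Z^{\theta_{i,j},k}_{s_i,u}1_{A_{i,j}}$ for $s_i\le u\le s_{i+1}$; $Q^\gamma_{r,y}$ is the unique solution to $Z^\gamma$ starting from $y$ at time $r$. Canonical conditional expectations: for $\theta\in\Theta$, $s<T$, $\psi$ bounded $\mathcal B^r_T$-measurable, $T^\theta_s(\psi)(\omega)=\int_{\Omega^s_T}\psi(i(\omega_{|[r,s]},\omega'))\,dQ^\theta_{s,X_s(\omega)}(\omega')$, where $i(\omega,\omega')(u)=\omega(u)$ for $r\le u\le s$ and $\omega'(u)+\omega(s)-\omega'(s)$ for $s\le u\le T$. For $\gamma\in\Theta(\Gamma)^r_T$: $T^\gamma_T=\mathrm{id}$ and, for $s_i\le s<s_{i+1}$, $T^\gamma_s(\psi)=\sum_{j\in I_i}1_{A_{i,j}}T^{\theta_{i,j}}_s(T^\gamma_{s_{i+1}}(\psi))$. For $\psi$ measurable bounded from below, $T^\gamma_s(\psi)=\lim_mT^\gamma_s(\psi\wedge m)$. Write $T^Q_s=T^\gamma_s$ if $Q=Q^\gamma_{r,y}$. Penalty on $\mathcal Q$: a family $(\alpha_{s,t}(Q))_{r\le s\le t\le T,\,Q\in\mathcal Q}$ of $\mathcal B^r_s$-measurable functions on $\Omega^r$, bounded from above, such that (local) for $\gamma,\eta\in\Theta(\Gamma)^r_T$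 and $A\in\mathcal B^r_s$, if $1_A\gamma(u,\cdot)=1_A\eta(u,\cdot)$ for all $u\in[s,t[$ then $1_A\alpha_{s,t}(Q^\gamma_{r,y})=1_A\alpha_{s,t}(Q^\eta_{r,y})$; (cocycle) $\alpha_{s,u}(Q)=\alpha_{s,t}(Q)-T^Q_s(-\alpha_{t,u}(Q))$ for all $Q\in\mathcal Q$, $r\le s\le t\le u\le T$. It is a Feller penalty if for all $\theta\in\Theta(\Gamma)$ there are continuous functions $\beta^\theta_{s,t}$ on $\mathbb R^n$ with $\alpha_{s,t}(Q^\theta_{r,y})=\beta^\theta_{s,t}(X_s)$. $\hat{\mathcal W}^r_t$ is the set of functions $f(X_{t_1},\dots,X_{t_k})$, $k\ge1$, $r\le t_1<\dots<t_k\le t$, $f$ lower semicontinuous bounded from below on $(\mathbb R^n)^k$; $\hat{\mathcal L}_t$ is the set of $f(X_t)$, $f$ lower semicontinuous bounded from below on $\mathbb R^n$.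
   Formalization: For s=r the increasing limit in 1 is claimed, for each x, on paths with X_r=x, with a sequence that may depend on x; on càdlàg paths "predictable" is read as progressively measurable; Θ(Γ) is assumed nonempty; 4 concerns penalties at different r sharing the same β. *)

theory Defs
  imports "HOL-Probability.Probability"
begin

text \<open>
  A path on \<open>[r,t]\<close> is a function that is \<^const>\<open>extensional\<close> on \<open>{r..t}\<close>, so that two paths
  are equal iff they agree on \<open>[r,t]\<close>, and \<open>restrict \<omega> {a..b}\<close> is restriction of paths.
\<close>

datatype path_kind = Continuous | Cadlag

type_synonym 'n path = "real \<Rightarrow> real ^ 'n"

definition cadlag_on :: "real \<Rightarrow> real \<Rightarrow> 'n::finite path \<Rightarrow> bool" where
  "cadlag_on r t \<omega> \<longleftrightarrow>
     (\<forall>u\<in>{r..<t}. (\<omega> \<longlongrightarrow> \<omega> u) (at_right u)) \<and>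
     (\<forall>u\<in>{r<..t}. \<exists>l. (\<omega> \<longlongrightarrow> l) (at_left u))"

fun paths :: "path_kind \<Rightarrow> real \<Rightarrow> real \<Rightarrow> 'n::finite path set" where
  "paths Continuous r t = {\<omega> \<in> extensional {r..t}. continuous_on {r..t} \<omega>}"
| "paths Cadlag r t = {\<omega> \<in> extensional {r..t}. cadlag_on r t \<omega>}"

text \<open>
  Uniform closeness, respectively closeness up to a time change of size less than \<open>e\<close>; the latter
  describes the balls of the Skorokhod (J1) metric.
\<close>

fun path_close :: "path_kind \<Rightarrow> real \<Rightarrow> real \<Rightarrow> real \<Rightarrow> 'n::finite path \<Rightarrow> 'n path \<Rightarrow> bool" where
  "path_close Continuous r t e \<omega> \<omega>' \<longleftrightarrow> (\<forall>u\<in>{r..t}. dist (\<omega> u) (\<omega>' u) < e)"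
| "path_close Cadlag r t e \<omega> \<omega>' \<longleftrightarrow>
     (\<exists>l. strict_mono_on {r..t} l \<and> continuous_on {r..t} l \<and> l ` {r..t} = {r..t} \<and>
          (\<forall>u\<in>{r..t}. \<bar>l u - u\<bar> < e \<and> dist (\<omega> (l u)) (\<omega>' u) < e))"

definition path_topology :: "path_kind \<Rightarrow> real \<Rightarrow> real \<Rightarrow> 'n::finite path topology" where
  "path_topology kd r t = topology (\<lambda>U. U \<subseteq> paths kd r t \<and>
     (\<forall>\<omega>\<in>U. \<exists>e>0. \<forall>\<omega>'\<in>paths kd r t. path_close kd r t e \<omega> \<omega>' \<longrightarrow> \<omega>' \<in> U))"

lemma path_close_mono: "path_close kd r t d \<omega> \<omega>' \<Longrightarrow> d \<le> e \<Longrightarrow> path_close kd r t e \<omega> \<omega>'"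
  by (cases kd) fastforce+

lemma openin_path_topology:
  "openin (path_topology kd r t) U \<longleftrightarrow> U \<subseteq> paths kd r t \<and>
     (\<forall>\<omega>\<in>U. \<exists>e>0. \<forall>\<omega>'\<in>paths kd r t. path_close kd r t e \<omega> \<omega>' \<longrightarrow> \<omega>' \<in> U)"
proof -
  have "istopology (\<lambda>U. U \<subseteq> paths kd r t \<and>
     (\<forall>\<omega>\<in>U. \<exists>e>0. \<forall>\<omega>'\<in>paths kd r t. path_close kd r t e \<omega> \<omega>' \<longrightarrow> \<omega>' \<in> U))"
    (is "istopology ?P")
    unfolding istopology_def
  proof (intro conjI allI impI)
    fix S V assume S: "?P S" and V: "?P V"
    show "S \<inter> V \<subseteq> paths kd r t" using S by blast
    show "\<forall>\<omega>\<in>S \<inter> V. \<exists>e>0. \<forall>\<omega>'\<in>paths kd r t. path_close kd r t e \<omega> \<omega>' \<longrightarrow> \<omega>' \<in> S \<inter> V"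
    proof
      fix \<omega> assume "\<omega> \<in> S \<inter> V"
      then obtain d e where
        d: "d > 0" "\<forall>\<omega>'\<in>paths kd r t. path_close kd r t d \<omega> \<omega>' \<longrightarrow> \<omega>' \<in> S" and
        e: "e > 0" "\<forall>\<omega>'\<in>paths kd r t. path_close kd r t e \<omega> \<omega>' \<longrightarrow> \<omega>' \<in> V"
        using S V by blast
      have "\<forall>\<omega>'\<in>paths kd r t. path_close kd r t (min d e) \<omega> \<omega>' \<longrightarrow> \<omega>' \<in> S \<inter> V"
        using d(2) e(2) path_close_mono[of kd r t "min d e" \<omega>] by (metis IntI min.cobounded1 min.cobounded2)
      then show "\<exists>e>0. \<forall>\<omega>'\<in>paths kd r t. path_close kd r t e \<omega> \<omega>' \<longrightarrow> \<omega>' \<in> S \<inter> V"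
        using d(1) e(1) by (intro exI[of _ "min d e"]) auto
    qed
  next
    fix \<K> assume K: "\<forall>K\<in>\<K>. ?P K"
    show "\<Union> \<K> \<subseteq> paths kd r t" using K by blast
    show "\<forall>\<omega>\<in>\<Union> \<K>. \<exists>e>0. \<forall>\<omega>'\<in>paths kd r t. path_close kd r t e \<omega> \<omega>' \<longrightarrow> \<omega>' \<in> \<Union> \<K>"
      using K by (meson UnionE UnionI)
  qed
  from fun_cong[OF topology_inverse'[OF this], of U] show ?thesis
    unfolding path_topology_def .
qed

text \<open>\<open>path_filt kd r t u\<close> is \<open>\<B>\<^sup>r\<^sub>u\<close> on the path space \<open>\<Omega>\<^sup>r\<^sub>t\<close>, for \<open>r \<le> u \<le> t\<close>.\<close>

definition path_filt :: "path_kind \<Rightarrow> real \<Rightarrow> real \<Rightarrow> real \<Rightarrow> 'n::finite path measure" where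
  "path_filt kd r t u = sigma (paths kd r t)
     {(\<lambda>\<omega>. \<omega> v) -` B \<inter> paths kd r t | v B. v \<in> {r..u} \<and> B \<in> sets borel}"

definition is_martingale ::
  "'a measure \<Rightarrow> (real \<Rightarrow> 'a measure) \<Rightarrow> real set \<Rightarrow> (real \<Rightarrow> 'a \<Rightarrow> real) \<Rightarrow> bool" where
  "is_martingale Q F J M \<longleftrightarrow>
     (\<forall>u\<in>J. M u \<in> borel_measurable (F u) \<and> integrable Q (M u)) \<and>
     (\<forall>u\<in>J. \<forall>v\<in>J. u \<le> v \<longrightarrow> (AE \<omega> in Q. real_cond_exp Q (F u) (M v) \<omega> = M u \<omega>))"

text \<open>
  \<open>Z k r t\<close> is a function on \<open>\<Omega>\<^sup>r\<^sub>t\<close>; as a function on a larger path space it is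
  \<open>\<lambda>\<omega>. Z k r t (restrict \<omega> {r..t})\<close>.
\<close>

type_synonym ('k, 'n) mart_problem = "'k \<Rightarrow> real \<Rightarrow> real \<Rightarrow> 'n path \<Rightarrow> real"

definition additive_problem ::
  "path_kind \<Rightarrow> real \<Rightarrow> 'k set \<Rightarrow> ('k, 'n::finite) mart_problem \<Rightarrow> bool" where
  "additive_problem kd T K Z \<longleftrightarrow> (\<forall>k\<in>K.
     (\<forall>r s. 0 \<le> r \<and> r \<le> s \<and> s \<le> T \<longrightarrow> Z k r s \<in> borel_measurable (path_filt kd r s s)) \<and>
     (\<forall>r s. 0 \<le> r \<and> r \<le> s \<and> s < T \<longrightarrow> (\<forall>\<omega>\<in>paths kd r T.
        ((\<lambda>u. Z k r u (restrict \<omega> {r..u})) \<longlongrightarrow> Z k r s (restrict \<omega> {r..s})) (at_right s))) \<and>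
     (\<forall>r s t. 0 \<le> r \<and> r \<le> s \<and> s \<le> t \<and> t \<le> T \<longrightarrow> (\<forall>\<omega>\<in>paths kd r t.
        Z k r t \<omega> = Z k r s (restrict \<omega> {r..s}) + Z k s t (restrict \<omega> {s..t}))))"

definition bounded_problem ::
  "path_kind \<Rightarrow> real \<Rightarrow> 'k set \<Rightarrow> ('k, 'n::finite) mart_problem \<Rightarrow> bool" where
  "bounded_problem kd T K Z \<longleftrightarrow>
     (\<forall>k\<in>K. \<forall>r t. 0 \<le> r \<and> r \<le> t \<and> t \<le> T \<longrightarrow> (\<exists>c. \<forall>\<omega>\<in>paths kd r t. \<bar>Z k r t \<omega>\<bar> \<le> c))"

text \<open>
  In \<open>is_solution kd K r t y M Q\<close> the family \<open>M k u\<close> stands for the processes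
  \<open>(Z\<^sup>k\<^bsub>r,u\<^esub>)\<close>, \<open>r \<le> u \<le> t\<close>, as functions on \<open>\<Omega>\<^sup>r\<^sub>t\<close>.
\<close>

definition is_solution ::
  "path_kind \<Rightarrow> 'k set \<Rightarrow> real \<Rightarrow> real \<Rightarrow> real ^ 'n::finite \<Rightarrow>
   ('k \<Rightarrow> real \<Rightarrow> 'n path \<Rightarrow> real) \<Rightarrow> 'n path measure \<Rightarrow> bool" where
  "is_solution kd K r t y M Q \<longleftrightarrow>
     prob_space Q \<and> sets Q = sets (path_filt kd r t t) \<and>
     measure Q {\<omega> \<in> space Q. \<omega> r = y} = 1 \<and>
     (\<forall>k\<in>K. is_martingale Q (path_filt kd r t) {r..t} (M k))"

definition problem_from ::
  "('k, 'n::finite) mart_problem \<Rightarrow> real \<Rightarrow> 'k \<Rightarrow> real \<Rightarrow> 'n path \<Rightarrow> real" where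
  "problem_from Z r k u \<omega> = Z k r u (restrict \<omega> {r..u})"

definition law ::
  "path_kind \<Rightarrow> 'k set \<Rightarrow> ('k, 'n::finite) mart_problem \<Rightarrow> real \<Rightarrow> real \<Rightarrow> real ^ 'n \<Rightarrow>
   'n path measure" where
  "law kd K Z r t y = (THE Q. is_solution kd K r t y (problem_from Z r) Q)"

type_synonym ('n, 'e) bmap = "real \<times> (real ^ 'n) \<Rightarrow> 'e"

definition Theta_hypothesis ::
  "path_kind \<Rightarrow> real \<Rightarrow> 'k set \<Rightarrow> ('n::finite, 'e::topological_space) bmap set \<Rightarrow>
   (('n, 'e) bmap \<Rightarrow> ('k, 'n) mart_problem) \<Rightarrow> bool" where
  "Theta_hypothesis kd T K \<Theta> Z \<longleftrightarrow> (\<forall>\<theta>\<in>\<Theta>.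
     \<theta> \<in> extensional ({0..} \<times> UNIV) \<and>
     \<theta> \<in> borel_measurable (restrict_space borel ({0..} \<times> UNIV)) \<and>
     additive_problem kd T K (Z \<theta>) \<and> bounded_problem kd T K (Z \<theta>) \<and>
     (\<forall>r t y. 0 \<le> r \<and> r < t \<and> t \<le> T \<longrightarrow>
        (\<exists>!Q. is_solution kd K r t y (problem_from (Z \<theta>) r) Q)) \<and>
     (\<forall>r f. 0 \<le> r \<and> r < T \<and> continuous_map (path_topology kd r T) euclideanreal f \<and>
        bounded (f ` paths kd r T) \<longrightarrow>
        continuous_on UNIV (\<lambda>y. \<integral>\<omega>. f \<omega> \<partial>law kd K (Z \<theta>) r T y)))"

definition Feller_property ::
  "path_kind \<Rightarrow> real \<Rightarrow> 'k set \<Rightarrow> ('n::finite, 'e) bmap set \<Rightarrow>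
   (('n, 'e) bmap \<Rightarrow> ('k, 'n) mart_problem) \<Rightarrow> bool" where
  "Feller_property kd T K \<Theta> Z \<longleftrightarrow>
     (\<forall>\<theta>\<in>\<Theta>. \<forall>s t. \<forall>f :: real ^ 'n \<Rightarrow> real.
        0 \<le> s \<and> s \<le> t \<and> t \<le> T \<and> continuous_on UNIV f \<and> bounded (range f) \<longrightarrow>
        continuous_on UNIV (\<lambda>x. \<integral>\<omega>. f (\<omega> t) \<partial>law kd K (Z \<theta>) s T x))"

definition multivalued_Borel ::
  "(real \<times> (real ^ 'n::finite) \<Rightarrow> 'e::{topological_space, zero} set) \<Rightarrow> bool" where
  "multivalued_Borel \<Gamma> \<longleftrightarrow>
     (\<forall>p \<in> {0..} \<times> UNIV. 0 \<in> \<Gamma> p) \<and>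
     (\<forall>U. open U \<longrightarrow> {p \<in> {0..} \<times> UNIV. \<Gamma> p \<inter> U \<noteq> {}} \<in> sets borel)"

definition Theta_of ::
  "('n::finite, 'e) bmap set \<Rightarrow> (real \<times> (real ^ 'n) \<Rightarrow> 'e set) \<Rightarrow> ('n, 'e) bmap set" where
  "Theta_of \<Theta> \<Gamma> = {\<theta> \<in> \<Theta>. \<forall>p \<in> {0..} \<times> UNIV. \<theta> p \<in> \<Gamma> p}"

text \<open>
  An element of \<open>\<Theta>(\<Gamma>)\<^sup>r\<^sub>t\<close>, i.e. a process \<open>proc\<close> together with a decomposition that exhibits it
  as such an element: subdivision points \<open>node 0 < \<dots> < node steps\<close>, finite index sets \<open>idx i\<close>,
  cells \<open>A\<^bsub>i,j\<^esub>\<close> and maps \<open>\<theta>\<^bsub>i,j\<^esub>\<close>.  The decomposition is kept because \<open>Z\<^sup>\<gamma>\<close> and \<open>T\<^sup>\<gamma>\<close> are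
  defined through it, and nothing forces \<open>Z\<^sup>\<theta>\<close> on \<open>[s\<^sub>i, s\<^bsub>i+1\<^esub>]\<close> to depend only on the values
  of \<open>\<theta>\<close> there.
\<close>

record ('n, 'e) control =
  proc :: "real \<Rightarrow> (real \<Rightarrow> real ^ 'n) \<Rightarrow> 'e"
  steps :: nat
  node :: "nat \<Rightarrow> real"
  idx :: "nat \<Rightarrow> nat set"
  cell :: "nat \<Rightarrow> nat \<Rightarrow> (real \<Rightarrow> real ^ 'n) set"
  param :: "nat \<Rightarrow> nat \<Rightarrow> real \<times> (real ^ 'n) \<Rightarrow> 'e"

definition predictable_sigma ::
  "path_kind \<Rightarrow> real \<Rightarrow> real \<Rightarrow> (real \<times> 'n::finite path) measure" where
  "predictable_sigma kd r T = sigma ({r..T} \<times> paths kd r T)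
     ({{r} \<times> A | A. A \<in> sets (path_filt kd r T r)} \<union>
      {{a<..b} \<times> A | a b A. r \<le> a \<and> a \<le> b \<and> b \<le> T \<and> A \<in> sets (path_filt kd r T a)})"

text \<open>
  Predictability on \<open>[r,t[\<close>.  On continuous paths this is measurability for the predictable
  sigma-algebra.  On cadlag paths neither \<open>\<theta>(u, X\<^sub>u)\<close> nor the indicator of
  \<open>[s\<^sub>i, s\<^bsub>i+1\<^esub>[ \<times> A\<close> with \<open>A \<in> \<B>\<^sup>r\<^bsub>s\<^sub>i\<^esub>\<close> is measurable for that sigma-algebra in
  general, so there the word has to be read as progressive measurability (on continuous paths
  the two notions coincide).
\<close>

fun predictable ::
  "path_kind \<Rightarrow> real \<Rightarrow> real \<Rightarrow> real \<Rightarrow> (real \<Rightarrow> 'n::finite path \<Rightarrow> 'e::topological_space) \<Rightarrow> bool"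
where
  "predictable Continuous T r t \<gamma> \<longleftrightarrow>
     (\<lambda>(u, \<omega>). \<gamma> u \<omega>) \<in> borel_measurable
       (restrict_space (predictable_sigma Continuous r T) ({r..<t} \<times> paths Continuous r T))"
| "predictable Cadlag T r t \<gamma> \<longleftrightarrow>
     (\<forall>u\<in>{r..<t}. (\<lambda>(v, \<omega>). \<gamma> v \<omega>) \<in> borel_measurable
       (restrict_space borel {r..u} \<Otimes>\<^sub>M path_filt Cadlag r T u))"

text \<open>
  Since the cells form a partition, the sum \<open>\<Sum>\<^sub>j \<theta>\<^bsub>i,j\<^esub>(u, X\<^sub>u) 1\<^bsub>A\<^bsub>i,j\<^esub>\<^esub>\<close> is the map
  equal to \<open>\<theta>\<^bsub>i,j\<^esub>(u, X\<^sub>u)\<close> on \<open>A\<^bsub>i,j\<^esub>\<close>; no addition on the value space is needed.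
  \<open>steps = 0\<close> occurs only for \<open>r = t\<close>.
\<close>

definition controls ::
  "path_kind \<Rightarrow> real \<Rightarrow> ('n::finite, 'e::topological_space) bmap set \<Rightarrow> real \<Rightarrow> real \<Rightarrow>
   ('n, 'e) control set" where
  "controls kd T \<Theta>\<Gamma> r t = {\<gamma>.
     predictable kd T r t (proc \<gamma>) \<and>
     node \<gamma> 0 = r \<and> node \<gamma> (steps \<gamma>) = t \<and>
     (\<forall>i<steps \<gamma>. node \<gamma> i < node \<gamma> (Suc i)) \<and>
     idx \<gamma> 0 = {1} \<and>
     (\<forall>i<steps \<gamma>.
        finite (idx \<gamma> i) \<and>
        disjoint_family_on (cell \<gamma> i) (idx \<gamma> i) \<and>
        (\<Union>j\<in>idx \<gamma> i. cell \<gamma> i j) = paths kd r T \<and>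
        (\<forall>j\<in>idx \<gamma> i.
           cell \<gamma> i j \<in> sets (path_filt kd r T (node \<gamma> i)) \<and>
           param \<gamma> i j \<in> \<Theta>\<Gamma> \<and>
           (\<forall>u\<in>{node \<gamma> i..<node \<gamma> (Suc i)}. \<forall>\<omega>\<in>cell \<gamma> i j.
              proc \<gamma> u \<omega> = param \<gamma> i j (u, \<omega> u))))}"

text \<open>
  The process \<open>u \<mapsto> Z\<^sup>\<gamma>\<^bsub>r,u\<^esub>\<close>, obtained from the values on the intervals
  \<open>[s\<^sub>i, s\<^bsub>i+1\<^esub>]\<close> by additivity.
\<close>

definition control_problem ::
  "(('n::finite, 'e) bmap \<Rightarrow> ('k, 'n) mart_problem) \<Rightarrow> ('n, 'e) control \<Rightarrow>
   'k \<Rightarrow> real \<Rightarrow> 'n path \<Rightarrow> real" where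
  "control_problem Z \<gamma> k u \<omega> =
     (\<Sum>i\<in>{i. i < steps \<gamma> \<and> node \<gamma> i \<le> u}. \<Sum>j\<in>idx \<gamma> i.
        Z (param \<gamma> i j) k (node \<gamma> i) (min u (node \<gamma> (Suc i)))
          (restrict \<omega> {node \<gamma> i..min u (node \<gamma> (Suc i))}) * indicator (cell \<gamma> i j) \<omega>)"

definition control_law ::
  "path_kind \<Rightarrow> real \<Rightarrow> 'k set \<Rightarrow> (('n::finite, 'e) bmap \<Rightarrow> ('k, 'n) mart_problem) \<Rightarrow>
   real \<Rightarrow> real ^ 'n \<Rightarrow> ('n, 'e) control \<Rightarrow> 'n path measure" where
  "control_law kd T K Z r y \<gamma> = (THE Q. is_solution kd K r T y (control_problem Z \<gamma>) Q)"

text \<open>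
  A measure \<open>Q\<^sup>\<gamma>\<^bsub>r,y\<^esub>\<close> is carried along with its \<open>\<gamma>\<close>.  \<open>T\<^sup>\<gamma>\<close> and the locality of penalties are
  pointwise notions on the whole path space, and they are not functions of the bare measure,
  which does not see \<open>\<gamma>\<close> on null sets.
\<close>

type_synonym ('n, 'e) tagged_law = "(real \<Rightarrow> real ^ 'n) measure \<times> ('n, 'e) control"

definition tagged ::
  "path_kind \<Rightarrow> real \<Rightarrow> 'k set \<Rightarrow> (('n::finite, 'e) bmap \<Rightarrow> ('k, 'n) mart_problem) \<Rightarrow>
   real \<Rightarrow> real ^ 'n \<Rightarrow> ('n, 'e) control \<Rightarrow> ('n, 'e) tagged_law" where
  "tagged kd T K Z r y \<gamma> = (control_law kd T K Z r y \<gamma>, \<gamma>)"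

definition stable_set ::
  "path_kind \<Rightarrow> real \<Rightarrow> 'k set \<Rightarrow> ('n::finite, 'e::topological_space) bmap set \<Rightarrow>
   (('n, 'e) bmap \<Rightarrow> ('k, 'n) mart_problem) \<Rightarrow> real \<Rightarrow> real ^ 'n \<Rightarrow> ('n, 'e) tagged_law set" where
  "stable_set kd T K \<Theta>\<Gamma> Z r y = tagged kd T K Z r y ` controls kd T \<Theta>\<Gamma> r T"

definition splice :: "real \<Rightarrow> real \<Rightarrow> real \<Rightarrow> 'n::finite path \<Rightarrow> 'n path \<Rightarrow> 'n path" where
  "splice r s T \<omega> \<omega>' = (\<lambda>u\<in>{r..T}. if u \<le> s then \<omega> u else \<omega>' u + \<omega> s - \<omega>' s)"

definition cond_theta ::
  "path_kind \<Rightarrow> real \<Rightarrow> 'k set \<Rightarrow> ('k, 'n::finite) mart_problem \<Rightarrow> real \<Rightarrow> real \<Rightarrow>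
   ('n path \<Rightarrow> real) \<Rightarrow> 'n path \<Rightarrow> real" where
  "cond_theta kd T K Z r s \<psi> \<omega> = (\<integral>\<omega>'. \<psi> (splice r s T \<omega> \<omega>') \<partial>law kd K Z s T (\<omega> s))"

text \<open>
  \<open>cond_tail \<dots> l s\<close> is \<open>T\<^sup>\<gamma>\<^sub>s\<close> on bounded functions for \<open>s\<close> in the union of the last \<open>l\<close> intervals
  of the subdivision.
\<close>

primrec cond_tail ::
  "path_kind \<Rightarrow> real \<Rightarrow> 'k set \<Rightarrow> (('n::finite, 'e) bmap \<Rightarrow> ('k, 'n) mart_problem) \<Rightarrow> real \<Rightarrow>
   ('n, 'e) control \<Rightarrow> nat \<Rightarrow> real \<Rightarrow> ('n path \<Rightarrow> real) \<Rightarrow> 'n path \<Rightarrow> real" where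
  "cond_tail kd T K Z r \<gamma> 0 = (\<lambda>s \<psi>. \<psi>)"
| "cond_tail kd T K Z r \<gamma> (Suc l) = (\<lambda>s \<psi>.
     let i = steps \<gamma> - Suc l in
     if node \<gamma> (Suc i) \<le> s then cond_tail kd T K Z r \<gamma> l s \<psi>
     else (\<lambda>\<omega>. \<Sum>j\<in>idx \<gamma> i. indicator (cell \<gamma> i j) \<omega> *
             cond_theta kd T K (Z (param \<gamma> i j)) r s
               (cond_tail kd T K Z r \<gamma> l (node \<gamma> (Suc i)) \<psi>) \<omega>))"

definition cond_bounded ::
  "path_kind \<Rightarrow> real \<Rightarrow> 'k set \<Rightarrow> (('n::finite, 'e) bmap \<Rightarrow> ('k, 'n) mart_problem) \<Rightarrow> real \<Rightarrow>
   ('n, 'e) control \<Rightarrow> real \<Rightarrow> ('n path \<Rightarrow> real) \<Rightarrow> 'n path \<Rightarrow> real" where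
  "cond_bounded kd T K Z r \<gamma> s \<psi> = cond_tail kd T K Z r \<gamma> (steps \<gamma>) s \<psi>"

text \<open>Functions bounded from below take values in \<open>]-\<infinity>,\<infinity>]\<close>.\<close>

definition cond_control ::
  "path_kind \<Rightarrow> real \<Rightarrow> 'k set \<Rightarrow> (('n::finite, 'e) bmap \<Rightarrow> ('k, 'n) mart_problem) \<Rightarrow> real \<Rightarrow>
   ('n, 'e) control \<Rightarrow> real \<Rightarrow> ('n path \<Rightarrow> ereal) \<Rightarrow> 'n path \<Rightarrow> ereal" where
  "cond_control kd T K Z r \<gamma> s \<psi> \<omega> =
     lim (\<lambda>m::nat. ereal (cond_bounded kd T K Z r \<gamma> s
       (\<lambda>\<omega>'. real_of_ereal (min (\<psi> \<omega>') (ereal (real m)))) \<omega>))"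

definition cond_law ::
  "path_kind \<Rightarrow> real \<Rightarrow> 'k set \<Rightarrow> (('n::finite, 'e) bmap \<Rightarrow> ('k, 'n) mart_problem) \<Rightarrow> real \<Rightarrow>
   ('n, 'e) tagged_law \<Rightarrow> real \<Rightarrow> ('n path \<Rightarrow> ereal) \<Rightarrow> 'n path \<Rightarrow> ereal" where
  "cond_law kd T K Z r Q = cond_control kd T K Z r (snd Q)"

type_synonym ('n, 'e) penalty_family =
  "real \<Rightarrow> real \<Rightarrow> ('n, 'e) tagged_law \<Rightarrow> (real \<Rightarrow> real ^ 'n) \<Rightarrow> ereal"

text \<open>Penalties are bounded from above; the value \<open>-\<infinity>\<close> is allowed.\<close>

definition penalty ::
  "path_kind \<Rightarrow> real \<Rightarrow> 'k set \<Rightarrow> ('n::finite, 'e::topological_space) bmap set \<Rightarrow>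
   (('n, 'e) bmap \<Rightarrow> ('k, 'n) mart_problem) \<Rightarrow> real \<Rightarrow> real ^ 'n \<Rightarrow> ('n, 'e) penalty_family \<Rightarrow> bool"
where
  "penalty kd T K \<Theta>\<Gamma> Z r y \<alpha> \<longleftrightarrow>
     (\<forall>s t. \<forall>Q\<in>stable_set kd T K \<Theta>\<Gamma> Z r y. r \<le> s \<and> s \<le> t \<and> t \<le> T \<longrightarrow>
        \<alpha> s t Q \<in> borel_measurable (path_filt kd r T s) \<and>
        (\<exists>c::real. \<forall>\<omega>\<in>paths kd r T. \<alpha> s t Q \<omega> \<le> ereal c)) \<and>
     (\<forall>s t. \<forall>\<gamma>\<in>controls kd T \<Theta>\<Gamma> r T. \<forall>\<eta>\<in>controls kd T \<Theta>\<Gamma> r T.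
        \<forall>A\<in>sets (path_filt kd r T s). r \<le> s \<and> s \<le> t \<and> t \<le> T \<and>
        (\<forall>u\<in>{s..<t}. \<forall>\<omega>\<in>A. proc \<gamma> u \<omega> = proc \<eta> u \<omega>) \<longrightarrow>
        (\<forall>\<omega>\<in>A. \<alpha> s t (tagged kd T K Z r y \<gamma>) \<omega> = \<alpha> s t (tagged kd T K Z r y \<eta>) \<omega>)) \<and>
     (\<forall>s t u. \<forall>Q\<in>stable_set kd T K \<Theta>\<Gamma> Z r y. r \<le> s \<and> s \<le> t \<and> t \<le> u \<and> u \<le> T \<longrightarrow>
        (\<forall>\<omega>\<in>paths kd r T.
           \<alpha> s u Q \<omega> = \<alpha> s t Q \<omega> - cond_law kd T K Z r Q s (\<lambda>\<omega>'. - \<alpha> t u Q \<omega>') \<omega>))"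

definition Feller_penalty_with ::
  "path_kind \<Rightarrow> real \<Rightarrow> 'k set \<Rightarrow> ('n::finite, 'e::topological_space) bmap set \<Rightarrow>
   (('n, 'e) bmap \<Rightarrow> ('k, 'n) mart_problem) \<Rightarrow> real \<Rightarrow> real ^ 'n \<Rightarrow> ('n, 'e) penalty_family \<Rightarrow>
   (('n, 'e) bmap \<Rightarrow> real \<Rightarrow> real \<Rightarrow> real ^ 'n \<Rightarrow> real) \<Rightarrow> bool" where
  "Feller_penalty_with kd T K \<Theta>\<Gamma> Z r y \<alpha> \<beta> \<longleftrightarrow>
     penalty kd T K \<Theta>\<Gamma> Z r y \<alpha> \<and>
     (\<forall>\<theta>\<in>\<Theta>\<Gamma>. \<forall>s t. r \<le> s \<and> s \<le> t \<and> t \<le> T \<longrightarrow>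
        continuous_on UNIV (\<beta> \<theta> s t) \<and>
        (\<forall>\<gamma>\<in>controls kd T \<Theta>\<Gamma> r T.
           (\<forall>u\<in>{r..<T}. \<forall>\<omega>\<in>paths kd r T. proc \<gamma> u \<omega> = \<theta> (u, \<omega> u)) \<longrightarrow>
           (\<forall>\<omega>\<in>paths kd r T. \<alpha> s t (tagged kd T K Z r y \<gamma>) \<omega> = ereal (\<beta> \<theta> s t (\<omega> s)))))"

definition Feller_penalty ::
  "path_kind \<Rightarrow> real \<Rightarrow> 'k set \<Rightarrow> ('n::finite, 'e::topological_space) bmap set \<Rightarrow>
   (('n, 'e) bmap \<Rightarrow> ('k, 'n) mart_problem) \<Rightarrow> real \<Rightarrow> real ^ 'n \<Rightarrow> ('n, 'e) penalty_family \<Rightarrow> bool"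
where
  "Feller_penalty kd T K \<Theta>\<Gamma> Z r y \<alpha> \<longleftrightarrow> (\<exists>\<beta>. Feller_penalty_with kd T K \<Theta>\<Gamma> Z r y \<alpha> \<beta>)"

definition lsc_bounded_below :: "'a topology \<Rightarrow> ('a \<Rightarrow> ereal) \<Rightarrow> bool" where
  "lsc_bounded_below X f \<longleftrightarrow>
     (\<forall>a. openin X {x \<in> topspace X. a < f x}) \<and>
     (\<exists>c::real. \<forall>x\<in>topspace X. ereal c \<le> f x)"

text \<open>
  Elements of these classes are functions on \<open>\<Omega>\<^sup>r\<close>; their values outside \<open>\<Omega>\<^sup>r\<close> are irrelevant.
  \<open>(\<real>\<^sup>n)\<^sup>k\<close> is the product of \<open>k\<close> copies of \<open>\<real>\<^sup>n\<close> indexed by \<open>{..<k}\<close>.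
\<close>

definition W_hat :: "path_kind \<Rightarrow> real \<Rightarrow> real \<Rightarrow> real \<Rightarrow> ('n::finite path \<Rightarrow> ereal) set" where
  "W_hat kd T r t = {Y. \<exists>(k::nat) (\<tau>::nat \<Rightarrow> real) f.
     1 \<le> k \<and> strict_mono_on {..<k} \<tau> \<and> \<tau> ` {..<k} \<subseteq> {r..t} \<and>
     lsc_bounded_below (product_topology (\<lambda>_. euclidean) {..<k}) f \<and>
     (\<forall>\<omega>\<in>paths kd r T. Y \<omega> = f (\<lambda>i\<in>{..<k}. \<omega> (\<tau> i)))}"

definition L_hat :: "path_kind \<Rightarrow> real \<Rightarrow> real \<Rightarrow> real \<Rightarrow> ('n::finite path \<Rightarrow> ereal) set" where
  "L_hat kd T r t = {Y. \<exists>f. lsc_bounded_below euclidean f \<and> (\<forall>\<omega>\<in>paths kd r T. Y \<omega> = f (\<omega> t))}"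

definition gain ::
  "path_kind \<Rightarrow> real \<Rightarrow> 'k set \<Rightarrow> (('n::finite, 'e) bmap \<Rightarrow> ('k, 'n) mart_problem) \<Rightarrow> real \<Rightarrow>
   ('n, 'e) penalty_family \<Rightarrow> real \<Rightarrow> real \<Rightarrow> ('n path \<Rightarrow> ereal) \<Rightarrow> ('n, 'e) tagged_law \<Rightarrow>
   'n path \<Rightarrow> ereal" where
  "gain kd T K Z r \<alpha> s t Y Q \<omega> = cond_law kd T K Z r Q s Y \<omega> - \<alpha> s t Q \<omega>"

definition Pi_op ::
  "path_kind \<Rightarrow> real \<Rightarrow> 'k set \<Rightarrow> ('n::finite, 'e::topological_space) bmap set \<Rightarrow>
   (('n, 'e) bmap \<Rightarrow> ('k, 'n) mart_problem) \<Rightarrow> real \<Rightarrow> real ^ 'n \<Rightarrow> ('n, 'e) penalty_family \<Rightarrow>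
   real \<Rightarrow> real \<Rightarrow> ('n path \<Rightarrow> ereal) \<Rightarrow> 'n path \<Rightarrow> ereal" where
  "Pi_op kd T K \<Theta>\<Gamma> Z r y \<alpha> s t Y \<omega> =
     (SUP Q\<in>stable_set kd T K \<Theta>\<Gamma> Z r y. gain kd T K Z r \<alpha> s t Y Q \<omega>)"

text \<open>
  Paths on which the limit at time \<open>s\<close> is required: all paths if \<open>s > r\<close>, and the paths issued
  from a given point \<open>x\<close> if \<open>s = r\<close>.  At the initial time the condition \<open>I\<^sub>0 = {1}\<close> forbids
  controls that depend on \<open>X\<^sub>r\<close> right after \<open>r\<close>, so one sequence of controls cannot be optimal
  for all starting points.
\<close>

definition paths_from :: "path_kind \<Rightarrow> real \<Rightarrow> real \<Rightarrow> real ^ 'n::finite \<Rightarrow> real \<Rightarrow> 'n path set" where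
  "paths_from kd T r x s = {\<omega> \<in> paths kd r T. s = r \<longrightarrow> \<omega> r = x}"

definition optimizing_sequence ::
  "path_kind \<Rightarrow> real \<Rightarrow> 'k set \<Rightarrow> ('n::finite, 'e::topological_space) bmap set \<Rightarrow>
   (('n, 'e) bmap \<Rightarrow> ('k, 'n) mart_problem) \<Rightarrow> real \<Rightarrow> real ^ 'n \<Rightarrow> ('n, 'e) penalty_family \<Rightarrow>
   (real \<Rightarrow> real \<Rightarrow> ('n path \<Rightarrow> ereal) set) \<Rightarrow> real \<Rightarrow> real \<Rightarrow> ('n path \<Rightarrow> ereal) \<Rightarrow>
   real ^ 'n \<Rightarrow> (nat \<Rightarrow> ('n, 'e) control) \<Rightarrow> bool" where
  "optimizing_sequence kd T K \<Theta>\<Gamma> Z r y \<alpha> H s t Y x \<gamma> \<longleftrightarrow>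
     (\<forall>m. tagged kd T K Z r y (\<gamma> m) \<in> stable_set kd T K \<Theta>\<Gamma> Z r y \<and>
          proc (\<gamma> m) \<in> proc ` controls kd T \<Theta>\<Gamma> r t \<and>
          gain kd T K Z r \<alpha> s t Y (tagged kd T K Z r y (\<gamma> m)) \<in> H r s) \<and>
     (\<forall>\<omega>\<in>paths_from kd T r x s.
        incseq (\<lambda>m. gain kd T K Z r \<alpha> s t Y (tagged kd T K Z r y (\<gamma> m)) \<omega>) \<and>
        (\<lambda>m. gain kd T K Z r \<alpha> s t Y (tagged kd T K Z r y (\<gamma> m)) \<omega>)
          \<longlonglongrightarrow> Pi_op kd T K \<Theta>\<Gamma> Z r y \<alpha> s t Y \<omega>)"

end

theory Submission
  imports Defs
begin

text \<open>
  The supremum over all controls is reached along finite problems.  For a finite set \<open>J\<close> of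
  parameters and a finite set \<open>D\<close> of switching times let \<open>val\<close> be the value obtained by choosing, at
  every point of \<open>D\<close>, the best parameter of \<open>J\<close> until the next point.  For a single parameter
  \<open>\<theta>\<close> the operator \<open>S \<theta> s u W = T\<^sup>\<theta>\<^sub>s(W) - \<beta>\<^sup>\<theta>\<^bsub>s,u\<^esub>(X\<^sub>s)\<close> preserves lower semicontinuous
  functions of finitely many observations (\<open>S_cyl\<close>): if there is no observation time between
  \<open>s\<close> and \<open>u\<close> this is the Feller property together with the continuity of \<open>\<beta>\<close>, and longer
  intervals are composed by the semigroup property \<open>S_semigroup\<close>, which joins the Markov property of
  the solutions to the cocycle identity of the penalty.  Maxima of finitely many such functions
  are again lower semicontinuous, so every \<open>val\<close> is.

  The finite problems are directed upwards.  Since the space of observations is second countable, an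
  increasing sequence of their values has the supremum \<open>V\<close> as its limit (\<open>V_sequence\<close>); by monotone convergence
  \<open>V\<close> dominates all steps \<open>S\<close>, and it is the least family above the terminal value with this property
  (\<open>V_super\<close>, \<open>V_least\<close>).  Dynamic programming for \<open>V\<close> follows.

  The operator \<open>\<Pi>\<close> is \<open>V\<close> (\<open>Pi_eq_V\<close>).  Between two nodes and on one cell a control follows a
  single parameter; locality identifies its penalty there with that of the constant control, so its
  gain is obtained by steps \<open>S\<close> and stays below \<open>V\<close> (\<open>gain_step\<close>, \<open>gain_le_V\<close>).  Conversely the
  value of a finite problem is the gain of the feedback control that selects at every node the first
  maximizing parameter (\<open>strategy_gain\<close>); the selection is measurable because it compares functions
  of the past.  At the initial time a control cannot depend on the path, which is why the
  optimizing sequence is then attached to a starting point.  Convexity, monotonicity and continuity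
  from below hold for the gain of each control and pass to the supremum.  For a function of the
  terminal position the finite problems and their maximizing parameters after time \<open>s\<close> do not see the
  path before \<open>s\<close>, so one feedback rule serves all initial times up to \<open>s\<close>.

  Two facts about the solutions underlie everything.  Their law is a measurable function of the
  starting point (\<open>law_kernel\<close>), although evaluation at a time is not continuous on the space of
  cadlag paths: averages over short time intervals are continuous and approximate it.  And uniqueness
  implies the Markov property (\<open>law_Markov\<close>), because a solution restarted from the point reached at
  a later time is again a solution.
\<close>

section \<open>Paths\<close>

lemma space_path_filt [simp]: "space (path_filt kd r t u) = paths kd r t"
  unfolding path_filt_def by (rule space_measure_of) auto

lemma sets_path_filt:
  "sets (path_filt kd r t u) = sigma_sets (paths kd r t)
     {(\<lambda>\<omega>. \<omega> v) -` B \<inter> paths kd r t | v B. v \<in> {r..u} \<and> B \<in> sets borel}"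
  unfolding path_filt_def by (intro sets_measure_of) auto

lemma measurable_coordinate:
  assumes "r \<le> v" "v \<le> u"
  shows "(\<lambda>\<omega>. \<omega> v) \<in> borel_measurable (path_filt kd r t u)"
proof (rule measurableI)
  fix B :: "(real^'n) set" assume "B \<in> sets borel"
  then have "(\<lambda>\<omega>. \<omega> v) -` B \<inter> paths kd r t \<in> sets (path_filt kd r t u)"
    unfolding sets_path_filt using assms by (intro sigma_sets.Basic) auto
  then show "(\<lambda>\<omega>. \<omega> v) -` B \<inter> space (path_filt kd r t u) \<in> sets (path_filt kd r t u)" by simp
qed auto

lemma measurable_into_path_filt:
  fixes f :: "'a \<Rightarrow> 'n::finite path"
  assumes "\<And>x. x \<in> space N \<Longrightarrow> f x \<in> paths kd r t"
    and "\<And>v. r \<le> v \<Longrightarrow> v \<le> u \<Longrightarrow> (\<lambda>x. f x v) \<in> borel_measurable N"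
  shows "f \<in> measurable N (path_filt kd r t u)"
  unfolding path_filt_def
proof (rule measurable_measure_of)
  fix Y :: "'n path set" assume "Y \<in> {(\<lambda>\<omega>. \<omega> v) -` B \<inter> paths kd r t | v B. v \<in> {r..u} \<and> B \<in> sets borel}"
  then obtain v B where Y: "Y = (\<lambda>\<omega>. \<omega> v) -` B \<inter> paths kd r t" and v: "v \<in> {r..u}"
    and B: "B \<in> sets borel" by blast
  have "f -` Y \<inter> space N = (\<lambda>x. f x v) -` B \<inter> space N"
    using assms(1) Y by auto
  then show "f -` Y \<inter> space N \<in> sets N"
    using measurable_sets[OF assms(2) B] v by auto
qed (use assms(1) in auto)

lemma sets_path_filt_mono: "u \<le> u' \<Longrightarrow> sets (path_filt kd r t u) \<subseteq> sets (path_filt kd r t u')"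
  unfolding sets_path_filt by (intro sigma_sets_mono') force

lemma measurable_path_filt_mono:
  assumes "f \<in> measurable (path_filt kd r t u) N" "u \<le> u'"
  shows "f \<in> measurable (path_filt kd r t u') N"
  using assms sets_path_filt_mono[OF assms(2), of kd r t]
  by (auto intro!: measurableI dest: measurable_space measurable_sets)

text \<open>
  The sets decided by the path up to time \<open>u\<close> form a \<open>\<sigma>\<close>-algebra
  that contains the generators.
\<close>

lemma path_filt_agree_mem:
  assumes "A \<in> sets (path_filt kd r t u)" "\<omega> \<in> paths kd r t" "\<omega>' \<in> paths kd r t"
    and "\<And>v. r \<le> v \<Longrightarrow> v \<le> u \<Longrightarrow> \<omega> v = \<omega>' v"
  shows "\<omega> \<in> A \<longleftrightarrow> \<omega>' \<in> A"
  using assms(1) unfolding sets_path_filt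
  by (induction rule: sigma_sets.induct) (use assms(2-4) in auto)

lemma path_filt_agree_fun:
  fixes f :: "'n::finite path \<Rightarrow> 'b::t1_space"
  assumes "f \<in> borel_measurable (path_filt kd r t u)" "\<omega> \<in> paths kd r t" "\<omega>' \<in> paths kd r t"
    and "\<And>v. r \<le> v \<Longrightarrow> v \<le> u \<Longrightarrow> \<omega> v = \<omega>' v"
  shows "f \<omega> = f \<omega>'"
proof -
  have "f -` {f \<omega>} \<inter> space (path_filt kd r t u) \<in> sets (path_filt kd r t u)"
    by (rule measurable_sets[OF assms(1)]) simp
  from path_filt_agree_mem[OF this assms(2,3,4)] show ?thesis using assms(2,3) by simp
qed

lemma cadlag_on_cong:
  assumes "\<And>u. u \<in> {r..t} \<Longrightarrow> \<omega> u = \<omega>' u"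
  shows "cadlag_on r t \<omega> \<longleftrightarrow> cadlag_on r t \<omega>'"
proof -
  have "cadlag_on r t b" if c: "cadlag_on r t a" and e: "\<And>u. u \<in> {r..t} \<Longrightarrow> a u = b u" for a b :: "'a path"
    unfolding cadlag_on_def
  proof (intro conjI ballI)
    fix u assume u: "u \<in> {r..<t}"
    have "\<forall>\<^sub>F v in at_right u. v < t \<and> u < v"
      unfolding eventually_at_right_field using u by (auto intro!: exI[of _ t])
    then have "\<forall>\<^sub>F v in at_right u. a v = b v"
      by eventually_elim (use u e in auto)
    moreover have "(a \<longlongrightarrow> b u) (at_right u)"
      using c u e[of u, symmetric] unfolding cadlag_on_def by auto
    ultimately show "(b \<longlongrightarrow> b u) (at_right u)" by (rule Lim_transform_eventually[rotated])
  next
    fix u assume u: "u \<in> {r<..t}"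
    then obtain l where l: "(a \<longlongrightarrow> l) (at_left u)" using c unfolding cadlag_on_def by blast
    have "\<forall>\<^sub>F v in at_left u. v < u \<and> r < v"
      unfolding eventually_at_left_field using u by (auto intro!: exI[of _ r])
    then have "\<forall>\<^sub>F v in at_left u. a v = b v"
      by eventually_elim (use u e in auto)
    with l have "(b \<longlongrightarrow> l) (at_left u)" by (rule Lim_transform_eventually)
    then show "\<exists>l. (b \<longlongrightarrow> l) (at_left u)" by blast
  qed
  from this[of \<omega> \<omega>'] this[of \<omega>' \<omega>] show ?thesis using assms by metis
qed

lemma cadlag_on_subinterval:
  assumes "cadlag_on r t \<omega>" "r \<le> a" "b \<le> t"
  shows "cadlag_on a b \<omega>"
  using assms unfolding cadlag_on_def by auto

lemma cadlag_on_add: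
  assumes "cadlag_on r t \<omega>"
  shows "cadlag_on r t (\<lambda>u. \<omega> u + c)"
  unfolding cadlag_on_def
proof (intro conjI ballI)
  fix u assume "u \<in> {r..<t}"
  then show "((\<lambda>u. \<omega> u + c) \<longlongrightarrow> \<omega> u + c) (at_right u)"
    using assms unfolding cadlag_on_def by (intro tendsto_add tendsto_const) simp
next
  fix u assume "u \<in> {r<..t}"
  then obtain l where "(\<omega> \<longlongrightarrow> l) (at_left u)" using assms unfolding cadlag_on_def by meson
  then have "((\<lambda>u. \<omega> u + c) \<longlongrightarrow> l + c) (at_left u)" by (intro tendsto_add tendsto_const)
  then show "\<exists>l. ((\<lambda>u. \<omega> u + c) \<longlongrightarrow> l) (at_left u)" by blast
qed

lemma cadlag_on_glue:
  assumes "cadlag_on r s \<omega>" "cadlag_on s t \<omega>'" "\<omega> s = \<omega>' s" "r \<le> s" "s \<le> t"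
  shows "cadlag_on r t (\<lambda>u. if u \<le> s then \<omega> u else \<omega>' u)"
  unfolding cadlag_on_def
proof (intro conjI ballI)
  let ?f = "\<lambda>u. if u \<le> s then \<omega> u else \<omega>' u"
  fix u assume u: "u \<in> {r..<t}"
  show "(?f \<longlongrightarrow> ?f u) (at_right u)"
  proof (cases "u < s")
    case True
    then have "\<forall>\<^sub>F v in at_right u. v < s" unfolding eventually_at_right_field by blast
    then have "\<forall>\<^sub>F v in at_right u. \<omega> v = ?f v" by eventually_elim auto
    with assms(1) True u show ?thesis unfolding cadlag_on_def
      by (auto intro: Lim_transform_eventually)
  next
    case False
    have "\<forall>\<^sub>F v in at_right u. u < v" by (rule eventually_at_right_less)
    then have "\<forall>\<^sub>F v in at_right u. \<omega>' v = ?f v" by eventually_elim (use False in auto)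
    moreover have "(\<omega>' \<longlongrightarrow> \<omega>' u) (at_right u)" using assms(2) False u unfolding cadlag_on_def by auto
    moreover have "?f u = \<omega>' u" using False assms(3) by auto
    ultimately show ?thesis using Lim_transform_eventually[of \<omega>' "?f u" "at_right u" ?f] by simp
  qed
next
  let ?f = "\<lambda>u. if u \<le> s then \<omega> u else \<omega>' u"
  fix u assume u: "u \<in> {r<..t}"
  show "\<exists>l. (?f \<longlongrightarrow> l) (at_left u)"
  proof (cases "u \<le> s")
    case True
    then obtain l where l: "(\<omega> \<longlongrightarrow> l) (at_left u)"
      using assms(1) u unfolding cadlag_on_def by (meson greaterThanAtMost_iff)
    have "\<forall>\<^sub>F v in at_left u. v < u" unfolding eventually_at_left_field by (auto intro!: exI[of _ "u - 1"])
    then have "\<forall>\<^sub>F v in at_left u. \<omega> v = ?f v" by eventually_elim (use True in auto)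
    with l have "(?f \<longlongrightarrow> l) (at_left u)" by (rule Lim_transform_eventually)
    then show ?thesis by blast
  next
    case False
    then obtain l where l: "(\<omega>' \<longlongrightarrow> l) (at_left u)"
      using assms(2) u unfolding cadlag_on_def by (meson greaterThanAtMost_iff not_le)
    have "\<forall>\<^sub>F v in at_left u. s < v" unfolding eventually_at_left_field using False by (auto intro!: exI[of _ "s"])
    then have "\<forall>\<^sub>F v in at_left u. \<omega>' v = ?f v" by eventually_elim auto
    with l have "(?f \<longlongrightarrow> l) (at_left u)" by (rule Lim_transform_eventually)
    then show ?thesis by blast
  qed
qed

lemma splice_in_paths:
  assumes "\<omega> \<in> paths kd r T" "\<omega>' \<in> paths kd s T" "r \<le> s" "s \<le> T"
  shows "splice r s T \<omega> \<omega>' \<in> paths kd r T"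
proof (cases kd)
  case Continuous
  have "continuous_on {r..T} (\<lambda>u. if u \<le> s then \<omega> u else \<omega>' u + \<omega> s - \<omega>' s)"
    using assms Continuous
    by (intro continuous_on_cases_le) (auto intro!: continuous_intros elim: continuous_on_subset)
  then have "continuous_on {r..T} (splice r s T \<omega> \<omega>')"
    unfolding splice_def by (rule continuous_on_eq) auto
  moreover have "splice r s T \<omega> \<omega>' \<in> extensional {r..T}" by (simp add: splice_def)
  ultimately show ?thesis using Continuous by simp
next
  case Cadlag
  have "cadlag_on r T (\<lambda>u. if u \<le> s then \<omega> u else \<omega>' u + (\<omega> s - \<omega>' s))"
    using assms Cadlag
    by (intro cadlag_on_glue cadlag_on_add) (auto elim: cadlag_on_subinterval)
  then have "cadlag_on r T (splice r s T \<omega> \<omega>')"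
    unfolding splice_def by (rule iffD1[OF cadlag_on_cong, rotated]) auto
  moreover have "splice r s T \<omega> \<omega>' \<in> extensional {r..T}" by (simp add: splice_def)
  ultimately show ?thesis using Cadlag by simp
qed

lemma restrict_in_paths:
  assumes "\<omega> \<in> paths kd r t" "r \<le> a" "b \<le> t"
  shows "restrict \<omega> {a..b} \<in> paths kd a b"
proof (cases kd)
  case Continuous
  with assms have "continuous_on {a..b} \<omega>"
    using continuous_on_subset[of "{r..t}" \<omega> "{a..b}"] by simp
  then have "continuous_on {a..b} (restrict \<omega> {a..b})" by (rule continuous_on_eq) auto
  then show ?thesis using Continuous by simp
next
  case Cadlag
  with assms have "cadlag_on a b \<omega>" using cadlag_on_subinterval[of r t \<omega> a b] by simp
  then have "cadlag_on a b (restrict \<omega> {a..b})" by (rule iffD1[OF cadlag_on_cong, rotated]) auto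
  then show ?thesis using Cadlag by simp
qed

lemma constant_in_paths: "(\<lambda>u\<in>{r..t}. x) \<in> paths kd r t"
proof (cases kd)
  case Continuous
  have "continuous_on {r..t} (\<lambda>u\<in>{r..t}. x)" by (rule continuous_on_eq[of _ "\<lambda>_. x"]) auto
  then show ?thesis using Continuous by simp
next
  case Cadlag
  have "cadlag_on r t (\<lambda>u. x)" unfolding cadlag_on_def by auto
  then have "cadlag_on r t (\<lambda>u\<in>{r..t}. x)" by (rule iffD1[OF cadlag_on_cong, rotated]) auto
  then show ?thesis using Cadlag by simp
qed

lemma splice_upto: "r \<le> u \<Longrightarrow> u \<le> s \<Longrightarrow> s \<le> T \<Longrightarrow> splice r s T \<omega> \<omega>' u = \<omega> u"
  by (simp add: splice_def)

lemma splice_after: "r \<le> s \<Longrightarrow> s \<le> u \<Longrightarrow> u \<le> T \<Longrightarrow> splice r s T \<omega> \<omega>' u = \<omega>' u + \<omega> s - \<omega>' s"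
  by (auto simp: splice_def)

lemma measurable_restrict_path:
  assumes "r \<le> a" "b \<le> u" "b \<le> t" "c \<le> b"
  shows "(\<lambda>\<omega>. restrict \<omega> {a..b}) \<in> measurable (path_filt kd r t u) (path_filt kd a b c)"
proof (rule measurable_into_path_filt)
  fix v assume "a \<le> v" "v \<le> c"
  then have "(\<lambda>\<omega>. restrict \<omega> {a..b} v) = (\<lambda>\<omega>::'a path. \<omega> v)" using assms by (auto simp: fun_eq_iff)
  then show "(\<lambda>\<omega>::'a path. restrict \<omega> {a..b} v) \<in> borel_measurable (path_filt kd r t u)"
    using measurable_coordinate[of r v u] \<open>a \<le> v\<close> \<open>v \<le> c\<close> assms by auto
qed (use assms in \<open>auto intro: restrict_in_paths\<close>)

lemma measurable_splice:
  assumes "r \<le> s" "s \<le> w" "w \<le> T" "w \<le> a" "w \<le> b"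
  shows "(\<lambda>(\<omega> :: 'n::finite path, \<omega>'). splice r s T \<omega> \<omega>') \<in>
    measurable (path_filt kd r T a \<Otimes>\<^sub>M path_filt kd s T b) (path_filt kd r T w)"
proof (rule measurable_into_path_filt)
  fix v assume v: "r \<le> v" "v \<le> w"
  have c: "(\<lambda>x::'n path \<times> 'n path. fst x q) \<in> borel_measurable (path_filt kd r T a \<Otimes>\<^sub>M path_filt kd s T b)"
    if "r \<le> q" "q \<le> w" for q
    by (rule measurable_compose[OF measurable_fst measurable_coordinate]) (use that assms in auto)
  have d: "(\<lambda>x::'n path \<times> 'n path. snd x q) \<in> borel_measurable (path_filt kd r T a \<Otimes>\<^sub>M path_filt kd s T b)"
    if "s \<le> q" "q \<le> w" for q
    by (rule measurable_compose[OF measurable_snd measurable_coordinate]) (use that assms in auto)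
  show "(\<lambda>x. (case x of (\<omega> :: 'n path, \<omega>') \<Rightarrow> splice r s T \<omega> \<omega>') v)
      \<in> borel_measurable (path_filt kd r T a \<Otimes>\<^sub>M path_filt kd s T b)"
  proof (cases "v \<le> s")
    case True
    then have "(\<lambda>x. (case x of (\<omega> :: 'n path, \<omega>') \<Rightarrow> splice r s T \<omega> \<omega>') v) = (\<lambda>x::'n path \<times> 'n path. fst x v)"
      using v assms by (auto simp: splice_def fun_eq_iff)
    then show ?thesis using c v by simp
  next
    case False
    then have "(\<lambda>x. (case x of (\<omega> :: 'n path, \<omega>') \<Rightarrow> splice r s T \<omega> \<omega>') v)
        = (\<lambda>x::'n path \<times> 'n path. snd x v + fst x s - snd x s)"
      using v assms by (auto simp: splice_def fun_eq_iff)
    then show ?thesis using c[of s] d[of v] d[of s] v assms False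
      by (auto intro!: borel_measurable_add borel_measurable_diff)
  qed
qed (use assms in \<open>auto simp: space_pair_measure intro!: splice_in_paths\<close>)

lemma measurable_splice_section:
  assumes "r \<le> s" "s \<le> w" "w \<le> T" "\<omega> \<in> paths kd r T"
  shows "splice r s T \<omega> \<in> measurable (path_filt kd s T w) (path_filt kd r T w)"
  using measurable_Pair2[OF measurable_splice[of r s w T w w kd]] assms by simp

lemma splice_splice:
  assumes "r \<le> s" "s \<le> v" "v \<le> T"
  shows "splice r s T \<omega> (splice s v T \<omega>' \<omega>'') = splice r v T (splice r s T \<omega> \<omega>') \<omega>''"
  using assms by (auto simp: splice_def fun_eq_iff)

section \<open>Regularity of paths\<close>

lemma paths_cadlag: "\<omega> \<in> paths kd r t \<Longrightarrow> cadlag_on r t \<omega>"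
proof (cases kd)
  case Continuous
  assume "\<omega> \<in> paths kd r t"
  with Continuous have c: "continuous_on {r..t} \<omega>" by simp
  show ?thesis
    unfolding cadlag_on_def
  proof (intro conjI ballI)
    fix u assume u: "u \<in> {r..<t}"
    then have "continuous_on {u..t} \<omega>" using continuous_on_subset[OF c, of "{u..t}"] by simp
    from continuous_on_Icc_at_rightD[OF this] u show "(\<omega> \<longlongrightarrow> \<omega> u) (at_right u)" by simp
  next
    fix u assume u: "u \<in> {r<..t}"
    then have "continuous_on {r..u} \<omega>" using continuous_on_subset[OF c, of "{r..u}"] by simp
    from continuous_on_Icc_at_leftD[OF this] u show "\<exists>l. (\<omega> \<longlongrightarrow> l) (at_left u)" by auto
  qed
qed simp

text \<open>
  Clamping the time extends a path on \<open>[r,u]\<close> by constants to the whole line, so that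
  limits need no separate treatment of the end points.
\<close>

definition clamp_time :: "real \<Rightarrow> real \<Rightarrow> real \<Rightarrow> real" where
  "clamp_time r u v = max r (min v u)"

lemma clamp_time_bounds: "r \<le> u \<Longrightarrow> r \<le> clamp_time r u v" "r \<le> u \<Longrightarrow> clamp_time r u v \<le> u"
  by (auto simp: clamp_time_def)

lemma clamp_time_id: "r \<le> v \<Longrightarrow> v \<le> u \<Longrightarrow> clamp_time r u v = v"
  by (auto simp: clamp_time_def)

lemma clamped_path_right_continuous:
  assumes "cadlag_on r T \<omega>" "r \<le> u" "u \<le> T"
  shows "((\<lambda>x. \<omega> (clamp_time r u x)) \<longlongrightarrow> \<omega> (clamp_time r u v)) (at_right v)"
proof -
  consider "v < r" | "u \<le> v" "r \<le> v" | "r \<le> v" "v < u" by linarith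
  then show ?thesis
  proof cases
    case 1
    then have "\<forall>\<^sub>F x in at_right v. x < r" unfolding eventually_at_right_field by blast
    then have "\<forall>\<^sub>F x in at_right v. \<omega> (clamp_time r u v) = \<omega> (clamp_time r u x)"
      by eventually_elim (use 1 assms in \<open>auto simp: clamp_time_def min_def max_def\<close>)
    then show ?thesis by (rule Lim_transform_eventually[OF tendsto_const])
  next
    case 2
    have "\<forall>\<^sub>F x in at_right v. v < x" by (rule eventually_at_right_less)
    then have "\<forall>\<^sub>F x in at_right v. \<omega> (clamp_time r u v) = \<omega> (clamp_time r u x)"
      by eventually_elim (use 2 assms in \<open>auto simp: clamp_time_def min_def max_def\<close>)
    then show ?thesis by (rule Lim_transform_eventually[OF tendsto_const])
  next
    case 3
    then have "\<forall>\<^sub>F x in at_right v. x < u \<and> v < x"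
      unfolding eventually_at_right_field by blast
    then have "\<forall>\<^sub>F x in at_right v. \<omega> x = \<omega> (clamp_time r u x)"
      by eventually_elim (use 3 in \<open>auto simp: clamp_time_id\<close>)
    moreover have "(\<omega> \<longlongrightarrow> \<omega> v) (at_right v)" using assms 3 unfolding cadlag_on_def by simp
    moreover have "clamp_time r u v = v" using 3 by (simp add: clamp_time_id)
    ultimately show ?thesis using Lim_transform_eventually[of \<omega> "\<omega> v" "at_right v"] by simp
  qed
qed

lemma clamped_path_left_limit:
  assumes "cadlag_on r T \<omega>" "r \<le> u" "u \<le> T"
  shows "\<exists>l. ((\<lambda>x. \<omega> (clamp_time r u x)) \<longlongrightarrow> l) (at_left v)"
proof -
  consider "v \<le> r" | "u < v" "r < v" | "r < v" "v \<le> u" by linarith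
  then show ?thesis
  proof cases
    case 1
    have "\<forall>\<^sub>F x in at_left v. x < v" unfolding eventually_at_left_field by (intro exI[of _ "v - 1"]) simp
    then have "\<forall>\<^sub>F x in at_left v. \<omega> r = \<omega> (clamp_time r u x)"
      by eventually_elim (use 1 assms in \<open>auto simp: clamp_time_def min_def max_def\<close>)
    then have "((\<lambda>x. \<omega> (clamp_time r u x)) \<longlongrightarrow> \<omega> r) (at_left v)"
      by (rule Lim_transform_eventually[OF tendsto_const])
    then show ?thesis by blast
  next
    case 2
    then have "\<forall>\<^sub>F x in at_left v. u < x" unfolding eventually_at_left_field by blast
    then have "\<forall>\<^sub>F x in at_left v. \<omega> u = \<omega> (clamp_time r u x)"
      by eventually_elim (use 2 assms in \<open>auto simp: clamp_time_def min_def max_def\<close>)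
    then have "((\<lambda>x. \<omega> (clamp_time r u x)) \<longlongrightarrow> \<omega> u) (at_left v)"
      by (rule Lim_transform_eventually[OF tendsto_const])
    then show ?thesis by blast
  next
    case 3
    then have "\<forall>\<^sub>F x in at_left v. x < v \<and> r < x"
      unfolding eventually_at_left_field by blast
    then have e: "\<forall>\<^sub>F x in at_left v. \<omega> x = \<omega> (clamp_time r u x)"
      by eventually_elim (use 3 in \<open>auto simp: clamp_time_id\<close>)
    have "v \<in> {r<..T}" using 3 assms(3) by simp
    then obtain l where "(\<omega> \<longlongrightarrow> l) (at_left v)" using assms(1) unfolding cadlag_on_def by meson
    from Lim_transform_eventually[OF this e] show ?thesis by blast
  qed
qed

text \<open>
  A function with one-sided limits has only finitely many jumps of size at least \<open>1/(n+1)\<close> near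
  any point, since close to the point, but away from it, it oscillates by less than that.
\<close>

lemma countable_discontinuities:
  fixes f :: "real \<Rightarrow> 'a::metric_space"
  assumes R: "\<And>u. (f \<longlongrightarrow> f u) (at_right u)" and L: "\<And>u. \<exists>l. (f \<longlongrightarrow> l) (at_left u)"
  shows "countable {u. \<not> isCont f u}"
proof -
  define D where "D n = {u. \<forall>d>0. \<exists>v. \<bar>v - u\<bar> < d \<and> dist (f v) (f u) \<ge> 1 / real (Suc n)}" for n
  have out: "u \<notin> D n" if o: "a < u" "u < b" "\<And>v. a < v \<Longrightarrow> v < b \<Longrightarrow> dist (f v) c < 1 / (2 * real (Suc n))"
    for u a b c n
  proof
    assume "u \<in> D n"
    moreover have "0 < min (u - a) (b - u)" using o(1,2) by simp
    ultimately obtain v where v: "\<bar>v - u\<bar> < min (u - a) (b - u)" "dist (f v) (f u) \<ge> 1 / real (Suc n)"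
      unfolding D_def by blast
    have "dist (f v) (f u) \<le> dist (f v) c + dist (f u) c" by (rule dist_triangle2)
    also have "\<dots> < 1 / (2 * real (Suc n)) + 1 / (2 * real (Suc n))"
      using v(1) o by (intro add_strict_mono) auto
    also have "\<dots> = 1 / real (Suc n)" by (simp add: field_simps)
    finally show False using v(2) by simp
  qed
  have "\<not> x islimpt D n" for x n
  proof -
    have pos: "1 / (2 * real (Suc n)) > 0" by simp
    have "\<forall>\<^sub>F v in at_right x. dist (f v) (f x) < 1 / (2 * real (Suc n))"
      using R[of x] pos unfolding tendsto_iff by blast
    then obtain b where b: "x < b" "\<And>v. x < v \<Longrightarrow> v < b \<Longrightarrow> dist (f v) (f x) < 1 / (2 * real (Suc n))"
      unfolding eventually_at_right_field by blast
    obtain l where "(f \<longlongrightarrow> l) (at_left x)" using L by blast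
    then have "\<forall>\<^sub>F v in at_left x. dist (f v) l < 1 / (2 * real (Suc n))"
      using pos unfolding tendsto_iff by blast
    then obtain a where a: "a < x" "\<And>v. a < v \<Longrightarrow> v < x \<Longrightarrow> dist (f v) l < 1 / (2 * real (Suc n))"
      unfolding eventually_at_left_field by blast
    have away: "y \<notin> D n" if "y \<in> {a<..<b}" "y \<noteq> x" for y
    proof (cases "y < x")
      case True
      with that show ?thesis using a(2) by (intro out[of a y x l]) auto
    next
      case False
      with that show ?thesis using b(2) by (intro out[of x y b "f x"]) auto
    qed
    show ?thesis
    proof
      assume "x islimpt D n"
      then have "\<exists>y\<in>D n. y \<in> {a<..<b} \<and> y \<noteq> x"
        using a(1) b(1) unfolding islimpt_def by (auto dest!: spec[of _ "{a<..<b}"])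
      with away show False by blast
    qed
  qed
  then have "countable (\<Union>n. D n)" by (intro countable_UN no_limpt_imp_countable) auto
  moreover have "{u. \<not> isCont f u} \<subseteq> (\<Union>n. D n)"
  proof
    fix u assume "u \<in> {u. \<not> isCont f u}"
    then obtain e where e: "e > 0" "\<And>d. d > 0 \<Longrightarrow> \<exists>v. dist v u < d \<and> \<not> dist (f v) (f u) < e"
      unfolding continuous_at_eps_delta by blast
    obtain n where "1 / real (Suc n) < e" using reals_Archimedean[OF e(1)] by (auto simp: inverse_eq_divide)
    then have "u \<in> D n" unfolding D_def using e(2) by (fastforce simp: dist_real_def)
    then show "u \<in> (\<Union>n. D n)" by blast
  qed
  ultimately show ?thesis by (rule countable_subset[rotated])
qed

lemma clamped_path_countable_discontinuities:
  assumes "cadlag_on r T \<omega>" "r \<le> u" "u \<le> T"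
  shows "countable {v. \<not> isCont (\<lambda>x. \<omega> (clamp_time r u x)) v}"
  by (intro countable_discontinuities clamped_path_right_continuous[OF assms] clamped_path_left_limit[OF assms])

lemma clamped_path_borel:
  assumes "cadlag_on r T \<omega>" "r \<le> u" "u \<le> T"
  shows "(\<lambda>x. \<omega> (clamp_time r u x)) \<in> borel_measurable borel"
  by (rule borel_measurable_continuous_countable_exceptions[OF clamped_path_countable_discontinuities[OF assms]])
     (auto intro: continuous_at_imp_continuous_on)

lemma clamped_path_LIMSEQ:
  assumes "cadlag_on r T \<omega>" "r \<le> u" "u \<le> T" and "x \<longlonglongrightarrow> v" "\<And>n. v \<le> x n"
  shows "(\<lambda>n. \<omega> (clamp_time r u (x n))) \<longlonglongrightarrow> \<omega> (clamp_time r u v)"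
proof -
  have "continuous (at v within {v..}) (\<lambda>x. \<omega> (clamp_time r u x))"
    unfolding continuous_within at_within_Ici_at_right
    by (rule clamped_path_right_continuous[OF assms(1-3)])
  then show ?thesis using assms(4,5) unfolding continuous_within_sequentially comp_def by auto
qed

text \<open>
  The coordinate process stopped at \<open>u\<close> is progressively measurable: by right continuity it is
  the limit of the processes that are constant on the intervals \<open>[i/(m+1), (i+1)/(m+1)[\<close>.
\<close>

lemma measurable_clamped_evaluation:
  assumes "r \<le> u" "u \<le> T"
  shows "(\<lambda>(v, \<omega> :: 'n::finite path). \<omega> (clamp_time r u v)) \<in> borel_measurable (borel \<Otimes>\<^sub>M path_filt kd r T u)"
proof -
  define a where "a m v = (real_of_int \<lfloor>real (Suc m) * v\<rfloor> + 1) / real (Suc m)" for m v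
  have a1: "v \<le> a m v" for m v
  proof -
    have "real (Suc m) * v \<le> real_of_int \<lfloor>real (Suc m) * v\<rfloor> + 1" by linarith
    then show ?thesis unfolding a_def by (subst pos_le_divide_eq) (simp_all add: mult.commute)
  qed
  have a2: "a m v \<le> v + 1 / real (Suc m)" for m v
  proof -
    have "a m v \<le> (real (Suc m) * v + 1) / real (Suc m)"
      unfolding a_def by (intro divide_right_mono) linarith+
    also have "\<dots> = v + 1 / real (Suc m)" by (simp add: add_divide_distrib)
    finally show ?thesis .
  qed
  have a3: "(\<lambda>m. a m v) \<longlonglongrightarrow> v" for v
  proof (rule tendsto_sandwich[of "\<lambda>_. v" _ _ "\<lambda>m. v + 1 / real (Suc m)"])
    show "(\<lambda>m. v + 1 / real (Suc m)) \<longlonglongrightarrow> v"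
      using tendsto_add[OF tendsto_const[of v] LIMSEQ_inverse_real_of_nat] by (simp add: inverse_eq_divide)
  qed (use a1 a2 in auto)
  show ?thesis
  proof (rule borel_measurable_LIMSEQ_metric)
    fix m
    have "(\<lambda>x::real \<times> 'n path. (\<lambda>i x. snd x (clamp_time r u ((real_of_int i + 1) / real (Suc m)))) \<lfloor>real (Suc m) * fst x\<rfloor> x)
        \<in> borel_measurable (borel \<Otimes>\<^sub>M path_filt kd r T u)"
      by (rule measurable_compose_countable'[where I = UNIV])
         (auto intro!: measurable_compose[OF measurable_snd measurable_coordinate] clamp_time_bounds assms)
    then show "(\<lambda>(v, \<omega> :: 'n path). \<omega> (clamp_time r u (a m v))) \<in> borel_measurable (borel \<Otimes>\<^sub>M path_filt kd r T u)"
      by (simp add: case_prod_beta a_def)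
  next
    fix x :: "real \<times> 'n path" assume "x \<in> space (borel \<Otimes>\<^sub>M path_filt kd r T u)"
    then have "cadlag_on r T (snd x)" by (auto simp: space_pair_measure intro: paths_cadlag)
    from clamped_path_LIMSEQ[OF this assms a3[of "fst x"] a1[of "fst x"]]
    show "(\<lambda>m. case x of (v, \<omega>) \<Rightarrow> \<omega> (clamp_time r u (a m v))) \<longlonglongrightarrow> (case x of (v, \<omega>) \<Rightarrow> \<omega> (clamp_time r u v))"
      by (simp add: case_prod_beta)
  qed
qed

section \<open>Continuous functionals on path space\<close>

lemma topspace_path_topology: "topspace (path_topology kd r t) = paths kd r t"
proof
  show "topspace (path_topology kd r t) \<subseteq> paths kd r t"
    using openin_topspace[of "path_topology kd r t"] unfolding openin_path_topology by blast
  have "openin (path_topology kd r t) (paths kd r t)"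
    unfolding openin_path_topology by (auto intro: exI[of _ 1])
  then show "paths kd r t \<subseteq> topspace (path_topology kd r t)" by (rule openin_subset)
qed

text \<open>
  The neighbourhoods of radius \<open>1/(n+1)\<close> are countably many at every path, so
  sequences decide continuity.
\<close>

lemma continuous_map_path_topologyI:
  fixes F :: "'n::finite path \<Rightarrow> real"
  assumes "\<And>\<omega> \<omega>'. \<omega> \<in> paths kd r t \<Longrightarrow> (\<And>n. \<omega>' n \<in> paths kd r t) \<Longrightarrow>
      (\<And>n. path_close kd r t (1 / real (Suc n)) \<omega> (\<omega>' n)) \<Longrightarrow> (\<lambda>n. F (\<omega>' n)) \<longlonglongrightarrow> F \<omega>"
  shows "continuous_map (path_topology kd r t) euclideanreal F"
  unfolding continuous_map_def
proof (intro conjI allI impI)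
  fix U :: "real set" assume "openin euclideanreal U"
  then have U: "open U" by simp
  show "openin (path_topology kd r t) {x \<in> topspace (path_topology kd r t). F x \<in> U}"
    unfolding openin_path_topology topspace_path_topology
  proof (intro conjI ballI)
    fix \<omega> assume \<omega>: "\<omega> \<in> {x \<in> paths kd r t. F x \<in> U}"
    show "\<exists>e>0. \<forall>\<omega>'\<in>paths kd r t. path_close kd r t e \<omega> \<omega>' \<longrightarrow> \<omega>' \<in> {x \<in> paths kd r t. F x \<in> U}"
    proof (rule ccontr)
      assume "\<not> ?thesis"
      then have "\<forall>n. \<exists>\<omega>'\<in>paths kd r t. path_close kd r t (1 / real (Suc n)) \<omega> \<omega>' \<and> F \<omega>' \<notin> U"
        by (auto dest!: spec[of _ "1 / real (Suc _)"])
      then obtain \<omega>' where \<omega>': "\<And>n. \<omega>' n \<in> paths kd r t"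
        "\<And>n. path_close kd r t (1 / real (Suc n)) \<omega> (\<omega>' n)" "\<And>n. F (\<omega>' n) \<notin> U" by metis
      have "(\<lambda>n. F (\<omega>' n)) \<longlonglongrightarrow> F \<omega>" by (rule assms) (use \<omega> \<omega>' in auto)
      with U \<omega> have "\<forall>\<^sub>F n in sequentially. F (\<omega>' n) \<in> U" by (auto dest: topological_tendstoD)
      with \<omega>'(3) show False by simp
    qed
  qed auto
qed auto

text \<open>
  Uniform closeness is closeness with the identity as time change. A time change displaces a point
  by little, which is harmless where the limit path is continuous, and it fixes the end points.
\<close>

lemma path_close_pointwise:
  fixes \<omega> :: "'n::finite path"
  assumes "r \<le> t" and close: "\<And>n. path_close kd r t (1 / real (Suc n)) \<omega> (\<omega>' n)"
    and v: "v \<ge> t \<or> isCont (\<lambda>x. \<omega> (clamp_time r t x)) v"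
  shows "(\<lambda>n. \<omega>' n (clamp_time r t v)) \<longlonglongrightarrow> \<omega> (clamp_time r t v)"
proof -
  have "path_close Cadlag r t e \<omega> w" if "path_close kd r t e \<omega> w" "e > 0" for e w
  proof (cases kd)
    case Continuous
    with that show ?thesis by (auto intro!: exI[of _ "\<lambda>x. x"] strict_mono_onI)
  qed (use that in simp)
  then have "path_close Cadlag r t (1 / real (Suc n)) \<omega> (\<omega>' n)" for n using close by simp
  then obtain l where l: "\<And>n. strict_mono_on {r..t} (l n)" "\<And>n. l n ` {r..t} = {r..t}"
    "\<And>n u. u \<in> {r..t} \<Longrightarrow> \<bar>l n u - u\<bar> < 1 / real (Suc n)"
    "\<And>n u. u \<in> {r..t} \<Longrightarrow> dist (\<omega> (l n u)) (\<omega>' n u) < 1 / real (Suc n)"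
    by (simp only: path_close.simps) metis
  define u where "u = clamp_time r t v"
  have u: "u \<in> {r..t}" unfolding u_def using clamp_time_bounds[OF assms(1)] by simp
  have null: "(\<lambda>n. 1 / real (Suc n)) \<longlonglongrightarrow> 0" using LIMSEQ_inverse_real_of_nat by (simp add: inverse_eq_divide)
  have lin: "l n u \<in> {r..t}" for n using l(2)[of n] u by blast
  have "(\<lambda>n. \<omega> (l n u)) \<longlonglongrightarrow> \<omega> u"
  proof (cases "v \<ge> t")
    case True
    then have ut: "u = t" using assms(1) unfolding u_def clamp_time_def by simp
    have "l n t = t" for n
    proof -
      have "t \<in> l n ` {r..t}" using l(2) assms(1) by simp
      then obtain w where w: "w \<in> {r..t}" "t = l n w" by blast
      then have "l n w \<le> l n t" using strict_mono_on_leD[OF l(1)[of n], of w t] assms(1) by simp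
      moreover have "l n t \<le> t" using lin[of n] ut by simp
      ultimately show ?thesis using w by simp
    qed
    then show ?thesis using ut by simp
  next
    case False
    then have c: "isCont (\<lambda>x. \<omega> (clamp_time r t x)) v" using v by simp
    have "isCont (\<lambda>x. \<omega> (clamp_time r t x)) u \<or> v < r"
      using c False unfolding u_def clamp_time_def by (auto simp: max_def min_def)
    then show ?thesis
    proof
      assume c: "isCont (\<lambda>x. \<omega> (clamp_time r t x)) u"
      have "(\<lambda>n. l n u) \<longlonglongrightarrow> u"
        by (rule LIM_zero_cancel, rule Lim_null_comparison[OF _ null]) (use l(3)[OF u] in \<open>auto intro!: always_eventually simp: less_imp_le\<close>)
      from isCont_tendsto_compose[OF c this]
      show ?thesis using lin u by (simp add: clamp_time_id)
    next
      assume vr: "v < r"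
      then have ur: "u = r" using assms(1) unfolding u_def clamp_time_def by simp
      have "l n r = r" for n
      proof -
        have "r \<in> l n ` {r..t}" using l(2) assms(1) by simp
        then obtain w where w: "w \<in> {r..t}" "r = l n w" by blast
        then have "l n r \<le> l n w" using strict_mono_on_leD[OF l(1)[of n], of r w] assms(1) by simp
        moreover have "r \<le> l n r" using lin[of n] ur by simp
        ultimately show ?thesis using w by simp
      qed
      then show ?thesis using ur by simp
    qed
  qed
  moreover have "(\<lambda>n. dist (\<omega> (l n u)) (\<omega>' n u)) \<longlonglongrightarrow> 0"
    by (rule Lim_null_comparison[OF _ null]) (use l(4)[OF u] in \<open>auto intro!: always_eventually simp: less_imp_le\<close>)
  ultimately have "(\<lambda>n. dist (\<omega> (l n u)) (\<omega>' n u) + dist (\<omega> (l n u)) (\<omega> u)) \<longlonglongrightarrow> 0 + 0"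
    by (intro tendsto_add iffD1[OF tendsto_dist_iff])
  then have z: "(\<lambda>n. dist (\<omega> (l n u)) (\<omega>' n u) + dist (\<omega> (l n u)) (\<omega> u)) \<longlonglongrightarrow> 0" by simp
  have "(\<lambda>n. dist (\<omega>' n u) (\<omega> u)) \<longlonglongrightarrow> 0"
    by (rule Lim_null_comparison[OF _ z]) (auto intro!: always_eventually dist_triangle3)
  then show ?thesis unfolding u_def[symmetric] by (rule iffD2[OF tendsto_dist_iff])
qed

section \<open>Measurability of the solution kernels\<close>

text \<open>
  Evaluation at a fixed time is not continuous on a space of cadlag paths, whereas the average
  over a time interval \<open>[v, v+e]\<close> is.
\<close>

definition time_average ::
  "real \<Rightarrow> real \<Rightarrow> real \<Rightarrow> real \<Rightarrow> (real ^ 'n::finite \<Rightarrow> real) \<Rightarrow> 'n path \<Rightarrow> real" where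
  "time_average r t e v g \<omega> = (\<integral>w. indicator {0..1} w * g (\<omega> (clamp_time r t (v + e * w))) \<partial>lborel)"

lemma time_average_integrand_measurable:
  fixes g :: "real ^ 'n::finite \<Rightarrow> real"
  assumes "\<omega> \<in> paths kd r t" "r \<le> t" "continuous_on UNIV g"
  shows "(\<lambda>w. indicator {0..1} w * g (\<omega> (clamp_time r t (v + e * w)))) \<in> borel_measurable lborel"
proof -
  have "g \<in> borel_measurable borel" using assms(3) by (rule borel_measurable_continuous_onI)
  moreover have "(\<lambda>x. \<omega> (clamp_time r t x)) \<in> borel_measurable borel"
    by (rule clamped_path_borel[OF paths_cadlag[OF assms(1)] assms(2) order_refl])
  ultimately have "(\<lambda>x. g (\<omega> (clamp_time r t x))) \<in> borel_measurable borel"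
    using measurable_compose by blast
  from measurable_compose[OF _ this, of "\<lambda>w. v + e * w" lborel]
  have "(\<lambda>w. g (\<omega> (clamp_time r t (v + e * w)))) \<in> borel_measurable lborel" by simp
  moreover have "(indicator {0..1} :: real \<Rightarrow> real) \<in> borel_measurable lborel" by simp
  ultimately show ?thesis by (intro borel_measurable_times)
qed

lemma integrable_unit_indicator: "integrable lborel (indicator {0..1::real} :: real \<Rightarrow> real)"
  by (rule integrable_real_indicator) auto

lemma time_average_bounded:
  assumes "\<omega> \<in> paths kd r t" "r \<le> t" "continuous_on UNIV g" "\<And>x. \<bar>g x\<bar> \<le> 1"
  shows "\<bar>time_average r t e v g \<omega>\<bar> \<le> 1"
proof -
  have "integrable lborel (\<lambda>w. indicator {0..1} w * g (\<omega> (clamp_time r t (v + e * w))))"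
    by (rule Bochner_Integration.integrable_bound[OF integrable_unit_indicator
          time_average_integrand_measurable[OF assms(1-3)]])
       (auto simp: indicator_def assms(4) intro!: AE_I2)
  then have "\<bar>time_average r t e v g \<omega>\<bar> \<le>
      (\<integral>w. indicator {0..1::real} w \<partial>lborel)"
    unfolding time_average_def
    by (intro order_trans[OF integral_abs_bound] integral_mono integrable_unit_indicator)
       (auto simp: indicator_def assms(4))
  then show ?thesis by simp
qed

text \<open>
  The limit path has countably many discontinuities, so evaluations converge at almost every time
  of the averaging window.
\<close>

lemma time_average_path_close:
  fixes g :: "real ^ 'n::finite \<Rightarrow> real"
  assumes "r \<le> t" "\<omega> \<in> paths kd r t" "\<And>n. \<omega>' n \<in> paths kd r t"
    and close: "\<And>n. path_close kd r t (1 / real (Suc n)) \<omega> (\<omega>' n)"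
    and "0 < e" "continuous_on UNIV g" "\<And>x. \<bar>g x\<bar> \<le> 1"
  shows "(\<lambda>n. time_average r t e v g (\<omega>' n)) \<longlonglongrightarrow> time_average r t e v g \<omega>"
  unfolding time_average_def
proof (rule integral_dominated_convergence[where w = "indicator {0..1::real}"])
  define X where "X = {q. \<not> isCont (\<lambda>x. \<omega> (clamp_time r t x)) q}"
  have "countable X" unfolding X_def
    by (rule clamped_path_countable_discontinuities[OF paths_cadlag[OF assms(2)] assms(1) order_refl])
  then have "countable ((\<lambda>q. (q - v) / e) ` X)" by (rule countable_image)
  then have "AE w in lborel. w \<notin> (\<lambda>q. (q - v) / e) ` X"
    by (intro AE_not_in countable_imp_null_set_lborel)
  then show "AE w in lborel. (\<lambda>n. indicator {0..1} w * g (\<omega>' n (clamp_time r t (v + e * w))))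
      \<longlonglongrightarrow> indicator {0..1} w * g (\<omega> (clamp_time r t (v + e * w)))"
  proof eventually_elim
    case (elim w)
    have "w = ((v + e * w) - v) / e" using assms(5) by simp
    with elim have "v + e * w \<notin> X" by (metis image_eqI)
    then have "(\<lambda>n. \<omega>' n (clamp_time r t (v + e * w))) \<longlonglongrightarrow> \<omega> (clamp_time r t (v + e * w))"
      unfolding X_def by (intro path_close_pointwise[OF assms(1) close]) simp
    moreover have "isCont g q" for q using assms(6) continuous_on_eq_continuous_at by blast
    ultimately show ?case by (intro tendsto_mult tendsto_const isCont_tendsto_compose[of _ g])
  qed
qed (use time_average_integrand_measurable[OF _ assms(1,6)] assms(2,3,7) integrable_unit_indicator in
      \<open>auto simp: indicator_def\<close>)

lemma time_average_measurable:
  fixes g :: "real ^ 'n::finite \<Rightarrow> real"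
  assumes "r \<le> t" "continuous_on UNIV g"
  shows "time_average r t e v g \<in> borel_measurable (path_filt kd r t t)"
proof -
  have g: "g \<in> borel_measurable borel" using assms(2) by (rule borel_measurable_continuous_onI)
  have m: "(\<lambda>x::'n path \<times> real. (v + e * snd x, fst x)) \<in>
      measurable (path_filt kd r t t \<Otimes>\<^sub>M lborel) (borel \<Otimes>\<^sub>M path_filt kd r t t)"
    by (intro measurable_Pair) (auto intro!: measurable_compose[OF measurable_snd])
  have "(\<lambda>x::'n path \<times> real. g (fst x (clamp_time r t (v + e * snd x))))
      \<in> borel_measurable (path_filt kd r t t \<Otimes>\<^sub>M lborel)"
    using measurable_compose[OF measurable_compose[OF m measurable_clamped_evaluation[OF assms(1) order_refl]] g]
    by simp
  moreover have "(\<lambda>x::'n path \<times> real. indicator {0..1::real} (snd x) :: real)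
      \<in> borel_measurable (path_filt kd r t t \<Otimes>\<^sub>M lborel)"
    by (rule measurable_compose[OF measurable_snd]) simp
  ultimately have "(\<lambda>x::'n path \<times> real. indicator {0..1} (snd x) * g (fst x (clamp_time r t (v + e * snd x))))
      \<in> borel_measurable (path_filt kd r t t \<Otimes>\<^sub>M lborel)" by (rule borel_measurable_times[rotated])
  then have "(\<lambda>(\<omega>::'n path, w). indicator {0..1} w * g (\<omega> (clamp_time r t (v + e * w))))
      \<in> borel_measurable (path_filt kd r t t \<Otimes>\<^sub>M lborel)" by (simp add: case_prod_beta)
  from lborel.borel_measurable_lebesgue_integral[OF this]
  show ?thesis unfolding time_average_def[abs_def] by simp
qed

lemma time_average_limit:
  fixes g :: "real ^ 'n::finite \<Rightarrow> real"
  assumes "r \<le> t" "\<omega> \<in> paths kd r t" "continuous_on UNIV g" "\<And>x. \<bar>g x\<bar> \<le> 1"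
  shows "(\<lambda>k. time_average r t (1 / real (Suc k)) v g \<omega>) \<longlonglongrightarrow> g (\<omega> (clamp_time r t v))"
proof -
  have "(\<lambda>k. time_average r t (1 / real (Suc k)) v g \<omega>) \<longlonglongrightarrow>
      (\<integral>w. indicator {0..1::real} w * g (\<omega> (clamp_time r t v)) \<partial>lborel)"
    unfolding time_average_def
  proof (rule integral_dominated_convergence[where w = "indicator {0..1::real}"])
    show "AE w in lborel. (\<lambda>k. indicator {0..1} w * g (\<omega> (clamp_time r t (v + 1 / real (Suc k) * w))))
        \<longlonglongrightarrow> indicator {0..1} w * g (\<omega> (clamp_time r t v))"
    proof (rule AE_I2)
      fix w :: real
      show "(\<lambda>k. indicator {0..1} w * g (\<omega> (clamp_time r t (v + 1 / real (Suc k) * w))))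
        \<longlonglongrightarrow> indicator {0..1} w * g (\<omega> (clamp_time r t v))"
      proof (cases "w \<in> {0..1}")
        case True
        have "(\<lambda>k. 1 / real (Suc k)) \<longlonglongrightarrow> 0" using LIMSEQ_inverse_real_of_nat by (simp add: inverse_eq_divide)
        then have "(\<lambda>k. v + 1 / real (Suc k) * w) \<longlonglongrightarrow> v + 0 * w" by (intro tendsto_intros)
        then have "(\<lambda>k. \<omega> (clamp_time r t (v + 1 / real (Suc k) * w))) \<longlonglongrightarrow> \<omega> (clamp_time r t v)"
          using True by (intro clamped_path_LIMSEQ[OF paths_cadlag[OF assms(2)] assms(1) order_refl]) auto
        moreover have "isCont g q" for q using assms(3) continuous_on_eq_continuous_at by blast
        ultimately show ?thesis by (intro tendsto_mult tendsto_const isCont_tendsto_compose[of _ g])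
      qed simp
    qed
    show "(\<lambda>w. indicator {0..1} w * g (\<omega> (clamp_time r t (v + 1 / real (Suc k) * w)))) \<in> borel_measurable lborel" for k
      by (rule time_average_integrand_measurable[OF assms(2,1,3)])
  qed (use integrable_unit_indicator assms(4) in \<open>auto simp: indicator_def\<close>)
  then show ?thesis by simp
qed

definition closed_bump :: "nat \<Rightarrow> 'a::metric_space set \<Rightarrow> 'a \<Rightarrow> real" where
  "closed_bump k C x = (if C = {} then 0 else max 0 (1 - real k * infdist x C))"

lemma closed_bump_continuous: "continuous_on UNIV (closed_bump k C)"
  unfolding closed_bump_def[abs_def] by (cases "C = {}") (auto intro!: continuous_intros)

lemma closed_bump_bounded: "\<bar>closed_bump k C x\<bar> \<le> 1"
  unfolding closed_bump_def using infdist_nonneg[of x C] by (auto simp: max_def)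

lemma closed_bump_limit:
  assumes "closed C"
  shows "(\<lambda>k. closed_bump k C x) \<longlonglongrightarrow> indicator C x"
proof (cases "C = {} \<or> x \<in> C")
  case True
  then have "closed_bump k C x = indicator C x" for k by (auto simp: closed_bump_def)
  then show ?thesis by simp
next
  case False
  then have d: "infdist x C > 0" using infdist_pos_not_in_closed[OF assms] by blast
  obtain N where N: "1 / infdist x C < real N" using reals_Archimedean2 by blast
  have "\<forall>\<^sub>F k in sequentially. indicator C x = closed_bump k C x"
    unfolding eventually_sequentially
  proof (intro exI[of _ N] allI impI)
    fix k assume "N \<le> k"
    then have "1 / infdist x C < real k" using N by linarith
    then have "1 < real k * infdist x C" using d by (simp add: pos_divide_less_eq)
    then show "indicator C x = closed_bump k C x" using False by (simp add: closed_bump_def)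
  qed
  then show ?thesis by (rule Lim_transform_eventually[OF tendsto_const])
qed

text \<open>
  \<open>P \<theta> s x\<close> is the solution on \<open>[s,T]\<close> with parameter
  \<open>\<theta>\<close> starting from \<open>x\<close>, and \<open>F s u\<close> is the
  \<open>\<sigma>\<close>-algebra of the past of \<open>u\<close> on the paths over
  \<open>[s,T]\<close>.
\<close>

locale martingale_family =
  fixes kd :: path_kind and T :: real and K :: "'k set"
    and \<Theta> :: "('n::finite, 'e::topological_space) bmap set"
    and Z :: "('n, 'e) bmap \<Rightarrow> ('k, 'n) mart_problem"
  assumes T_pos: "0 < T" and hypothesis: "Theta_hypothesis kd T K \<Theta> Z"
begin

abbreviation F :: "real \<Rightarrow> real \<Rightarrow> 'n path measure" where
  "F s u \<equiv> path_filt kd s T u"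

abbreviation P :: "('n, 'e) bmap \<Rightarrow> real \<Rightarrow> real ^ 'n \<Rightarrow> 'n path measure" where
  "P \<theta> s x \<equiv> law kd K (Z \<theta>) s T x"

lemma ex1_solution:
  "\<theta> \<in> \<Theta> \<Longrightarrow> 0 \<le> s \<Longrightarrow> s < T \<Longrightarrow> \<exists>!Q. is_solution kd K s T x (problem_from (Z \<theta>) s) Q"
  using hypothesis unfolding Theta_hypothesis_def by blast

lemma law_is_solution:
  assumes "\<theta> \<in> \<Theta>" "0 \<le> s" "s < T"
  shows "is_solution kd K s T x (problem_from (Z \<theta>) s) (P \<theta> s x)"
  unfolding law_def by (rule theI'[OF ex1_solution[OF assms]])

lemma law_unique:
  assumes "\<theta> \<in> \<Theta>" "0 \<le> s" "s < T" "is_solution kd K s T x (problem_from (Z \<theta>) s) Q"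
  shows "P \<theta> s x = Q"
  unfolding law_def by (rule the1_equality[OF ex1_solution[OF assms(1-3)] assms(4)])

context
  fixes \<theta> s assumes \<theta>: "\<theta> \<in> \<Theta>" and s: "0 \<le> s" "s < T"
begin

lemma prob_space_law: "prob_space (P \<theta> s x)"
  using law_is_solution[OF \<theta> s] unfolding is_solution_def by blast

lemma sets_law: "sets (P \<theta> s x) = sets (F s T)"
  using law_is_solution[OF \<theta> s] unfolding is_solution_def by blast

lemma space_law: "space (P \<theta> s x) = paths kd s T"
  using sets_eq_imp_space_eq[OF sets_law] by simp

lemma measurable_law: "measurable (P \<theta> s x) N = measurable (F s T) N"
  by (rule measurable_cong_sets[OF sets_law refl])

lemma law_start: "AE \<omega> in P \<theta> s x. \<omega> s = x"
proof -
  interpret prob_space "P \<theta> s x" by (rule prob_space_law)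
  have "prob {\<omega> \<in> space (P \<theta> s x). \<omega> s = x} = 1"
    using law_is_solution[OF \<theta> s] unfolding is_solution_def by blast
  moreover have "(\<lambda>\<omega>. \<omega> s) -` {x} \<inter> space (P \<theta> s x) \<in> events"
    by (rule measurable_sets[of _ _ borel]) (use s in \<open>auto simp: measurable_law measurable_coordinate\<close>)
  then have "{\<omega> \<in> space (P \<theta> s x). \<omega> s = x} \<in> events" by (simp add: vimage_def Int_def conj_commute)
  ultimately show ?thesis by (subst (asm) prob_eq_1) auto
qed

lemma weak_continuity:
  assumes "continuous_map (path_topology kd s T) euclideanreal f" "\<And>\<omega>. \<omega> \<in> paths kd s T \<Longrightarrow> \<bar>f \<omega>\<bar> \<le> c"
  shows "continuous_on UNIV (\<lambda>x. \<integral>\<omega>. f \<omega> \<partial>P \<theta> s x)"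
proof -
  have "bounded (f ` paths kd s T)" using assms(2) by (auto simp: bounded_iff intro!: exI[of _ c])
  with hypothesis \<theta> s assms(1) show ?thesis unfolding Theta_hypothesis_def by blast
qed

lemma law_cylinder_product_measurable:
  assumes I: "finite I" and g: "\<And>v. continuous_on UNIV (g v)" "\<And>v x. \<bar>g v x\<bar> \<le> (1::real)"
  shows "(\<lambda>x. \<integral>\<omega>. (\<Prod>v\<in>I. g v (\<omega> (clamp_time s T v))) \<partial>P \<theta> s x) \<in> borel_measurable borel"
proof (rule borel_measurable_LIMSEQ_real)
  define A where "A k \<omega> = (\<Prod>v\<in>I. time_average s T (1 / real (Suc k)) v (g v) \<omega>)" for k and \<omega> :: "'n path"
  have bound: "\<bar>A k \<omega>\<bar> \<le> 1" if "\<omega> \<in> paths kd s T" for k \<omega>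
    unfolding A_def abs_prod using time_average_bounded[OF that less_imp_le[OF s(2)] g] by (intro prod_le_1) auto
  show "(\<lambda>x. \<integral>\<omega>. A k \<omega> \<partial>P \<theta> s x) \<in> borel_measurable borel" for k
  proof (intro borel_measurable_continuous_onI weak_continuity[where c = 1] bound)
    show "continuous_map (path_topology kd s T) euclideanreal (A k)"
      unfolding A_def
      by (rule continuous_map_path_topologyI, rule tendsto_prod, rule time_average_path_close) (use g s in auto)
  qed
  show "(\<lambda>k. \<integral>\<omega>. A k \<omega> \<partial>P \<theta> s x) \<longlonglongrightarrow> (\<integral>\<omega>. (\<Prod>v\<in>I. g v (\<omega> (clamp_time s T v))) \<partial>P \<theta> s x)" for x
  proof (rule integral_dominated_convergence[where w = "\<lambda>_. 1"])
    interpret prob_space "P \<theta> s x" by (rule prob_space_law)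
    show "integrable (P \<theta> s x) (\<lambda>_. 1::real)" by simp
    show "A k \<in> borel_measurable (P \<theta> s x)" for k
      unfolding measurable_law A_def using g(1) s
      by (intro borel_measurable_prod time_average_measurable) auto
    show "(\<lambda>\<omega>. \<Prod>v\<in>I. g v (\<omega> (clamp_time s T v))) \<in> borel_measurable (P \<theta> s x)"
      unfolding measurable_law using g(1) s
      by (intro borel_measurable_prod measurable_compose[OF measurable_coordinate] borel_measurable_continuous_onI)
         (auto intro: clamp_time_bounds)
    show "AE \<omega> in P \<theta> s x. (\<lambda>k. A k \<omega>) \<longlonglongrightarrow> (\<Prod>v\<in>I. g v (\<omega> (clamp_time s T v)))"
    proof (rule AE_I2)
      fix \<omega> assume "\<omega> \<in> space (P \<theta> s x)"
      then have "\<omega> \<in> paths kd s T" by (simp add: space_law)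
      then show "(\<lambda>k. A k \<omega>) \<longlonglongrightarrow> (\<Prod>v\<in>I. g v (\<omega> (clamp_time s T v)))"
        unfolding A_def by (intro tendsto_prod time_average_limit) (use s g in auto)
    qed
    show "AE \<omega> in P \<theta> s x. norm (A k \<omega>) \<le> 1" for k
      by (rule AE_I2) (simp add: space_law bound)
  qed
qed

text \<open>Closed sets are chosen because their indicators are limits of continuous functions.\<close>

definition closed_cylinders :: "'n path set set" where
  "closed_cylinders = {{\<omega> \<in> paths kd s T. \<forall>v\<in>I. \<omega> v \<in> C v} | I C.
     finite I \<and> I \<subseteq> {s..T} \<and> (\<forall>v. closed (C v))}"

lemma sets_closed_cylinders: "sets (F s T) = sigma_sets (paths kd s T) closed_cylinders"
proof
  let ?N = "sigma (paths kd s T) closed_cylinders"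
  have N: "sets ?N = sigma_sets (paths kd s T) closed_cylinders" "space ?N = paths kd s T"
    by (auto simp: closed_cylinders_def intro!: sets_measure_of space_measure_of)
  have "(\<lambda>\<omega>. \<omega> v) \<in> borel_measurable ?N" if v: "s \<le> v" "v \<le> T" for v
  proof (rule borel_measurableI)
    fix S :: "(real^'n) set" assume S: "open S"
    have "{\<omega> \<in> paths kd s T. \<forall>v\<in>{v}. \<omega> v \<in> - S} \<in> closed_cylinders"
      unfolding closed_cylinders_def mem_Collect_eq
      by (rule exI[of _ "{v}"], rule exI[of _ "\<lambda>_. - S"]) (use v S in auto)
    then have "{\<omega> \<in> paths kd s T. \<omega> v \<in> - S} \<in> sets ?N" unfolding N by auto
    then have "space ?N - {\<omega> \<in> paths kd s T. \<omega> v \<in> - S} \<in> sets ?N" by (rule sets.compl_sets)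
    also have "space ?N - {\<omega> \<in> paths kd s T. \<omega> v \<in> - S} = (\<lambda>\<omega>. \<omega> v) -` S \<inter> space ?N"
      unfolding N by auto
    finally show "(\<lambda>\<omega>. \<omega> v) -` S \<inter> space ?N \<in> sets ?N" .
  qed
  then have "(\<lambda>\<omega>. \<omega>) \<in> measurable ?N (F s T)" by (intro measurable_into_path_filt) (auto simp: N)
  then show "sets (F s T) \<subseteq> sigma_sets (paths kd s T) closed_cylinders"
    unfolding N(1)[symmetric] using N(2) sets.sets_into_space[of _ "F s T"]
    by (auto dest!: measurable_sets simp: Int_absorb2)
  have "{\<omega> \<in> paths kd s T. \<forall>v\<in>I. \<omega> v \<in> C v} \<in> sets (F s T)"
    if "finite I" "I \<subseteq> {s..T}" "\<And>v. closed (C v)" for I and C :: "real \<Rightarrow> (real^'n) set"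
  proof -
    have "{\<omega> \<in> paths kd s T. \<omega> v \<in> C v} \<in> sets (F s T)" if "v \<in> I" for v
      using measurable_sets[OF measurable_coordinate[of s v T kd T], of "C v"] that \<open>I \<subseteq> {s..T}\<close>
        \<open>\<And>v. closed (C v)\<close> by (auto simp: vimage_def Int_def conj_commute)
    then have "{\<omega> \<in> space (F s T). \<forall>v\<in>I. \<omega> v \<in> C v} \<in> sets (F s T)"
      using \<open>finite I\<close> by (intro sets.sets_Collect_finite_All) auto
    then show ?thesis by simp
  qed
  then show "sigma_sets (paths kd s T) closed_cylinders \<subseteq> sets (F s T)"
    using sets.sigma_sets_subset[of closed_cylinders "F s T"] by (auto simp: closed_cylinders_def)
qed

text \<open>
  Products of time averages are continuous on path space, so weak continuity makes their means
  continuous in the starting point; letting the averaging window shrink and the bump functions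
  decrease to indicators reaches the closed cylinders, which are stable under intersection.
\<close>

lemma law_kernel: "P \<theta> s \<in> measurable borel (prob_algebra (F s T))"
proof (rule measurable_prob_algebra_generated[OF sets_closed_cylinders])
  show "Int_stable closed_cylinders"
  proof (rule Int_stableI)
    fix a b assume "a \<in> closed_cylinders" "b \<in> closed_cylinders"
    then obtain I C J D where a: "a = {\<omega> \<in> paths kd s T. \<forall>v\<in>I. \<omega> v \<in> C v}"
      "finite I" "I \<subseteq> {s..T}" "\<forall>v. closed (C v)"
      and b: "b = {\<omega> \<in> paths kd s T. \<forall>v\<in>J. \<omega> v \<in> D v}"
      "finite J" "J \<subseteq> {s..T}" "\<forall>v. closed (D v)"
      unfolding closed_cylinders_def by blast
    show "a \<inter> b \<in> closed_cylinders"
      unfolding closed_cylinders_def mem_Collect_eq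
      by (rule exI[of _ "I \<union> J"],
          rule exI[of _ "\<lambda>v. (if v \<in> I then C v else UNIV) \<inter> (if v \<in> J then D v else UNIV)"])
         (use a b in auto)
  qed
  fix A assume "A \<in> closed_cylinders"
  then obtain I C where A: "A = {\<omega> \<in> paths kd s T. \<forall>v\<in>I. \<omega> v \<in> C v}"
    and I: "finite I" "I \<subseteq> {s..T}" and C: "\<And>v. closed (C v)"
    unfolding closed_cylinders_def by blast
  have AS: "A \<in> sets (F s T)" unfolding sets_closed_cylinders using \<open>A \<in> closed_cylinders\<close> by auto
  have "(\<lambda>x. measure (P \<theta> s x) A) \<in> borel_measurable borel"
  proof (rule borel_measurable_LIMSEQ_real)
    show "(\<lambda>x. \<integral>\<omega>. (\<Prod>v\<in>I. closed_bump k (C v) (\<omega> (clamp_time s T v))) \<partial>P \<theta> s x) \<in> borel_measurable borel" for k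
      by (rule law_cylinder_product_measurable[OF I(1) closed_bump_continuous closed_bump_bounded])
    fix x
    interpret prob_space "P \<theta> s x" by (rule prob_space_law)
    have "(\<lambda>k. \<integral>\<omega>. (\<Prod>v\<in>I. closed_bump k (C v) (\<omega> (clamp_time s T v))) \<partial>P \<theta> s x)
        \<longlonglongrightarrow> (\<integral>\<omega>. indicator A \<omega> \<partial>P \<theta> s x)"
    proof (rule integral_dominated_convergence[where w = "\<lambda>_. 1"])
      show "(indicator A :: 'n path \<Rightarrow> real) \<in> borel_measurable (P \<theta> s x)"
        unfolding measurable_law using AS by simp
      show "(\<lambda>\<omega>. \<Prod>v\<in>I. closed_bump k (C v) (\<omega> (clamp_time s T v))) \<in> borel_measurable (P \<theta> s x)" for k
        unfolding measurable_law using s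
        by (intro borel_measurable_prod measurable_compose[OF measurable_coordinate]
              borel_measurable_continuous_onI closed_bump_continuous) (auto intro: clamp_time_bounds)
      show "AE \<omega> in P \<theta> s x. (\<lambda>k. \<Prod>v\<in>I. closed_bump k (C v) (\<omega> (clamp_time s T v))) \<longlonglongrightarrow> indicator A \<omega>"
      proof (rule AE_I2)
        fix \<omega> assume "\<omega> \<in> space (P \<theta> s x)"
        then have w: "\<omega> \<in> paths kd s T" by (simp add: space_law)
        have "(\<lambda>k. \<Prod>v\<in>I. closed_bump k (C v) (\<omega> (clamp_time s T v))) \<longlonglongrightarrow>
            (\<Prod>v\<in>I. indicator (C v) (\<omega> (clamp_time s T v)))"
          by (intro tendsto_prod closed_bump_limit C)
        also have "(\<Prod>v\<in>I. indicator (C v) (\<omega> (clamp_time s T v))) = (\<Prod>v\<in>I. indicator (C v) (\<omega> v) :: real)"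
          using I(2) by (intro prod.cong) (auto simp: clamp_time_id subset_iff)
        also have "\<dots> = indicator A \<omega>"
          using I(1) w unfolding A by (auto simp: indicator_def prod_zero_iff intro!: prod.neutral)
        finally show "(\<lambda>k. \<Prod>v\<in>I. closed_bump k (C v) (\<omega> (clamp_time s T v))) \<longlonglongrightarrow> indicator A \<omega>" .
      qed
      show "AE \<omega> in P \<theta> s x. norm (\<Prod>v\<in>I. closed_bump k (C v) (\<omega> (clamp_time s T v))) \<le> 1" for k
        by (rule AE_I2) (auto simp: abs_prod intro!: prod_le_1 closed_bump_bounded)
    qed simp
    also have "(\<integral>\<omega>. indicator A \<omega> \<partial>P \<theta> s x) = measure (P \<theta> s x) A"
      using AS sets_law by simp
    finally show "(\<lambda>k. \<integral>\<omega>. (\<Prod>v\<in>I. closed_bump k (C v) (\<omega> (clamp_time s T v))) \<partial>P \<theta> s x)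
        \<longlonglongrightarrow> measure (P \<theta> s x) A" .
  qed
  then have "(\<lambda>x. ennreal (measure (P \<theta> s x) A)) \<in> borel_measurable borel" by simp
  moreover have "emeasure (P \<theta> s x) A = ennreal (measure (P \<theta> s x) A)" for x
    using prob_space_law[of x] by (simp add: finite_measure.emeasure_eq_measure prob_space_def)
  ultimately show "(\<lambda>x. emeasure (P \<theta> s x) A) \<in> borel_measurable borel" by simp
qed (auto simp: prob_space_law sets_law closed_cylinders_def)

end

end

section \<open>Expectations of functions bounded from below\<close>

text \<open>
  Expectation of a function with values in \<open>]-\<infinity>,\<infinity>]\<close>, by the same
  truncation as in the conditional expectations of a control.
\<close>

definition eexp :: "'a measure \<Rightarrow> ('a \<Rightarrow> ereal) \<Rightarrow> ereal" where
  "eexp N \<psi> = lim (\<lambda>m::nat. ereal (\<integral>\<omega>. real_of_ereal (min (\<psi> \<omega>) (ereal (real m))) \<partial>N))"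

text \<open>The name abbreviates: bounded from below, measurable.\<close>

definition bbm :: "'a measure \<Rightarrow> ('a \<Rightarrow> ereal) set" where
  "bbm M = {\<psi>. \<psi> \<in> borel_measurable M \<and> (\<exists>c::real. \<forall>\<omega>\<in>space M. ereal c \<le> \<psi> \<omega>)}"

lemma bbmI: "\<psi> \<in> borel_measurable M \<Longrightarrow> (\<And>\<omega>. \<omega> \<in> space M \<Longrightarrow> ereal c \<le> \<psi> \<omega>) \<Longrightarrow> \<psi> \<in> bbm M"
  unfolding bbm_def by auto

lemma bbm_measurable: "\<psi> \<in> bbm M \<Longrightarrow> \<psi> \<in> borel_measurable M"
  unfolding bbm_def by auto

lemma bbm_lower:
  assumes "\<psi> \<in> bbm M"
  obtains c where "0 \<le> c" "\<And>\<omega>. \<omega> \<in> space M \<Longrightarrow> ereal (- c) \<le> \<psi> \<omega>"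
proof -
  obtain c where c: "\<And>\<omega>. \<omega> \<in> space M \<Longrightarrow> ereal c \<le> \<psi> \<omega>" using assms unfolding bbm_def by auto
  show ?thesis
    by (rule that[of "max 0 (- c)"]) (auto intro: order_trans[OF _ c])
qed

lemma bbm_cong: "\<psi> \<in> bbm M \<Longrightarrow> (\<And>\<omega>. \<omega> \<in> space M \<Longrightarrow> \<phi> \<omega> = \<psi> \<omega>) \<Longrightarrow> \<phi> \<in> bbm M"
  unfolding bbm_def by (auto simp: measurable_cong[of M \<phi> \<psi>])

lemma bbm_add: "\<psi> \<in> bbm M \<Longrightarrow> \<phi> \<in> bbm M \<Longrightarrow> (\<lambda>\<omega>. \<psi> \<omega> + \<phi> \<omega>) \<in> bbm M"
proof -
  assume a: "\<psi> \<in> bbm M" "\<phi> \<in> bbm M"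
  obtain c where "\<And>\<omega>. \<omega> \<in> space M \<Longrightarrow> ereal c \<le> \<psi> \<omega>" using a unfolding bbm_def by auto
  moreover obtain d where "\<And>\<omega>. \<omega> \<in> space M \<Longrightarrow> ereal d \<le> \<phi> \<omega>" using a unfolding bbm_def by auto
  ultimately have l: "ereal (c + d) \<le> \<psi> \<omega> + \<phi> \<omega>" if "\<omega> \<in> space M" for \<omega>
    using that unfolding plus_ereal.simps(1)[symmetric] by (intro add_mono)
  have [measurable]: "\<psi> \<in> borel_measurable M" "\<phi> \<in> borel_measurable M" using a bbm_measurable by auto
  show ?thesis by (rule bbmI[OF _ l]) measurable
qed

lemma bbm_mult: "\<psi> \<in> bbm M \<Longrightarrow> 0 \<le> l \<Longrightarrow> (\<lambda>\<omega>. ereal l * \<psi> \<omega>) \<in> bbm M"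
proof -
  assume a: "\<psi> \<in> bbm M" "0 \<le> l"
  obtain c where c: "\<And>\<omega>. \<omega> \<in> space M \<Longrightarrow> ereal c \<le> \<psi> \<omega>" using a unfolding bbm_def by auto
  show ?thesis
  proof (rule bbmI[where c = "l * c"])
    show "(\<lambda>\<omega>. ereal l * \<psi> \<omega>) \<in> borel_measurable M" using bbm_measurable[OF a(1)] by simp
    show "ereal (l * c) \<le> ereal l * \<psi> \<omega>" if "\<omega> \<in> space M" for \<omega>
      using ereal_mult_left_mono[OF c[OF that], of "ereal l"] a(2) by simp
  qed
qed

lemma bbm_SUP:
  assumes "\<And>m::nat. \<psi> m \<in> bbm M"
  shows "(\<lambda>\<omega>. SUP m. \<psi> m \<omega>) \<in> bbm M"
proof -
  obtain c where c: "\<And>\<omega>. \<omega> \<in> space M \<Longrightarrow> ereal c \<le> \<psi> 0 \<omega>" using assms[of 0] unfolding bbm_def by auto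
  then have l: "ereal c \<le> (SUP m. \<psi> m \<omega>)" if "\<omega> \<in> space M" for \<omega>
    using that by (intro SUP_upper2[of 0]) auto
  have [measurable]: "\<psi> m \<in> borel_measurable M" for m using assms bbm_measurable by auto
  show ?thesis by (rule bbmI[OF _ l]) measurable
qed

lemma bbm_const: "(\<lambda>_. ereal k) \<in> bbm M"
  by (rule bbmI[where c = k]) auto

lemma truncation_bounds:
  assumes "0 \<le> c" "ereal (- c) \<le> x"
  shows "ereal (real_of_ereal (min x (ereal (real m)))) = min x (ereal (real m))"
    and "- c \<le> real_of_ereal (min x (ereal (real m)))" and "real_of_ereal (min x (ereal (real m))) \<le> real m"
  using assms by (cases x; simp add: min_def; linarith)+

text \<open>The truncated integrals increase to the Lebesgue integral of the shifted function.\<close>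

lemma eexp_nn_integral:
  assumes N: "prob_space N" and m: "\<psi> \<in> borel_measurable N" and c: "0 \<le> c"
    and lower: "\<And>\<omega>. \<omega> \<in> space N \<Longrightarrow> ereal (- c) \<le> \<psi> \<omega>"
  shows "eexp N \<psi> = enn2ereal (\<integral>\<^sup>+\<omega>. e2ennreal (\<psi> \<omega> + ereal c) \<partial>N) - ereal c"
proof -
  interpret prob_space N by (rule N)
  define g where "g k \<omega> = real_of_ereal (min (\<psi> \<omega>) (ereal (real k)))" for k \<omega>
  have gm [measurable]: "g k \<in> borel_measurable N" for k
    unfolding g_def[abs_def] using m by measurable
  have gb: "- c \<le> g k \<omega>" "g k \<omega> \<le> real k" "ereal (g k \<omega>) = min (\<psi> \<omega>) (ereal (real k))"
    if "\<omega> \<in> space N" for k \<omega>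
    unfolding g_def using truncation_bounds[OF c lower[OF that]] by auto
  have gn: "0 \<le> g k \<omega> + c" if "\<omega> \<in> space N" for k \<omega> using gb(1)[OF that, of k] by linarith
  have gi: "integrable N (g k)" for k
  proof (rule integrable_const_bound[of _ "c + real k"])
    have "norm (g k \<omega>) \<le> c + real k" if "\<omega> \<in> space N" for \<omega>
      using gb(1,2)[OF that, of k] c by (simp add: abs_le_iff)
    then show "AE \<omega> in N. norm (g k \<omega>) \<le> c + real k" by (rule AE_I2)
  qed measurable
  have int: "ereal (\<integral>\<omega>. g k \<omega> \<partial>N) = enn2ereal (\<integral>\<^sup>+\<omega>. ennreal (g k \<omega> + c) \<partial>N) - ereal c" for k
  proof -
    have "(\<integral>\<^sup>+\<omega>. ennreal (g k \<omega> + c) \<partial>N) = ennreal (\<integral>\<omega>. g k \<omega> + c \<partial>N)"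
      using gi gn[of _ k] by (intro nn_integral_eq_integral AE_I2) auto
    also have "(\<integral>\<omega>. g k \<omega> + c \<partial>N) = (\<integral>\<omega>. g k \<omega> \<partial>N) + c"
      using gi by (simp add: prob_space)
    finally have e: "(\<integral>\<^sup>+\<omega>. ennreal (g k \<omega> + c) \<partial>N) = ennreal ((\<integral>\<omega>. g k \<omega> \<partial>N) + c)" .
    have "0 \<le> (\<integral>\<omega>. g k \<omega> + c \<partial>N)"
      using gn[of _ k] by (intro Bochner_Integration.integral_nonneg_AE AE_I2) auto
    then have "0 \<le> (\<integral>\<omega>. g k \<omega> \<partial>N) + c" using gi by (simp add: prob_space)
    then show ?thesis unfolding e by (simp add: enn2ereal_ennreal)
  qed
  have inc: "ennreal (g k \<omega> + c) \<le> ennreal (g (Suc k) \<omega> + c)" if "\<omega> \<in> space N" for k \<omega>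
  proof -
    have "ereal (g k \<omega>) \<le> ereal (g (Suc k) \<omega>)"
      unfolding gb(3)[OF that] by (rule min.mono) auto
    then show ?thesis by (intro ennreal_leI) simp
  qed
  have sup: "(SUP k. ennreal (g k \<omega> + c)) = e2ennreal (\<psi> \<omega> + ereal c)" if w: "\<omega> \<in> space N" for \<omega>
  proof -
    have "(\<lambda>k. min (\<psi> \<omega>) (ereal (real k))) \<longlonglongrightarrow> \<psi> \<omega>"
    proof -
      have "(\<lambda>k. min (\<psi> \<omega>) (ereal (real k))) \<longlonglongrightarrow> min (\<psi> \<omega>) \<infinity>"
        by (intro tendsto_min tendsto_const) (simp add: id_nat_ereal_tendsto_PInf)
      then show ?thesis by (simp add: min_def)
    qed
    then have "(\<lambda>k. ereal (g k \<omega>)) \<longlonglongrightarrow> \<psi> \<omega>" unfolding gb(3)[OF w] .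
    then have "(\<lambda>k. ereal (g k \<omega>) + ereal c) \<longlonglongrightarrow> \<psi> \<omega> + ereal c"
      using lower[OF w] by (intro tendsto_cadd_ereal) auto
    then have "(\<lambda>k. e2ennreal (ereal (g k \<omega>) + ereal c)) \<longlonglongrightarrow> e2ennreal (\<psi> \<omega> + ereal c)"
      by (rule tendsto_e2ennrealI)
    then have "(\<lambda>k. ennreal (g k \<omega> + c)) \<longlonglongrightarrow> e2ennreal (\<psi> \<omega> + ereal c)" by simp
    moreover have "(\<lambda>k. ennreal (g k \<omega> + c)) \<longlonglongrightarrow> (SUP k. ennreal (g k \<omega> + c))"
      by (intro LIMSEQ_SUP incseq_SucI inc w)
    ultimately show ?thesis using LIMSEQ_unique by blast
  qed
  have "(\<integral>\<^sup>+\<omega>. e2ennreal (\<psi> \<omega> + ereal c) \<partial>N) = (\<integral>\<^sup>+\<omega>. (SUP k. ennreal (g k \<omega> + c)) \<partial>N)"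
    using sup by (intro nn_integral_cong) simp
  also have "\<dots> = (SUP k. \<integral>\<^sup>+\<omega>. ennreal (g k \<omega> + c) \<partial>N)"
    using inc by (intro nn_integral_monotone_convergence_SUP_AE AE_I2) auto
  finally have S: "(\<integral>\<^sup>+\<omega>. e2ennreal (\<psi> \<omega> + ereal c) \<partial>N) = (SUP k. \<integral>\<^sup>+\<omega>. ennreal (g k \<omega> + c) \<partial>N)" .
  have "(\<lambda>k. \<integral>\<^sup>+\<omega>. ennreal (g k \<omega> + c) \<partial>N) \<longlonglongrightarrow> (\<integral>\<^sup>+\<omega>. e2ennreal (\<psi> \<omega> + ereal c) \<partial>N)"
    unfolding S using inc by (intro LIMSEQ_SUP incseq_SucI nn_integral_mono) auto
  then have "(\<lambda>k. enn2ereal (\<integral>\<^sup>+\<omega>. ennreal (g k \<omega> + c) \<partial>N)) \<longlonglongrightarrow> enn2ereal (\<integral>\<^sup>+\<omega>. e2ennreal (\<psi> \<omega> + ereal c) \<partial>N)"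
    by (rule tendsto_enn2erealI)
  then have "(\<lambda>k. enn2ereal (\<integral>\<^sup>+\<omega>. ennreal (g k \<omega> + c) \<partial>N) + ereal (- c))
      \<longlonglongrightarrow> enn2ereal (\<integral>\<^sup>+\<omega>. e2ennreal (\<psi> \<omega> + ereal c) \<partial>N) + ereal (- c)"
    by (intro tendsto_cadd_ereal) (auto simp: enn2ereal_nonneg)
  then have "(\<lambda>k. ereal (\<integral>\<omega>. g k \<omega> \<partial>N)) \<longlonglongrightarrow> enn2ereal (\<integral>\<^sup>+\<omega>. e2ennreal (\<psi> \<omega> + ereal c) \<partial>N) - ereal c"
    unfolding int by (simp add: minus_ereal_def)
  then show ?thesis unfolding eexp_def g_def[symmetric] by (rule limI)
qed

lemma eexp_cong:
  "(\<And>\<omega>. \<omega> \<in> space N \<Longrightarrow> \<psi> \<omega> = \<phi> \<omega>) \<Longrightarrow> eexp N \<psi> = eexp N \<phi>"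
  unfolding eexp_def by (intro arg_cong[where f = lim] ext arg_cong[where f = ereal] Bochner_Integration.integral_cong) auto

context
  fixes N M :: "'a measure"
  assumes prob: "prob_space N" and sets: "sets N = sets M"
begin

lemma space_eq: "space N = space M" using sets_eq_imp_space_eq[OF sets] .

lemma eexp_shift:
  assumes "\<psi> \<in> bbm M" "0 \<le> c" "\<And>\<omega>. \<omega> \<in> space M \<Longrightarrow> ereal (- c) \<le> \<psi> \<omega>"
  shows "eexp N \<psi> = enn2ereal (\<integral>\<^sup>+\<omega>. e2ennreal (\<psi> \<omega> + ereal c) \<partial>N) - ereal c"
  using assms bbm_measurable[of \<psi> M] measurable_cong_sets[OF sets refl, of "borel :: ereal measure"] space_eq
  by (intro eexp_nn_integral[OF prob]) auto

lemma eexp_mono_AE: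
  assumes "\<psi> \<in> bbm M" "\<phi> \<in> bbm M" "AE \<omega> in N. \<psi> \<omega> \<le> \<phi> \<omega>"
  shows "eexp N \<psi> \<le> eexp N \<phi>"
proof -
  obtain c d where c: "0 \<le> c" "\<And>\<omega>. \<omega> \<in> space M \<Longrightarrow> ereal (- c) \<le> \<psi> \<omega>"
    and d: "0 \<le> d" "\<And>\<omega>. \<omega> \<in> space M \<Longrightarrow> ereal (- d) \<le> \<phi> \<omega>"
    using bbm_lower assms by metis
  have "ereal (- (c + d)) \<le> ereal (- c)" "ereal (- (c + d)) \<le> ereal (- d)" using c d by auto
  then have cd: "\<And>\<omega>. \<omega> \<in> space M \<Longrightarrow> ereal (- (c + d)) \<le> \<psi> \<omega>" "\<And>\<omega>. \<omega> \<in> space M \<Longrightarrow> ereal (- (c + d)) \<le> \<phi> \<omega>"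
    using c d order_trans by blast+
  have "(\<integral>\<^sup>+\<omega>. e2ennreal (\<psi> \<omega> + ereal (c + d)) \<partial>N) \<le> (\<integral>\<^sup>+\<omega>. e2ennreal (\<phi> \<omega> + ereal (c + d)) \<partial>N)"
  proof (rule nn_integral_mono_AE)
    show "AE \<omega> in N. e2ennreal (\<psi> \<omega> + ereal (c + d)) \<le> e2ennreal (\<phi> \<omega> + ereal (c + d))"
      using assms(3) by eventually_elim (auto intro!: e2ennreal_mono add_mono simp del: plus_ereal.simps)
  qed
  then show ?thesis
    using eexp_shift[OF assms(1) _ cd(1)] eexp_shift[OF assms(2) _ cd(2)] c d
    by (auto intro!: ereal_minus_mono simp: less_eq_ennreal.rep_eq)
qed

lemma eexp_mono:
  assumes "\<psi> \<in> bbm M" "\<phi> \<in> bbm M" "\<And>\<omega>. \<omega> \<in> space M \<Longrightarrow> \<psi> \<omega> \<le> \<phi> \<omega>"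
  shows "eexp N \<psi> \<le> eexp N \<phi>"
  using assms(3) space_eq by (intro eexp_mono_AE assms AE_I2) auto

lemma eexp_cong_AE:
  assumes "\<psi> \<in> bbm M" "\<phi> \<in> bbm M" "AE \<omega> in N. \<psi> \<omega> = \<phi> \<omega>"
  shows "eexp N \<psi> = eexp N \<phi>"
  using assms by (intro antisym eexp_mono_AE) (auto elim: eventually_mono)

lemma eexp_const: "eexp N (\<lambda>_. ereal k) = ereal k"
  unfolding eexp_def
proof (rule limI)
  interpret prob_space N by (rule prob)
  have "(\<lambda>m. min (ereal k) (ereal (real m))) \<longlonglongrightarrow> min (ereal k) \<infinity>"
    by (intro tendsto_min tendsto_const) (simp add: id_nat_ereal_tendsto_PInf)
  then show "(\<lambda>m. ereal (\<integral>\<omega>. real_of_ereal (min (ereal k) (ereal (real m))) \<partial>N)) \<longlonglongrightarrow> ereal k"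
    by (simp add: prob_space min_def)
qed

lemma eexp_lower:
  assumes "\<psi> \<in> bbm M" "\<And>\<omega>. \<omega> \<in> space M \<Longrightarrow> ereal k \<le> \<psi> \<omega>"
  shows "ereal k \<le> eexp N \<psi>"
  using eexp_mono[OF bbm_const assms(1), of k] assms(2) by (simp add: eexp_const)

lemma eexp_add:
  assumes "\<psi> \<in> bbm M" "\<phi> \<in> bbm M"
  shows "eexp N (\<lambda>\<omega>. \<psi> \<omega> + \<phi> \<omega>) = eexp N \<psi> + eexp N \<phi>"
proof -
  obtain c d where c: "0 \<le> c" "\<And>\<omega>. \<omega> \<in> space M \<Longrightarrow> ereal (- c) \<le> \<psi> \<omega>"
    and d: "0 \<le> d" "\<And>\<omega>. \<omega> \<in> space M \<Longrightarrow> ereal (- d) \<le> \<phi> \<omega>"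
    using bbm_lower assms by metis
  have cd: "ereal (- (c + d)) \<le> \<psi> \<omega> + \<phi> \<omega>" if "\<omega> \<in> space M" for \<omega>
    using add_mono[OF c(2)[OF that] d(2)[OF that]] by simp
  have [measurable]: "\<psi> \<in> borel_measurable N" "\<phi> \<in> borel_measurable N"
    using assms bbm_measurable measurable_cong_sets[OF sets refl, of "borel :: ereal measure"] by auto
  have "(\<integral>\<^sup>+\<omega>. e2ennreal (\<psi> \<omega> + \<phi> \<omega> + ereal (c + d)) \<partial>N)
      = (\<integral>\<^sup>+\<omega>. e2ennreal (\<psi> \<omega> + ereal c) + e2ennreal (\<phi> \<omega> + ereal d) \<partial>N)"
  proof (rule nn_integral_cong)
    fix \<omega> assume "\<omega> \<in> space N"
    then have w: "\<omega> \<in> space M" by (simp add: space_eq)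
    have "enn2ereal (e2ennreal (\<psi> \<omega> + \<phi> \<omega> + ereal (c + d))) = \<psi> \<omega> + \<phi> \<omega> + ereal (c + d)"
      using add_right_mono[OF cd[OF w], of "ereal (c + d)"] by (intro enn2ereal_e2ennreal) (simp add: zero_ereal_def)
    moreover have "enn2ereal (e2ennreal (\<psi> \<omega> + ereal c)) = \<psi> \<omega> + ereal c"
      using add_right_mono[OF c(2)[OF w], of "ereal c"] by (intro enn2ereal_e2ennreal) (simp add: zero_ereal_def)
    moreover have "enn2ereal (e2ennreal (\<phi> \<omega> + ereal d)) = \<phi> \<omega> + ereal d"
      using add_right_mono[OF d(2)[OF w], of "ereal d"] by (intro enn2ereal_e2ennreal) (simp add: zero_ereal_def)
    moreover have "\<psi> \<omega> + \<phi> \<omega> + ereal (c + d) = (\<psi> \<omega> + ereal c) + (\<phi> \<omega> + ereal d)"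
      by (cases "\<psi> \<omega>"; cases "\<phi> \<omega>") auto
    ultimately show "e2ennreal (\<psi> \<omega> + \<phi> \<omega> + ereal (c + d)) = e2ennreal (\<psi> \<omega> + ereal c) + e2ennreal (\<phi> \<omega> + ereal d)"
      by (simp add: plus_ennreal.rep_eq flip: enn2ereal_inject)
  qed
  also have "\<dots> = (\<integral>\<^sup>+\<omega>. e2ennreal (\<psi> \<omega> + ereal c) \<partial>N) + (\<integral>\<^sup>+\<omega>. e2ennreal (\<phi> \<omega> + ereal d) \<partial>N)"
    by (rule nn_integral_add) measurable
  finally have *: "enn2ereal (\<integral>\<^sup>+\<omega>. e2ennreal (\<psi> \<omega> + \<phi> \<omega> + ereal (c + d)) \<partial>N)
      = enn2ereal (\<integral>\<^sup>+\<omega>. e2ennreal (\<psi> \<omega> + ereal c) \<partial>N) + enn2ereal (\<integral>\<^sup>+\<omega>. e2ennreal (\<phi> \<omega> + ereal d) \<partial>N)"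
    by (simp add: plus_ennreal.rep_eq)
  have arith: "A + B - ereal (c + d) = (A - ereal c) + (B - ereal d)" if "0 \<le> A" "0 \<le> B" for A B
    using that by (cases A; cases B) auto
  have e1: "eexp N \<psi> = enn2ereal (\<integral>\<^sup>+\<omega>. e2ennreal (\<psi> \<omega> + ereal c) \<partial>N) - ereal c"
    by (rule eexp_shift[OF assms(1) c])
  have e2: "eexp N \<phi> = enn2ereal (\<integral>\<^sup>+\<omega>. e2ennreal (\<phi> \<omega> + ereal d) \<partial>N) - ereal d"
    by (rule eexp_shift[OF assms(2) d])
  have e3: "eexp N (\<lambda>\<omega>. \<psi> \<omega> + \<phi> \<omega>)
      = enn2ereal (\<integral>\<^sup>+\<omega>. e2ennreal (\<psi> \<omega> + \<phi> \<omega> + ereal (c + d)) \<partial>N) - ereal (c + d)"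
    by (rule eexp_shift[OF bbm_add[OF assms] add_nonneg_nonneg[OF c(1) d(1)] cd])
  show ?thesis
    unfolding e1 e2 e3 *
    by (rule arith) (simp_all add: enn2ereal_nonneg)
qed

lemma eexp_mult:
  assumes "\<psi> \<in> bbm M" "0 \<le> l"
  shows "eexp N (\<lambda>\<omega>. ereal l * \<psi> \<omega>) = ereal l * eexp N \<psi>"
proof -
  obtain c where c: "0 \<le> c" "\<And>\<omega>. \<omega> \<in> space M \<Longrightarrow> ereal (- c) \<le> \<psi> \<omega>"
    using bbm_lower assms by metis
  have lc: "ereal (- (l * c)) \<le> ereal l * \<psi> \<omega>" if "\<omega> \<in> space M" for \<omega>
    using ereal_mult_left_mono[OF c(2)[OF that], of "ereal l"] assms(2) by simp
  have [measurable]: "\<psi> \<in> borel_measurable N"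
    using assms bbm_measurable measurable_cong_sets[OF sets refl, of "borel :: ereal measure"] by auto
  have dist: "ereal l * (x + ereal c) = ereal l * x + ereal (l * c)" for x
    using assms(2) by (cases x) (auto simp: distrib_left)
  have "(\<integral>\<^sup>+\<omega>. e2ennreal (ereal l * \<psi> \<omega> + ereal (l * c)) \<partial>N)
      = (\<integral>\<^sup>+\<omega>. ennreal l * e2ennreal (\<psi> \<omega> + ereal c) \<partial>N)"
  proof (rule nn_integral_cong)
    fix \<omega> assume "\<omega> \<in> space N"
    then have w: "\<omega> \<in> space M" by (simp add: space_eq)
    have "enn2ereal (e2ennreal (ereal l * \<psi> \<omega> + ereal (l * c))) = ereal l * \<psi> \<omega> + ereal (l * c)"
      using add_right_mono[OF lc[OF w], of "ereal (l * c)"] by (intro enn2ereal_e2ennreal) (simp add: zero_ereal_def)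
    moreover have "enn2ereal (e2ennreal (\<psi> \<omega> + ereal c)) = \<psi> \<omega> + ereal c"
      using add_right_mono[OF c(2)[OF w], of "ereal c"] by (intro enn2ereal_e2ennreal) (simp add: zero_ereal_def)
    ultimately show "e2ennreal (ereal l * \<psi> \<omega> + ereal (l * c)) = ennreal l * e2ennreal (\<psi> \<omega> + ereal c)"
      using assms(2) by (simp add: times_ennreal.rep_eq enn2ereal_ennreal dist flip: enn2ereal_inject)
  qed
  also have "\<dots> = ennreal l * (\<integral>\<^sup>+\<omega>. e2ennreal (\<psi> \<omega> + ereal c) \<partial>N)"
    by (rule nn_integral_cmult) measurable
  finally have *: "enn2ereal (\<integral>\<^sup>+\<omega>. e2ennreal (ereal l * \<psi> \<omega> + ereal (l * c)) \<partial>N)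
      = ereal l * enn2ereal (\<integral>\<^sup>+\<omega>. e2ennreal (\<psi> \<omega> + ereal c) \<partial>N)"
    using assms(2) by (simp add: times_ennreal.rep_eq enn2ereal_ennreal)
  have arith: "ereal l * A - ereal (l * c) = ereal l * (A - ereal c)" if "0 \<le> A" for A
    using that assms(2) by (cases A) (auto simp: right_diff_distrib)
  have lcn: "0 \<le> l * c" using assms(2) c(1) by simp
  have e1: "eexp N \<psi> = enn2ereal (\<integral>\<^sup>+\<omega>. e2ennreal (\<psi> \<omega> + ereal c) \<partial>N) - ereal c"
    by (rule eexp_shift[OF assms(1) c])
  have e2: "eexp N (\<lambda>\<omega>. ereal l * \<psi> \<omega>)
      = enn2ereal (\<integral>\<^sup>+\<omega>. e2ennreal (ereal l * \<psi> \<omega> + ereal (l * c)) \<partial>N) - ereal (l * c)"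
    by (rule eexp_shift[OF bbm_mult[OF assms] lcn lc])
  show ?thesis
    unfolding e1 e2 *
    by (rule arith) (simp add: enn2ereal_nonneg)
qed

lemma eexp_SUP:
  assumes "\<And>m::nat. \<psi> m \<in> bbm M" "\<And>m \<omega>. \<omega> \<in> space M \<Longrightarrow> \<psi> m \<omega> \<le> \<psi> (Suc m) \<omega>"
  shows "eexp N (\<lambda>\<omega>. SUP m. \<psi> m \<omega>) = (SUP m. eexp N (\<psi> m))"
proof -
  obtain c where c: "0 \<le> c" "\<And>\<omega>. \<omega> \<in> space M \<Longrightarrow> ereal (- c) \<le> \<psi> 0 \<omega>"
    using bbm_lower assms(1) by metis
  have c': "ereal (- c) \<le> \<psi> m \<omega>" if "\<omega> \<in> space M" for m \<omega>
    by (induction m) (use c assms(2) that order_trans in blast)+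
  have cs: "ereal (- c) \<le> (SUP m. \<psi> m \<omega>)" if "\<omega> \<in> space M" for \<omega>
    using c'[OF that] by (rule SUP_upper2[OF UNIV_I])
  have [measurable]: "\<psi> m \<in> borel_measurable N" for m
    using bbm_measurable[OF assms(1)[of m]] measurable_cong_sets[OF sets refl, of "borel :: ereal measure"] by simp
  have "(\<integral>\<^sup>+\<omega>. e2ennreal ((SUP m. \<psi> m \<omega>) + ereal c) \<partial>N) = (\<integral>\<^sup>+\<omega>. (SUP m. e2ennreal (\<psi> m \<omega> + ereal c)) \<partial>N)"
  proof (rule nn_integral_cong)
    fix \<omega> assume "\<omega> \<in> space N"
    then have w: "\<omega> \<in> space M" by (simp add: space_eq)
    have i: "incseq (\<lambda>m. \<psi> m \<omega>)" using assms(2) w by (intro incseq_SucI)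
    have "(\<lambda>m. \<psi> m \<omega>) \<longlonglongrightarrow> (SUP m. \<psi> m \<omega>)" by (rule LIMSEQ_SUP[OF i])
    then have "(\<lambda>m. \<psi> m \<omega> + ereal c) \<longlonglongrightarrow> (SUP m. \<psi> m \<omega>) + ereal c"
      using cs[OF w] by (intro tendsto_cadd_ereal) auto
    then have "(\<lambda>m. e2ennreal (\<psi> m \<omega> + ereal c)) \<longlonglongrightarrow> e2ennreal ((SUP m. \<psi> m \<omega>) + ereal c)"
      by (rule tendsto_e2ennrealI)
    moreover have "(\<lambda>m. e2ennreal (\<psi> m \<omega> + ereal c)) \<longlonglongrightarrow> (SUP m. e2ennreal (\<psi> m \<omega> + ereal c))"
      using i by (intro LIMSEQ_SUP incseq_SucI e2ennreal_mono add_right_mono) (auto dest: incseq_SucD)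
    ultimately show "e2ennreal ((SUP m. \<psi> m \<omega>) + ereal c) = (SUP m. e2ennreal (\<psi> m \<omega> + ereal c))"
      by (rule LIMSEQ_unique)
  qed
  also have "\<dots> = (SUP m. \<integral>\<^sup>+\<omega>. e2ennreal (\<psi> m \<omega> + ereal c) \<partial>N)"
    using assms(2) space_eq
    by (intro nn_integral_monotone_convergence_SUP_AE AE_I2 e2ennreal_mono add_right_mono) auto
  finally have *: "(\<integral>\<^sup>+\<omega>. e2ennreal ((SUP m. \<psi> m \<omega>) + ereal c) \<partial>N) = (SUP m. \<integral>\<^sup>+\<omega>. e2ennreal (\<psi> m \<omega> + ereal c) \<partial>N)" .
  have inc: "incseq (\<lambda>m. \<integral>\<^sup>+\<omega>. e2ennreal (\<psi> m \<omega> + ereal c) \<partial>N)"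
    using assms(2) space_eq by (intro incseq_SucI nn_integral_mono e2ennreal_mono add_right_mono) auto
  from LIMSEQ_SUP[OF inc] have "(\<lambda>m. enn2ereal (\<integral>\<^sup>+\<omega>. e2ennreal (\<psi> m \<omega> + ereal c) \<partial>N))
      \<longlonglongrightarrow> enn2ereal (\<integral>\<^sup>+\<omega>. e2ennreal ((SUP m. \<psi> m \<omega>) + ereal c) \<partial>N)"
    unfolding * by (rule tendsto_enn2erealI)
  then have "(\<lambda>m. enn2ereal (\<integral>\<^sup>+\<omega>. e2ennreal (\<psi> m \<omega> + ereal c) \<partial>N) + ereal (- c))
      \<longlonglongrightarrow> enn2ereal (\<integral>\<^sup>+\<omega>. e2ennreal ((SUP m. \<psi> m \<omega>) + ereal c) \<partial>N) + ereal (- c)"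
    by (intro tendsto_cadd_ereal) (auto simp: enn2ereal_nonneg)
  then have "(\<lambda>m. eexp N (\<psi> m)) \<longlonglongrightarrow> eexp N (\<lambda>\<omega>. SUP m. \<psi> m \<omega>)"
    using eexp_shift[OF assms(1) c(1) c'] eexp_shift[OF bbm_SUP[OF assms(1)] c(1) cs] by (simp add: minus_ereal_def)
  moreover have "(\<lambda>m. eexp N (\<psi> m)) \<longlonglongrightarrow> (SUP m. eexp N (\<psi> m))"
    by (intro LIMSEQ_SUP incseq_SucI eexp_mono assms)
  ultimately show ?thesis by (rule LIMSEQ_unique)
qed

lemma eexp_real:
  assumes "g \<in> borel_measurable M" "\<And>\<omega>. \<omega> \<in> space M \<Longrightarrow> \<bar>g \<omega>\<bar> \<le> c"
  shows "eexp N (\<lambda>\<omega>. ereal (g \<omega>)) = ereal (\<integral>\<omega>. g \<omega> \<partial>N)"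
  unfolding eexp_def
proof (rule limI, rule Lim_transform_eventually[OF tendsto_const])
  have "\<forall>\<^sub>F m in sequentially. c \<le> real m"
    using eventually_ge_at_top[of "nat \<lceil>c\<rceil>"] by eventually_elim linarith
  then show "\<forall>\<^sub>F m in sequentially. ereal (\<integral>\<omega>. g \<omega> \<partial>N)
      = ereal (\<integral>\<omega>. real_of_ereal (min (ereal (g \<omega>)) (ereal (real m))) \<partial>N)"
  proof eventually_elim
    case (elim m)
    have "real_of_ereal (min (ereal (g \<omega>)) (ereal (real m))) = g \<omega>" if "\<omega> \<in> space N" for \<omega>
      using assms(2)[of \<omega>] elim that by (auto simp: space_eq min_def)
    then show ?case by (intro arg_cong[where f = ereal] Bochner_Integration.integral_cong) auto
  qed
qed

end

text \<open>
  After adding a constant the function is nonnegative, and the claim is Fubini's theorem for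
  kernels.
\<close>

lemma eexp_bind:
  assumes N: "N \<in> space (prob_algebra M)" and \<kappa>: "\<kappa> \<in> measurable M (prob_algebra R)" and \<psi>: "\<psi> \<in> bbm R"
  shows "eexp (N \<bind> \<kappa>) \<psi> = eexp N (\<lambda>\<omega>. eexp (\<kappa> \<omega>) \<psi>)" and "(\<lambda>\<omega>. eexp (\<kappa> \<omega>) \<psi>) \<in> bbm M"
proof -
  obtain c where c: "0 \<le> c" "\<And>\<omega>. \<omega> \<in> space R \<Longrightarrow> ereal (- c) \<le> \<psi> \<omega>" using bbm_lower[OF \<psi>] by metis
  have m [measurable]: "\<psi> \<in> borel_measurable R" using bbm_measurable[OF \<psi>] .
  have p: "prob_space (\<kappa> \<omega>)" "sets (\<kappa> \<omega>) = sets R" if "\<omega> \<in> space M" for \<omega>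
    using measurable_space[OF \<kappa> that] by (auto simp: space_prob_algebra)
  have \<kappa>': "\<kappa> \<in> measurable M (subprob_algebra R)" using measurable_prob_algebraD[OF \<kappa>] .
  have e: "eexp (\<kappa> \<omega>) \<psi> = enn2ereal (\<integral>\<^sup>+x. e2ennreal (\<psi> x + ereal c) \<partial>\<kappa> \<omega>) - ereal c" if "\<omega> \<in> space M" for \<omega>
    by (rule eexp_shift[OF p[OF that] \<psi> c])
  have "(\<lambda>\<omega>. \<integral>\<^sup>+x. e2ennreal (\<psi> x + ereal c) \<partial>\<kappa> \<omega>) \<in> borel_measurable M"
    by (rule measurable_compose[OF \<kappa>' nn_integral_measurable_subprob_algebra]) measurable
  then have "(\<lambda>\<omega>. enn2ereal (\<integral>\<^sup>+x. e2ennreal (\<psi> x + ereal c) \<partial>\<kappa> \<omega>) - ereal c) \<in> borel_measurable M"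
    by measurable
  then have meas: "(\<lambda>\<omega>. eexp (\<kappa> \<omega>) \<psi>) \<in> borel_measurable M"
    using e by (subst measurable_cong) auto
  have low: "ereal (- c) \<le> eexp (\<kappa> \<omega>) \<psi>" if "\<omega> \<in> space M" for \<omega>
    by (rule eexp_lower[OF p[OF that] \<psi> c(2)])
  show b: "(\<lambda>\<omega>. eexp (\<kappa> \<omega>) \<psi>) \<in> bbm M" by (rule bbmI[OF meas low])
  have NP: "prob_space N" "sets N = sets M" using N by (auto simp: space_prob_algebra)
  have \<kappa>N: "\<kappa> \<in> measurable N (prob_algebra R)" "\<kappa> \<in> measurable N (subprob_algebra R)"
    using \<kappa> \<kappa>' measurable_cong_sets[OF NP(2) refl] by auto
  have B: "prob_space (N \<bind> \<kappa>)" "sets (N \<bind> \<kappa>) = sets R"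
    using prob_space_bind'[OF N \<kappa>] sets_bind'[OF N \<kappa>] by auto
  have "(\<integral>\<^sup>+x. e2ennreal (\<psi> x + ereal c) \<partial>(N \<bind> \<kappa>)) = (\<integral>\<^sup>+\<omega>. \<integral>\<^sup>+x. e2ennreal (\<psi> x + ereal c) \<partial>\<kappa> \<omega> \<partial>N)"
    by (rule nn_integral_bind[OF _ \<kappa>N(2)]) measurable
  then have "eexp (N \<bind> \<kappa>) \<psi> = enn2ereal (\<integral>\<^sup>+\<omega>. \<integral>\<^sup>+x. e2ennreal (\<psi> x + ereal c) \<partial>\<kappa> \<omega> \<partial>N) - ereal c"
    using eexp_shift[OF B \<psi> c] by simp
  also have "(\<integral>\<^sup>+\<omega>. \<integral>\<^sup>+x. e2ennreal (\<psi> x + ereal c) \<partial>\<kappa> \<omega> \<partial>N) = (\<integral>\<^sup>+\<omega>. e2ennreal (eexp (\<kappa> \<omega>) \<psi> + ereal c) \<partial>N)"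
  proof (rule nn_integral_cong)
    fix \<omega> assume "\<omega> \<in> space N"
    then have w: "\<omega> \<in> space M" using sets_eq_imp_space_eq[OF NP(2)] by simp
    have "(x - ereal c) + ereal c = x" if "0 \<le> x" for x using that by (cases x) auto
    then show "(\<integral>\<^sup>+x. e2ennreal (\<psi> x + ereal c) \<partial>\<kappa> \<omega>) = e2ennreal (eexp (\<kappa> \<omega>) \<psi> + ereal c)"
      unfolding e[OF w] by (simp add: enn2ereal_nonneg)
  qed
  also have "enn2ereal \<dots> - ereal c = eexp N (\<lambda>\<omega>. eexp (\<kappa> \<omega>) \<psi>)"
    by (rule eexp_shift[OF NP b c(1) low, symmetric])
  finally show "eexp (N \<bind> \<kappa>) \<psi> = eexp N (\<lambda>\<omega>. eexp (\<kappa> \<omega>) \<psi>)" .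
qed

lemma eexp_distr:
  assumes "f \<in> measurable N M" "\<psi> \<in> borel_measurable M"
  shows "eexp (distr N M f) \<psi> = eexp N (\<lambda>\<omega>. \<psi> (f \<omega>))"
  unfolding eexp_def
proof (intro arg_cong[where f = lim] ext arg_cong[where f = ereal] integral_distr assms(1))
  note [measurable] = assms(2)
  show "(\<lambda>\<omega>. real_of_ereal (min (\<psi> \<omega>) (ereal (real m)))) \<in> borel_measurable M" for m by measurable
qed

lemma lim_truncation:
  assumes "k \<noteq> - \<infinity>"
  shows "lim (\<lambda>m::nat. ereal (real_of_ereal (min k (ereal (real m))))) = k"
proof (rule limI)
  have "(\<lambda>m. min k (ereal (real m))) \<longlonglongrightarrow> min k \<infinity>"
    by (intro tendsto_min tendsto_const) (simp add: id_nat_ereal_tendsto_PInf)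
  moreover have "ereal (real_of_ereal (min k (ereal (real m)))) = min k (ereal (real m))" for m
    using assms by (cases k) (auto simp: min_def)
  ultimately show "(\<lambda>m. ereal (real_of_ereal (min k (ereal (real m))))) \<longlonglongrightarrow> k" by (simp add: min_def)
qed

lemma eexp_constant:
  assumes "prob_space N" "\<And>\<omega>. \<omega> \<in> space N \<Longrightarrow> \<psi> \<omega> = k" "k \<noteq> - \<infinity>"
  shows "eexp N \<psi> = k"
proof -
  interpret prob_space N by (rule assms(1))
  have "eexp N \<psi> = eexp N (\<lambda>_. k)" by (rule eexp_cong) (rule assms(2))
  also have "\<dots> = k"
    unfolding eexp_def by (simp add: prob_space lim_truncation[OF assms(3)])
  finally show ?thesis .
qed

lemma bbm_path_filt_mono:
  assumes "\<psi> \<in> bbm (path_filt kd r T u)" "u \<le> u'"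
  shows "\<psi> \<in> bbm (path_filt kd r T u')"
proof -
  obtain c where "\<And>\<omega>. \<omega> \<in> paths kd r T \<Longrightarrow> ereal c \<le> \<psi> \<omega>" using assms(1) unfolding bbm_def by auto
  then show ?thesis
    using measurable_path_filt_mono[OF bbm_measurable[OF assms(1)] assms(2)] by (intro bbmI[of _ _ c]) auto
qed

lemma bbm_compose:
  assumes "\<psi> \<in> bbm M" "f \<in> measurable N M"
  shows "(\<lambda>x. \<psi> (f x)) \<in> bbm N"
proof -
  obtain c where "\<And>\<omega>. \<omega> \<in> space M \<Longrightarrow> ereal c \<le> \<psi> \<omega>" using assms(1) unfolding bbm_def by auto
  then show ?thesis
    using measurable_compose[OF assms(2) bbm_measurable[OF assms(1)]] measurable_space[OF assms(2)]
    by (intro bbmI[of _ _ c]) auto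
qed

section \<open>The Markov property\<close>

context martingale_family
begin

definition increment :: "('n, 'e) bmap \<Rightarrow> 'k \<Rightarrow> real \<Rightarrow> real \<Rightarrow> 'n path \<Rightarrow> real" where
  "increment \<theta> k a b \<omega> = Z \<theta> k a b (restrict \<omega> {a..b})"

context
  fixes \<theta> k assumes \<theta>: "\<theta> \<in> \<Theta>" and k: "k \<in> K"
begin

lemma additive: "additive_problem kd T K (Z \<theta>)" and bounded: "bounded_problem kd T K (Z \<theta>)"
  using hypothesis \<theta> unfolding Theta_hypothesis_def by blast+

lemma increment_measurable:
  assumes "0 \<le> r" "r \<le> a" "a \<le> b" "b \<le> T"
  shows "increment \<theta> k a b \<in> borel_measurable (F r b)"
proof -
  have "Z \<theta> k a b \<in> borel_measurable (path_filt kd a b b)"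
    using additive k assms unfolding additive_problem_def by auto
  from measurable_compose[OF measurable_restrict_path this, of r b T] show ?thesis
    using assms unfolding increment_def by simp
qed

lemma increment_bounded:
  assumes "0 \<le> r" "r \<le> a" "a \<le> b" "b \<le> T"
  shows "\<exists>c. \<forall>\<omega>\<in>paths kd r T. \<bar>increment \<theta> k a b \<omega>\<bar> \<le> c"
proof -
  obtain c where "\<forall>\<omega>\<in>paths kd a b. \<bar>Z \<theta> k a b \<omega>\<bar> \<le> c"
    using bounded k assms unfolding bounded_problem_def by (meson order_trans)
  then show ?thesis unfolding increment_def
    using restrict_in_paths[of _ kd r T a b] assms by blast
qed

lemma increment_add:
  assumes "0 \<le> a" "a \<le> b" "b \<le> c" "c \<le> T" "\<omega> \<in> paths kd r T" "r \<le> a"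
  shows "increment \<theta> k a c \<omega> = increment \<theta> k a b \<omega> + increment \<theta> k b c \<omega>"
proof -
  have "restrict \<omega> {a..c} \<in> paths kd a c" using assms by (intro restrict_in_paths[of \<omega> kd r T]) auto
  then have "Z \<theta> k a c (restrict \<omega> {a..c}) = Z \<theta> k a b (restrict (restrict \<omega> {a..c}) {a..b})
      + Z \<theta> k b c (restrict (restrict \<omega> {a..c}) {b..c})"
    using additive k assms unfolding additive_problem_def by auto
  moreover have "restrict (restrict \<omega> {a..c}) {a..b} = restrict \<omega> {a..b}"
    "restrict (restrict \<omega> {a..c}) {b..c} = restrict \<omega> {b..c}"
    using assms by (auto simp: restrict_def fun_eq_iff)
  ultimately show ?thesis unfolding increment_def by simp
qed

text \<open>
  The martingale property is tested on events of the past, and additivity turns differences of the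
  process into increments. In this form it can be checked separately before and after a given
  time.
\<close>

lemma martingale_iff_increments:
  assumes s: "0 \<le> s" "s \<le> T" and Q: "prob_space Q" "sets Q = sets (F s T)"
  shows "is_martingale Q (F s) {s..T} (problem_from (Z \<theta>) s k) \<longleftrightarrow>
    (\<forall>a b. \<forall>A\<in>sets (F s a). s \<le> a \<and> a \<le> b \<and> b \<le> T \<longrightarrow>
       (\<integral>\<omega>. indicator A \<omega> * increment \<theta> k a b \<omega> \<partial>Q) = 0)"
proof -
  interpret prob_space Q by (rule Q(1))
  have spQ: "space Q = paths kd s T" using sets_eq_imp_space_eq[OF Q(2)] by simp
  have sub: "subalgebra Q (F s a)" if "a \<le> T" for a
    using sets_path_filt_mono[OF that, of kd s T] unfolding subalgebra_def spQ Q(2) by simp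
  define X where "X = problem_from (Z \<theta>) s k"
  have X: "X b = increment \<theta> k s b" for b by (auto simp: X_def problem_from_def increment_def fun_eq_iff)
  have meas: "increment \<theta> k a b \<in> borel_measurable Q" if "s \<le> a" "a \<le> b" "b \<le> T" for a b
    using measurable_path_filt_mono[OF increment_measurable[OF s(1) that] that(3)] measurable_cong_sets[OF Q(2) refl, of "borel :: real measure"] by simp
  have int: "integrable Q (increment \<theta> k a b)" if "s \<le> a" "a \<le> b" "b \<le> T" for a b
  proof -
    from increment_bounded[OF s(1) that]
    obtain c where "\<forall>\<omega>\<in>paths kd s T. \<bar>increment \<theta> k a b \<omega>\<bar> \<le> c" by blast
    then show ?thesis by (intro integrable_const_bound[of _ c] meas that AE_I2) (auto simp: spQ)
  qed
  have XS: "X b \<omega> = X a \<omega> + increment \<theta> k a b \<omega>" if "s \<le> a" "a \<le> b" "b \<le> T" "\<omega> \<in> space Q" for a b \<omega>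
    unfolding X using that s spQ by (intro increment_add[of s a b \<omega> s]) auto
  have split: "(\<integral>\<omega>. indicator A \<omega> * increment \<theta> k a b \<omega> \<partial>Q)
      = (\<integral>\<omega>\<in>A. X b \<omega> \<partial>Q) - (\<integral>\<omega>\<in>A. X a \<omega> \<partial>Q)" if ab: "s \<le> a" "a \<le> b" "b \<le> T" and A: "A \<in> sets (F s a)" for a b A
  proof -
    have AQ: "A \<in> sets Q" using A sub[of a] ab unfolding subalgebra_def by auto
    have i: "integrable Q (\<lambda>\<omega>. indicator A \<omega> *\<^sub>R X b' \<omega>)" if "s \<le> b'" "b' \<le> T" for b'
      unfolding X using int[of s b'] that AQ by (intro integrable_mult_indicator) auto
    have "(\<integral>\<omega>. indicator A \<omega> * increment \<theta> k a b \<omega> \<partial>Q)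
        = (\<integral>\<omega>. indicator A \<omega> *\<^sub>R X b \<omega> - indicator A \<omega> *\<^sub>R X a \<omega> \<partial>Q)"
      using XS[OF ab] by (intro Bochner_Integration.integral_cong) (auto simp: algebra_simps)
    also have "\<dots> = (\<integral>\<omega>\<in>A. X b \<omega> \<partial>Q) - (\<integral>\<omega>\<in>A. X a \<omega> \<partial>Q)"
      unfolding set_lebesgue_integral_def using i ab by (intro Bochner_Integration.integral_diff) auto
    finally show ?thesis .
  qed
  show ?thesis
    unfolding X_def[symmetric]
  proof
    assume M: "is_martingale Q (F s) {s..T} X"
    show "\<forall>a b. \<forall>A\<in>sets (F s a). s \<le> a \<and> a \<le> b \<and> b \<le> T \<longrightarrow>
       (\<integral>\<omega>. indicator A \<omega> * increment \<theta> k a b \<omega> \<partial>Q) = 0"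
    proof (intro allI ballI impI)
      fix a b A assume A: "A \<in> sets (F s a)" and ab: "s \<le> a \<and> a \<le> b \<and> b \<le> T"
      interpret finite_measure_subalgebra Q "F s a"
        by unfold_locales (use sub ab in auto)
      have AQ: "A \<in> sets Q" using A subalg unfolding subalgebra_def by auto
      have "AE \<omega> in Q. real_cond_exp Q (F s a) (X b) \<omega> = X a \<omega>"
        using M ab unfolding is_martingale_def by auto
      moreover have "X a \<in> borel_measurable Q" unfolding X using meas ab by simp
      ultimately have "(\<integral>\<omega>\<in>A. real_cond_exp Q (F s a) (X b) \<omega> \<partial>Q) = (\<integral>\<omega>\<in>A. X a \<omega> \<partial>Q)"
        using AQ borel_measurable_cond_exp2 unfolding set_lebesgue_integral_def
        by (intro integral_cong_AE borel_measurable_scaleR) (auto elim: eventually_mono)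
      moreover have "(\<integral>\<omega>\<in>A. X b \<omega> \<partial>Q) = (\<integral>\<omega>\<in>A. real_cond_exp Q (F s a) (X b) \<omega> \<partial>Q)"
        by (rule real_cond_exp_intA) (use A int ab in \<open>auto simp: X\<close>)
      ultimately show "(\<integral>\<omega>. indicator A \<omega> * increment \<theta> k a b \<omega> \<partial>Q) = 0"
        using split[OF _ _ _ A] ab by simp
    qed
  next
    assume I: "\<forall>a b. \<forall>A\<in>sets (F s a). s \<le> a \<and> a \<le> b \<and> b \<le> T \<longrightarrow>
       (\<integral>\<omega>. indicator A \<omega> * increment \<theta> k a b \<omega> \<partial>Q) = 0"
    show "is_martingale Q (F s) {s..T} X"
      unfolding is_martingale_def
    proof (intro conjI ballI impI)
      fix u assume "u \<in> {s..T}"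
      then show "X u \<in> borel_measurable (F s u)" "integrable Q (X u)"
        unfolding X using increment_measurable[OF s(1)] int by auto
    next
      fix a b assume ab: "a \<in> {s..T}" "b \<in> {s..T}" "a \<le> b"
      interpret finite_measure_subalgebra Q "F s a"
        by unfold_locales (use sub ab in auto)
      show "AE \<omega> in Q. real_cond_exp Q (F s a) (X b) \<omega> = X a \<omega>"
      proof (rule real_cond_exp_charact)
        fix A assume A: "A \<in> sets (F s a)"
        then show "(\<integral>\<omega>\<in>A. X b \<omega> \<partial>Q) = (\<integral>\<omega>\<in>A. X a \<omega> \<partial>Q)"
          using I split[OF _ _ _ A, of b] ab by auto
      qed (use ab int increment_measurable[OF s(1)] in \<open>auto simp: X\<close>)
    qed
  qed
qed

lemma law_increment_zero:
  assumes "0 \<le> s" "s < T" "s \<le> a" "a \<le> b" "b \<le> T" "A \<in> sets (F s a)"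
  shows "(\<integral>\<omega>. indicator A \<omega> * increment \<theta> k a b \<omega> \<partial>P \<theta> s x) = 0"
proof -
  have "is_martingale (P \<theta> s x) (F s) {s..T} (problem_from (Z \<theta>) s k)"
    using law_is_solution[OF \<theta> assms(1,2)] k unfolding is_solution_def by blast
  then show ?thesis
    using martingale_iff_increments[OF assms(1) less_imp_le[OF assms(2)] prob_space_law[OF \<theta> assms(1,2)] sets_law[OF \<theta> assms(1,2)]]
      assms by blast
qed

end

text \<open>
  The law of the path that follows \<open>\<omega>\<close> up to time \<open>s\<close> and
  continues with the solution started from the point reached.
\<close>

definition kernel :: "('n, 'e) bmap \<Rightarrow> real \<Rightarrow> real \<Rightarrow> 'n path \<Rightarrow> 'n path measure" where
  "kernel \<theta> r s \<omega> = distr (P \<theta> s (\<omega> s)) (F r T) (splice r s T \<omega>)"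

lemma kernel_measurable:
  assumes "\<theta> \<in> \<Theta>" "0 \<le> r" "r \<le> s" "s < T"
  shows "kernel \<theta> r s \<in> measurable (F r T) (prob_algebra (F r T))"
  unfolding kernel_def[abs_def]
proof (rule measurable_distr_prob_space2)
  show "(\<lambda>\<omega>. P \<theta> s (\<omega> s)) \<in> measurable (F r T) (prob_algebra (F s T))"
    by (rule measurable_compose[OF measurable_coordinate law_kernel]) (use assms in auto)
  show "(\<lambda>(\<omega>, y). splice r s T \<omega> y) \<in> measurable (F r T \<Otimes>\<^sub>M F s T) (F r T)"
    by (rule measurable_splice) (use assms in auto)
qed

lemma law_in_prob_algebra:
  assumes "\<theta> \<in> \<Theta>" "0 \<le> s" "s < T"
  shows "P \<theta> s x \<in> space (prob_algebra (F s T))"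
  using prob_space_law[OF assms] sets_law[OF assms] by (simp add: space_prob_algebra)

lemma kernel_prob_space:
  assumes "\<theta> \<in> \<Theta>" "0 \<le> r" "r \<le> s" "s < T" "\<omega> \<in> paths kd r T"
  shows "prob_space (kernel \<theta> r s \<omega>)" "sets (kernel \<theta> r s \<omega>) = sets (F r T)"
  using measurable_space[OF kernel_measurable[OF assms(1-4)]] assms(5) by (auto simp: space_prob_algebra)

lemma splice_law_measurable:
  assumes "\<theta> \<in> \<Theta>" "0 \<le> r" "r \<le> s" "s < T" "\<omega> \<in> paths kd r T"
  shows "splice r s T \<omega> \<in> measurable (P \<theta> s x) (F r T)"
proof -
  have "splice r s T \<omega> \<in> measurable (F s T) (F r T)"
    by (rule measurable_splice_section) (use assms in auto)
  then show ?thesis using assms(2,3) by (simp add: measurable_law[OF assms(1) _ assms(4)])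
qed

lemma integral_kernel:
  fixes h :: "'n path \<Rightarrow> real"
  assumes "\<theta> \<in> \<Theta>" "0 \<le> r" "r \<le> s" "s < T" "\<omega> \<in> paths kd r T" "h \<in> borel_measurable (F r T)"
  shows "(\<integral>x. h x \<partial>kernel \<theta> r s \<omega>) = (\<integral>\<omega>'. h (splice r s T \<omega> \<omega>') \<partial>P \<theta> s (\<omega> s))"
  unfolding kernel_def by (rule integral_distr[OF splice_law_measurable[OF assms(1-5)] assms(6)])

text \<open>
  Restarting the solution at time \<open>v\<close> from the point reached there gives again a solution with the
  same starting point: before \<open>v\<close> increments have mean zero under the first law, after \<open>v\<close> under
  the restarted one.  Uniqueness identifies the two laws.
\<close>

lemma law_Markov:
  assumes \<theta>: "\<theta> \<in> \<Theta>" and s: "0 \<le> s" "s \<le> v" "v < T"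
  shows "P \<theta> s x = P \<theta> s x \<bind> kernel \<theta> s v"
proof (rule law_unique[OF \<theta>])
  let ?Q = "P \<theta> s x \<bind> kernel \<theta> s v"
  have sT: "s < T" using s by simp
  note \<kappa> = kernel_measurable[OF \<theta> s]
  note PP = law_in_prob_algebra[OF \<theta> s(1) sT, of x]
  have Q: "prob_space ?Q" "sets ?Q = sets (F s T)"
    using prob_space_bind'[OF PP \<kappa>] sets_bind'[OF PP \<kappa>] by auto
  have spQ: "space ?Q = paths kd s T" using sets_eq_imp_space_eq[OF Q(2)] by simp
  have \<kappa>P: "kernel \<theta> s v \<in> measurable (P \<theta> s x) (subprob_algebra (F s T))"
    using measurable_prob_algebraD[OF \<kappa>] by (simp add: measurable_law[OF \<theta> s(1) sT])
  have intQ: "(\<integral>\<omega>. h \<omega> \<partial>?Q) = (\<integral>\<omega>. \<integral>\<omega>'. h (splice s v T \<omega> \<omega>') \<partial>P \<theta> v (\<omega> v) \<partial>P \<theta> s x)"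
    if h: "h \<in> borel_measurable (F s T)" "\<And>\<omega>. \<omega> \<in> paths kd s T \<Longrightarrow> \<bar>h \<omega>\<bar> \<le> c" for h :: "'n path \<Rightarrow> real" and c
  proof -
    interpret p: prob_space "P \<theta> s x" by (rule prob_space_law[OF \<theta> s(1) sT])
    have "(\<integral>\<omega>. h \<omega> \<partial>?Q) = (\<integral>\<omega>. \<integral>y. h y \<partial>kernel \<theta> s v \<omega> \<partial>P \<theta> s x)"
    proof (rule integral_bind[OF h(1) _ \<kappa>P p.finite_measure_axioms, where B' = 1 and B = c])
      show "AE \<omega> in P \<theta> s x. emeasure (kernel \<theta> s v \<omega>) (space (kernel \<theta> s v \<omega>)) \<le> ennreal 1"
        by (intro AE_I2)
           (simp add: space_law[OF \<theta> s(1) sT] prob_space.emeasure_space_1[OF kernel_prob_space(1)[OF \<theta> s]])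
    qed (use h(2) in auto)
    also have "\<dots> = (\<integral>\<omega>. \<integral>\<omega>'. h (splice s v T \<omega> \<omega>') \<partial>P \<theta> v (\<omega> v) \<partial>P \<theta> s x)"
      by (rule Bochner_Integration.integral_cong)
         (auto simp: space_law[OF \<theta> s(1) sT] integral_kernel[OF \<theta> s _ h(1)])
    finally show ?thesis .
  qed
  show "is_solution kd K s T x (problem_from (Z \<theta>) s) ?Q"
    unfolding is_solution_def
  proof (intro conjI ballI Q)
    have ev: "{\<omega> \<in> paths kd s T. \<omega> s = x} \<in> sets (F s T)"
      using measurable_sets[OF measurable_coordinate[of s s T kd T], of "{x}"] sT
      by (auto simp: vimage_def Int_def conj_commute)
    have "AE \<omega> in ?Q. \<omega> s = x"
    proof (subst AE_bind[OF \<kappa>P])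
      show "Measurable.pred (F s T) (\<lambda>\<omega>. \<omega> s = x)" using ev by (simp add: pred_def)
      show "AE \<omega> in P \<theta> s x. AE y in kernel \<theta> s v \<omega>. y s = x"
        using law_start[OF \<theta> s(1) sT, of x] AE_space[of "P \<theta> s x"]
      proof eventually_elim
        case (elim \<omega>)
        then have w: "\<omega> \<in> paths kd s T" using space_law[OF \<theta> s(1) sT] by simp
        have "AE y in P \<theta> v (\<omega> v). splice s v T \<omega> y s = x"
          using elim(1) s by (intro AE_I2) (simp add: splice_upto)
        then show ?case unfolding kernel_def
          using AE_distr_iff[OF splice_law_measurable[OF \<theta> s w], of "\<lambda>y. y s = x"] ev by simp
      qed
    qed
    then have "AE \<omega> in ?Q. \<omega> \<in> {\<omega> \<in> space ?Q. \<omega> s = x}"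
      using AE_space[of ?Q] by eventually_elim simp
    moreover have "{\<omega> \<in> space ?Q. \<omega> s = x} \<in> sets ?Q" using ev unfolding spQ Q(2) .
    ultimately show "measure ?Q {\<omega> \<in> space ?Q. \<omega> s = x} = 1"
      using prob_space.prob_eq_1[OF Q(1)] by blast
  next
    fix k assume k: "k \<in> K"
    show "is_martingale ?Q (F s) {s..T} (problem_from (Z \<theta>) s k)"
      unfolding martingale_iff_increments[OF \<theta> k s(1) less_imp_le[OF sT] Q]
    proof (intro allI ballI impI)
      fix a b A assume A: "A \<in> sets (F s a)" and "s \<le> a \<and> a \<le> b \<and> b \<le> T"
      then have ab: "s \<le> a" "a \<le> b" "b \<le> T" by auto
      have hb: "\<exists>c. \<forall>\<omega>\<in>paths kd s T. \<bar>indicator A \<omega> * increment \<theta> k a' b' \<omega>\<bar> \<le> c"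
        if "s \<le> a'" "a' \<le> b'" "b' \<le> T" for a' b'
      proof -
        from increment_bounded[OF \<theta> k s(1) that]
        obtain c where "\<forall>\<omega>\<in>paths kd s T. \<bar>increment \<theta> k a' b' \<omega>\<bar> \<le> c" by blast
        then show ?thesis by (intro exI[of _ "\<bar>c\<bar>"]) (auto simp: indicator_def abs_mult intro: order_trans)
      qed
      have hm: "(\<lambda>\<omega>. indicator A \<omega> * increment \<theta> k a' b' \<omega>) \<in> borel_measurable (F s T)"
        if "s \<le> a'" "a' \<le> b'" "b' \<le> T" for a' b'
        using measurable_path_filt_mono[OF increment_measurable[OF \<theta> k s(1) that] that(3)] A ab
          sets_path_filt_mono[of a T kd s T]
        by (intro borel_measurable_times borel_measurable_indicator) auto
      \<comment> \<open>Up to time \<open>v\<close> the spliced path is the first path.\<close>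
      have before: "(\<integral>\<omega>. indicator A \<omega> * increment \<theta> k a' b' \<omega> \<partial>?Q) = 0"
        if ab': "a \<le> a'" "a' \<le> b'" "b' \<le> v" for a' b'
      proof -
        have ab2: "s \<le> a'" "a' \<le> b'" "b' \<le> T" using ab' ab s by auto
        obtain c where c: "\<forall>\<omega>\<in>paths kd s T. \<bar>indicator A \<omega> * increment \<theta> k a' b' \<omega>\<bar> \<le> c"
          using hb[OF ab2] by blast
        have "(\<integral>\<omega>. indicator A \<omega> * increment \<theta> k a' b' \<omega> \<partial>?Q)
          = (\<integral>\<omega>. \<integral>\<omega>'. indicator A (splice s v T \<omega> \<omega>') * increment \<theta> k a' b' (splice s v T \<omega> \<omega>') \<partial>P \<theta> v (\<omega> v) \<partial>P \<theta> s x)"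
          by (rule intQ[OF hm[OF ab2]]) (use c in auto)
        also have "\<dots> = (\<integral>\<omega>. indicator A \<omega> * increment \<theta> k a' b' \<omega> \<partial>P \<theta> s x)"
        proof (rule Bochner_Integration.integral_cong[OF refl])
          fix \<omega> assume "\<omega> \<in> space (P \<theta> s x)"
          then have w: "\<omega> \<in> paths kd s T" using space_law[OF \<theta> s(1) sT] by simp
          have "indicator A (splice s v T \<omega> \<omega>') * increment \<theta> k a' b' (splice s v T \<omega> \<omega>')
              = indicator A \<omega> * increment \<theta> k a' b' \<omega>" if "\<omega>' \<in> space (P \<theta> v (\<omega> v))" for \<omega>'
          proof -
            have w': "splice s v T \<omega> \<omega>' \<in> paths kd s T"
              using that w s space_law[OF \<theta> _ s(3)] by (intro splice_in_paths) auto
            have eq: "splice s v T \<omega> \<omega>' u = \<omega> u" if "s \<le> u" "u \<le> v" for u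
              using that s by (simp add: splice_upto)
            have "splice s v T \<omega> \<omega>' \<in> A \<longleftrightarrow> \<omega> \<in> A"
              by (rule path_filt_agree_mem[OF A w' w]) (use eq ab' in auto)
            moreover have "increment \<theta> k a' b' (splice s v T \<omega> \<omega>') = increment \<theta> k a' b' \<omega>"
              by (rule path_filt_agree_fun[OF increment_measurable[OF \<theta> k s(1) ab2] w' w]) (use eq ab' in auto)
            ultimately show ?thesis by (simp add: indicator_def)
          qed
          then have "(\<integral>\<omega>'. indicator A (splice s v T \<omega> \<omega>') * increment \<theta> k a' b' (splice s v T \<omega> \<omega>') \<partial>P \<theta> v (\<omega> v))
              = (\<integral>\<omega>'. indicator A \<omega> * increment \<theta> k a' b' \<omega> \<partial>P \<theta> v (\<omega> v))"
            by (intro Bochner_Integration.integral_cong) auto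
          also have "\<dots> = indicator A \<omega> * increment \<theta> k a' b' \<omega>"
            using prob_space.prob_space[OF prob_space_law[OF \<theta> _ s(3)]] s by simp
          finally show "(\<integral>\<omega>'. indicator A (splice s v T \<omega> \<omega>') * increment \<theta> k a' b' (splice s v T \<omega> \<omega>') \<partial>P \<theta> v (\<omega> v))
              = indicator A \<omega> * increment \<theta> k a' b' \<omega>" .
        qed
        also have "\<dots> = 0"
          by (rule law_increment_zero[OF \<theta> k s(1) sT ab2]) (use A sets_path_filt_mono[OF ab'(1)] in blast)
        finally show ?thesis .
      qed
      \<comment> \<open>After time \<open>v\<close> the increment only sees the restarted path, for which \<open>A\<close> becomes an event \<open>B\<close> of its past.\<close>
      have after: "(\<integral>\<omega>. indicator A \<omega> * increment \<theta> k a' b' \<omega> \<partial>?Q) = 0"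
        if ab': "a \<le> a'" "v \<le> a'" "a' \<le> b'" "b' \<le> T" for a' b'
      proof -
        have ab2: "s \<le> a'" "a' \<le> b'" "b' \<le> T" using ab' ab s by auto
        obtain c where c: "\<forall>\<omega>\<in>paths kd s T. \<bar>indicator A \<omega> * increment \<theta> k a' b' \<omega>\<bar> \<le> c"
          using hb[OF ab2] by blast
        have "(\<integral>\<omega>. indicator A \<omega> * increment \<theta> k a' b' \<omega> \<partial>?Q)
          = (\<integral>\<omega>. \<integral>\<omega>'. indicator A (splice s v T \<omega> \<omega>') * increment \<theta> k a' b' (splice s v T \<omega> \<omega>') \<partial>P \<theta> v (\<omega> v) \<partial>P \<theta> s x)"
          by (rule intQ[OF hm[OF ab2]]) (use c in auto)
        also have "\<dots> = (\<integral>\<omega>. 0 \<partial>P \<theta> s x)"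
        proof (rule Bochner_Integration.integral_cong[OF refl])
          fix \<omega> assume "\<omega> \<in> space (P \<theta> s x)"
          then have w: "\<omega> \<in> paths kd s T" using space_law[OF \<theta> s(1) sT] by simp
          have v0: "0 \<le> v" using s by simp
          define B where "B = splice s v T \<omega> -` A \<inter> paths kd v T"
          have B: "B \<in> sets (F v a')"
          proof -
            have "splice s v T \<omega> \<in> measurable (F v a') (F s a')"
              using ab' ab w s by (intro measurable_splice_section) auto
            moreover have "A \<in> sets (F s a')" using A sets_path_filt_mono[OF ab'(1)] by blast
            ultimately show ?thesis unfolding B_def by (auto dest: measurable_sets)
          qed
          have im: "increment \<theta> k a' b' \<in> borel_measurable (P \<theta> v (\<omega> v))"
            unfolding measurable_law[OF \<theta> v0 s(3)]
            using measurable_path_filt_mono[OF increment_measurable[OF \<theta> k v0 ab'(2-4)] ab'(4)] .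
          have BP: "B \<in> sets (P \<theta> v (\<omega> v))"
            using B sets_path_filt_mono[of a' T kd v T] ab' sets_law[OF \<theta> v0 s(3)] by auto
          have "(\<integral>\<omega>'. indicator A (splice s v T \<omega> \<omega>') * increment \<theta> k a' b' (splice s v T \<omega> \<omega>') \<partial>P \<theta> v (\<omega> v))
              = (\<integral>\<omega>'. indicator B \<omega>' * increment \<theta> k a' b' \<omega>' \<partial>P \<theta> v (\<omega> v))"
          proof (rule integral_cong_AE)
            show "(\<lambda>\<omega>'. indicator A (splice s v T \<omega> \<omega>') * increment \<theta> k a' b' (splice s v T \<omega> \<omega>')) \<in> borel_measurable (P \<theta> v (\<omega> v))"
              by (rule measurable_compose[OF splice_law_measurable[OF \<theta> s w] hm[OF ab2]])
            show "(\<lambda>\<omega>'. indicator B \<omega>' * increment \<theta> k a' b' \<omega>') \<in> borel_measurable (P \<theta> v (\<omega> v))"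
              using im BP by (intro borel_measurable_times borel_measurable_indicator)
            show "AE \<omega>' in P \<theta> v (\<omega> v). indicator A (splice s v T \<omega> \<omega>') * increment \<theta> k a' b' (splice s v T \<omega> \<omega>')
                = indicator B \<omega>' * increment \<theta> k a' b' \<omega>'"
              using law_start[OF \<theta> v0 s(3), of "\<omega> v"] AE_space[of "P \<theta> v (\<omega> v)"]
            proof eventually_elim
              case (elim \<omega>')
              have "restrict (splice s v T \<omega> \<omega>') {a'..b'} = restrict \<omega>' {a'..b'}"
                using elim(1) ab' s splice_after[of s v _ T \<omega> \<omega>'] by (auto simp: restrict_def fun_eq_iff)
              then have "increment \<theta> k a' b' (splice s v T \<omega> \<omega>') = increment \<theta> k a' b' \<omega>'"
                unfolding increment_def by simp
              moreover have "\<omega>' \<in> B \<longleftrightarrow> splice s v T \<omega> \<omega>' \<in> A"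
                using elim(2) space_law[OF \<theta> v0 s(3)] unfolding B_def by simp
              ultimately show ?case by (simp add: indicator_def)
            qed
          qed
          also have "\<dots> = 0" by (rule law_increment_zero[OF \<theta> k v0 s(3) ab'(2-4) B])
          finally show "(\<integral>\<omega>'. indicator A (splice s v T \<omega> \<omega>') * increment \<theta> k a' b' (splice s v T \<omega> \<omega>') \<partial>P \<theta> v (\<omega> v)) = 0" .
        qed
        finally show ?thesis by simp
      qed
      consider "b \<le> v" | "v \<le> a" | "a \<le> v" "v \<le> b" by linarith
      then show "(\<integral>\<omega>. indicator A \<omega> * increment \<theta> k a b \<omega> \<partial>?Q) = 0"
      proof cases
        case 1
        then show ?thesis using before[of a b] ab by simp
      next
        case 2
        then show ?thesis using after[of a b] ab by simp
      next
        case 3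
        have i: "integrable ?Q (\<lambda>\<omega>. indicator A \<omega> * increment \<theta> k a' b' \<omega>)"
          if "s \<le> a'" "a' \<le> b'" "b' \<le> T" for a' b'
        proof -
          interpret q: prob_space ?Q by (rule Q(1))
          from hb[OF that]
          obtain c where c: "\<forall>\<omega>\<in>paths kd s T. \<bar>indicator A \<omega> * increment \<theta> k a' b' \<omega>\<bar> \<le> c" by blast
          show ?thesis
            by (rule q.integrable_const_bound[of _ c])
               (use c hm[OF that] measurable_cong_sets[OF Q(2) refl, of "borel :: real measure"] spQ in \<open>auto intro: AE_I2\<close>)
        qed
        have "(\<integral>\<omega>. indicator A \<omega> * increment \<theta> k a b \<omega> \<partial>?Q)
            = (\<integral>\<omega>. indicator A \<omega> * increment \<theta> k a v \<omega> + indicator A \<omega> * increment \<theta> k v b \<omega> \<partial>?Q)"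
          using increment_add[OF \<theta> k _ 3 ab(3), of _ s] ab s
          by (intro Bochner_Integration.integral_cong) (auto simp: spQ algebra_simps)
        also have "\<dots> = 0"
          using i[of a v] i[of v b] ab 3 s before[of a v] after[of v b]
          by (subst Bochner_Integration.integral_add) auto
        finally show ?thesis .
      qed
    qed
  qed
qed (use s in auto)

end

section \<open>Lower semicontinuous functions\<close>

abbreviation lscb :: "('a::topological_space \<Rightarrow> ereal) \<Rightarrow> bool" where
  "lscb \<equiv> lsc_bounded_below euclidean"

lemma lscb_iff: "lscb f \<longleftrightarrow> (\<forall>a. open {x. a < f x}) \<and> (\<exists>c::real. \<forall>x. ereal c \<le> f x)"
  unfolding lsc_bounded_below_def by simp

lemma lscb_borel: "lscb f \<Longrightarrow> f \<in> borel_measurable borel"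
  unfolding lscb_iff by (intro borel_measurableI_greater) auto

lemma lscb_compose:
  assumes "lscb f" "continuous_on UNIV h"
  shows "lscb (\<lambda>x. f (h x))"
proof -
  have "open {x. a < f (h x)}" for a
    using open_vimage[of "{x. a < f x}" h] assms unfolding lscb_iff by (simp add: vimage_def)
  then show ?thesis using assms(1) unfolding lscb_iff by auto
qed

lemma lscb_SUP:
  assumes "I \<noteq> {}" "\<And>i. i \<in> I \<Longrightarrow> lscb (f i)"
  shows "lscb (\<lambda>x. SUP i\<in>I. f i x)"
  unfolding lscb_iff
proof (intro conjI allI)
  fix a
  have "{x. a < (SUP i\<in>I. f i x)} = (\<Union>i\<in>I. {x. a < f i x})" by (auto simp: less_SUP_iff)
  then show "open {x. a < (SUP i\<in>I. f i x)}" using assms(2) by (auto simp: lscb_iff)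
next
  obtain i where i: "i \<in> I" using assms(1) by blast
  then obtain c where c: "\<And>x. ereal c \<le> f i x" using assms(2) unfolding lscb_iff by blast
  have "ereal c \<le> (SUP i\<in>I. f i x)" for x by (rule SUP_upper2[OF i]) (rule c)
  then show "\<exists>c::real. \<forall>x. ereal c \<le> (SUP i\<in>I. f i x)" by blast
qed

lemma lscb_continuous:
  assumes "continuous_on UNIV g" "\<And>x. c \<le> g x"
  shows "lscb (\<lambda>x. ereal (g x))"
  unfolding lscb_iff
proof (intro conjI allI)
  fix a :: ereal
  have "open (g -` {y. a < ereal y})"
  proof (rule open_vimage[OF _ assms(1)])
    have "{y. a < ereal y} = ereal -` {a<..}" by auto
    then show "open {y. a < ereal y}" using open_ereal_vimage[of "{a<..}"] by simp
  qed
  then show "open {x. a < ereal (g x)}" by (simp add: vimage_def)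
qed (use assms(2) in auto)

text \<open>
  The inf-convolutions \<open>x \<mapsto> inf\<^sub>q (min (f q) m + m dist x q)\<close> increase to \<open>f\<close>; near \<open>x\<close> lower
  semicontinuity keeps \<open>f q\<close> large, and away from \<open>x\<close> the distance term does.
\<close>

lemma lscb_Lipschitz_approximation:
  fixes f :: "'a::metric_space \<Rightarrow> ereal"
  assumes "lscb f"
  obtains g :: "nat \<Rightarrow> 'a \<Rightarrow> real" and c where
    "\<And>m x y. \<bar>g m x - g m y\<bar> \<le> real m * dist x y" "\<And>m x. - c \<le> g m x" "\<And>m x. g m x \<le> real m"
    "\<And>m x. g m x \<le> g (Suc m) x" "\<And>x. f x = (SUP m. ereal (g m x))"
proof -
  obtain c0 where c0: "\<And>x. ereal c0 \<le> f x" using assms unfolding lscb_iff by blast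
  define c where "c = max 0 (- c0)"
  have c: "0 \<le> c" "ereal (- c) \<le> f x" for x
    unfolding c_def using order_trans[OF _ c0[of x], of "ereal (- max 0 (- c0))"] by auto
  define h where "h m q = real_of_ereal (min (f q) (ereal (real m)))" for m :: nat and q
  have h: "ereal (h m q) = min (f q) (ereal (real m))" "- c \<le> h m q" "h m q \<le> real m" for m q
    unfolding h_def using truncation_bounds[OF c] by auto
  define g where "g m x = (INF q. h m q + real m * dist x q)" for m x
  have lower: "- c \<le> h m q + real m * dist x q" for m x q using h(2)[of m q] by (simp add: add_increasing2)
  then have bdd: "bdd_below (range (\<lambda>q. h m q + real m * dist x q))" for m x by (intro bdd_belowI2)
  have gle: "g m x \<le> h m q + real m * dist x q" for m x q
    unfolding g_def by (rule cINF_lower[OF bdd]) simp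
  have gge: "a \<le> g m x" if "\<And>q. a \<le> h m q + real m * dist x q" for a m x
    unfolding g_def by (rule cINF_greatest) (use that in auto)
  have lip1: "g m x \<le> g m y + real m * dist x y" for m x y
  proof -
    have "g m x - real m * dist x y \<le> g m y"
    proof (rule gge)
      fix q
      have "real m * dist x q \<le> real m * (dist x y + dist y q)"
        by (intro mult_left_mono dist_triangle) simp
      then show "g m x - real m * dist x y \<le> h m q + real m * dist y q"
        using gle[of m x q] by (simp add: distrib_left)
    qed
    then show ?thesis by simp
  qed
  have lip: "\<bar>g m x - g m y\<bar> \<le> real m * dist x y" for m x y
    using lip1[of m x y] lip1[of m y x] by (simp add: abs_le_iff dist_commute)
  have ghf: "g m x \<le> h m x" for m x using gle[of m x x] by simp
  have mono: "g m x \<le> g (Suc m) x" for m x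
  proof (rule gge)
    fix q
    have "ereal (h m q) \<le> ereal (h (Suc m) q)" unfolding h(1) by (rule min.mono) auto
    then show "g m x \<le> h (Suc m) q + real (Suc m) * dist x q"
      using gle[of m x q] by (simp add: distrib_right) (smt (verit) zero_le_dist)
  qed
  have "f x \<le> (SUP m. ereal (g m x))" for x
    unfolding le_SUP_iff
  proof (intro allI impI)
    fix y assume "y < f x"
    then obtain a where a: "y < ereal a" "ereal a < f x" using ereal_dense2 by blast
    have "open {z. ereal a < f z}" using assms unfolding lscb_iff by blast
    then obtain d where d: "d > 0" "\<And>z. dist z x < d \<Longrightarrow> ereal a < f z"
      using a(2) unfolding open_dist by blast
    \<comment> \<open>For this \<open>m\<close> the distance term exceeds \<open>a + c\<close> outside the ball of radius \<open>d\<close>.\<close>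
    obtain m where m: "max a ((a + c) / d) \<le> real m" using real_arch_simple by blast
    have "a \<le> g m x"
    proof (rule gge)
      fix q
      show "a \<le> h m q + real m * dist x q"
      proof (cases "dist q x < d")
        case True
        then have "ereal a \<le> ereal (h m q)" unfolding h(1) using d(2) m by (simp add: less_imp_le)
        then show ?thesis by (simp add: add_increasing2)
      next
        case False
        have "a + c \<le> real m * d" using m d(1) by (simp add: pos_divide_le_eq)
        also have "\<dots> \<le> real m * dist x q" using False by (intro mult_left_mono) (auto simp: dist_commute)
        finally show ?thesis using h(2)[of m q] by simp
      qed
    qed
    then show "\<exists>i\<in>UNIV. y < ereal (g i x)" using a(1) by (intro bexI[of _ m]) (auto intro: less_le_trans)
  qed
  moreover have "(SUP m. ereal (g m x)) \<le> f x" for x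
  proof (rule SUP_least)
    fix m
    have "ereal (g m x) \<le> ereal (h m x)" using ghf by simp
    also have "\<dots> \<le> f x" unfolding h(1) by simp
    finally show "ereal (g m x) \<le> f x" .
  qed
  ultimately have "f x = (SUP m. ereal (g m x))" for x by (rule antisym)
  moreover have "- c \<le> g m x" for m x by (rule gge) (rule lower)
  moreover have "g m x \<le> real m" for m x using ghf[of m x] h(3)[of m x] by simp
  ultimately show ?thesis using that lip mono by blast
qed

lemma Lipschitz_imp_continuous:
  fixes g :: "'a::metric_space \<Rightarrow> real"
  assumes "\<And>x y. \<bar>g x - g y\<bar> \<le> L * dist x y" "0 \<le> L"
  shows "continuous_on UNIV g"
  using assms by (intro lipschitz_on_continuous_on[of L]) (auto simp: lipschitz_on_def dist_real_def)

lemma lscb_add_continuous: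
  fixes f :: "'a::metric_space \<Rightarrow> ereal"
  assumes "lscb f" "continuous_on UNIV b" "\<And>x. k \<le> b x"
  shows "lscb (\<lambda>x. f x + ereal (b x))"
proof -
  obtain g c where g: "\<And>m x y. \<bar>g m x - g m y\<bar> \<le> real m * dist x y" "\<And>m x. - c \<le> g m x"
    "\<And>x. f x = (SUP m. ereal (g m x))" using lscb_Lipschitz_approximation[OF assms(1)] by metis
  have "f x + ereal (b x) = (SUP m. ereal (g m x + b x))" for x
    unfolding g(3) by (subst SUP_ereal_add_left[symmetric]) auto
  moreover have "lscb (\<lambda>x. SUP m. ereal (g m x + b x))"
  proof (rule lscb_SUP, simp, rule lscb_continuous)
    show "continuous_on UNIV (\<lambda>x. g m x + b x)" for m
      using Lipschitz_imp_continuous[OF g(1)] assms(2) by (intro continuous_on_add) auto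
    show "- c + k \<le> g m x + b x" for m x using g(2)[of m x] assms(3)[of x] by linarith
  qed
  ultimately show ?thesis by simp
qed

text \<open>Lindelof's theorem, applied to the sets \<open>{f\<^sub>i > q}\<close> with \<open>q\<close> rational.\<close>

lemma lscb_countable_SUP:
  fixes f :: "'i \<Rightarrow> 'a::second_countable_topology \<Rightarrow> ereal"
  assumes "\<And>i. i \<in> I \<Longrightarrow> lscb (f i)"
  obtains C where "C \<subseteq> I" "countable C" "\<And>x. (SUP i\<in>C. f i x) = (SUP i\<in>I. f i x)"
proof -
  have "\<exists>C\<subseteq>I. countable C \<and> (\<Union>i\<in>C. {x. ereal (real_of_rat q) < f i x}) = (\<Union>i\<in>I. {x. ereal (real_of_rat q) < f i x})" for q
  proof -
    define F where "F = (\<lambda>i. {x. ereal (real_of_rat q) < f i x}) ` I"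
    have "\<And>S. S \<in> F \<Longrightarrow> open S" using assms unfolding F_def lscb_iff by auto
    then obtain F' where F': "F' \<subseteq> F" "countable F'" "\<Union>F' = \<Union>F" using Lindelof by metis
    obtain C where "C \<subseteq> I" "countable C" "F' = (\<lambda>i. {x. ereal (real_of_rat q) < f i x}) ` C"
      using F'(1,2) unfolding F_def by (meson countable_subset_image)
    then show ?thesis using F'(3) unfolding F_def by (intro exI[of _ C]) auto
  qed
  then obtain C where C: "\<And>q. C q \<subseteq> I" "\<And>q. countable (C q)"
    "\<And>q. (\<Union>i\<in>C q. {x. ereal (real_of_rat q) < f i x}) = (\<Union>i\<in>I. {x. ereal (real_of_rat q) < f i x})"
    by metis
  show ?thesis
  proof (rule that[of "\<Union>q. C q"])
    fix x
    show "(SUP i\<in>\<Union>q. C q. f i x) = (SUP i\<in>I. f i x)"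
    proof (rule antisym)
      show "(SUP i\<in>\<Union>q. C q. f i x) \<le> (SUP i\<in>I. f i x)" using C(1) by (intro SUP_subset_mono) auto
      show "(SUP i\<in>I. f i x) \<le> (SUP i\<in>\<Union>q. C q. f i x)"
      proof (rule dense_le)
        fix y assume "y < (SUP i\<in>I. f i x)"
        then obtain q where q: "y < ereal (real_of_rat q)" "ereal (real_of_rat q) < (SUP i\<in>I. f i x)"
          using ereal_dense3 by blast
        then have "x \<in> (\<Union>i\<in>C q. {x. ereal (real_of_rat q) < f i x})"
          unfolding C(3) by (auto simp: less_SUP_iff)
        then obtain i where i: "i \<in> C q" "ereal (real_of_rat q) < f i x" by blast
        then have "f i x \<le> (SUP i\<in>\<Union>q. C q. f i x)" by (intro SUP_upper) auto
        with q(1) i(2) show "y \<le> (SUP i\<in>\<Union>q. C q. f i x)" by (meson less_le_trans less_imp_le less_trans)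
      qed
    qed
  qed (use C in auto)
qed

text \<open>
  Countably many members of the family already have the same supremum; taking common upper bounds
  of one after the other makes them increasing.
\<close>

lemma lscb_directed_sequence:
  fixes f :: "'i \<Rightarrow> 'a::second_countable_topology \<Rightarrow> ereal"
  assumes lsc: "\<And>i. i \<in> I \<Longrightarrow> lscb (f i)" and I: "I \<noteq> {}"
    and ub: "\<And>i j. i \<in> I \<Longrightarrow> j \<in> I \<Longrightarrow> \<exists>k\<in>I. \<forall>x\<in>A. f i x \<le> f k x \<and> f j x \<le> f k x"
  obtains \<iota> :: "nat \<Rightarrow> 'i" where "\<And>m. \<iota> m \<in> I" "\<And>m x. x \<in> A \<Longrightarrow> f (\<iota> m) x \<le> f (\<iota> (Suc m)) x"
    "\<And>x. x \<in> A \<Longrightarrow> (SUP m. f (\<iota> m) x) = (SUP i\<in>I. f i x)"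
proof -
  obtain C where C: "C \<subseteq> I" "countable C" "\<And>x. (SUP i\<in>C. f i x) = (SUP i\<in>I. f i x)"
    by (rule lscb_countable_SUP[of I f]) (use lsc in blast)+
  obtain i0 where i0: "i0 \<in> I" using I by blast
  have "countable (insert i0 C)" "insert i0 C \<noteq> {}" using C(2) by auto
  then obtain e :: "nat \<Rightarrow> 'i" where e: "range e = insert i0 C"
    using range_from_nat_into[of "insert i0 C"] by blast
  have eI: "e m \<in> I" for m using rangeI[of e m] C(1) i0 unfolding e by blast
  define up where "up i j = (SOME k. k \<in> I \<and> (\<forall>x\<in>A. f i x \<le> f k x \<and> f j x \<le> f k x))" for i j
  have up: "up i j \<in> I \<and> (\<forall>x\<in>A. f i x \<le> f (up i j) x \<and> f j x \<le> f (up i j) x)"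
    if "i \<in> I" "j \<in> I" for i j
    unfolding up_def by (rule someI_ex) (use ub[OF that] in blast)
  define \<iota> where "\<iota> = rec_nat (e 0) (\<lambda>m i. up i (e (Suc m)))"
  have \<iota>: "\<iota> 0 = e 0" "\<iota> (Suc m) = up (\<iota> m) (e (Suc m))" for m unfolding \<iota>_def by auto
  have \<iota>I: "\<iota> m \<in> I" for m by (induction m) (auto simp: \<iota> eI up)
  have ge: "f (e m) x \<le> f (\<iota> m) x" if "x \<in> A" for m x
    by (cases m) (use up[OF \<iota>I eI] that in \<open>auto simp: \<iota>\<close>)
  show ?thesis
  proof (rule that[of \<iota>])
    show "f (\<iota> m) x \<le> f (\<iota> (Suc m)) x" if "x \<in> A" for m x
      using up[OF \<iota>I eI] that unfolding \<iota> by blast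
    fix x assume x: "x \<in> A"
    show "(SUP m. f (\<iota> m) x) = (SUP i\<in>I. f i x)"
    proof (rule antisym)
      show "(SUP m. f (\<iota> m) x) \<le> (SUP i\<in>I. f i x)" by (intro SUP_least SUP_upper \<iota>I)
      have "(SUP i\<in>C. f i x) \<le> (SUP m. f (\<iota> m) x)"
      proof (rule SUP_least)
        fix i assume "i \<in> C"
        then have "i \<in> range e" unfolding e by blast
        then obtain m where "i = e m" by blast
        then show "f i x \<le> (SUP m. f (\<iota> m) x)" using ge[OF x, of m] by (auto intro: SUP_upper2)
      qed
      then show "(SUP i\<in>I. f i x) \<le> (SUP m. f (\<iota> m) x)" unfolding C(3) .
    qed
  qed (rule \<iota>I)
qed

text \<open>
  The parameter enters both through the law, which is weakly continuous, and through the
  integrand.  For Lipschitz integrands the two dependences separate, and \<open>f\<close> is a supremum of such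
  functions.
\<close>

lemma lscb_parameter_integral:
  fixes \<mu> :: "'z::metric_space \<Rightarrow> 'y measure" and X :: "'y \<Rightarrow> 'w::metric_space"
    and h :: "'z \<Rightarrow> 'w \<Rightarrow> 'v::metric_space"
  assumes \<mu>: "\<And>z. prob_space (\<mu> z)" "\<And>z. sets (\<mu> z) = sets M" and X: "X \<in> borel_measurable M"
    and weak: "\<And>g. continuous_on UNIV g \<Longrightarrow> bounded (range g) \<Longrightarrow>
      continuous_on UNIV (\<lambda>z. \<integral>\<omega>. g (X \<omega>) \<partial>\<mu> z :: real)"
    and h: "\<And>z z' y. dist (h z y) (h z' y) \<le> dist z z'" "\<And>z. continuous_on UNIV (h z)"
    and f: "lscb f"
  shows "lscb (\<lambda>z. eexp (\<mu> z) (\<lambda>\<omega>. f (h z (X \<omega>))))"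
proof -
  obtain g c where g: "\<And>m x y. \<bar>g m x - g m y\<bar> \<le> real m * dist x y" "\<And>m x. - c \<le> g m x"
    "\<And>m x. g m x \<le> real m" "\<And>m x. g m x \<le> g (Suc m) x" "\<And>x. f x = (SUP m. ereal (g m x))"
    using lscb_Lipschitz_approximation[OF f] by metis
  have gc: "continuous_on UNIV (g m)" for m using Lipschitz_imp_continuous[OF g(1)] by simp
  have ghc: "continuous_on UNIV (\<lambda>y. g m (h z y))" for m z
    using continuous_on_compose2[OF gc h(2)] by simp
  have gb: "\<bar>g m x\<bar> \<le> \<bar>c\<bar> + real m" for m x using g(2)[of m x] g(3)[of m x] by linarith
  have meas: "(\<lambda>\<omega>. g m (h z (X \<omega>))) \<in> borel_measurable M" for m z
    by (rule measurable_compose[OF X borel_measurable_continuous_onI[OF ghc]])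
  have bb: "(\<lambda>\<omega>. ereal (g m (h z (X \<omega>)))) \<in> bbm M" for m z
    by (rule bbmI[where c = "- c"]) (use meas g(2) in auto)
  define \<phi> where "\<phi> m z = (\<integral>\<omega>. g m (h z (X \<omega>)) \<partial>\<mu> z)" for m z
  have int: "integrable (\<mu> z) (\<lambda>\<omega>. g m (h z' (X \<omega>)))" for m z z'
  proof -
    interpret prob_space "\<mu> z" by (rule \<mu>)
    have "borel_measurable (\<mu> z) = (borel_measurable M :: ('y \<Rightarrow> real) set)"
      by (rule measurable_cong_sets[OF \<mu>(2) refl])
    then show ?thesis
      by (intro integrable_const_bound[of _ "\<bar>c\<bar> + real m"]) (use gb meas in auto)
  qed
  have e: "eexp (\<mu> z) (\<lambda>\<omega>. f (h z (X \<omega>))) = (SUP m. ereal (\<phi> m z))" for z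
  proof -
    have "eexp (\<mu> z) (\<lambda>\<omega>. f (h z (X \<omega>))) = eexp (\<mu> z) (\<lambda>\<omega>. SUP m. ereal (g m (h z (X \<omega>))))"
      unfolding g(5) ..
    also have "\<dots> = (SUP m. eexp (\<mu> z) (\<lambda>\<omega>. ereal (g m (h z (X \<omega>)))))"
      using bb g(4) by (intro eexp_SUP[OF \<mu>]) auto
    also have "\<dots> = (SUP m. ereal (\<phi> m z))"
      unfolding \<phi>_def using gb meas by (intro SUP_cong refl eexp_real[OF \<mu>]) auto
    finally show ?thesis .
  qed
  have "continuous_on UNIV (\<phi> m)" for m
    unfolding continuous_on_eq_continuous_at[OF open_UNIV]
  proof
    fix z
    have w: "continuous_on UNIV (\<lambda>z'. \<integral>\<omega>. g m (h z (X \<omega>)) \<partial>\<mu> z')"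
      by (rule weak[OF ghc]) (use gb in \<open>auto simp: bounded_iff\<close>)
    have lim: "((\<lambda>z'. real m * dist z' z + \<bar>(\<integral>\<omega>. g m (h z (X \<omega>)) \<partial>\<mu> z') - \<phi> m z\<bar>) \<longlongrightarrow> 0) (at z)"
    proof -
      have "((\<lambda>z'. \<integral>\<omega>. g m (h z (X \<omega>)) \<partial>\<mu> z') \<longlongrightarrow> \<phi> m z) (at z)"
        using w unfolding continuous_on_eq_continuous_at[OF open_UNIV] isCont_def \<phi>_def by blast
      then have "((\<lambda>z'. real m * dist z' z + \<bar>(\<integral>\<omega>. g m (h z (X \<omega>)) \<partial>\<mu> z') - \<phi> m z\<bar>)
          \<longlongrightarrow> real m * dist z z + \<bar>\<phi> m z - \<phi> m z\<bar>) (at z)"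
        by (intro tendsto_intros)
      then show ?thesis by simp
    qed
    have "\<bar>\<phi> m z' - \<phi> m z\<bar> \<le> real m * dist z' z + \<bar>(\<integral>\<omega>. g m (h z (X \<omega>)) \<partial>\<mu> z') - \<phi> m z\<bar>" for z'
    proof -
      interpret prob_space "\<mu> z'" by (rule \<mu>)
      have "\<bar>\<phi> m z' - (\<integral>\<omega>. g m (h z (X \<omega>)) \<partial>\<mu> z')\<bar> = \<bar>\<integral>\<omega>. g m (h z' (X \<omega>)) - g m (h z (X \<omega>)) \<partial>\<mu> z'\<bar>"
        unfolding \<phi>_def using int by simp
      also have "\<dots> \<le> (\<integral>\<omega>. \<bar>g m (h z' (X \<omega>)) - g m (h z (X \<omega>))\<bar> \<partial>\<mu> z')" by (rule integral_abs_bound)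
      also have "\<dots> \<le> (\<integral>\<omega>. real m * dist z' z \<partial>\<mu> z')"
      proof (rule integral_mono)
        show "\<bar>g m (h z' (X \<omega>)) - g m (h z (X \<omega>))\<bar> \<le> real m * dist z' z" for \<omega>
          using order_trans[OF g(1)[of m "h z' (X \<omega>)" "h z (X \<omega>)"] mult_left_mono[OF h(1)]] by simp
      qed (use int in auto)
      also have "\<dots> = real m * dist z' z" by (simp add: prob_space)
      finally show ?thesis by linarith
    qed
    then have "((\<lambda>z'. \<phi> m z' - \<phi> m z) \<longlongrightarrow> 0) (at z)"
      by (intro Lim_null_comparison[OF _ lim] always_eventually) simp
    then show "isCont (\<phi> m) z" unfolding isCont_def by (rule LIM_zero_cancel)
  qed
  moreover have "- c \<le> \<phi> m z" for m z
  proof -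
    interpret prob_space "\<mu> z" by (rule \<mu>)
    have "(\<integral>\<omega>. - c \<partial>\<mu> z) \<le> \<phi> m z" unfolding \<phi>_def using int g(2) by (intro integral_mono) auto
    then show ?thesis by (simp add: prob_space)
  qed
  ultimately have "lscb (\<lambda>z. SUP m. ereal (\<phi> m z))"
    by (intro lscb_SUP lscb_continuous) auto
  then show ?thesis unfolding e .
qed

text \<open>
  The distance of two sequences is a weighted sum of the distances of their members, cut off at 1.
\<close>

lemma dist_fun_mono:
  fixes a b c d :: "'i::countable \<Rightarrow> 'a::metric_space"
  assumes "\<And>i. dist (a i) (b i) \<le> dist (c i) (d i)"
  shows "dist a b \<le> dist c d"
proof -
  have s: "summable (\<lambda>n. (1/2)^n * min (dist (x (from_nat n)) (y (from_nat n))) 1)" for x y :: "'i \<Rightarrow> 'a"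
    by (rule summable_comparison_test'[of "\<lambda>n. (1/2)^n"]) (auto simp: summable_geometric_iff)
  show ?thesis
    unfolding dist_fun_def using assms by (intro suminf_le s mult_left_mono min.mono) auto
qed

section \<open>Conditional expectations along the solution kernels\<close>

context martingale_family
begin

text \<open>
  The canonical conditional expectation \<open>T\<^sup>\<theta>\<^sub>s\<close> on functions
  bounded from below, as an expectation under the solution kernel.
\<close>

definition E :: "('n, 'e) bmap \<Rightarrow> real \<Rightarrow> real \<Rightarrow> ('n path \<Rightarrow> ereal) \<Rightarrow> 'n path \<Rightarrow> ereal" where
  "E \<theta> r s \<psi> \<omega> = eexp (kernel \<theta> r s \<omega>) \<psi>"

context
  fixes \<theta> r s assumes \<theta>: "\<theta> \<in> \<Theta>" and r: "0 \<le> r" and rs: "r \<le> s" and sT: "s < T"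
begin

lemma s_nonneg: "0 \<le> s" using r rs by simp

lemma E_eq:
  assumes "\<psi> \<in> borel_measurable (F r T)" "\<omega> \<in> paths kd r T"
  shows "E \<theta> r s \<psi> \<omega> = eexp (P \<theta> s (\<omega> s)) (\<lambda>\<omega>'. \<psi> (splice r s T \<omega> \<omega>'))"
  unfolding E_def kernel_def by (rule eexp_distr[OF splice_law_measurable[OF \<theta> r rs sT assms(2)] assms(1)])

lemma kernel_in_prob_algebra:
  assumes "\<omega> \<in> paths kd r T"
  shows "kernel \<theta> r s \<omega> \<in> space (prob_algebra (F r T))"
  using kernel_prob_space[OF \<theta> r rs sT assms] by (simp add: space_prob_algebra)

lemma E_bbm:
  assumes "\<psi> \<in> bbm (F r T)"
  shows "E \<theta> r s \<psi> \<in> bbm (F r T)"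
  using eexp_bind(2)[OF kernel_in_prob_algebra[OF constant_in_paths] kernel_measurable[OF \<theta> r rs sT] assms]
  unfolding E_def .

lemma space_kernel:
  assumes "\<omega> \<in> paths kd r T"
  shows "space (kernel \<theta> r s \<omega>) = paths kd r T"
  using sets_eq_imp_space_eq[OF kernel_prob_space(2)[OF \<theta> r rs sT assms]] by simp

lemma E_cong:
  assumes "\<And>\<omega>. \<omega> \<in> paths kd r T \<Longrightarrow> \<psi> \<omega> = \<phi> \<omega>" "\<omega> \<in> paths kd r T"
  shows "E \<theta> r s \<psi> \<omega> = E \<theta> r s \<phi> \<omega>"
  unfolding E_def by (rule eexp_cong) (simp add: space_kernel assms)

lemma E_mono:
  assumes "\<psi> \<in> bbm (F r T)" "\<phi> \<in> bbm (F r T)" "\<And>\<omega>. \<omega> \<in> paths kd r T \<Longrightarrow> \<psi> \<omega> \<le> \<phi> \<omega>" "\<omega> \<in> paths kd r T"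
  shows "E \<theta> r s \<psi> \<omega> \<le> E \<theta> r s \<phi> \<omega>"
  unfolding E_def
  by (rule eexp_mono[OF kernel_prob_space[OF \<theta> r rs sT assms(4)] assms(1,2)]) (use assms(3) in auto)

lemma E_add:
  assumes "\<psi> \<in> bbm (F r T)" "\<phi> \<in> bbm (F r T)" "\<omega> \<in> paths kd r T"
  shows "E \<theta> r s (\<lambda>\<omega>. \<psi> \<omega> + \<phi> \<omega>) \<omega> = E \<theta> r s \<psi> \<omega> + E \<theta> r s \<phi> \<omega>"
  unfolding E_def by (rule eexp_add[OF kernel_prob_space[OF \<theta> r rs sT assms(3)] assms(1,2)])

lemma E_SUP:
  assumes "\<And>m::nat. \<psi> m \<in> bbm (F r T)" "\<And>m \<omega>. \<omega> \<in> paths kd r T \<Longrightarrow> \<psi> m \<omega> \<le> \<psi> (Suc m) \<omega>" "\<omega> \<in> paths kd r T"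
  shows "E \<theta> r s (\<lambda>\<omega>. SUP m. \<psi> m \<omega>) \<omega> = (SUP m. E \<theta> r s (\<psi> m) \<omega>)"
  unfolding E_def
  by (rule eexp_SUP[OF kernel_prob_space[OF \<theta> r rs sT assms(3)] assms(1)]) (use assms(2) in auto)

lemma E_not_MInf:
  assumes "\<psi> \<in> bbm (F r T)" "\<omega> \<in> paths kd r T"
  shows "E \<theta> r s \<psi> \<omega> \<noteq> - \<infinity>"
proof -
  obtain c where "\<And>\<omega>. \<omega> \<in> paths kd r T \<Longrightarrow> ereal c \<le> E \<theta> r s \<psi> \<omega>" using E_bbm[OF assms(1)] unfolding bbm_def by auto
  with assms(2) show ?thesis by fastforce
qed

lemma E_past:
  assumes "\<psi> \<in> borel_measurable (F r T)" "\<omega> \<in> paths kd r T" "\<psi> \<omega> \<noteq> - \<infinity>"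
    and "\<And>\<omega>'. \<omega>' \<in> paths kd r T \<Longrightarrow> (\<And>v. r \<le> v \<Longrightarrow> v \<le> s \<Longrightarrow> \<omega>' v = \<omega> v) \<Longrightarrow> \<psi> \<omega>' = \<psi> \<omega>"
  shows "E \<theta> r s \<psi> \<omega> = \<psi> \<omega>"
  unfolding E_eq[OF assms(1,2)]
proof (rule eexp_constant[OF prob_space_law[OF \<theta> s_nonneg sT] _ assms(3)])
  fix \<omega>' assume "\<omega>' \<in> space (P \<theta> s (\<omega> s))"
  then show "\<psi> (splice r s T \<omega> \<omega>') = \<psi> \<omega>"
    using rs sT assms(2) space_law[OF \<theta> s_nonneg sT]
    by (intro assms(4) splice_in_paths) (auto simp: splice_upto)
qed

text \<open>The flow property of the canonical conditional expectations is the Markov property.\<close>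

lemma E_flow:
  assumes sv: "s \<le> v" "v < T" and \<psi>: "\<psi> \<in> bbm (F r T)" and \<omega>: "\<omega> \<in> paths kd r T"
  shows "E \<theta> r s (E \<theta> r v \<psi>) \<omega> = E \<theta> r s \<psi> \<omega>"
proof -
  have rv: "r \<le> v" and v0: "0 \<le> v" using rs sv r by auto
  let ?P = "P \<theta> s (\<omega> s)"
  have "kernel \<theta> r v \<in> measurable (F r T) (prob_algebra (F r T))" by (rule kernel_measurable[OF \<theta> r rv sv(2)])
  have Ev: "E \<theta> r v \<psi> \<in> bbm (F r T)"
    unfolding E_def[abs_def]
    by (rule eexp_bind(2)[OF kernel_in_prob_algebra[OF constant_in_paths] kernel_measurable[OF \<theta> r rv sv(2)] \<psi>])
  have spl: "splice r s T \<omega> \<in> measurable (F s T) (F r T)"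
    by (rule measurable_splice_section) (use rs sT \<omega> in auto)
  have \<psi>s: "(\<lambda>\<omega>'. \<psi> (splice r s T \<omega> \<omega>')) \<in> bbm (F s T)" by (rule bbm_compose[OF \<psi> spl])
  have "E \<theta> r s (E \<theta> r v \<psi>) \<omega> = eexp ?P (\<lambda>\<omega>'. E \<theta> r v \<psi> (splice r s T \<omega> \<omega>'))"
    by (rule E_eq[OF bbm_measurable[OF Ev] \<omega>])
  also have "\<dots> = eexp ?P (\<lambda>\<omega>'. eexp (kernel \<theta> s v \<omega>') (\<lambda>\<omega>''. \<psi> (splice r s T \<omega> \<omega>'')))"
  proof (rule eexp_cong_AE[OF prob_space_law[OF \<theta> s_nonneg sT] sets_law[OF \<theta> s_nonneg sT]])
    show "(\<lambda>\<omega>'. E \<theta> r v \<psi> (splice r s T \<omega> \<omega>')) \<in> bbm (F s T)" by (rule bbm_compose[OF Ev spl])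
    show "(\<lambda>\<omega>'. eexp (kernel \<theta> s v \<omega>') (\<lambda>\<omega>''. \<psi> (splice r s T \<omega> \<omega>''))) \<in> bbm (F s T)"
      by (rule eexp_bind(2)[OF law_in_prob_algebra[OF \<theta> s_nonneg sT] kernel_measurable[OF \<theta> s_nonneg sv] \<psi>s])
    show "AE \<omega>' in ?P. E \<theta> r v \<psi> (splice r s T \<omega> \<omega>') = eexp (kernel \<theta> s v \<omega>') (\<lambda>\<omega>''. \<psi> (splice r s T \<omega> \<omega>''))"
      using law_start[OF \<theta> s_nonneg sT, of "\<omega> s"] AE_space[of ?P]
    proof eventually_elim
      case (elim \<omega>')
      then have \<omega>': "\<omega>' \<in> paths kd s T" using space_law[OF \<theta> s_nonneg sT] by simp
      have sp: "splice r s T \<omega> \<omega>' \<in> paths kd r T" using \<omega> \<omega>' rs sT by (intro splice_in_paths) auto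
      have "E \<theta> r v \<psi> (splice r s T \<omega> \<omega>')
          = eexp (P \<theta> v (splice r s T \<omega> \<omega>' v)) (\<lambda>\<omega>''. \<psi> (splice r v T (splice r s T \<omega> \<omega>') \<omega>''))"
        unfolding E_def kernel_def
        by (rule eexp_distr[OF splice_law_measurable[OF \<theta> r rv sv(2) sp] bbm_measurable[OF \<psi>]])
      \<comment> \<open>Almost every \<open>\<omega>'\<close> starts at \<open>\<omega> s\<close>, so splicing does not shift it.\<close>
      also have "splice r s T \<omega> \<omega>' v = \<omega>' v" using elim(1) rs sv sT by (simp add: splice_after)
      also have "eexp (P \<theta> v (\<omega>' v)) (\<lambda>\<omega>''. \<psi> (splice r v T (splice r s T \<omega> \<omega>') \<omega>''))
          = eexp (P \<theta> v (\<omega>' v)) (\<lambda>\<omega>''. \<psi> (splice r s T \<omega> (splice s v T \<omega>' \<omega>'')))"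
        using rs sv by (simp add: splice_splice)
      also have "\<dots> = eexp (kernel \<theta> s v \<omega>') (\<lambda>\<omega>''. \<psi> (splice r s T \<omega> \<omega>''))"
        unfolding kernel_def
        by (rule eexp_distr[symmetric, OF splice_law_measurable[OF \<theta> s_nonneg sv \<omega>'] bbm_measurable[OF \<psi>s]])
      finally show ?case .
    qed
  qed
  also have "\<dots> = eexp (?P \<bind> kernel \<theta> s v) (\<lambda>\<omega>''. \<psi> (splice r s T \<omega> \<omega>''))"
    by (rule eexp_bind(1)[symmetric, OF law_in_prob_algebra[OF \<theta> s_nonneg sT] kernel_measurable[OF \<theta> s_nonneg sv] \<psi>s])
  also have "\<dots> = eexp ?P (\<lambda>\<omega>''. \<psi> (splice r s T \<omega> \<omega>''))"
    using law_Markov[OF \<theta> s_nonneg sv, of "\<omega> s"] by simp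
  also have "\<dots> = E \<theta> r s \<psi> \<omega>" by (rule E_eq[symmetric, OF bbm_measurable[OF \<psi>] \<omega>])
  finally show ?thesis .
qed

end

text \<open>
  The lower semicontinuous functions of finitely many coordinates up to time \<open>u\<close>.  Writing the
  observation times as \<open>\<tau> i\<close> stopped at \<open>u\<close>, one sequence \<open>\<tau>\<close> serves all \<open>u\<close>; the value \<open>T\<close> among
  the \<open>\<tau> i\<close> makes \<open>X\<^sub>u\<close> one of the coordinates.
\<close>

definition cyl :: "real \<Rightarrow> (nat \<Rightarrow> real) \<Rightarrow> real \<Rightarrow> ('n path \<Rightarrow> ereal) set" where
  "cyl r \<tau> u = {W. \<exists>f. lscb f \<and> (\<forall>\<omega>\<in>paths kd r T. W \<omega> = f (\<lambda>i. \<omega> (min (\<tau> i) u)))}"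

lemma cylE:
  assumes "W \<in> cyl r \<tau> u"
  obtains f where "lscb f" "\<And>\<omega>. \<omega> \<in> paths kd r T \<Longrightarrow> W \<omega> = f (\<lambda>i. \<omega> (min (\<tau> i) u))"
  using assms unfolding cyl_def by blast

lemma cyl_cong:
  "W \<in> cyl r \<tau> u \<Longrightarrow> (\<And>\<omega>. \<omega> \<in> paths kd r T \<Longrightarrow> W' \<omega> = W \<omega>) \<Longrightarrow> W' \<in> cyl r \<tau> u"
  unfolding cyl_def by auto

lemma measurable_coordinate_sequence:
  assumes "\<And>i::nat. r \<le> \<tau> i" "r \<le> u"
  shows "(\<lambda>\<omega> i. \<omega> (min (\<tau> i) u)) \<in> borel_measurable (F r u)"
  by (rule measurable_coordinatewise_then_product, rule measurable_coordinate) (use assms in auto)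

lemma cyl_bbm:
  assumes "W \<in> cyl r \<tau> u" "\<And>i. r \<le> \<tau> i" "r \<le> u"
  shows "W \<in> bbm (F r u)"
proof -
  obtain f where f: "lscb f" "\<And>\<omega>. \<omega> \<in> paths kd r T \<Longrightarrow> W \<omega> = f (\<lambda>i. \<omega> (min (\<tau> i) u))"
    using cylE[OF assms(1)] by blast
  obtain c where c: "\<And>x. ereal c \<le> f x" using f(1) unfolding lscb_iff by blast
  have "(\<lambda>\<omega>. f (\<lambda>i. \<omega> (min (\<tau> i) u))) \<in> bbm (F r u)"
    by (rule bbmI[OF measurable_compose[OF measurable_coordinate_sequence[OF assms(2,3)] lscb_borel[OF f(1)]] c])
  then show ?thesis by (rule bbm_cong) (use f(2) in auto)
qed

lemma cyl_bbm_terminal: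
  assumes "W \<in> cyl r \<tau> u" "\<And>i. r \<le> \<tau> i" "r \<le> u" "u \<le> T"
  shows "W \<in> bbm (F r T)"
  using bbm_path_filt_mono[OF cyl_bbm[OF assms(1-3)] assms(4)] .

lemma cyl_SUP:
  assumes "I \<noteq> {}" "\<And>i. i \<in> I \<Longrightarrow> W i \<in> cyl r \<tau> u"
  shows "(\<lambda>\<omega>. SUP i\<in>I. W i \<omega>) \<in> cyl r \<tau> u"
proof -
  have "\<forall>i\<in>I. \<exists>f. lscb f \<and> (\<forall>\<omega>\<in>paths kd r T. W i \<omega> = f (\<lambda>j. \<omega> (min (\<tau> j) u)))"
    using assms(2) unfolding cyl_def by auto
  from bchoice[OF this] obtain f where f: "\<forall>i\<in>I. lscb (f i) \<and>
    (\<forall>\<omega>\<in>paths kd r T. W i \<omega> = f i (\<lambda>j. \<omega> (min (\<tau> j) u)))" by blast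
  have "lscb (\<lambda>x. SUP i\<in>I. f i x)" by (rule lscb_SUP[OF assms(1)]) (use f in simp)
  moreover have "(SUP i\<in>I. W i \<omega>) = (SUP i\<in>I. f i (\<lambda>j. \<omega> (min (\<tau> j) u)))" if "\<omega> \<in> paths kd r T" for \<omega>
    by (rule SUP_cong) (use f that in auto)
  ultimately show ?thesis unfolding cyl_def by blast
qed

lemma cyl_add_continuous:
  assumes "W \<in> cyl r \<tau> u" "continuous_on UNIV b" "\<And>x. k \<le> b x" "\<tau> 0 = T" "u \<le> T"
  shows "(\<lambda>\<omega>. W \<omega> + ereal (b (\<omega> u))) \<in> cyl r \<tau> u"
proof -
  obtain f where f: "lscb f" "\<And>\<omega>. \<omega> \<in> paths kd r T \<Longrightarrow> W \<omega> = f (\<lambda>i. \<omega> (min (\<tau> i) u))"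
    using cylE[OF assms(1)] by blast
  have bc: "continuous_on UNIV (\<lambda>z::nat \<Rightarrow> real ^ 'n. b (z 0))"
    by (rule continuous_on_compose2[OF assms(2) continuous_on_product_coordinates]) simp
  have "lscb (\<lambda>z::nat \<Rightarrow> real ^ 'n. f z + ereal (b (z 0)))"
    by (rule lscb_add_continuous[OF f(1) bc, of k]) (rule assms(3))
  then show ?thesis
    unfolding cyl_def mem_Collect_eq
    by (intro exI[of _ "\<lambda>z. f z + ereal (b (z 0))"]) (use f(2) assms(4,5) in auto)
qed

end

text \<open>
  The law after time \<open>g\<close> depends on the path through its position at time
  \<open>g\<close> only, so forgetting the path before \<open>s\<close> changes nothing for a
  function of the path after \<open>s\<close>.
\<close>

lemma (in martingale_family) E_change_base:
  assumes \<theta>: "\<theta> \<in> \<Theta>" and q: "0 \<le> q" "q \<le> s" "s \<le> g" "g < T" and \<omega>: "\<omega> \<in> paths kd q T"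
    and W: "W \<in> borel_measurable (F q T)" "W' \<in> borel_measurable (F s T)"
    and WW: "\<And>\<omega>. \<omega> \<in> paths kd q T \<Longrightarrow> W \<omega> = W' (restrict \<omega> {s..T})"
  shows "E \<theta> q g W \<omega> = E \<theta> s g W' (restrict \<omega> {s..T})"
proof -
  have s0: "0 \<le> s" and qg: "q \<le> g" and g0: "0 \<le> g" using q by auto
  have r: "restrict \<omega> {s..T} \<in> paths kd s T" using \<omega> q by (intro restrict_in_paths[of \<omega> kd q T]) auto
  have "E \<theta> q g W \<omega> = eexp (P \<theta> g (\<omega> g)) (\<lambda>\<omega>'. W (splice q g T \<omega> \<omega>'))"
    by (rule E_eq[OF \<theta> q(1) qg q(4) W(1) \<omega>])
  also have "\<dots> = eexp (P \<theta> g (\<omega> g)) (\<lambda>\<omega>'. W' (splice s g T (restrict \<omega> {s..T}) \<omega>'))"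
  proof (rule eexp_cong)
    fix \<omega>' :: "'n path" assume "\<omega>' \<in> space (P \<theta> g (\<omega> g))"
    then have "\<omega>' \<in> paths kd g T" using space_law[OF \<theta> g0 q(4)] by simp
    then have "splice q g T \<omega> \<omega>' \<in> paths kd q T" using \<omega> qg q(4) by (intro splice_in_paths) auto
    moreover have "restrict (splice q g T \<omega> \<omega>') {s..T} = splice s g T (restrict \<omega> {s..T}) \<omega>'"
      using q by (auto simp: splice_def restrict_def fun_eq_iff)
    ultimately show "W (splice q g T \<omega> \<omega>') = W' (splice s g T (restrict \<omega> {s..T}) \<omega>')" using WW by simp
  qed
  also have "\<dots> = eexp (P \<theta> g (restrict \<omega> {s..T} g)) (\<lambda>\<omega>'. W' (splice s g T (restrict \<omega> {s..T}) \<omega>'))"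
    using q by simp
  also have "\<dots> = E \<theta> s g W' (restrict \<omega> {s..T})" by (rule E_eq[symmetric, OF \<theta> s0 q(3,4) W(2) r])
  finally show ?thesis .
qed

section \<open>One-step operators\<close>

locale feller_family = martingale_family kd T K \<Theta> Z
  for kd :: path_kind and T :: real and K :: "'k set"
    and \<Theta> :: "('n::finite, 'e::topological_space) bmap set"
    and Z :: "('n, 'e) bmap \<Rightarrow> ('k, 'n) mart_problem" +
  assumes Feller: "Feller_property kd T K \<Theta> Z"
begin

lemma law_evaluation_continuous:
  assumes "\<theta> \<in> \<Theta>" "0 \<le> s" "s \<le> u" "u \<le> T" "continuous_on UNIV g" "bounded (range g)"
  shows "continuous_on UNIV (\<lambda>x. \<integral>\<omega>. g (\<omega> u) \<partial>P \<theta> s x :: real)"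
  using Feller assms unfolding Feller_property_def by blast

text \<open>
  Observations up to \<open>s\<close> are frozen, and all later ones are the position at time
  \<open>u\<close>, because no observation time lies strictly between. What is left is an integral
  over the law of \<open>X\<^sub>u\<close>, in which the frozen observations are parameters and
  the law depends continuously on \<open>X\<^sub>s\<close>.
\<close>

lemma E_cyl_step:
  assumes \<theta>: "\<theta> \<in> \<Theta>" and r: "0 \<le> r" "r \<le> s" and su: "s < u" "u \<le> T"
    and \<tau>: "\<tau> 0 = T" "\<And>i. r \<le> \<tau> i" "\<And>i. \<not> (s < \<tau> i \<and> \<tau> i < u)" and W: "W \<in> cyl r \<tau> u"
  shows "E \<theta> r s W \<in> cyl r \<tau> s"
proof -
  have sT: "s < T" and s0: "0 \<le> s" using su r by auto
  have ru: "r \<le> u" using r su by simp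
  obtain f where f: "lscb f" "\<And>\<omega>. \<omega> \<in> paths kd r T \<Longrightarrow> W \<omega> = f (\<lambda>i. \<omega> (min (\<tau> i) u))"
    using cylE[OF W] by blast
  define h :: "(nat \<Rightarrow> real ^ 'n) \<Rightarrow> real ^ 'n \<Rightarrow> nat \<Rightarrow> real ^ 'n"
    where "h z y = (\<lambda>i. if \<tau> i \<le> s then z i else y)" for z y
  have "continuous_on UNIV (\<lambda>y. h z y i)" for z :: "nat \<Rightarrow> real ^ 'n" and i
    unfolding h_def by (cases "\<tau> i \<le> s") auto
  then have hc: "continuous_on UNIV (h z)" for z :: "nat \<Rightarrow> real ^ 'n"
    by (rule continuous_on_coordinatewise_then_product)
  have hd: "dist (h z y) (h z' y) \<le> dist z z'" for z z' :: "nat \<Rightarrow> real ^ 'n" and y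
    unfolding h_def by (rule dist_fun_mono) auto
  have eval: "(\<lambda>\<omega>. \<omega> u) \<in> borel_measurable (F s T)" by (rule measurable_coordinate) (use su in auto)
  have "lscb (\<lambda>z. eexp (P \<theta> s (z 0)) (\<lambda>\<omega>'. f (h z (\<omega>' u))))"
  proof (rule lscb_parameter_integral[OF prob_space_law[OF \<theta> s0 sT] sets_law[OF \<theta> s0 sT] eval _ hd hc f(1)])
    fix g :: "real ^ 'n \<Rightarrow> real" assume g: "continuous_on UNIV g" "bounded (range g)"
    have "continuous_on UNIV (\<lambda>x. \<integral>\<omega>. g (\<omega> u) \<partial>P \<theta> s x)"
      by (rule law_evaluation_continuous[OF \<theta> s0 _ su(2) g]) (use su in simp)
    then show "continuous_on UNIV (\<lambda>z::nat \<Rightarrow> real ^ 'n. \<integral>\<omega>. g (\<omega> u) \<partial>P \<theta> s (z 0))"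
      by (rule continuous_on_compose2[OF _ continuous_on_product_coordinates]) simp
  qed
  moreover have "E \<theta> r s W \<omega> = eexp (P \<theta> s (\<omega> (min (\<tau> 0) s))) (\<lambda>\<omega>'. f (h (\<lambda>i. \<omega> (min (\<tau> i) s)) (\<omega>' u)))"
    if \<omega>: "\<omega> \<in> paths kd r T" for \<omega>
  proof -
    have Wb: "W \<in> bbm (F r T)" by (rule cyl_bbm_terminal[OF W \<tau>(2) ru su(2)])
    have spl: "splice r s T \<omega> \<in> measurable (F s T) (F r T)"
      by (rule measurable_splice_section) (use r sT \<omega> in auto)
    have "E \<theta> r s W \<omega> = eexp (P \<theta> s (\<omega> s)) (\<lambda>\<omega>'. W (splice r s T \<omega> \<omega>'))"
      by (rule E_eq[OF \<theta> r sT bbm_measurable[OF Wb] \<omega>])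
    also have "\<dots> = eexp (P \<theta> s (\<omega> s)) (\<lambda>\<omega>'. f (h (\<lambda>i. \<omega> (min (\<tau> i) s)) (\<omega>' u)))"
    proof (rule eexp_cong_AE[OF prob_space_law[OF \<theta> s0 sT] sets_law[OF \<theta> s0 sT] bbm_compose[OF Wb spl]])
      have fm: "(\<lambda>y. f (h z y)) \<in> borel_measurable borel" for z
        by (rule measurable_compose[OF borel_measurable_continuous_onI[OF hc] lscb_borel[OF f(1)]])
      obtain c where c: "\<And>x. ereal c \<le> f x" using f(1) unfolding lscb_iff by blast
      show "(\<lambda>\<omega>'. f (h (\<lambda>i. \<omega> (min (\<tau> i) s)) (\<omega>' u))) \<in> bbm (F s T)"
        by (rule bbmI[OF measurable_compose[OF eval fm] c])
      show "AE \<omega>' in P \<theta> s (\<omega> s). W (splice r s T \<omega> \<omega>') = f (h (\<lambda>i. \<omega> (min (\<tau> i) s)) (\<omega>' u))"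
        using law_start[OF \<theta> s0 sT, of "\<omega> s"] AE_space[of "P \<theta> s (\<omega> s)"]
      proof eventually_elim
        case (elim \<omega>')
        then have \<omega>': "\<omega>' \<in> paths kd s T" using space_law[OF \<theta> s0 sT] by simp
        have "splice r s T \<omega> \<omega>' \<in> paths kd r T" using \<omega> \<omega>' r sT by (intro splice_in_paths) auto
        moreover have "(\<lambda>i. splice r s T \<omega> \<omega>' (min (\<tau> i) u)) = h (\<lambda>i. \<omega> (min (\<tau> i) s)) (\<omega>' u)"
        proof
          fix i
          show "splice r s T \<omega> \<omega>' (min (\<tau> i) u) = h (\<lambda>i. \<omega> (min (\<tau> i) s)) (\<omega>' u) i"
          proof (cases "\<tau> i \<le> s")
            case True
            then have "splice r s T \<omega> \<omega>' (\<tau> i) = \<omega> (\<tau> i)" using \<tau>(2) sT by (intro splice_upto) auto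
            then show ?thesis using True su(1) by (simp add: h_def min_def)
          next
            case False
            then have "min (\<tau> i) u = u" using \<tau>(3)[of i] by auto
            moreover have "splice r s T \<omega> \<omega>' u = \<omega>' u" using elim(1) r su by (simp add: splice_after)
            ultimately show ?thesis using False by (simp add: h_def)
          qed
        qed
        ultimately show ?case using f(2) by simp
      qed
    qed
    finally show ?thesis using sT \<tau>(1) by simp
  qed
  ultimately show ?thesis unfolding cyl_def mem_Collect_eq
    by (intro exI[of _ "\<lambda>z. eexp (P \<theta> s (z 0)) (\<lambda>\<omega>'. f (h z (\<omega>' u)))"]) blast
qed

end

text \<open>
  What the finite problems use of a penalty: its values \<open>\<beta>\<^sup>\<theta>\<close> on
  constant parameters, which are continuous, bounded from above and satisfy the cocycle identity.
\<close>

locale penalized_family = feller_family kd T K \<Theta> Z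
  for kd :: path_kind and T :: real and K :: "'k set"
    and \<Theta> :: "('n::finite, 'e::topological_space) bmap set"
    and Z :: "('n, 'e) bmap \<Rightarrow> ('k, 'n) mart_problem" +
  fixes \<Theta>' :: "('n, 'e) bmap set" and \<beta> :: "('n, 'e) bmap \<Rightarrow> real \<Rightarrow> real \<Rightarrow> real ^ 'n \<Rightarrow> real" and r :: real
  assumes \<Theta>'_subset: "\<Theta>' \<subseteq> \<Theta>" and \<Theta>'_nonempty: "\<Theta>' \<noteq> {}" and r_nonneg: "0 \<le> r" and r_le: "r \<le> T"
    and \<beta>_continuous: "\<theta> \<in> \<Theta>' \<Longrightarrow> r \<le> s \<Longrightarrow> s \<le> t \<Longrightarrow> t \<le> T \<Longrightarrow> continuous_on UNIV (\<beta> \<theta> s t)"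
    and \<beta>_bounded: "\<theta> \<in> \<Theta>' \<Longrightarrow> r \<le> s \<Longrightarrow> s \<le> t \<Longrightarrow> t \<le> T \<Longrightarrow> \<exists>c. \<forall>x. \<beta> \<theta> s t x \<le> c"
    and \<beta>_cocycle: "\<theta> \<in> \<Theta>' \<Longrightarrow> r \<le> s \<Longrightarrow> s < v \<Longrightarrow> v \<le> u \<Longrightarrow> u \<le> T \<Longrightarrow> \<omega> \<in> paths kd r T \<Longrightarrow>
      ereal (\<beta> \<theta> s u (\<omega> s)) = ereal (\<beta> \<theta> s v (\<omega> s)) - E \<theta> r s (\<lambda>\<omega>'. ereal (- \<beta> \<theta> v u (\<omega>' v))) \<omega>"
begin

text \<open>
  The gain on \<open>[s,u]\<close> of following the parameter \<open>\<theta>\<close> if the value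
  \<open>W\<close> is obtained at time \<open>u\<close>.
\<close>

definition S :: "('n, 'e) bmap \<Rightarrow> real \<Rightarrow> real \<Rightarrow> ('n path \<Rightarrow> ereal) \<Rightarrow> 'n path \<Rightarrow> ereal" where
  "S \<theta> s u W \<omega> = E \<theta> r s W \<omega> + ereal (- \<beta> \<theta> s u (\<omega> s))"

context
  fixes \<theta> s u assumes \<theta>': "\<theta> \<in> \<Theta>'" and s: "r \<le> s" "s < u" "u \<le> T"
begin

lemma \<theta>_in: "\<theta> \<in> \<Theta>" using \<theta>' \<Theta>'_subset by blast
lemma s_less: "s < T" using s by simp

lemma penalty_bbm: "(\<lambda>\<omega>. ereal (- \<beta> \<theta> s u (\<omega> s))) \<in> bbm (F r T)"
proof -
  obtain c where c: "\<forall>x. \<beta> \<theta> s u x \<le> c" using \<beta>_bounded[OF \<theta>', of s u] s by auto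
  have "\<beta> \<theta> s u \<in> borel_measurable borel"
    using \<beta>_continuous[OF \<theta>', of s u] s by (intro borel_measurable_continuous_onI) auto
  then have "(\<lambda>\<omega>. \<beta> \<theta> s u (\<omega> s)) \<in> borel_measurable (F r T)"
    by (rule measurable_compose[OF measurable_coordinate, rotated 2]) (use s in auto)
  then show ?thesis by (intro bbmI[where c = "- c"]) (use c in auto)
qed

lemma S_bbm: "W \<in> bbm (F r T) \<Longrightarrow> S \<theta> s u W \<in> bbm (F r T)"
  unfolding S_def[abs_def]
  by (intro bbm_add penalty_bbm E_bbm[OF \<theta>_in r_nonneg s(1) s_less])

lemma S_cong:
  assumes "\<And>\<omega>. \<omega> \<in> paths kd r T \<Longrightarrow> W \<omega> = W' \<omega>" "\<omega> \<in> paths kd r T"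
  shows "S \<theta> s u W \<omega> = S \<theta> s u W' \<omega>"
  unfolding S_def using E_cong[OF \<theta>_in r_nonneg s(1) s_less assms] by simp

lemma S_mono:
  assumes "W \<in> bbm (F r T)" "W' \<in> bbm (F r T)" "\<And>\<omega>. \<omega> \<in> paths kd r T \<Longrightarrow> W \<omega> \<le> W' \<omega>" "\<omega> \<in> paths kd r T"
  shows "S \<theta> s u W \<omega> \<le> S \<theta> s u W' \<omega>"
  unfolding S_def by (intro add_right_mono E_mono[OF \<theta>_in r_nonneg s(1) s_less] assms)

lemma S_SUP:
  assumes "\<And>m::nat. W m \<in> bbm (F r T)" "\<And>m \<omega>. \<omega> \<in> paths kd r T \<Longrightarrow> W m \<omega> \<le> W (Suc m) \<omega>" "\<omega> \<in> paths kd r T"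
  shows "S \<theta> s u (\<lambda>\<omega>. SUP m. W m \<omega>) \<omega> = (SUP m. S \<theta> s u (W m) \<omega>)"
proof -
  have "E \<theta> r s (\<lambda>\<omega>. SUP m. W m \<omega>) \<omega> = (SUP m. E \<theta> r s (W m) \<omega>)"
    by (rule E_SUP[OF \<theta>_in r_nonneg s(1) s_less]) (use assms in auto)
  then show ?thesis unfolding S_def by (simp add: SUP_ereal_add_left)
qed

end

text \<open>
  The Markov property composes the expectations and the cocycle identity composes the penalties.
\<close>

lemma S_semigroup:
  assumes \<theta>: "\<theta> \<in> \<Theta>'" and s: "r \<le> s" "s < v" "v < u" "u \<le> T" and W: "W \<in> bbm (F r T)" and \<omega>: "\<omega> \<in> paths kd r T"
  shows "S \<theta> s v (S \<theta> v u W) \<omega> = S \<theta> s u W \<omega>"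
proof -
  have \<theta>i: "\<theta> \<in> \<Theta>" using \<theta> \<Theta>'_subset by blast
  have sT: "s < T" and vT: "v < T" and rv: "r \<le> v" using s by auto
  note E_rules = \<theta>i r_nonneg s(1) sT
  let ?pen = "\<lambda>\<omega>'. ereal (- \<beta> \<theta> v u (\<omega>' v))"
  have pb: "?pen \<in> bbm (F r T)" by (rule penalty_bbm[OF \<theta> rv s(3,4)])
  have Ev: "E \<theta> r v W \<in> bbm (F r T)" by (rule E_bbm[OF \<theta>i r_nonneg rv vT W])
  have "S \<theta> s v (S \<theta> v u W) \<omega> = E \<theta> r s W \<omega> + E \<theta> r s ?pen \<omega> + ereal (- \<beta> \<theta> s v (\<omega> s))"
    unfolding S_def[abs_def] E_add[OF E_rules Ev pb \<omega>] E_flow[OF E_rules less_imp_le[OF s(2)] vT W \<omega>] ..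
  also have "\<dots> = E \<theta> r s W \<omega> + ereal (- \<beta> \<theta> s u (\<omega> s))"
    using \<beta>_cocycle[OF \<theta> s(1,2) less_imp_le[OF s(3)] s(4) \<omega>]
    by (cases "E \<theta> r s ?pen \<omega>"; cases "E \<theta> r s W \<omega>") auto
  finally show ?thesis unfolding S_def .
qed

text \<open>
  A step over a time interval free of observation times is the Feller property; a general step is
  composed of such steps by the Markov property and the cocycle identity.
\<close>

lemma S_cyl:
  assumes \<theta>: "\<theta> \<in> \<Theta>'" and \<tau>: "\<tau> 0 = T" "\<And>i. r \<le> \<tau> i" "finite (range \<tau>)"
    and s: "r \<le> s" "s < u" "u \<le> T" and W: "W \<in> cyl r \<tau> u"
  shows "S \<theta> s u W \<in> cyl r \<tau> s"
  using s W
proof (induction "card (range \<tau> \<inter> {s<..<u})" arbitrary: s u W rule: less_induct)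
  case less
  show ?case
  proof (cases "range \<tau> \<inter> {s<..<u} = {}")
    case True
    have \<theta>i: "\<theta> \<in> \<Theta>" using \<theta> \<Theta>'_subset by blast
    have "\<not> (s < \<tau> i \<and> \<tau> i < u)" for i using True by (auto simp: disjoint_iff)
    then have "E \<theta> r s W \<in> cyl r \<tau> s"
      by (intro E_cyl_step[OF \<theta>i r_nonneg]) (use less.prems \<tau>(1,2) in auto)
    moreover obtain c where "\<forall>x. \<beta> \<theta> s u x \<le> c" using \<beta>_bounded[OF \<theta>, of s u] less.prems by auto
    ultimately show ?thesis
      unfolding S_def[abs_def] using \<beta>_continuous[OF \<theta>, of s u] less.prems \<tau>(1)
      by (intro cyl_add_continuous[where k = "- c"] continuous_on_minus) auto
  next
    case False
    then obtain v where "v \<in> range \<tau>" "v \<in> {s<..<u}" by blast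
    then have v: "v \<in> range \<tau>" "s < v" "v < u" by auto
    have "range \<tau> \<inter> {v<..<u} \<subset> range \<tau> \<inter> {s<..<u}" "range \<tau> \<inter> {s<..<v} \<subset> range \<tau> \<inter> {s<..<u}"
      using v by auto
    then have c: "card (range \<tau> \<inter> {v<..<u}) < card (range \<tau> \<inter> {s<..<u})"
      "card (range \<tau> \<inter> {s<..<v}) < card (range \<tau> \<inter> {s<..<u})"
      using \<tau>(3) by (auto intro!: psubset_card_mono)
    have "S \<theta> v u W \<in> cyl r \<tau> v" by (rule less.hyps[OF c(1)]) (use less.prems v in auto)
    then have "S \<theta> s v (S \<theta> v u W) \<in> cyl r \<tau> s" by (intro less.hyps[OF c(2)]) (use less.prems v in auto)
    moreover have "W \<in> bbm (F r T)" using less.prems by (intro cyl_bbm_terminal[OF _ \<tau>(2)]) auto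
    then have "S \<theta> s u W \<omega> = S \<theta> s v (S \<theta> v u W) \<omega>" if "\<omega> \<in> paths kd r T" for \<omega>
      using S_semigroup[OF \<theta> less.prems(1) v(2,3) less.prems(3) _ that] by simp
    ultimately show ?thesis by (rule cyl_cong)
  qed
qed

end

section \<open>The value function\<close>

definition grid :: "real set \<Rightarrow> real \<Rightarrow> real \<Rightarrow> real list" where
  "grid D t g = sorted_list_of_set {d \<in> insert t D. g < d \<and> d \<le> t}"

definition next_node :: "real set \<Rightarrow> real \<Rightarrow> real \<Rightarrow> real" where
  "next_node D t g = Min {d \<in> insert t D. g < d \<and> d \<le> t}"

lemma next_node:
  assumes "finite D" "g < t"
  shows "g < next_node D t g" "next_node D t g \<le> t" "next_node D t g \<in> insert t D"
    and "\<And>d. d \<in> insert t D \<Longrightarrow> g < d \<Longrightarrow> d \<le> t \<Longrightarrow> next_node D t g \<le> d"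
proof -
  let ?A = "{d \<in> insert t D. g < d \<and> d \<le> t}"
  have A: "finite ?A" "?A \<noteq> {}" using assms by auto
  show "g < next_node D t g" "next_node D t g \<le> t" "next_node D t g \<in> insert t D"
    using Min_in[OF A] unfolding next_node_def by auto
  show "\<And>d. d \<in> insert t D \<Longrightarrow> g < d \<Longrightarrow> d \<le> t \<Longrightarrow> next_node D t g \<le> d"
    unfolding next_node_def using A by (intro Min_le) auto
qed

lemma grid_step:
  assumes "finite D" "g < t"
  shows "grid D t g = next_node D t g # grid D t (next_node D t g)"
proof -
  let ?A = "{d \<in> insert t D. g < d \<and> d \<le> t}"
  have A: "finite ?A" "?A \<noteq> {}" using assms by auto
  have "?A - {next_node D t g} = {d \<in> insert t D. next_node D t g < d \<and> d \<le> t}"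
    using next_node[OF assms] by (auto simp: less_le)
  then show ?thesis
    unfolding grid_def using sorted_list_of_set_nonempty[OF A] by (simp add: next_node_def)
qed

lemma grid_end: "grid D t t = []"
  unfolding grid_def by (simp add: Collect_empty_eq[THEN iffD2])

text \<open>
  Backward induction in time. The time \<open>g'\<close> need not belong to the grid; the step
  leads from the first grid point after it.
\<close>

lemma grid_induct [consumes 2, case_names terminal step]:
  assumes "finite D" "g \<le> t" "P t"
    and step: "\<And>g'. g \<le> g' \<Longrightarrow> g' < t \<Longrightarrow> P (next_node D t g') \<Longrightarrow> P g'"
  shows "P g"
proof -
  have "P g'" if "g \<le> g'" "g' \<le> t" for g'
    using that
  proof (induction "length (grid D t g')" arbitrary: g' rule: less_induct)
    case less
    show ?case
    proof (cases "g' = t")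
      case False
      then have lt: "g' < t" using less.prems by simp
      have "P (next_node D t g')"
        by (rule less.hyps) (use grid_step[OF assms(1) lt] next_node[OF assms(1) lt] less.prems in auto)
      then show ?thesis by (rule step[OF less.prems(1) lt])
    qed (use assms(3) in simp)
  qed
  then show ?thesis using assms(2) by simp
qed

context penalized_family
begin

definition R :: "('n, 'e) bmap set \<Rightarrow> real \<Rightarrow> real \<Rightarrow> ('n path \<Rightarrow> ereal) \<Rightarrow> 'n path \<Rightarrow> ereal" where
  "R J s u W \<omega> = (SUP \<theta>\<in>J. S \<theta> s u W \<omega>)"

primrec chain :: "('n, 'e) bmap set \<Rightarrow> ('n path \<Rightarrow> ereal) \<Rightarrow> real list \<Rightarrow> real \<Rightarrow> 'n path \<Rightarrow> ereal" where
  "chain J Y [] = (\<lambda>g. Y)"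
| "chain J Y (h # L) = (\<lambda>g. R J g h (chain J Y L h))"

text \<open>The value of the problem with parameters in \<open>J\<close> that may be switched at the points of \<open>D\<close>.\<close>

definition val :: "('n path \<Rightarrow> ereal) \<Rightarrow> real \<Rightarrow> ('n, 'e) bmap set \<Rightarrow> real set \<Rightarrow> real \<Rightarrow> 'n path \<Rightarrow> ereal" where
  "val Y t J D g = chain J Y (grid D t g) g"

definition strategies :: "(('n, 'e) bmap set \<times> real set) set" where
  "strategies = {(J, D). finite J \<and> J \<noteq> {} \<and> J \<subseteq> \<Theta>' \<and> finite D}"

definition V :: "('n path \<Rightarrow> ereal) \<Rightarrow> real \<Rightarrow> real \<Rightarrow> 'n path \<Rightarrow> ereal" where
  "V Y t g \<omega> = (SUP (J, D)\<in>strategies. val Y t J D g \<omega>)"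

lemma val_end: "val Y t J D t = Y"
  unfolding val_def grid_end by simp

lemma val_step:
  assumes "finite D" "g < t"
  shows "val Y t J D g = R J g (next_node D t g) (val Y t J D (next_node D t g))"
  unfolding val_def grid_step[OF assms] by simp

lemma strategies_nonempty: "strategies \<noteq> {}"
proof -
  obtain \<theta> where "\<theta> \<in> \<Theta>'" using \<Theta>'_nonempty by blast
  then have "({\<theta>}, {}) \<in> strategies" unfolding strategies_def by simp
  then show ?thesis by blast
qed

lemma strategies_union:
  "(J, D) \<in> strategies \<Longrightarrow> (J', D') \<in> strategies \<Longrightarrow> (J \<union> J', D \<union> D') \<in> strategies"
  unfolding strategies_def by auto

context
  fixes \<tau> :: "nat \<Rightarrow> real" and t :: real and Y :: "'n path \<Rightarrow> ereal"
  assumes \<tau>: "\<tau> 0 = T" "\<And>i. r \<le> \<tau> i" "finite (range \<tau>)"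
    and t: "r \<le> t" "t \<le> T" and Y: "Y \<in> cyl r \<tau> t"
begin

lemma cyl_in_bbm: "W \<in> cyl r \<tau> g \<Longrightarrow> r \<le> g \<Longrightarrow> g \<le> t \<Longrightarrow> W \<in> bbm (F r T)"
  using t by (intro cyl_bbm_terminal[where \<tau> = \<tau> and u = g] \<tau>(2)) auto

lemma R_cyl:
  assumes "J \<noteq> {}" "J \<subseteq> \<Theta>'" "r \<le> g" "g < h" "h \<le> t" "W \<in> cyl r \<tau> h"
  shows "R J g h W \<in> cyl r \<tau> g"
  unfolding R_def[abs_def]
  by (rule cyl_SUP[OF assms(1)], rule S_cyl[OF _ \<tau>]) (use assms t in auto)

lemma val_cyl:
  assumes "J \<noteq> {}" "J \<subseteq> \<Theta>'" "finite D" "r \<le> g" "g \<le> t"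
  shows "val Y t J D g \<in> cyl r \<tau> g"
  using assms(3,5)
proof (induction rule: grid_induct)
  case terminal
  then show ?case unfolding val_end by (rule Y)
next
  case (step g')
  then show ?case
    unfolding val_step[OF assms(3) step(2)]
    using next_node[OF assms(3) step(2)] assms by (intro R_cyl) auto
qed

lemma val_bbm:
  assumes "J \<noteq> {}" "J \<subseteq> \<Theta>'" "finite D" "r \<le> g" "g \<le> t"
  shows "val Y t J D g \<in> bbm (F r T)"
  using cyl_in_bbm[OF val_cyl[OF assms] assms(4,5)] .

text \<open>
  Backward induction along the grid: the semigroup property cuts the step from \<open>g\<close> to
  \<open>h\<close> at the first grid point after \<open>g\<close>.
\<close>

lemma val_super:
  assumes \<theta>: "\<theta> \<in> J" and J: "J \<subseteq> \<Theta>'" and D: "finite D"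
    and g: "r \<le> g" "g < h" "h \<le> t" "h \<in> insert t D" and \<omega>: "\<omega> \<in> paths kd r T"
  shows "S \<theta> g h (val Y t J D h) \<omega> \<le> val Y t J D g \<omega>"
proof -
  have J0: "J \<noteq> {}" and \<theta>': "\<theta> \<in> \<Theta>'" using \<theta> J by auto
  have "g < h \<longrightarrow> (\<forall>\<omega>\<in>paths kd r T. S \<theta> g h (val Y t J D h) \<omega> \<le> val Y t J D g \<omega>)"
    using D order_trans[OF less_imp_le[OF g(2)] g(3)]
  proof (induction rule: grid_induct)
    case terminal
    then show ?case using g(3) by simp
  next
    case (step g')
    let ?h = "next_node D t g'"
    note n = next_node[OF D step(2)]
    show ?case
    proof (intro impI ballI)
      fix \<omega> :: "'n path" assume gh: "g' < h" and \<omega>: "\<omega> \<in> paths kd r T"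
      have rg: "r \<le> g'" "r \<le> ?h" using g(1) step(1) n(1) by auto
      have upper: "S \<theta> g' ?h (val Y t J D ?h) \<omega> \<le> val Y t J D g' \<omega>"
        unfolding val_step[OF D step(2)] R_def using \<theta> by (rule SUP_upper)
      show "S \<theta> g' h (val Y t J D h) \<omega> \<le> val Y t J D g' \<omega>"
      proof (cases "?h = h")
        case True
        then show ?thesis using upper by simp
      next
        case False
        then have lt: "?h < h" using n(4)[OF g(4) gh g(3)] by simp
        have hT: "h \<le> T" using g(3) t by simp
        have rh: "r \<le> h" using rg(1) gh by simp
        have b: "val Y t J D h \<in> bbm (F r T)" by (rule val_bbm[OF J0 J D rh g(3)])
        have "S \<theta> g' h (val Y t J D h) \<omega> = S \<theta> g' ?h (S \<theta> ?h h (val Y t J D h)) \<omega>"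
          by (rule S_semigroup[symmetric, OF \<theta>' rg(1) n(1) lt hT b \<omega>])
        also have "\<dots> \<le> S \<theta> g' ?h (val Y t J D ?h) \<omega>"
        proof (rule S_mono[OF \<theta>' rg(1) n(1) _ S_bbm[OF \<theta>' rg(2) lt hT b] val_bbm[OF J0 J D rg(2) n(2)] _ \<omega>])
          show "?h \<le> T" using n(2) t by simp
          show "S \<theta> ?h h (val Y t J D h) \<omega>' \<le> val Y t J D ?h \<omega>'" if "\<omega>' \<in> paths kd r T" for \<omega>'
            using step(3) lt that by blast
        qed
        also note upper
        finally show ?thesis .
      qed
    qed
  qed
  then show ?thesis using g(2) \<omega> by blast
qed

text \<open>
  A step between two neighbouring points of \<open>D\<close> is a step between two points of
  \<open>D'\<close>, so the supermartingale property of the finer problem bounds it.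
\<close>

lemma val_mono:
  assumes J: "J \<noteq> {}" "J \<subseteq> J'" "J' \<subseteq> \<Theta>'" and D: "D \<subseteq> D'" "finite D'"
    and g: "r \<le> g" "g \<le> t" and \<omega>: "\<omega> \<in> paths kd r T"
  shows "val Y t J D g \<omega> \<le> val Y t J' D' g \<omega>"
proof -
  have fD: "finite D" using D finite_subset by blast
  have J': "J' \<noteq> {}" "J \<subseteq> \<Theta>'" using J by auto
  have "\<forall>\<omega>\<in>paths kd r T. val Y t J D g \<omega> \<le> val Y t J' D' g \<omega>"
    using fD g(2)
  proof (induction rule: grid_induct)
    case (step g')
    let ?h = "next_node D t g'"
    note n = next_node[OF fD step(2)]
    have rg: "r \<le> g'" "r \<le> ?h" using g(1) step(1) n(1) by auto
    have hT: "?h \<le> T" using n(2) t by simp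
    show ?case
    proof
      fix \<omega> :: "'n path" assume \<omega>: "\<omega> \<in> paths kd r T"
      show "val Y t J D g' \<omega> \<le> val Y t J' D' g' \<omega>"
        unfolding val_step[OF fD step(2)] R_def
      proof (rule SUP_least)
        fix \<theta> assume \<theta>: "\<theta> \<in> J"
        then have \<theta>': "\<theta> \<in> \<Theta>'" "\<theta> \<in> J'" using J by auto
        have "S \<theta> g' ?h (val Y t J D ?h) \<omega> \<le> S \<theta> g' ?h (val Y t J' D' ?h) \<omega>"
          by (rule S_mono[OF \<theta>'(1) rg(1) n(1) hT val_bbm[OF J(1) J'(2) fD rg(2) n(2)]
                val_bbm[OF J'(1) J(3) D(2) rg(2) n(2)] _ \<omega>]) (use step(3) in blast)
        also have "\<dots> \<le> val Y t J' D' g' \<omega>"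
          by (rule val_super[OF \<theta>'(2) J(3) D(2) rg(1) n(1,2) _ \<omega>]) (use n(3) D(1) in blast)
        finally show "S \<theta> g' ?h (val Y t J D ?h) \<omega> \<le> val Y t J' D' g' \<omega>" .
      qed
    qed
  qed (simp add: val_end)
  then show ?thesis using \<omega> by blast
qed

lemma V_cyl:
  assumes "r \<le> g" "g \<le> t"
  shows "V Y t g \<in> cyl r \<tau> g"
  unfolding V_def[abs_def]
  by (rule cyl_SUP[OF strategies_nonempty]) (use val_cyl assms in \<open>auto simp: strategies_def\<close>)

lemma V_bbm: "r \<le> g \<Longrightarrow> g \<le> t \<Longrightarrow> V Y t g \<in> bbm (F r T)"
  using cyl_in_bbm[OF V_cyl] by blast

lemma V_end: "V Y t t \<omega> = Y \<omega>"
  unfolding V_def val_end using strategies_nonempty by (simp add: case_prod_beta)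

lemma val_le_V: "(J, D) \<in> strategies \<Longrightarrow> val Y t J D g \<omega> \<le> V Y t g \<omega>"
  unfolding V_def by (rule SUP_upper2) auto

text \<open>
  The finite problems are directed, since two of them are dominated by the problem with the union
  of the parameters and of the switching times, and their values are lower semicontinuous
  functions of the same finitely many observations.
\<close>

lemma V_sequence:
  assumes g: "r \<le> g" "g \<le> t"
  obtains J D where "\<And>m::nat. (J m, D m) \<in> strategies"
    "\<And>m \<omega>. \<omega> \<in> paths kd r T \<Longrightarrow> val Y t (J m) (D m) g \<omega> \<le> val Y t (J (Suc m)) (D (Suc m)) g \<omega>"
    "\<And>\<omega>. \<omega> \<in> paths kd r T \<Longrightarrow> V Y t g \<omega> = (SUP m. val Y t (J m) (D m) g \<omega>)"
proof -
  define \<xi> where "\<xi> \<omega> = (\<lambda>i. \<omega> (min (\<tau> i) g))" for \<omega> :: "'n path"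
  have "\<forall>p\<in>strategies. \<exists>f. lscb f \<and> (\<forall>\<omega>\<in>paths kd r T. val Y t (fst p) (snd p) g \<omega> = f (\<xi> \<omega>))"
  proof
    fix p assume "p \<in> strategies"
    then have "val Y t (fst p) (snd p) g \<in> cyl r \<tau> g" using g by (intro val_cyl) (auto simp: strategies_def)
    then show "\<exists>f. lscb f \<and> (\<forall>\<omega>\<in>paths kd r T. val Y t (fst p) (snd p) g \<omega> = f (\<xi> \<omega>))"
      unfolding cyl_def \<xi>_def by blast
  qed
  from bchoice[OF this] obtain f where f: "\<forall>p\<in>strategies. lscb (f p) \<and>
      (\<forall>\<omega>\<in>paths kd r T. val Y t (fst p) (snd p) g \<omega> = f p (\<xi> \<omega>))" by blast
  have lsc: "lscb (f p)" if "p \<in> strategies" for p using f that by blast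
  have ub: "\<exists>k\<in>strategies. \<forall>x\<in>\<xi> ` paths kd r T. f i x \<le> f k x \<and> f j x \<le> f k x"
    if i: "i \<in> strategies" and j: "j \<in> strategies" for i j
  proof -
    let ?k = "(fst i \<union> fst j, snd i \<union> snd j)"
    have k: "?k \<in> strategies" using strategies_union[of "fst i" "snd i" "fst j" "snd j"] i j by simp
    have "f i (\<xi> \<omega>) \<le> f ?k (\<xi> \<omega>) \<and> f j (\<xi> \<omega>) \<le> f ?k (\<xi> \<omega>)" if \<omega>: "\<omega> \<in> paths kd r T" for \<omega>
    proof -
      have "val Y t (fst i) (snd i) g \<omega> \<le> val Y t (fst ?k) (snd ?k) g \<omega>"
        "val Y t (fst j) (snd j) g \<omega> \<le> val Y t (fst ?k) (snd ?k) g \<omega>"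
        using i j g \<omega> by (auto simp: strategies_def intro!: val_mono)
      then show ?thesis using bspec[OF f i] bspec[OF f j] bspec[OF f k] \<omega> by simp
    qed
    then show ?thesis using k by blast
  qed
  obtain \<iota> :: "nat \<Rightarrow> ('n, 'e) bmap set \<times> real set" where \<iota>: "\<And>m. \<iota> m \<in> strategies"
    "\<And>m x. x \<in> \<xi> ` paths kd r T \<Longrightarrow> f (\<iota> m) x \<le> f (\<iota> (Suc m)) x"
    "\<And>x. x \<in> \<xi> ` paths kd r T \<Longrightarrow> (SUP m. f (\<iota> m) x) = (SUP i\<in>strategies. f i x)"
    by (rule lscb_directed_sequence[OF lsc strategies_nonempty ub]) blast+
  show ?thesis
  proof (rule that[of "\<lambda>m. fst (\<iota> m)" "\<lambda>m. snd (\<iota> m)"])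
    show "(fst (\<iota> m), snd (\<iota> m)) \<in> strategies" for m using \<iota>(1) by simp
    fix \<omega> :: "'n path" assume \<omega>: "\<omega> \<in> paths kd r T"
    show "val Y t (fst (\<iota> m)) (snd (\<iota> m)) g \<omega> \<le> val Y t (fst (\<iota> (Suc m))) (snd (\<iota> (Suc m))) g \<omega>" for m
      using f \<iota>(1) \<iota>(2)[of "\<xi> \<omega>" m] \<omega> by simp
    have "V Y t g \<omega> = (SUP p\<in>strategies. f p (\<xi> \<omega>))"
      unfolding V_def by (rule SUP_cong) (use f \<omega> in \<open>auto simp: case_prod_beta\<close>)
    also have "\<dots> = (SUP m. f (\<iota> m) (\<xi> \<omega>))" using \<iota>(3)[of "\<xi> \<omega>"] \<omega> by simp
    also have "\<dots> = (SUP m. val Y t (fst (\<iota> m)) (snd (\<iota> m)) g \<omega>)"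
      by (rule SUP_cong) (use f \<iota>(1) \<omega> in auto)
    finally show "V Y t g \<omega> = (SUP m. val Y t (fst (\<iota> m)) (snd (\<iota> m)) g \<omega>)" .
  qed
qed

text \<open>
  Using \<open>\<theta>\<close> until \<open>h\<close> and a finite strategy afterwards is a finite strategy; monotone convergence
  carries this over to the supremum.
\<close>

lemma V_super:
  assumes \<theta>: "\<theta> \<in> \<Theta>'" and g: "r \<le> g" "g < h" "h \<le> t" and \<omega>: "\<omega> \<in> paths kd r T"
  shows "S \<theta> g h (V Y t h) \<omega> \<le> V Y t g \<omega>"
proof -
  have rh: "r \<le> h" and hT: "h \<le> T" using g t by auto
  obtain J D where JD: "\<And>m::nat. (J m, D m) \<in> strategies"
    "\<And>m \<omega>. \<omega> \<in> paths kd r T \<Longrightarrow> val Y t (J m) (D m) h \<omega> \<le> val Y t (J (Suc m)) (D (Suc m)) h \<omega>"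
    "\<And>\<omega>. \<omega> \<in> paths kd r T \<Longrightarrow> V Y t h \<omega> = (SUP m. val Y t (J m) (D m) h \<omega>)"
    using V_sequence[OF rh g(3)] by blast
  have b: "val Y t (J m) (D m) h \<in> bbm (F r T)" for m
    using JD(1)[of m] rh g(3) by (intro val_bbm) (auto simp: strategies_def)
  have "S \<theta> g h (V Y t h) \<omega> = S \<theta> g h (\<lambda>\<omega>. SUP m. val Y t (J m) (D m) h \<omega>) \<omega>"
    by (rule S_cong[OF \<theta> g(1,2) hT _ \<omega>]) (rule JD(3))
  also have "\<dots> = (SUP m. S \<theta> g h (val Y t (J m) (D m) h) \<omega>)"
    by (rule S_SUP[OF \<theta> g(1,2) hT b _ \<omega>]) (rule JD(2))
  also have "\<dots> \<le> V Y t g \<omega>"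
  proof (rule SUP_least)
    fix m
    let ?J = "insert \<theta> (J m)" and ?D = "insert h (D m)"
    have s: "(?J, ?D) \<in> strategies" using JD(1)[of m] \<theta> unfolding strategies_def by auto
    then have J': "?J \<noteq> {}" "?J \<subseteq> \<Theta>'" "finite ?D" and Jm: "J m \<noteq> {}"
      using JD(1)[of m] unfolding strategies_def by auto
    have "S \<theta> g h (val Y t (J m) (D m) h) \<omega> \<le> S \<theta> g h (val Y t ?J ?D h) \<omega>"
      by (rule S_mono[OF \<theta> g(1,2) hT b val_bbm[OF J' rh g(3)] _ \<omega>], rule val_mono[OF Jm _ J'(2) _ J'(3) rh g(3)]) auto
    also have "\<dots> \<le> val Y t ?J ?D g \<omega>" by (rule val_super[OF _ J'(2,3) g _ \<omega>]) auto
    also have "\<dots> \<le> V Y t g \<omega>" by (rule val_le_V[OF s])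
    finally show "S \<theta> g h (val Y t (J m) (D m) h) \<omega> \<le> V Y t g \<omega>" .
  qed
  finally show ?thesis .
qed

text \<open>Backward induction along the grid of every finite problem.\<close>

lemma V_least:
  assumes U: "\<And>g. g0 \<le> g \<Longrightarrow> g \<le> t \<Longrightarrow> U g \<in> bbm (F r T)"
    and bound: "\<And>\<omega>. \<omega> \<in> paths kd r T \<Longrightarrow> Y \<omega> \<le> U t \<omega>"
    and super: "\<And>\<theta> g h \<omega>. \<theta> \<in> \<Theta>' \<Longrightarrow> g0 \<le> g \<Longrightarrow> g < h \<Longrightarrow> h \<le> t \<Longrightarrow> \<omega> \<in> paths kd r T \<Longrightarrow> S \<theta> g h (U h) \<omega> \<le> U g \<omega>"
    and g0: "r \<le> g0" "g0 \<le> t" and \<omega>: "\<omega> \<in> paths kd r T"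
  shows "V Y t g0 \<omega> \<le> U g0 \<omega>"
proof -
  have "val Y t J D g0 \<omega> \<le> U g0 \<omega>" if "(J, D) \<in> strategies" for J D
  proof -
    have JD: "J \<noteq> {}" "J \<subseteq> \<Theta>'" "finite D" using that unfolding strategies_def by auto
    have "\<forall>\<omega>\<in>paths kd r T. val Y t J D g0 \<omega> \<le> U g0 \<omega>"
      using JD(3) g0(2)
    proof (induction rule: grid_induct)
      case terminal
      then show ?case using bound by (simp add: val_end)
    next
      case (step g')
      let ?h = "next_node D t g'"
      note n = next_node[OF JD(3) step(2)]
      have rg: "r \<le> g'" "r \<le> ?h" "g0 \<le> ?h" using g0(1) step(1) n(1) by auto
      have hT: "?h \<le> T" using n(2) t by simp
      show ?case
      proof
        fix \<omega> :: "'n path" assume \<omega>: "\<omega> \<in> paths kd r T"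
        show "val Y t J D g' \<omega> \<le> U g' \<omega>"
          unfolding val_step[OF JD(3) step(2)] R_def
        proof (rule SUP_least)
          fix \<theta> assume "\<theta> \<in> J"
          then have \<theta>: "\<theta> \<in> \<Theta>'" using JD by auto
          have "S \<theta> g' ?h (val Y t J D ?h) \<omega> \<le> S \<theta> g' ?h (U ?h) \<omega>"
            by (rule S_mono[OF \<theta> rg(1) n(1) hT val_bbm[OF JD rg(2) n(2)] U[OF rg(3) n(2)] _ \<omega>]) (use step(3) in blast)
          also have "\<dots> \<le> U g' \<omega>" by (rule super[OF \<theta> step(1) n(1,2) \<omega>])
          finally show "S \<theta> g' ?h (val Y t J D ?h) \<omega> \<le> U g' \<omega>" .
        qed
      qed
    qed
    then show ?thesis using \<omega> by blast
  qed
  then show ?thesis unfolding V_def by (auto intro: SUP_least)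
qed

end

text \<open>
  Bellman's principle: both sides are the least supermartingale above \<open>Y\<close>, that is,
  the least family whose members dominate the steps \<open>S\<close> of every parameter from later
  ones.
\<close>

lemma V_dynamic_programming:
  assumes \<tau>: "\<tau> 0 = T" "\<And>i. r \<le> \<tau> i" "finite (range \<tau>)"
    and s: "r \<le> s" "s \<le> t" "t \<le> u" "u \<le> T" and Y: "Y \<in> cyl r \<tau> u" and \<omega>: "\<omega> \<in> paths kd r T"
  shows "V Y u s \<omega> = V (V Y u t) t s \<omega>"
proof (rule antisym)
  have rt: "r \<le> t" and ru: "r \<le> u" and tT: "t \<le> T" using s by auto
  have W: "V Y u t \<in> cyl r \<tau> t" by (rule V_cyl[OF \<tau> ru s(4) Y rt s(3)])
  note Y_rules = \<tau> ru s(4) Y and W_rules = \<tau> rt tT W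
  show "V (V Y u t) t s \<omega> \<le> V Y u s \<omega>"
  proof (rule V_least[OF W_rules _ _ _ s(1,2) \<omega>, where U = "\<lambda>g. V Y u g"])
    show "V Y u g \<in> bbm (F r T)" if "s \<le> g" "g \<le> t" for g
      by (rule V_bbm[OF Y_rules]) (use that s in auto)
    show "S \<theta> g h (V Y u h) \<omega>' \<le> V Y u g \<omega>'"
      if "\<theta> \<in> \<Theta>'" "s \<le> g" "g < h" "h \<le> t" "\<omega>' \<in> paths kd r T" for \<theta> g h \<omega>'
      by (rule V_super[OF Y_rules that(1) _ that(3) _ that(5)]) (use that s in auto)
  qed simp
  \<comment> \<open>The two value functions are glued at time \<open>t\<close>, where they agree.\<close>
  define U where "U g = (if g \<le> t then V (V Y u t) t g else V Y u g)" for g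
  have Ub: "U g \<in> bbm (F r T)" if "s \<le> g" "g \<le> u" for g
    unfolding U_def using V_bbm[OF Y_rules, of g] V_bbm[OF W_rules, of g] that s by auto
  have Ut: "U t = V Y u t" unfolding U_def by (simp add: fun_eq_iff V_end[OF W_rules])
  have "V Y u s \<omega> \<le> U s \<omega>"
  proof (rule V_least[OF Y_rules Ub _ _ s(1) order_trans[OF s(2,3)] \<omega>])
    show "Y \<omega>' \<le> U u \<omega>'" for \<omega>'
    proof (cases "u = t")
      case True
      then show ?thesis using Ut V_end[OF Y_rules] by simp
    next
      case False
      then show ?thesis using s(3) unfolding U_def by (simp add: V_end[OF Y_rules])
    qed
    fix \<theta> g h and \<omega>' :: "'n path" assume \<theta>: "\<theta> \<in> \<Theta>'" and g: "s \<le> g" "g < h" "h \<le> u" and \<omega>': "\<omega>' \<in> paths kd r T"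
    have rg: "r \<le> g" using g(1) s(1) by simp
    consider "h \<le> t" | "t \<le> g" "t < h" | "g < t" "t < h" using g by linarith
    then show "S \<theta> g h (U h) \<omega>' \<le> U g \<omega>'"
    proof cases
      case 1
      then show ?thesis
        using V_super[OF W_rules \<theta> rg g(2) 1 \<omega>'] g unfolding U_def by simp
    next
      case 2
      have "U g = V Y u g" using 2(1) Ut unfolding U_def by (cases "g = t") auto
      moreover have "U h = V Y u h" using 2 unfolding U_def by simp
      ultimately show ?thesis using V_super[OF Y_rules \<theta> rg g(2,3) \<omega>'] by simp
    next
      case 3
      have hT: "h \<le> T" and rh: "r \<le> h" using g rg s(4) by auto
      have Uh: "U h = V Y u h" and Ug: "U g = V (V Y u t) t g" using 3 unfolding U_def by auto
      have hb: "V Y u h \<in> bbm (F r T)" by (rule V_bbm[OF Y_rules rh g(3)])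
      have "S \<theta> g h (U h) \<omega>' = S \<theta> g t (S \<theta> t h (V Y u h)) \<omega>'"
        unfolding Uh by (rule S_semigroup[symmetric, OF \<theta> rg 3 hT hb \<omega>'])
      also have "\<dots> \<le> S \<theta> g t (V Y u t) \<omega>'"
        by (rule S_mono[OF \<theta> rg 3(1) tT S_bbm[OF \<theta> rt 3(2) hT hb] V_bbm[OF Y_rules rt s(3)] _ \<omega>'])
           (rule V_super[OF Y_rules \<theta> rt 3(2) g(3)])
      also have "\<dots> = S \<theta> g t (V (V Y u t) t t) \<omega>'"
        by (rule S_cong[OF \<theta> rg 3(1) tT _ \<omega>']) (simp add: V_end[OF W_rules])
      also have "\<dots> \<le> U g \<omega>'" unfolding Ug by (rule V_super[OF W_rules \<theta> rg 3(1) order_refl \<omega>'])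
      finally show ?thesis .
    qed
  qed
  then show "V Y u s \<omega> \<le> V (V Y u t) t s \<omega>" using s(2) unfolding U_def by simp
qed

end

section \<open>Conditional expectations of controls\<close>

definition cell_index :: "('n::finite, 'e) control \<Rightarrow> nat \<Rightarrow> 'n path \<Rightarrow> nat" where
  "cell_index \<gamma> i \<omega> = (THE j. j \<in> idx \<gamma> i \<and> \<omega> \<in> cell \<gamma> i j)"

context martingale_family
begin

text \<open>
  The law of the path that follows \<open>\<omega>\<close> up to time \<open>s\<close> and then
  the control, for \<open>s\<close> in the last \<open>l\<close> intervals of its subdivision.
\<close>

primrec control_kernel ::
  "real \<Rightarrow> ('n, 'e) control \<Rightarrow> nat \<Rightarrow> real \<Rightarrow> 'n path \<Rightarrow> 'n path measure" where
  "control_kernel r \<gamma> 0 = (\<lambda>s \<omega>. return (F r T) \<omega>)"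
| "control_kernel r \<gamma> (Suc l) = (\<lambda>s \<omega>.
     let i = steps \<gamma> - Suc l in
     if node \<gamma> (Suc i) \<le> s then control_kernel r \<gamma> l s \<omega>
     else kernel (param \<gamma> i (cell_index \<gamma> i \<omega>)) r s \<omega> \<bind> control_kernel r \<gamma> l (node \<gamma> (Suc i)))"

abbreviation cond :: "real \<Rightarrow> ('n, 'e) control \<Rightarrow> real \<Rightarrow> ('n path \<Rightarrow> ereal) \<Rightarrow> 'n path \<Rightarrow> ereal" where
  "cond r \<gamma> s \<psi> \<equiv> cond_control kd T K Z r \<gamma> s \<psi>"

context
  fixes \<Theta>' r \<gamma> assumes sub: "\<Theta>' \<subseteq> \<Theta>" and r0: "0 \<le> r" and \<gamma>: "\<gamma> \<in> controls kd T \<Theta>' r T"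
begin

lemma node_first: "node \<gamma> 0 = r" and node_last: "node \<gamma> (steps \<gamma>) = T"
  and node_less: "i < steps \<gamma> \<Longrightarrow> node \<gamma> i < node \<gamma> (Suc i)"
  using \<gamma> unfolding controls_def by auto

lemma node_mono: "i \<le> j \<Longrightarrow> j \<le> steps \<gamma> \<Longrightarrow> node \<gamma> i \<le> node \<gamma> j"
proof (induction j rule: dec_induct)
  case (step j)
  then show ?case using node_less[of j] by simp
qed simp

lemma node_bounds: "i \<le> steps \<gamma> \<Longrightarrow> r \<le> node \<gamma> i" "i \<le> steps \<gamma> \<Longrightarrow> node \<gamma> i \<le> T"
  using node_mono[of 0 i] node_mono[of i "steps \<gamma>"] node_first node_last by auto

lemma cells:
  assumes "i < steps \<gamma>"
  shows "finite (idx \<gamma> i)" "disjoint_family_on (cell \<gamma> i) (idx \<gamma> i)" "(\<Union>j\<in>idx \<gamma> i. cell \<gamma> i j) = paths kd r T"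
    and "\<And>j. j \<in> idx \<gamma> i \<Longrightarrow> cell \<gamma> i j \<in> sets (F r (node \<gamma> i))"
    and "\<And>j. j \<in> idx \<gamma> i \<Longrightarrow> param \<gamma> i j \<in> \<Theta>'"
    and "\<And>j u \<omega>. j \<in> idx \<gamma> i \<Longrightarrow> node \<gamma> i \<le> u \<Longrightarrow> u < node \<gamma> (Suc i) \<Longrightarrow> \<omega> \<in> cell \<gamma> i j \<Longrightarrow>
      proc \<gamma> u \<omega> = param \<gamma> i j (u, \<omega> u)"
  using \<gamma> assms unfolding controls_def by auto

lemma cell_index_eq:
  assumes "i < steps \<gamma>" "j \<in> idx \<gamma> i" "\<omega> \<in> cell \<gamma> i j"
  shows "cell_index \<gamma> i \<omega> = j"
  unfolding cell_index_def
proof (rule the_equality)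
  fix k assume "k \<in> idx \<gamma> i \<and> \<omega> \<in> cell \<gamma> i k"
  then show "k = j" using cells(2)[OF assms(1)] assms(2,3) unfolding disjoint_family_on_def by blast
qed (use assms in blast)

lemma cell_index_in:
  assumes "i < steps \<gamma>" "\<omega> \<in> paths kd r T"
  shows "cell_index \<gamma> i \<omega> \<in> idx \<gamma> i" "\<omega> \<in> cell \<gamma> i (cell_index \<gamma> i \<omega>)"
proof -
  obtain j where "j \<in> idx \<gamma> i" "\<omega> \<in> cell \<gamma> i j" using cells(3)[OF assms(1)] assms(2) by blast
  then show "cell_index \<gamma> i \<omega> \<in> idx \<gamma> i" "\<omega> \<in> cell \<gamma> i (cell_index \<gamma> i \<omega>)"
    using cell_index_eq[OF assms(1)] by auto
qed

lemma cell_sum: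
  fixes f :: "nat \<Rightarrow> real"
  assumes "i < steps \<gamma>" "\<omega> \<in> paths kd r T"
  shows "(\<Sum>j\<in>idx \<gamma> i. indicator (cell \<gamma> i j) \<omega> * f j) = f (cell_index \<gamma> i \<omega>)"
proof -
  have "(\<Sum>j\<in>idx \<gamma> i. indicator (cell \<gamma> i j) \<omega> * f j) = (\<Sum>j\<in>idx \<gamma> i. if j = cell_index \<gamma> i \<omega> then f j else 0)"
  proof (rule sum.cong[OF refl])
    fix j assume j: "j \<in> idx \<gamma> i"
    show "indicator (cell \<gamma> i j) \<omega> * f j = (if j = cell_index \<gamma> i \<omega> then f j else 0)"
    proof (cases "\<omega> \<in> cell \<gamma> i j")
      case True
      then show ?thesis using cell_index_eq[OF assms(1) j] by simp
    next
      case False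
      then have "j \<noteq> cell_index \<gamma> i \<omega>" using cell_index_in(2)[OF assms] by blast
      then show ?thesis using False by simp
    qed
  qed
  then show ?thesis using cells(1)[OF assms(1)] cell_index_in(1)[OF assms] by simp
qed

lemma kernel_cell_measurable:
  assumes i: "i < steps \<gamma>" and s: "r \<le> s" "s < T" and \<kappa>: "\<kappa> \<in> measurable (F r T) (prob_algebra (F r T))"
  shows "(\<lambda>\<omega>. kernel (param \<gamma> i (cell_index \<gamma> i \<omega>)) r s \<omega> \<bind> \<kappa>) \<in> measurable (F r T) (prob_algebra (F r T))"
proof (rule measurable_piecewise_restrict[of "cell \<gamma> i ` idx \<gamma> i"])
  show "countable (cell \<gamma> i ` idx \<gamma> i)" using cells(1)[OF i] by (simp add: countable_finite)
  show "space (F r T) \<subseteq> \<Union> (cell \<gamma> i ` idx \<gamma> i)" using cells(3)[OF i] by simp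
  fix A assume "A \<in> cell \<gamma> i ` idx \<gamma> i"
  then obtain j where j: "j \<in> idx \<gamma> i" and A: "A = cell \<gamma> i j" by blast
  have "node \<gamma> i \<le> T" using node_bounds(2)[of i] i by simp
  then have AS: "A \<in> sets (F r T)" using cells(4)[OF i j] sets_path_filt_mono[of "node \<gamma> i" T kd r T] A by blast
  then show "A \<inter> space (F r T) \<in> sets (F r T)" by (rule sets.Int) (rule sets.top)
  have \<theta>: "param \<gamma> i j \<in> \<Theta>" using cells(5)[OF i j] sub by blast
  have "(\<lambda>\<omega>. kernel (param \<gamma> i j) r s \<omega> \<bind> \<kappa>) \<in> measurable (F r T) (prob_algebra (F r T))"
    by (rule measurable_bind_prob_space[OF kernel_measurable[OF \<theta> r0 s] \<kappa>])
  then have "(\<lambda>\<omega>. kernel (param \<gamma> i j) r s \<omega> \<bind> \<kappa>) \<in> measurable (restrict_space (F r T) A) (prob_algebra (F r T))"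
    by (rule measurable_restrict_space1)
  then show "(\<lambda>\<omega>. kernel (param \<gamma> i (cell_index \<gamma> i \<omega>)) r s \<omega> \<bind> \<kappa>)
      \<in> measurable (restrict_space (F r T) A) (prob_algebra (F r T))"
    by (rule measurable_cong[THEN iffD1, rotated]) (use cell_index_eq[OF i j] A in \<open>auto simp: space_restrict_space\<close>)
qed

lemma control_kernel_measurable:
  "l \<le> steps \<gamma> \<Longrightarrow> r \<le> s \<Longrightarrow> control_kernel r \<gamma> l s \<in> measurable (F r T) (prob_algebra (F r T))"
proof (induction l arbitrary: s)
  case (Suc l)
  let ?i = "steps \<gamma> - Suc l"
  have i: "?i < steps \<gamma>" "r \<le> node \<gamma> (Suc ?i)" "node \<gamma> (Suc ?i) \<le> T"
    using Suc.prems(1) node_bounds[of "Suc ?i"] by auto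
  show ?case
  proof (cases "node \<gamma> (Suc ?i) \<le> s")
    case True
    then show ?thesis using Suc by (simp add: Let_def)
  next
    case False
    have "(\<lambda>\<omega>. kernel (param \<gamma> ?i (cell_index \<gamma> ?i \<omega>)) r s \<omega> \<bind> control_kernel r \<gamma> l (node \<gamma> (Suc ?i)))
        \<in> measurable (F r T) (prob_algebra (F r T))"
      by (rule kernel_cell_measurable[OF i(1)]) (use Suc i False in auto)
    then show ?thesis using False by (simp add: Let_def)
  qed
qed (simp add: measurable_return_prob_space)

lemma control_kernel_prob_space:
  assumes "l \<le> steps \<gamma>" "r \<le> s" "\<omega> \<in> paths kd r T"
  shows "prob_space (control_kernel r \<gamma> l s \<omega>)" "sets (control_kernel r \<gamma> l s \<omega>) = sets (F r T)"
  using measurable_space[OF control_kernel_measurable[OF assms(1,2)]] assms(3) by (auto simp: space_prob_algebra)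

text \<open>
  The nested integrals in the recursive definition of the conditional expectation are one integral
  over the composed kernel, which makes linearity and monotone convergence available.
\<close>

lemma cond_tail_eq_integral:
  assumes \<psi>: "\<psi> \<in> borel_measurable (F r T)" "\<And>\<omega>. \<omega> \<in> paths kd r T \<Longrightarrow> \<bar>\<psi> \<omega>\<bar> \<le> c"
  shows "l \<le> steps \<gamma> \<Longrightarrow> r \<le> s \<Longrightarrow> \<omega> \<in> paths kd r T \<Longrightarrow>
    cond_tail kd T K Z r \<gamma> l s \<psi> \<omega> = (\<integral>x. \<psi> x \<partial>control_kernel r \<gamma> l s \<omega>)"
proof (induction l arbitrary: s \<omega>)
  case 0
  then show ?case using integral_return[of \<omega> "F r T" \<psi>] \<psi>(1) by simp
next
  case (Suc l)
  let ?i = "steps \<gamma> - Suc l"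
  let ?u = "node \<gamma> (Suc ?i)"
  have i: "?i < steps \<gamma>" "r \<le> ?u" "?u \<le> T" and l: "l \<le> steps \<gamma>"
    using Suc.prems(1) node_bounds[of "Suc ?i"] by auto
  show ?case
  proof (cases "?u \<le> s")
    case True
    then show ?thesis using Suc by (simp add: Let_def)
  next
    case False
    let ?\<theta> = "param \<gamma> ?i (cell_index \<gamma> ?i \<omega>)" and ?\<kappa> = "control_kernel r \<gamma> l ?u"
    have sT: "s < T" and s0: "0 \<le> s" using False i Suc.prems r0 by auto
    have \<theta>: "?\<theta> \<in> \<Theta>" using cells(5)[OF i(1)] cell_index_in[OF i(1) Suc.prems(3)] sub by blast
    note N = \<theta> r0 Suc.prems(2) sT Suc.prems(3)
    have \<kappa>: "?\<kappa> \<in> measurable (F r T) (prob_algebra (F r T))" by (rule control_kernel_measurable[OF l i(2)])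
    have \<kappa>': "?\<kappa> \<in> measurable (F r T) (subprob_algebra (F r T))" using measurable_prob_algebraD[OF \<kappa>] .
    have G: "(\<lambda>\<omega>. \<integral>x. \<psi> x \<partial>?\<kappa> \<omega>) \<in> borel_measurable (F r T)"
      by (rule measurable_compose[OF \<kappa>' integral_measurable_subprob_algebra[OF \<psi>(1)]])
    interpret p: prob_space "kernel ?\<theta> r s \<omega>" by (rule kernel_prob_space(1)[OF N])
    have spk: "space (kernel ?\<theta> r s \<omega>) = paths kd r T" by (rule space_kernel[OF N])
    have \<kappa>N: "?\<kappa> \<in> measurable (kernel ?\<theta> r s \<omega>) (subprob_algebra (F r T))"
      using \<kappa>' by (simp add: measurable_cong_sets[OF kernel_prob_space(2)[OF N] refl])
    have "cond_tail kd T K Z r \<gamma> (Suc l) s \<psi> \<omega> = cond_theta kd T K (Z ?\<theta>) r s (cond_tail kd T K Z r \<gamma> l ?u \<psi>) \<omega>"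
      using False cell_sum[OF i(1) Suc.prems(3), of "\<lambda>j. cond_theta kd T K (Z (param \<gamma> ?i j)) r s (cond_tail kd T K Z r \<gamma> l ?u \<psi>) \<omega>"]
      by (simp add: Let_def)
    also have "\<dots> = (\<integral>\<omega>'. (\<integral>x. \<psi> x \<partial>?\<kappa> (splice r s T \<omega> \<omega>')) \<partial>P ?\<theta> s (\<omega> s))"
      unfolding cond_theta_def
    proof (rule Bochner_Integration.integral_cong[OF refl])
      fix \<omega>' assume "\<omega>' \<in> space (P ?\<theta> s (\<omega> s))"
      then have "\<omega>' \<in> paths kd s T" using space_law[OF \<theta> s0 sT] by simp
      then have "splice r s T \<omega> \<omega>' \<in> paths kd r T" using Suc.prems sT by (intro splice_in_paths) auto
      then show "cond_tail kd T K Z r \<gamma> l ?u \<psi> (splice r s T \<omega> \<omega>') = (\<integral>x. \<psi> x \<partial>?\<kappa> (splice r s T \<omega> \<omega>'))"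
        by (rule Suc.IH[OF l i(2)])
    qed
    also have "\<dots> = (\<integral>\<omega>''. \<integral>x. \<psi> x \<partial>?\<kappa> \<omega>'' \<partial>kernel ?\<theta> r s \<omega>)" by (rule integral_kernel[symmetric, OF N G])
    also have "\<dots> = (\<integral>x. \<psi> x \<partial>(kernel ?\<theta> r s \<omega> \<bind> ?\<kappa>))"
    proof (rule integral_bind[symmetric, OF \<psi>(1) _ \<kappa>N p.finite_measure_axioms, where B' = 1 and B = c])
      show "AE \<omega>'' in kernel ?\<theta> r s \<omega>. emeasure (?\<kappa> \<omega>'') (space (?\<kappa> \<omega>'')) \<le> ennreal 1"
        by (intro AE_I2) (simp add: spk prob_space.emeasure_space_1[OF control_kernel_prob_space(1)[OF l i(2)]])
    qed (use \<psi>(2) in auto)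
    also have "\<dots> = (\<integral>x. \<psi> x \<partial>control_kernel r \<gamma> (Suc l) s \<omega>)" using False by (simp add: Let_def)
    finally show ?thesis .
  qed
qed

lemma cond_eq_eexp:
  assumes \<psi>: "\<psi> \<in> bbm (F r T)" and s: "r \<le> s" and \<omega>: "\<omega> \<in> paths kd r T"
  shows "cond r \<gamma> s \<psi> \<omega> = eexp (control_kernel r \<gamma> (steps \<gamma>) s \<omega>) \<psi>"
proof -
  obtain c where c: "0 \<le> c" "\<And>\<omega>. \<omega> \<in> paths kd r T \<Longrightarrow> ereal (- c) \<le> \<psi> \<omega>" using bbm_lower[OF \<psi>] by auto
  note [measurable] = bbm_measurable[OF \<psi>]
  have "cond_bounded kd T K Z r \<gamma> s (\<lambda>\<omega>'. real_of_ereal (min (\<psi> \<omega>') (ereal (real m)))) \<omega>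
      = (\<integral>x. real_of_ereal (min (\<psi> x) (ereal (real m))) \<partial>control_kernel r \<gamma> (steps \<gamma>) s \<omega>)" for m :: nat
    unfolding cond_bounded_def
  proof (rule cond_tail_eq_integral[OF _ _ order_refl s \<omega>])
    show "(\<lambda>\<omega>'. real_of_ereal (min (\<psi> \<omega>') (ereal (real m)))) \<in> borel_measurable (F r T)" by measurable
    fix \<omega>' :: "'n path" assume w: "\<omega>' \<in> paths kd r T"
    show "\<bar>real_of_ereal (min (\<psi> \<omega>') (ereal (real m)))\<bar> \<le> c + real m"
      using truncation_bounds(2,3)[OF c(1) c(2)[OF w], of m] c(1) unfolding abs_le_iff by linarith
  qed
  then show ?thesis unfolding cond_control_def eexp_def by simp
qed

lemma cond_bbm:
  assumes "\<psi> \<in> bbm (F r T)" "r \<le> s"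
  shows "cond r \<gamma> s \<psi> \<in> bbm (F r T)"
proof (rule bbm_cong)
  have "return (F r T) (\<lambda>u\<in>{r..T}. 0) \<in> space (prob_algebra (F r T))"
    using measurable_space[OF measurable_return_prob_space, of "\<lambda>u\<in>{r..T}. 0" "F r T"] by (simp add: constant_in_paths)
  then show "(\<lambda>\<omega>. eexp (control_kernel r \<gamma> (steps \<gamma>) s \<omega>) \<psi>) \<in> bbm (F r T)"
    by (rule eexp_bind(2)[OF _ control_kernel_measurable[OF order_refl assms(2)] assms(1)])
qed (simp add: cond_eq_eexp[OF assms])

lemma cond_mono:
  assumes "\<psi> \<in> bbm (F r T)" "\<phi> \<in> bbm (F r T)" "\<And>\<omega>. \<omega> \<in> paths kd r T \<Longrightarrow> \<psi> \<omega> \<le> \<phi> \<omega>" "r \<le> s" "\<omega> \<in> paths kd r T"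
  shows "cond r \<gamma> s \<psi> \<omega> \<le> cond r \<gamma> s \<phi> \<omega>"
  unfolding cond_eq_eexp[OF assms(1,4,5)] cond_eq_eexp[OF assms(2,4,5)]
  by (rule eexp_mono[OF control_kernel_prob_space[OF order_refl assms(4,5)] assms(1,2)]) (use assms(3) in auto)

lemma cond_add:
  assumes "\<psi> \<in> bbm (F r T)" "\<phi> \<in> bbm (F r T)" "r \<le> s" "\<omega> \<in> paths kd r T"
  shows "cond r \<gamma> s (\<lambda>\<omega>. \<psi> \<omega> + \<phi> \<omega>) \<omega> = cond r \<gamma> s \<psi> \<omega> + cond r \<gamma> s \<phi> \<omega>"
  unfolding cond_eq_eexp[OF assms(1,3,4)] cond_eq_eexp[OF assms(2,3,4)] cond_eq_eexp[OF bbm_add[OF assms(1,2)] assms(3,4)]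
  by (rule eexp_add[OF control_kernel_prob_space[OF order_refl assms(3,4)] assms(1,2)])

lemma cond_mult:
  assumes "\<psi> \<in> bbm (F r T)" "0 \<le> l" "r \<le> s" "\<omega> \<in> paths kd r T"
  shows "cond r \<gamma> s (\<lambda>\<omega>. ereal l * \<psi> \<omega>) \<omega> = ereal l * cond r \<gamma> s \<psi> \<omega>"
  unfolding cond_eq_eexp[OF assms(1,3,4)] cond_eq_eexp[OF bbm_mult[OF assms(1,2)] assms(3,4)]
  by (rule eexp_mult[OF control_kernel_prob_space[OF order_refl assms(3,4)] assms(1,2)])

lemma cond_SUP:
  assumes b: "\<And>m::nat. \<psi> m \<in> bbm (F r T)" and inc: "\<And>m \<omega>. \<omega> \<in> paths kd r T \<Longrightarrow> \<psi> m \<omega> \<le> \<psi> (Suc m) \<omega>"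
    and s: "r \<le> s" and \<omega>: "\<omega> \<in> paths kd r T"
  shows "cond r \<gamma> s (\<lambda>\<omega>. SUP m. \<psi> m \<omega>) \<omega> = (SUP m. cond r \<gamma> s (\<psi> m) \<omega>)"
proof -
  have "cond r \<gamma> s (\<lambda>\<omega>. SUP m. \<psi> m \<omega>) \<omega> = eexp (control_kernel r \<gamma> (steps \<gamma>) s \<omega>) (\<lambda>\<omega>. SUP m. \<psi> m \<omega>)"
    by (rule cond_eq_eexp[OF bbm_SUP[OF b] s \<omega>])
  also have "\<dots> = (SUP m. eexp (control_kernel r \<gamma> (steps \<gamma>) s \<omega>) (\<psi> m))"
    by (rule eexp_SUP[OF control_kernel_prob_space[OF order_refl s \<omega>] b]) (use inc in auto)
  finally show ?thesis unfolding cond_eq_eexp[OF b s \<omega>] .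
qed

lemma cond_cong:
  assumes "\<psi> \<in> bbm (F r T)" "\<And>\<omega>. \<omega> \<in> paths kd r T \<Longrightarrow> \<phi> \<omega> = \<psi> \<omega>" "r \<le> s" "\<omega> \<in> paths kd r T"
  shows "cond r \<gamma> s \<phi> \<omega> = cond r \<gamma> s \<psi> \<omega>"
proof -
  have "\<phi> \<in> bbm (F r T)" by (rule bbm_cong[OF assms(1)]) (simp add: assms(2))
  then show ?thesis using assms by (intro antisym cond_mono) auto
qed

lemma control_kernel_skip:
  assumes "i \<le> steps \<gamma>" "node \<gamma> i \<le> s"
  shows "control_kernel r \<gamma> (steps \<gamma>) s = control_kernel r \<gamma> (steps \<gamma> - i) s"
  using assms
proof (induction i)
  case (Suc i)
  have "node \<gamma> i \<le> s" using Suc.prems node_less[of i] by simp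
  moreover have "steps \<gamma> - i = Suc (steps \<gamma> - Suc i)" "steps \<gamma> - Suc (steps \<gamma> - Suc i) = i" using Suc.prems by auto
  ultimately show ?case using Suc by (simp add: Let_def fun_eq_iff)
qed simp

lemma cond_end:
  assumes "\<psi> \<in> bbm (F r T)" "\<omega> \<in> paths kd r T" "r \<le> T"
  shows "cond r \<gamma> T \<psi> \<omega> = \<psi> \<omega>"
proof -
  obtain c where c: "\<And>\<omega>. \<omega> \<in> paths kd r T \<Longrightarrow> ereal c \<le> \<psi> \<omega>" using assms(1) unfolding bbm_def by auto
  have "control_kernel r \<gamma> (steps \<gamma>) T = control_kernel r \<gamma> 0 T"
    using control_kernel_skip[of "steps \<gamma>" T] node_last by simp
  then have "cond r \<gamma> T \<psi> \<omega> = eexp (return (F r T) \<omega>) \<psi>" using cond_eq_eexp[OF assms(1,3,2)] by simp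
  also have "\<dots> = lim (\<lambda>m::nat. ereal (real_of_ereal (min (\<psi> \<omega>) (ereal (real m)))))"
  proof -
    note [measurable] = bbm_measurable[OF assms(1)]
    show ?thesis unfolding eexp_def
      by (subst integral_return) (use assms(2) in \<open>auto, measurable\<close>)
  qed
  also have "\<dots> = \<psi> \<omega>" by (rule lim_truncation) (use c[OF assms(2)] in auto)
  finally show ?thesis .
qed

lemma cond_step:
  assumes i: "i < steps \<gamma>" "node \<gamma> i \<le> s" "s < node \<gamma> (Suc i)"
    and \<omega>: "\<omega> \<in> paths kd r T" "j \<in> idx \<gamma> i" "\<omega> \<in> cell \<gamma> i j" and \<psi>: "\<psi> \<in> bbm (F r T)"
  shows "cond r \<gamma> s \<psi> \<omega> = E (param \<gamma> i j) r s (cond r \<gamma> (node \<gamma> (Suc i)) \<psi>) \<omega>"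
proof -
  let ?u = "node \<gamma> (Suc i)"
  have u: "r \<le> ?u" "?u \<le> T" and rs: "r \<le> s" using node_bounds[of "Suc i"] node_bounds(1)[of i] i by auto
  have sT: "s < T" using i u by simp
  have \<theta>: "param \<gamma> i j \<in> \<Theta>" using cells(5)[OF i(1) \<omega>(2)] sub by blast
  have l: "steps \<gamma> - i = Suc (steps \<gamma> - Suc i)" "steps \<gamma> - Suc (steps \<gamma> - Suc i) = i" using i by auto
  have "control_kernel r \<gamma> (steps \<gamma>) s \<omega> = control_kernel r \<gamma> (steps \<gamma> - i) s \<omega>"
    using control_kernel_skip[of i s] i by simp
  also have "\<dots> = kernel (param \<gamma> i (cell_index \<gamma> i \<omega>)) r s \<omega> \<bind> control_kernel r \<gamma> (steps \<gamma> - Suc i) ?u"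
    unfolding l(1) using i(3) by (simp add: l(2) Let_def)
  also have "control_kernel r \<gamma> (steps \<gamma> - Suc i) ?u = control_kernel r \<gamma> (steps \<gamma>) ?u"
    using control_kernel_skip[of "Suc i" ?u] i by simp
  also have "cell_index \<gamma> i \<omega> = j" by (rule cell_index_eq[OF i(1) \<omega>(2,3)])
  finally have k: "control_kernel r \<gamma> (steps \<gamma>) s \<omega> = kernel (param \<gamma> i j) r s \<omega> \<bind> control_kernel r \<gamma> (steps \<gamma>) ?u" .
  have "cond r \<gamma> s \<psi> \<omega> = eexp (kernel (param \<gamma> i j) r s \<omega>) (\<lambda>\<omega>'. eexp (control_kernel r \<gamma> (steps \<gamma>) ?u \<omega>') \<psi>)"
    unfolding cond_eq_eexp[OF \<psi> rs \<omega>(1)] k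
    by (rule eexp_bind(1)[OF kernel_in_prob_algebra[OF \<theta> r0 rs sT \<omega>(1)] control_kernel_measurable[OF order_refl u(1)] \<psi>])
  also have "\<dots> = E (param \<gamma> i j) r s (cond r \<gamma> ?u \<psi>) \<omega>"
    unfolding E_def by (rule eexp_cong) (simp add: space_kernel[OF \<theta> r0 rs sT \<omega>(1)] cond_eq_eexp[OF \<psi> u(1)])
  finally show ?thesis .
qed

text \<open>
  Every nested integral has a constant integrand, because the spliced paths agree with
  \<open>\<omega>\<close> up to time \<open>s\<close>.
\<close>

lemma cond_tail_past:
  fixes \<psi> :: "'n path \<Rightarrow> real"
  shows "l \<le> steps \<gamma> \<Longrightarrow> r \<le> s \<Longrightarrow> \<omega> \<in> paths kd r T \<Longrightarrow>
    (\<And>\<omega> \<omega>'. \<omega> \<in> paths kd r T \<Longrightarrow> \<omega>' \<in> paths kd r T \<Longrightarrow> (\<And>v. r \<le> v \<Longrightarrow> v \<le> s \<Longrightarrow> \<omega> v = \<omega>' v) \<Longrightarrow> \<psi> \<omega> = \<psi> \<omega>') \<Longrightarrow>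
    cond_tail kd T K Z r \<gamma> l s \<psi> \<omega> = \<psi> \<omega>"
proof (induction l arbitrary: s \<omega>)
  case 0
  show ?case by (simp only: cond_tail.simps)
next
  case (Suc l)
  let ?i = "steps \<gamma> - Suc l"
  let ?u = "node \<gamma> (Suc ?i)"
  have i: "?i < steps \<gamma>" "r \<le> ?u" "?u \<le> T" and l: "l \<le> steps \<gamma>"
    using Suc.prems(1) node_bounds[of "Suc ?i"] by auto
  show ?case
  proof (cases "?u \<le> s")
    case True
    have "cond_tail kd T K Z r \<gamma> l s \<psi> \<omega> = \<psi> \<omega>"
      by (rule Suc.IH[OF l Suc.prems(2,3)]) (rule Suc.prems(4))
    with True show ?thesis by (simp add: Let_def)
  next
    case False
    let ?\<theta> = "param \<gamma> ?i (cell_index \<gamma> ?i \<omega>)"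
    have sT: "s < T" and s0: "0 \<le> s" using False i Suc.prems(2) r0 by auto
    have \<theta>: "?\<theta> \<in> \<Theta>" using cells(5)[OF i(1)] cell_index_in[OF i(1) Suc.prems(3)] sub by blast
    have "cond_tail kd T K Z r \<gamma> (Suc l) s \<psi> \<omega> = cond_theta kd T K (Z ?\<theta>) r s (cond_tail kd T K Z r \<gamma> l ?u \<psi>) \<omega>"
      using False cell_sum[OF i(1) Suc.prems(3), of "\<lambda>j. cond_theta kd T K (Z (param \<gamma> ?i j)) r s (cond_tail kd T K Z r \<gamma> l ?u \<psi>) \<omega>"]
      by (simp add: Let_def)
    also have "\<dots> = (\<integral>\<omega>'. \<psi> \<omega> \<partial>P ?\<theta> s (\<omega> s))"
      unfolding cond_theta_def
    proof (rule Bochner_Integration.integral_cong[OF refl])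
      fix \<omega>' assume "\<omega>' \<in> space (P ?\<theta> s (\<omega> s))"
      then have "\<omega>' \<in> paths kd s T" using space_law[OF \<theta> s0 sT] by simp
      then have w: "splice r s T \<omega> \<omega>' \<in> paths kd r T" using Suc.prems(2,3) sT by (intro splice_in_paths) auto
      have "cond_tail kd T K Z r \<gamma> l ?u \<psi> (splice r s T \<omega> \<omega>') = \<psi> (splice r s T \<omega> \<omega>')"
        by (rule Suc.IH[OF l i(2) w Suc.prems(4)]) (use False in auto)
      also have "\<dots> = \<psi> \<omega>" by (rule Suc.prems(4)[OF w Suc.prems(3)]) (use sT in \<open>simp add: splice_upto\<close>)
      finally show "cond_tail kd T K Z r \<gamma> l ?u \<psi> (splice r s T \<omega> \<omega>') = \<psi> \<omega>" .
    qed
    also have "\<dots> = \<psi> \<omega>" using prob_space.prob_space[OF prob_space_law[OF \<theta> s0 sT]] by simp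
    finally show ?thesis .
  qed
qed

lemma cond_past:
  assumes s: "r \<le> s" and \<omega>: "\<omega> \<in> paths kd r T" "\<psi> \<omega> \<noteq> - \<infinity>"
    and past: "\<And>\<omega> \<omega>'. \<omega> \<in> paths kd r T \<Longrightarrow> \<omega>' \<in> paths kd r T \<Longrightarrow> (\<And>v. r \<le> v \<Longrightarrow> v \<le> s \<Longrightarrow> \<omega> v = \<omega>' v) \<Longrightarrow> \<psi> \<omega> = \<psi> \<omega>'"
  shows "cond r \<gamma> s \<psi> \<omega> = \<psi> \<omega>"
proof -
  have "cond_bounded kd T K Z r \<gamma> s (\<lambda>\<omega>'. real_of_ereal (min (\<psi> \<omega>') (ereal (real m)))) \<omega>
      = real_of_ereal (min (\<psi> \<omega>) (ereal (real m)))" for m :: nat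
    unfolding cond_bounded_def
  proof (rule cond_tail_past[OF order_refl s \<omega>(1)])
    fix \<omega>1 \<omega>2 :: "'n path" assume "\<omega>1 \<in> paths kd r T" "\<omega>2 \<in> paths kd r T" "\<And>v. r \<le> v \<Longrightarrow> v \<le> s \<Longrightarrow> \<omega>1 v = \<omega>2 v"
    then have "\<psi> \<omega>1 = \<psi> \<omega>2" by (rule past)
    then show "real_of_ereal (min (\<psi> \<omega>1) (ereal (real m))) = real_of_ereal (min (\<psi> \<omega>2) (ereal (real m)))" by simp
  qed
  then show ?thesis unfolding cond_control_def using lim_truncation[OF \<omega>(2)] by simp
qed

end

end

section \<open>Feedback controls\<close>

text \<open>
  At the last point \<open>g\<close> of \<open>D\<close> before the current time an index is read
  off the path; it selects the parameter to be followed.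
\<close>

definition feedback_process ::
  "real set \<Rightarrow> (real \<Rightarrow> nat \<Rightarrow> ('n::finite, 'e) bmap) \<Rightarrow> (real \<Rightarrow> 'n path \<Rightarrow> nat) \<Rightarrow> real \<Rightarrow> 'n path \<Rightarrow> 'e" where
  "feedback_process D par sel u \<omega> = (let g = Max {d \<in> D. d \<le> u} in par g (sel g \<omega>) (u, \<omega> u))"

text \<open>
  The end point of the subdivision is \<open>e\<close>. The first index set is \<open>{1}\<close>,
  as it has to be for a control.
\<close>

definition feedback_control ::
  "path_kind \<Rightarrow> real \<Rightarrow> real \<Rightarrow> real \<Rightarrow> real set \<Rightarrow> nat \<Rightarrow> (real \<Rightarrow> nat \<Rightarrow> ('n::finite, 'e) bmap) \<Rightarrow>
   (real \<Rightarrow> 'n path \<Rightarrow> nat) \<Rightarrow> ('n, 'e) control" where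
  "feedback_control kd T r e D m par sel = (let L = sorted_list_of_set {d \<in> D. r \<le> d \<and> d \<le> e} in
     \<lparr> proc = feedback_process D par sel, steps = length L - 1, node = (\<lambda>i. L ! i),
       idx = (\<lambda>i. if i = 0 then {1} else {1..m}),
       cell = (\<lambda>i j. {\<omega> \<in> paths kd r T. sel (L ! i) \<omega> = j}), param = (\<lambda>i j. par (L ! i) j) \<rparr>)"

text \<open>
  Measurability of a feedback process for any \<open>\<sigma>\<close>-algebra that sees the time, the current position
  and the events of the past; progressive and predictable measurability are instances.
\<close>

lemma (in martingale_family) feedback_process_measurable:
  assumes sp: "\<And>x. x \<in> space N \<Longrightarrow> r \<le> fst x \<and> snd x \<in> paths kd r T" and r: "0 \<le> r"
    and time: "fst \<in> borel_measurable N" and eval: "(\<lambda>x. snd x (fst x)) \<in> borel_measurable N"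
    and past: "\<And>d A. d \<in> D \<Longrightarrow> r \<le> d \<Longrightarrow> A \<in> sets (F r d) \<Longrightarrow> {x \<in> space N. d \<le> fst x \<and> snd x \<in> A} \<in> sets N"
    and D: "finite D" "r \<in> D" and par: "\<And>d j. par d j \<in> \<Theta>"
    and sel: "\<And>d. d \<in> D \<Longrightarrow> r \<le> d \<Longrightarrow> sel d \<in> measurable (F r d) (count_space UNIV)"
    and m: "\<And>d \<omega>. d \<in> D \<Longrightarrow> r \<le> d \<Longrightarrow> \<omega> \<in> paths kd r T \<Longrightarrow> sel d \<omega> \<in> {1..m}"
  shows "(\<lambda>x. feedback_process D par sel (fst x) (snd x)) \<in> borel_measurable N"
proof -
  define X where "X p = {x \<in> space N. fst p \<le> fst x \<and> snd x \<in> {\<omega> \<in> paths kd r T. sel (fst p) \<omega> = snd p}}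
      \<inter> {x \<in> space N. \<forall>d'\<in>D. fst p < d' \<longrightarrow> fst x < d'}" for p :: "real \<times> nat"
  define I where "I = {d \<in> D. r \<le> d} \<times> {1..m}"
  have maxi: "Max {d \<in> D. d \<le> v} = d" if "d \<in> D" "d \<le> v" "\<forall>d'\<in>D. d < d' \<longrightarrow> v < d'" for d v
    by (rule Max_eqI) (use that D(1) in \<open>auto simp: not_less[symmetric]\<close>)
  show ?thesis
  proof (rule measurable_piecewise_restrict[of "X ` I"])
    show "countable (X ` I)" unfolding I_def using D(1) by (intro countable_image countable_finite) auto
    show "space N \<subseteq> \<Union> (X ` I)"
    proof
      fix x assume x: "x \<in> space N"
      let ?A = "{d \<in> D. d \<le> fst x}"
      have A: "finite ?A" "r \<in> ?A" using D sp[OF x] by auto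
      have d: "Max ?A \<in> ?A" by (rule Max_in[OF A(1)]) (use A(2) in blast)
      moreover have "r \<le> Max ?A" by (rule Max_ge[OF A])
      ultimately have d: "Max ?A \<in> ?A" "r \<le> Max ?A" by auto
      have "x \<in> X (Max ?A, sel (Max ?A) (snd x))"
        unfolding X_def using x sp[OF x] d A by (auto simp: not_le[symmetric])
      moreover have "(Max ?A, sel (Max ?A) (snd x)) \<in> I"
        unfolding I_def using d m[of "Max ?A" "snd x"] sp[OF x] by auto
      ultimately show "x \<in> \<Union> (X ` I)" by blast
    qed
    fix B assume "B \<in> X ` I"
    then obtain d j where B: "B = X (d, j)" and d: "d \<in> D" "r \<le> d" and j: "j \<in> {1..m}"
      unfolding I_def by auto
    have "sel d -` {j} \<inter> space (F r d) \<in> sets (F r d)" by (rule measurable_sets[OF sel[OF d]]) simp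
    then have "{\<omega> \<in> paths kd r T. sel d \<omega> = j} \<in> sets (F r d)" by (simp add: vimage_def Int_def conj_commute)
    then have "{x \<in> space N. d \<le> fst x \<and> snd x \<in> {\<omega> \<in> paths kd r T. sel d \<omega> = j}} \<in> sets N" by (rule past[OF d])
    moreover have "{x \<in> space N. \<forall>d'\<in>D. d < d' \<longrightarrow> fst x < d'} \<in> sets N"
      using D(1) time by (intro sets.sets_Collect_finite_All sets.sets_Collect_imp borel_measurable_less) auto
    ultimately have "X (d, j) \<in> sets N" unfolding X_def by (simp only: fst_conv snd_conv sets.Int)
    then show "B \<inter> space N \<in> sets N" unfolding B by (intro sets.Int sets.top)
    have "(\<lambda>x. (fst x, snd x (fst x))) \<in> measurable N (restrict_space borel ({0..} \<times> UNIV))"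
    proof (rule measurable_restrict_space2[OF _ borel_measurable_Pair[OF time eval]])
      have "0 \<le> fst x" if "x \<in> space N" for x using sp[OF that] r by linarith
      then show "(\<lambda>x. (fst x, snd x (fst x))) \<in> space N \<rightarrow> {0..} \<times> UNIV" by auto
    qed
    moreover have "par d j \<in> borel_measurable (restrict_space borel ({0..} \<times> UNIV))"
      using hypothesis par unfolding Theta_hypothesis_def by blast
    ultimately have "(\<lambda>x. par d j (fst x, snd x (fst x))) \<in> borel_measurable N"
      by (rule measurable_compose)
    then have "(\<lambda>x. par d j (fst x, snd x (fst x))) \<in> borel_measurable (restrict_space N B)"
      by (rule measurable_restrict_space1)
    moreover have "feedback_process D par sel (fst x) (snd x) = par d j (fst x, snd x (fst x))"
      if "x \<in> space (restrict_space N B)" for x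
    proof -
      have x: "d \<le> fst x" "sel d (snd x) = j" "\<forall>d'\<in>D. d < d' \<longrightarrow> fst x < d'"
        using that unfolding B X_def by (auto simp: space_restrict_space)
      then show ?thesis using maxi[OF d(1) x(1,3)] by (simp add: feedback_process_def)
    qed
    ultimately show "(\<lambda>x. feedback_process D par sel (fst x) (snd x)) \<in> borel_measurable (restrict_space N B)"
      by (simp cong: measurable_cong)
  qed
qed

lemma predictable_generators:
  assumes "r \<le> T"
  shows "{{r} \<times> A |A. A \<in> sets (path_filt kd r T r)} \<union>
    {{a<..b} \<times> A |a b A. r \<le> a \<and> a \<le> b \<and> b \<le> T \<and> A \<in> sets (path_filt kd r T a)}
    \<subseteq> Pow ({r..T} \<times> paths kd r T)"
proof -
  have "A \<subseteq> paths kd r T" if "A \<in> sets (path_filt kd r T u)" for A u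
    using sets.sets_into_space[OF that] by simp
  then show ?thesis using assms by fastforce
qed

lemma space_predictable_sigma: "r \<le> T \<Longrightarrow> space (predictable_sigma kd r T) = {r..T} \<times> paths kd r T"
  unfolding predictable_sigma_def by (rule space_measure_of[OF predictable_generators])

lemma predictable_sigma_start:
  assumes "A \<in> sets (path_filt kd r T r)" "r \<le> T"
  shows "{r} \<times> A \<in> sets (predictable_sigma kd r T)"
  unfolding predictable_sigma_def
  by (rule in_measure_of[OF predictable_generators[OF assms(2)]]) (use assms in blast)

lemma predictable_sigma_interval:
  assumes "A \<in> sets (path_filt kd r T a)" "r \<le> a" "a \<le> b" "b \<le> T"
  shows "{a<..b} \<times> A \<in> sets (predictable_sigma kd r T)"
proof -
  have rT: "r \<le> T" using assms by simp
  show ?thesis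
    unfolding predictable_sigma_def
    by (rule in_measure_of[OF predictable_generators[OF rT]]) (use assms in blast)
qed

lemma predictable_sigma_initial:
  assumes "A \<in> sets (path_filt kd r T r)" "r \<le> T"
  shows "{r..T} \<times> A \<in> sets (predictable_sigma kd r T)"
proof -
  have "{r} \<times> A \<union> {r<..T} \<times> A \<in> sets (predictable_sigma kd r T)"
    using assms by (intro sets.Un predictable_sigma_start predictable_sigma_interval) auto
  also have "{r} \<times> A \<union> {r<..T} \<times> A = {r..T} \<times> A" using assms(2) by auto
  finally show ?thesis .
qed

lemma predictable_time:
  assumes "r \<le> T"
  shows "fst \<in> borel_measurable (predictable_sigma kd r T :: (real \<times> 'n::finite path) measure)"
proof (rule borel_measurableI_greater)
  fix a :: real
  have top: "paths kd r T \<in> sets (path_filt kd r T u)" for u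
    using sets.top[of "path_filt kd r T u"] by simp
  consider "a < r" | "r \<le> a" "a \<le> T" | "T < a" by linarith
  then show "{x \<in> space (predictable_sigma kd r T :: (real \<times> 'n path) measure). a < fst x} \<in> sets (predictable_sigma kd r T)"
  proof cases
    case 1
    then have "{x \<in> space (predictable_sigma kd r T :: (real \<times> 'n path) measure). a < fst x} = space (predictable_sigma kd r T)"
      by (auto simp: space_predictable_sigma[OF assms])
    then show ?thesis by simp
  next
    case 2
    then have "{x \<in> space (predictable_sigma kd r T :: (real \<times> 'n path) measure). a < fst x} = {a<..T} \<times> paths kd r T"
      by (auto simp: space_predictable_sigma[OF assms])
    then show ?thesis using predictable_sigma_interval[OF top 2(1) 2(2) order_refl] by simp
  next
    case 3
    then have "{x \<in> space (predictable_sigma kd r T :: (real \<times> 'n path) measure). a < fst x} = {}"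
      by (auto simp: space_predictable_sigma[OF assms])
    then show ?thesis by (simp only: sets.empty_sets)
  qed
qed

text \<open>
  On continuous paths the coordinate process stopped at \<open>w\<close> is the limit of left-continuous step
  processes, whose value on \<open>]i/(k+1), (i+1)/(k+1)]\<close> is known at the left end point.
\<close>

lemma predictable_stopped_evaluation:
  assumes rT: "r \<le> T" and w: "r \<le> w" "w \<le> T"
  shows "(\<lambda>x. snd x (min (fst x) w)) \<in> borel_measurable (predictable_sigma Continuous r T :: (real \<times> 'n::finite path) measure)"
proof -
  let ?N = "predictable_sigma Continuous r T :: (real \<times> 'n path) measure"
  have start: "(\<lambda>x. snd x r) \<in> borel_measurable ?N"
  proof (rule measurableI)
    fix B :: "(real ^ 'n) set" assume "B \<in> sets borel"
    then have "(\<lambda>\<omega>. \<omega> r) -` B \<inter> paths Continuous r T \<in> sets (path_filt Continuous r T r)"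
      using measurable_sets[OF measurable_coordinate[of r r r Continuous T], of B] by simp
    from predictable_sigma_initial[OF this rT]
    show "(\<lambda>x. snd x r) -` B \<inter> space ?N \<in> sets ?N"
      by (rule back_subst[where P = "\<lambda>A. A \<in> sets ?N"]) (auto simp: space_predictable_sigma[OF rT])
  qed simp
  have later: "(\<lambda>x. if c < fst x then snd x (min c w) else 0) \<in> borel_measurable ?N" if c: "r \<le> c" for c
  proof (cases "c \<le> T")
    case True
    show ?thesis
    proof (rule measurableI)
      fix B :: "(real ^ 'n) set" assume B: "B \<in> sets borel"
      have "(\<lambda>\<omega>. \<omega> (min c w)) -` B \<inter> paths Continuous r T \<in> sets (path_filt Continuous r T c)"
        using measurable_sets[OF measurable_coordinate[of r "min c w" c Continuous T] B] c w by simp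
      from predictable_sigma_interval[OF this c True order_refl]
      have 1: "{c<..T} \<times> ((\<lambda>\<omega>. \<omega> (min c w)) -` B \<inter> paths Continuous r T) \<in> sets ?N" .
      have "{x \<in> space ?N. fst x \<le> c} \<in> sets ?N"
        by (rule borel_measurable_le[OF predictable_time[OF rT] borel_measurable_const])
      then have 2: "(if 0 \<in> B then {x \<in> space ?N. fst x \<le> c} else {}) \<in> sets ?N" by simp
      have "(\<lambda>x. if c < fst x then snd x (min c w) else 0) -` B \<inter> space ?N
          = {c<..T} \<times> ((\<lambda>\<omega>. \<omega> (min c w)) -` B \<inter> paths Continuous r T) \<union> (if 0 \<in> B then {x \<in> space ?N. fst x \<le> c} else {})"
        using c by (auto simp: space_predictable_sigma[OF rT] split: if_splits)
      then show "(\<lambda>x. if c < fst x then snd x (min c w) else 0) -` B \<inter> space ?N \<in> sets ?N"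
        using sets.Un[OF 1 2] by simp
    qed simp
  next
    case False
    then have "(\<lambda>x. if c < fst x then snd x (min c w) else 0) x = 0" if "x \<in> space ?N" for x
      using that by (auto simp: space_predictable_sigma[OF rT])
    then show ?thesis by (subst measurable_cong[of ?N _ "\<lambda>_. 0"]) auto
  qed
  define a where "a k v = (real_of_int \<lceil>real (Suc k) * v\<rceil> - 1) / real (Suc k)" for k :: nat and v
  have a1: "a k v < v" for k v
  proof -
    have "real_of_int \<lceil>real (Suc k) * v\<rceil> - 1 < real (Suc k) * v" by linarith
    then show ?thesis unfolding a_def by (subst pos_divide_less_eq) (simp_all add: mult.commute)
  qed
  have a2: "v - 1 / real (Suc k) \<le> a k v" for k v
  proof -
    have "(real (Suc k) * v - 1) / real (Suc k) \<le> a k v"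
      unfolding a_def by (intro divide_right_mono) linarith+
    then show ?thesis by (simp add: diff_divide_distrib)
  qed
  have a3: "(\<lambda>k. a k v) \<longlonglongrightarrow> v" for v
  proof (rule tendsto_sandwich[of "\<lambda>k. v - 1 / real (Suc k)" _ _ "\<lambda>_. v"])
    show "(\<lambda>k. v - 1 / real (Suc k)) \<longlonglongrightarrow> v"
      using tendsto_diff[OF tendsto_const[of v] LIMSEQ_inverse_real_of_nat] by (simp add: inverse_eq_divide)
  qed (use a1 a2 in \<open>auto intro!: always_eventually less_imp_le\<close>)
  define h where "h c x = (if c < r then snd x r else if c < fst x then snd x (min c w) else 0)"
    for c and x :: "real \<times> 'n path"
  have hm: "h c \<in> borel_measurable ?N" for c
    unfolding h_def[abs_def] using start later[of c] by (cases "c < r") auto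
  show ?thesis
  proof (rule borel_measurable_LIMSEQ_metric)
    fix k
    have "(\<lambda>x. (\<lambda>i x. h ((real_of_int i - 1) / real (Suc k)) x) \<lceil>real (Suc k) * fst x\<rceil> x) \<in> borel_measurable ?N"
    proof (rule measurable_compose_countable'[where I = UNIV and g = "\<lambda>x. \<lceil>real (Suc k) * fst x\<rceil>"])
      note [measurable] = predictable_time[OF rT, of Continuous]
      show "(\<lambda>x. \<lceil>real (Suc k) * fst x\<rceil>) \<in> measurable ?N (count_space UNIV)" by measurable
    qed (auto intro!: hm)
    then show "(\<lambda>x. h (a k (fst x)) x) \<in> borel_measurable ?N" by (simp add: a_def)
  next
    fix x assume x: "x \<in> space ?N"
    then have v: "r \<le> fst x" "fst x \<le> T" and p: "continuous_on {r..T} (snd x)"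
      by (auto simp: space_predictable_sigma[OF rT])
    have "(\<lambda>k. min (max r (a k (fst x))) w) \<longlonglongrightarrow> min (max r (fst x)) w"
      by (intro tendsto_min tendsto_max tendsto_const a3)
    then have "(\<lambda>k. snd x (min (max r (a k (fst x))) w)) \<longlonglongrightarrow> snd x (min (max r (fst x)) w)"
      by (rule continuous_on_tendsto_compose[OF p]) (use w v in \<open>auto intro!: always_eventually\<close>)
    moreover have "h (a k (fst x)) x = snd x (min (max r (a k (fst x))) w)" for k
      using a1[of k "fst x"] w(1) unfolding h_def by (auto simp: max_def)
    ultimately show "(\<lambda>k. h (a k (fst x)) x) \<longlonglongrightarrow> snd x (min (fst x) w)"
      using v by (simp add: max_def)
  qed
qed

text \<open>
  After time \<open>d\<close> the event that \<open>X\<^sub>v\<close> is in \<open>B\<close>, for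
  \<open>v \<le> d\<close>, is an event for the process stopped at \<open>v\<close>, which is
  predictable.
\<close>

lemma predictable_past_event:
  assumes rT: "r \<le> T" and d: "r \<le> d" "d \<le> T" and A: "A \<in> sets (path_filt Continuous r T d)"
  shows "{x \<in> space (predictable_sigma Continuous r T). d \<le> fst x \<and> snd x \<in> (A :: 'n::finite path set)}
    \<in> sets (predictable_sigma Continuous r T)"
proof -
  let ?N = "predictable_sigma Continuous r T :: (real \<times> 'n path) measure"
  have time: "{x \<in> space ?N. d \<le> fst x} \<in> sets ?N"
    by (rule borel_measurable_le[OF borel_measurable_const predictable_time[OF rT]])
  show ?thesis
    using A unfolding sets_path_filt
  proof (induction rule: sigma_sets.induct)
    case (Basic A)
    then obtain v B where A: "A = (\<lambda>\<omega>. \<omega> v) -` B \<inter> paths Continuous r T" and v: "r \<le> v" "v \<le> d"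
      and B: "B \<in> sets borel" by auto
    have mv: "min q v = v" if "d \<le> q" for q using that v by simp
    have "(\<lambda>x. snd x (min (fst x) v)) -` B \<inter> space ?N \<in> sets ?N"
      by (rule measurable_sets[OF predictable_stopped_evaluation[OF rT] B]) (use v d in auto)
    then have "((\<lambda>x. snd x (min (fst x) v)) -` B \<inter> space ?N) \<inter> {x \<in> space ?N. d \<le> fst x} \<in> sets ?N"
      using time by (rule sets.Int)
    also have "((\<lambda>x. snd x (min (fst x) v)) -` B \<inter> space ?N) \<inter> {x \<in> space ?N. d \<le> fst x}
        = {x \<in> space ?N. d \<le> fst x \<and> snd x \<in> A}"
      unfolding A by (auto simp: space_predictable_sigma[OF rT] mv)
    finally show ?case .
  next
    case (Compl A)
    have "{x \<in> space ?N. d \<le> fst x} - {x \<in> space ?N. d \<le> fst x \<and> snd x \<in> A} \<in> sets ?N"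
      by (rule sets.Diff[OF time Compl.IH])
    also have "{x \<in> space ?N. d \<le> fst x} - {x \<in> space ?N. d \<le> fst x \<and> snd x \<in> A}
        = {x \<in> space ?N. d \<le> fst x \<and> snd x \<in> paths Continuous r T - A}"
      by (auto simp: space_predictable_sigma[OF rT])
    finally show ?case .
  next
    case (Union A)
    have "(\<Union>i. {x \<in> space ?N. d \<le> fst x \<and> snd x \<in> A i}) \<in> sets ?N"
      using Union.IH by (intro sets.countable_UN) auto
    also have "(\<Union>i. {x \<in> space ?N. d \<le> fst x \<and> snd x \<in> A i}) = {x \<in> space ?N. d \<le> fst x \<and> snd x \<in> (\<Union>i. A i)}"
      by auto
    finally show ?case .
  qed simp
qed

context martingale_family
begin

lemma feedback_process_predictable:
  assumes r: "0 \<le> r" and e: "r \<le> e" "e \<le> T" and D: "finite D" "r \<in> D" "D \<subseteq> {..T}" and par: "\<And>d j. par d j \<in> \<Theta>"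
    and sel: "\<And>d. d \<in> D \<Longrightarrow> r \<le> d \<Longrightarrow> sel d \<in> measurable (F r d) (count_space UNIV)"
    and m: "\<And>d \<omega>. d \<in> D \<Longrightarrow> r \<le> d \<Longrightarrow> \<omega> \<in> paths kd r T \<Longrightarrow> sel d \<omega> \<in> {1..m}"
  shows "predictable kd T r e (feedback_process D par sel)"
proof (cases kd)
  case Continuous
  let ?M = "predictable_sigma Continuous r T :: (real \<times> 'n path) measure"
  let ?\<Omega> = "{r..<e} \<times> paths Continuous r T"
  have rT: "r \<le> T" using e by simp
  have spM: "space (restrict_space ?M ?\<Omega>) = ?\<Omega> \<inter> space ?M" by (simp add: space_restrict_space Int_commute)
  have "(\<lambda>x. feedback_process D par sel (fst x) (snd x)) \<in> borel_measurable ?M"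
  proof (rule feedback_process_measurable[OF _ r _ _ _ D(1,2) par sel m])
    show "r \<le> fst x \<and> snd x \<in> paths kd r T" if "x \<in> space ?M" for x
      using that Continuous by (auto simp: space_predictable_sigma[OF rT])
    show "fst \<in> borel_measurable ?M" by (rule predictable_time[OF rT])
    have "(\<lambda>x. snd x (min (fst x) T)) \<in> borel_measurable ?M"
      by (rule predictable_stopped_evaluation[OF rT rT order_refl])
    then show "(\<lambda>x. snd x (fst x)) \<in> borel_measurable ?M"
      by (rule measurable_cong[THEN iffD1, rotated]) (auto simp: space_predictable_sigma[OF rT] min_def)
    show "{x \<in> space ?M. d \<le> fst x \<and> snd x \<in> A} \<in> sets ?M" if "d \<in> D" "r \<le> d" "A \<in> sets (F r d)" for d A
      using that D(3) Continuous by (intro predictable_past_event[OF rT]) auto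
  qed auto
  then have "(\<lambda>x. feedback_process D par sel (fst x) (snd x)) \<in> borel_measurable (restrict_space ?M ?\<Omega>)"
    by (rule measurable_restrict_space1)
  then show ?thesis using Continuous by (simp add: case_prod_beta)
next
  case Cadlag
  have "(\<lambda>x. feedback_process D par sel (fst x) (snd x)) \<in> borel_measurable (restrict_space borel {r..u} \<Otimes>\<^sub>M F r u)"
    if u: "r \<le> u" "u < e" for u
  proof (rule feedback_process_measurable[OF _ r _ _ _ D(1,2) par sel m])
    let ?N = "restrict_space borel {r..u} \<Otimes>\<^sub>M F r u"
    have uT: "u \<le> T" using u e by simp
    show sp: "r \<le> fst x \<and> snd x \<in> paths kd r T" if "x \<in> space ?N" for x
      using that by (auto simp: space_pair_measure space_restrict_space)
    have id: "(\<lambda>v. v) \<in> borel_measurable (restrict_space borel {r..u})"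
      by (rule measurable_restrict_space1) simp
    show time: "fst \<in> borel_measurable ?N" by (rule measurable_compose[OF measurable_fst id])
    have "(\<lambda>x. (fst x, snd x)) \<in> measurable ?N (borel \<Otimes>\<^sub>M F r u)"
      by (rule measurable_Pair[OF time measurable_snd])
    from measurable_compose[OF this measurable_clamped_evaluation[OF u(1) uT]]
    have "(\<lambda>x. snd x (clamp_time r u (fst x))) \<in> borel_measurable ?N" by simp
    then show "(\<lambda>x. snd x (fst x)) \<in> borel_measurable ?N"
      by (rule measurable_cong[THEN iffD1, rotated])
         (auto simp: space_pair_measure space_restrict_space clamp_time_id)
    show "{x \<in> space ?N. d \<le> fst x \<and> snd x \<in> A} \<in> sets ?N" if d: "d \<in> D" "r \<le> d" "A \<in> sets (F r d)" for d A
    proof (cases "d \<le> u")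
      case True
      have A: "A \<in> sets (F r u)" using d(3) sets_path_filt_mono[OF True] by blast
      have "{x \<in> space ?N. d \<le> fst x} \<inter> (snd -` A \<inter> space ?N) \<in> sets ?N"
        by (rule sets.Int[OF borel_measurable_le[OF borel_measurable_const time] measurable_sets[OF measurable_snd A]])
      also have "{x \<in> space ?N. d \<le> fst x} \<inter> (snd -` A \<inter> space ?N) = {x \<in> space ?N. d \<le> fst x \<and> snd x \<in> A}" by auto
      finally show ?thesis .
    next
      case False
      then have "{x \<in> space ?N. d \<le> fst x \<and> snd x \<in> A} = {}"
        by (auto simp: space_pair_measure space_restrict_space)
      then show ?thesis by (simp only: sets.empty_sets)
    qed
  qed auto
  then show ?thesis using Cadlag by (simp add: case_prod_beta)
qed

text \<open>At the initial time no choice is possible: all paths lie in the cell with index 1.\<close>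

lemma feedback_control_in_controls:
  assumes r: "0 \<le> r" and e: "r \<le> e" "e \<le> T" and D: "finite D" "r \<in> D" "e \<in> D" "D \<subseteq> {..T}"
    and sub: "\<Theta>' \<subseteq> \<Theta>" and par: "\<And>d j. par d j \<in> \<Theta>'"
    and sel: "\<And>d. d \<in> D \<Longrightarrow> r \<le> d \<Longrightarrow> sel d \<in> measurable (F r d) (count_space UNIV)"
    and m: "\<And>d \<omega>. d \<in> D \<Longrightarrow> r \<le> d \<Longrightarrow> \<omega> \<in> paths kd r T \<Longrightarrow> sel d \<omega> \<in> {1..m}"
    and start: "\<And>\<omega>. \<omega> \<in> paths kd r T \<Longrightarrow> sel r \<omega> = 1"
  shows "feedback_control kd T r e D m par sel \<in> controls kd T \<Theta>' r e"
proof -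
  let ?A = "{d \<in> D. r \<le> d \<and> d \<le> e}"
  define L where "L = sorted_list_of_set ?A"
  have A: "finite ?A" "?A \<noteq> {}" "r \<in> ?A" "e \<in> ?A" using D e by auto
  have setL: "set L = ?A" and sorted: "sorted_wrt (<) L" unfolding L_def using A(1) by auto
  have Lne: "L \<noteq> []" using setL A(2) by auto
  have nth_in: "L ! i \<in> ?A" if "i < length L" for i using that setL nth_mem by blast
  have less: "L ! i < L ! j" if "i < j" "j < length L" for i j using sorted_wrt_nth_less[OF sorted that] .
  have le: "L ! i \<le> L ! j" if "i \<le> j" "j < length L" for i j
    using less[of i j] that by (cases "i = j") auto
  have L0: "L ! 0 = r"
  proof -
    obtain i where i: "i < length L" "L ! i = r" using A(3) setL by (metis in_set_conv_nth)
    then have "L ! 0 \<le> r" using le[of 0 i] by simp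
    then show ?thesis using nth_in[of 0] Lne by simp
  qed
  have Ln: "L ! (length L - 1) = e"
  proof -
    obtain i where i: "i < length L" "L ! i = e" using A(4) setL by (metis in_set_conv_nth)
    then have "e \<le> L ! (length L - 1)" using le[of i "length L - 1"] by simp
    then show ?thesis using nth_in[of "length L - 1"] Lne by simp
  qed
  \<comment> \<open>Between two consecutive nodes the last point of \<open>D\<close> is the left node.\<close>
  have cur: "Max {d \<in> D. d \<le> u} = L ! i" if i: "i < length L - 1" "L ! i \<le> u" "u < L ! Suc i" for i u
  proof (rule Max_eqI)
    fix d assume "d \<in> {d \<in> D. d \<le> u}"
    then have d: "d \<in> D" "d \<le> u" by auto
    show "d \<le> L ! i"
    proof (cases "r \<le> d")
      case True
      have "L ! Suc i \<le> e" using nth_in[of "Suc i"] i(1) by simp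
      then have "d \<in> set L" using setL d True i(3) by auto
      then obtain k where k: "k < length L" "d = L ! k" by (metis in_set_conv_nth)
      have "k \<le> i"
      proof (rule ccontr)
        assume "\<not> k \<le> i"
        then have "L ! Suc i \<le> d" using le[of "Suc i" k] k by simp
        then show False using d(2) i(3) by simp
      qed
      then show ?thesis using le[of k i] k i(1) by simp
    next
      case False
      have "i < length L" using i(1) by simp
      then show ?thesis using nth_in[of i] False by auto
    qed
  qed (use nth_in[of i] i D(1) in auto)
  have par\<Theta>: "par d j \<in> \<Theta>" for d j using par sub by blast
  have pred: "predictable kd T r e (feedback_process D par sel)"
    by (rule feedback_process_predictable[OF r e D(1,2,4) par\<Theta> sel m]) auto
  show ?thesis
    unfolding controls_def mem_Collect_eq feedback_control_def L_def[symmetric] Let_def control.simps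
  proof (intro conjI allI impI ballI pred L0 Ln)
    fix i assume i: "i < length L - 1"
    have d: "L ! i \<in> D" "r \<le> L ! i" using nth_in[of i] i by auto
    show "L ! i < L ! Suc i" using less[of i "Suc i"] i by simp
    show "finite (if i = 0 then {1} else {1..m})" by simp
    show "disjoint_family_on (\<lambda>j. {\<omega> \<in> paths kd r T. sel (L ! i) \<omega> = j}) (if i = 0 then {1} else {1..m})"
      unfolding disjoint_family_on_def by auto
    show "(\<Union>j\<in>if i = 0 then {1} else {1..m}. {\<omega> \<in> paths kd r T. sel (L ! i) \<omega> = j}) = paths kd r T"
      using m[OF d] start L0 by (cases "i = 0") auto
    fix j assume j: "j \<in> (if i = 0 then {1} else {1..m})"
    have "sel (L ! i) -` {j} \<inter> space (F r (L ! i)) \<in> sets (F r (L ! i))"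
      by (rule measurable_sets[OF sel[OF d]]) simp
    then show "{\<omega> \<in> paths kd r T. sel (L ! i) \<omega> = j} \<in> sets (F r (L ! i))"
      by (simp add: vimage_def Int_def conj_commute)
    show "par (L ! i) j \<in> \<Theta>'" by (rule par)
    fix u \<omega> assume "u \<in> {L ! i..<L ! Suc i}" "\<omega> \<in> {\<omega> \<in> paths kd r T. sel (L ! i) \<omega> = j}"
    then show "feedback_process D par sel u \<omega> = par (L ! i) j (u, \<omega> u)"
      using cur[OF i] by (simp add: feedback_process_def Let_def)
  qed auto
qed

end

lemma feedback_control_consecutive:
  assumes D: "finite D" "g \<in> D" "h \<in> D" and g: "r \<le> g" "g < h" "h \<le> e"
    and gap: "\<And>d. d \<in> D \<Longrightarrow> g < d \<Longrightarrow> h \<le> d"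
  shows "\<exists>i < steps (feedback_control kd T r e D m par sel).
    node (feedback_control kd T r e D m par sel) i = g \<and> node (feedback_control kd T r e D m par sel) (Suc i) = h"
proof -
  let ?A = "{d \<in> D. r \<le> d \<and> d \<le> e}"
  define L where "L = sorted_list_of_set ?A"
  have setL: "set L = ?A" and sorted: "sorted_wrt (<) L" unfolding L_def using D(1) by auto
  have less: "L ! i < L ! j" if "i < j" "j < length L" for i j using sorted_wrt_nth_less[OF sorted that] .
  have "g \<in> set L" "h \<in> set L" using setL D g by auto
  then obtain i k where i: "i < length L" "L ! i = g" and k: "k < length L" "L ! k = h" by (metis in_set_conv_nth)
  have ik: "i < k"
  proof (rule ccontr)
    assume "\<not> i < k"
    then have "h \<le> g" using less[of k i] i k by (cases "i = k") auto
    then show False using g(2) by simp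
  qed
  have "k = Suc i"
  proof (rule ccontr)
    assume "k \<noteq> Suc i"
    then have lt: "Suc i < k" using ik by simp
    then have "g < L ! Suc i" "L ! Suc i < h" using less[of i "Suc i"] less[of "Suc i" k] i k by auto
    moreover have "L ! Suc i \<in> D" using nth_mem[of "Suc i" L] lt k(1) setL by auto
    ultimately show False using gap[of "L ! Suc i"] by simp
  qed
  then show ?thesis
    unfolding feedback_control_def L_def[symmetric] Let_def control.simps using i k by (intro exI[of _ i]) auto
qed

section \<open>Gains of controls\<close>

text \<open>
  A Feller penalty on the laws of the controls with initial time \<open>r\<close> and starting
  point \<open>y\<close>.
\<close>

locale penalty_setup = feller_family kd T K \<Theta> Z
  for kd :: path_kind and T :: real and K :: "'k set"
    and \<Theta> :: "('n::finite, 'e::topological_space) bmap set"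
    and Z :: "('n, 'e) bmap \<Rightarrow> ('k, 'n) mart_problem" +
  fixes \<Theta>' :: "('n, 'e) bmap set" and \<beta> :: "('n, 'e) bmap \<Rightarrow> real \<Rightarrow> real \<Rightarrow> real ^ 'n \<Rightarrow> real" and r :: real
    and y :: "real ^ 'n" and \<alpha> :: "('n, 'e) penalty_family"
  assumes subset: "\<Theta>' \<subseteq> \<Theta>" and nonempty: "\<Theta>' \<noteq> {}" and r0: "0 \<le> r" and rT: "r \<le> T"
    and Feller_penalty: "Feller_penalty_with kd T K \<Theta>' Z r y \<alpha> \<beta>"
begin

definition pen :: "real \<Rightarrow> real \<Rightarrow> ('n, 'e) control \<Rightarrow> 'n path \<Rightarrow> ereal" where
  "pen s t \<gamma> = \<alpha> s t (tagged kd T K Z r y \<gamma>)"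

definition G :: "real \<Rightarrow> real \<Rightarrow> ('n path \<Rightarrow> ereal) \<Rightarrow> ('n, 'e) control \<Rightarrow> 'n path \<Rightarrow> ereal" where
  "G s t Y \<gamma> = gain kd T K Z r \<alpha> s t Y (tagged kd T K Z r y \<gamma>)"

abbreviation adm :: "('n, 'e) control set" where
  "adm \<equiv> controls kd T \<Theta>' r T"

lemma G_eq: "G s t Y \<gamma> \<omega> = cond r \<gamma> s Y \<omega> - pen s t \<gamma> \<omega>"
  unfolding G_def pen_def gain_def cond_law_def tagged_def by simp

lemma penalty: "penalty kd T K \<Theta>' Z r y \<alpha>"
  using Feller_penalty unfolding Feller_penalty_with_def by blast

lemma tagged_in: "\<gamma> \<in> adm \<Longrightarrow> tagged kd T K Z r y \<gamma> \<in> stable_set kd T K \<Theta>' Z r y"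
  unfolding stable_set_def by blast

lemma pen_measurable:
  assumes "\<gamma> \<in> adm" "r \<le> s" "s \<le> t" "t \<le> T"
  shows "pen s t \<gamma> \<in> borel_measurable (F r s)" "\<exists>c::real. \<forall>\<omega>\<in>paths kd r T. pen s t \<gamma> \<omega> \<le> ereal c"
proof -
  have "r \<le> s \<and> s \<le> t \<and> t \<le> T" using assms by simp
  note penalty[unfolded penalty_def, THEN conjunct1, rule_format, OF tagged_in[OF assms(1)] this]
  then show "pen s t \<gamma> \<in> borel_measurable (F r s)" "\<exists>c::real. \<forall>\<omega>\<in>paths kd r T. pen s t \<gamma> \<omega> \<le> ereal c"
    unfolding pen_def by simp_all
qed

lemma pen_local:
  assumes "\<gamma> \<in> adm" "\<eta> \<in> adm" "A \<in> sets (F r s)" "r \<le> s" "s \<le> t" "t \<le> T"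
    and "\<And>u \<omega>. s \<le> u \<Longrightarrow> u < t \<Longrightarrow> \<omega> \<in> A \<Longrightarrow> proc \<gamma> u \<omega> = proc \<eta> u \<omega>" and "\<omega> \<in> A"
  shows "pen s t \<gamma> \<omega> = pen s t \<eta> \<omega>"
proof -
  have "r \<le> s \<and> s \<le> t \<and> t \<le> T \<and> (\<forall>u\<in>{s..<t}. \<forall>\<omega>\<in>A. proc \<gamma> u \<omega> = proc \<eta> u \<omega>)"
    using assms(4-7) by auto
  from penalty[unfolded penalty_def, THEN conjunct2, THEN conjunct1, rule_format, OF assms(1-3) this assms(8)]
  show ?thesis unfolding pen_def .
qed

lemma pen_cocycle:
  assumes "\<gamma> \<in> adm" "r \<le> s" "s \<le> t" "t \<le> u" "u \<le> T" "\<omega> \<in> paths kd r T"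
  shows "pen s u \<gamma> \<omega> = pen s t \<gamma> \<omega> - cond r \<gamma> s (\<lambda>\<omega>'. - pen t u \<gamma> \<omega>') \<omega>"
proof -
  have "pen s u \<gamma> \<omega> = pen s t \<gamma> \<omega> - cond_law kd T K Z r (tagged kd T K Z r y \<gamma>) s (\<lambda>\<omega>'. - pen t u \<gamma> \<omega>') \<omega>"
    unfolding pen_def
    by (rule penalty[unfolded penalty_def, THEN conjunct2, THEN conjunct2, rule_format, OF tagged_in[OF assms(1)]])
       (use assms(2-6) in auto)
  then show ?thesis by (simp add: cond_law_def tagged_def)
qed

lemma neg_pen_bbm:
  assumes "\<gamma> \<in> adm" "r \<le> s" "s \<le> t" "t \<le> T"
  shows "(\<lambda>\<omega>. - pen s t \<gamma> \<omega>) \<in> bbm (F r T)"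
proof -
  obtain c :: real where c: "\<forall>\<omega>\<in>paths kd r T. pen s t \<gamma> \<omega> \<le> ereal c" using pen_measurable(2)[OF assms] by blast
  have sT: "s \<le> T" using assms by simp
  have "pen s t \<gamma> \<in> borel_measurable (F r T)"
    by (rule measurable_path_filt_mono[OF pen_measurable(1)[OF assms] sT])
  then have "(\<lambda>\<omega>. - pen s t \<gamma> \<omega>) \<in> borel_measurable (F r T)" by (rule borel_measurable_uminus_ereal)
  then show ?thesis by (rule bbmI[where c = "- c"]) (use c ereal_minus_le_minus[of "ereal c"] in fastforce)
qed

lemma pen_not_PInf:
  assumes "\<gamma> \<in> adm" "r \<le> s" "s \<le> t" "t \<le> T" "\<omega> \<in> paths kd r T"
  shows "pen s t \<gamma> \<omega> \<noteq> \<infinity>"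
  using pen_measurable(2)[OF assms(1-4)] assms(5) by fastforce

lemma pen_past:
  assumes "\<gamma> \<in> adm" "r \<le> s" "s \<le> t" "t \<le> T" "\<omega> \<in> paths kd r T" "\<omega>' \<in> paths kd r T"
    and "\<And>v. r \<le> v \<Longrightarrow> v \<le> s \<Longrightarrow> \<omega> v = \<omega>' v"
  shows "pen s t \<gamma> \<omega> = pen s t \<gamma> \<omega>'"
  by (rule path_filt_agree_fun[OF pen_measurable(1)[OF assms(1-4)] assms(5,6,7)])

definition constant_control :: "('n, 'e) bmap \<Rightarrow> ('n, 'e) control" where
  "constant_control \<theta> = feedback_control kd T r T {r, T} 1 (\<lambda>_ _. \<theta>) (\<lambda>_ _. 1)"

lemma constant_control_in: "\<theta> \<in> \<Theta>' \<Longrightarrow> constant_control \<theta> \<in> adm"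
  unfolding constant_control_def
  by (rule feedback_control_in_controls[OF r0 rT order_refl _ _ _ _ subset]) (use rT in auto)

lemma constant_control_proc: "proc (constant_control \<theta>) u \<omega> = \<theta> (u, \<omega> u)"
  unfolding constant_control_def feedback_control_def feedback_process_def by (simp add: Let_def)

lemma constant_control_param: "param (constant_control \<theta>) i j = \<theta>"
  unfolding constant_control_def feedback_control_def by (simp add: Let_def)

lemma pen_constant:
  assumes "\<theta> \<in> \<Theta>'" "r \<le> s" "s \<le> t" "t \<le> T" "\<omega> \<in> paths kd r T"
  shows "pen s t (constant_control \<theta>) \<omega> = ereal (\<beta> \<theta> s t (\<omega> s))"
proof -
  have st: "r \<le> s \<and> s \<le> t \<and> t \<le> T" using assms by simp
  show ?thesis
    unfolding pen_def
    by (rule Feller_penalty[unfolded Feller_penalty_with_def, THEN conjunct2, rule_format, OF assms(1) st,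
          THEN conjunct2, rule_format, OF constant_control_in[OF assms(1)] _ assms(5)])
       (rule constant_control_proc)
qed

lemma cond_constant_control:
  assumes \<theta>: "\<theta> \<in> \<Theta>'" and s: "r \<le> s" "s < T" and \<psi>: "\<psi> \<in> bbm (F r T)" and \<omega>: "\<omega> \<in> paths kd r T"
  shows "cond r (constant_control \<theta>) s \<psi> \<omega> = E \<theta> r s \<psi> \<omega>"
proof -
  have rlT: "r < T" using s by simp
  note c = constant_control_in[OF \<theta>]
  note rules = subset r0 c
  obtain i where i: "i < steps (constant_control \<theta>)" "node (constant_control \<theta>) i = r" "node (constant_control \<theta>) (Suc i) = T"
    using feedback_control_consecutive[of "{r, T}" r T r T kd T 1 "\<lambda>_ _. \<theta>" "\<lambda>_ _. 1"] rlT
    unfolding constant_control_def by auto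
  obtain j where j: "j \<in> idx (constant_control \<theta>) i" "\<omega> \<in> cell (constant_control \<theta>) i j"
    using cells(3)[OF rules i(1)] \<omega> by blast
  have "cond r (constant_control \<theta>) s \<psi> \<omega> = E \<theta> r s (cond r (constant_control \<theta>) T \<psi>) \<omega>"
    using cond_step[OF rules i(1) _ _ \<omega> j \<psi>, of s] s i(2,3) constant_control_param by simp
  also have "\<dots> = E \<theta> r s \<psi> \<omega>"
    by (rule E_cong[OF _ r0 s _ \<omega>]) (use \<theta> subset cond_end[OF rules \<psi> _ rT] in auto)
  finally show ?thesis .
qed

sublocale penalized_family kd T K \<Theta> Z \<Theta>' \<beta> r
proof
  show "\<Theta>' \<subseteq> \<Theta>" "\<Theta>' \<noteq> {}" "0 \<le> r" "r \<le> T" by (rule subset nonempty r0 rT)+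
  fix \<theta> s t assume \<theta>: "\<theta> \<in> \<Theta>'" and s: "r \<le> s" "s \<le> t" "t \<le> T"
  show "continuous_on UNIV (\<beta> \<theta> s t)"
    by (rule Feller_penalty[unfolded Feller_penalty_with_def, THEN conjunct2, rule_format, OF \<theta>, THEN conjunct1])
       (use s in simp)
  obtain c :: real where c: "\<forall>\<omega>\<in>paths kd r T. pen s t (constant_control \<theta>) \<omega> \<le> ereal c"
    using pen_measurable(2)[OF constant_control_in[OF \<theta>] s] by blast
  have "\<beta> \<theta> s t x \<le> c" for x
  proof -
    have "ereal (\<beta> \<theta> s t ((\<lambda>u\<in>{r..T}. x) s)) \<le> ereal c"
      using c pen_constant[OF \<theta> s constant_in_paths] constant_in_paths by metis
    then show ?thesis using s by simp
  qed
  then show "\<exists>c. \<forall>x. \<beta> \<theta> s t x \<le> c" by blast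
next
  fix \<theta> s v u and \<omega> :: "'n path"
  assume \<theta>: "\<theta> \<in> \<Theta>'" and s: "r \<le> s" "s < v" "v \<le> u" "u \<le> T" and \<omega>: "\<omega> \<in> paths kd r T"
  have sv: "s \<le> v" and rv: "r \<le> v" and sT: "s < T" and su: "s \<le> u" and vT: "v \<le> T" using s by auto
  note c = constant_control_in[OF \<theta>]
  have "E \<theta> r s (\<lambda>\<omega>'. - pen v u (constant_control \<theta>) \<omega>') \<omega> = E \<theta> r s (\<lambda>\<omega>'. ereal (- \<beta> \<theta> v u (\<omega>' v))) \<omega>"
    by (rule E_cong[OF _ r0 s(1) sT _ \<omega>]) (use \<theta> subset pen_constant[OF \<theta> rv s(3,4)] in auto)
  then show "ereal (\<beta> \<theta> s u (\<omega> s)) = ereal (\<beta> \<theta> s v (\<omega> s)) - E \<theta> r s (\<lambda>\<omega>'. ereal (- \<beta> \<theta> v u (\<omega>' v))) \<omega>"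
    using pen_cocycle[OF c s(1) sv s(3,4) \<omega>] pen_constant[OF \<theta> s(1) su s(4) \<omega>] pen_constant[OF \<theta> s(1) sv vT \<omega>]
      cond_constant_control[OF \<theta> s(1) sT neg_pen_bbm[OF c rv s(3,4)] \<omega>] by simp
qed

text \<open>
  On an empty interval locality identifies all controls with a constant one, and then the cocycle
  identity reads \<open>b = b + b\<close> with \<open>b\<close> finite.
\<close>

lemma pen_diagonal:
  assumes \<gamma>: "\<gamma> \<in> adm" and t: "r \<le> t" "t \<le> T" and \<omega>: "\<omega> \<in> paths kd r T"
  shows "pen t t \<gamma> \<omega> = 0"
proof -
  obtain \<theta> where \<theta>: "\<theta> \<in> \<Theta>'" using nonempty by blast
  note c = constant_control_in[OF \<theta>]
  have top: "paths kd r T \<in> sets (F r t)" using sets.top[of "F r t"] by simp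
  have loc: "pen t t \<gamma> \<omega>' = ereal (\<beta> \<theta> t t (\<omega>' t))" if "\<omega>' \<in> paths kd r T" for \<omega>'
    using pen_local[OF \<gamma> c top t(1) order_refl t(2) _ that] pen_constant[OF \<theta> t(1) order_refl t(2) that] by simp
  have "cond r \<gamma> t (\<lambda>\<omega>'. - pen t t \<gamma> \<omega>') \<omega> = - pen t t \<gamma> \<omega>"
  proof (rule cond_past[OF subset r0 \<gamma> t(1) \<omega>])
    show "- pen t t \<gamma> \<omega> \<noteq> - \<infinity>" using loc[OF \<omega>] by simp
    show "- pen t t \<gamma> \<omega>1 = - pen t t \<gamma> \<omega>2"
      if "\<omega>1 \<in> paths kd r T" "\<omega>2 \<in> paths kd r T" "\<And>v. r \<le> v \<Longrightarrow> v \<le> t \<Longrightarrow> \<omega>1 v = \<omega>2 v" for \<omega>1 \<omega>2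
      using loc[OF that(1)] loc[OF that(2)] that(3)[OF t(1) order_refl] by simp
  qed
  then show ?thesis
    using pen_cocycle[OF \<gamma> t(1) order_refl order_refl t(2) \<omega>] loc[OF \<omega>] by simp
qed

lemma past_of_bbm:
  assumes "Y \<in> bbm (F r t)" "t \<le> s" "\<omega> \<in> paths kd r T" "\<omega>' \<in> paths kd r T" "\<And>v. r \<le> v \<Longrightarrow> v \<le> s \<Longrightarrow> \<omega> v = \<omega>' v"
  shows "Y \<omega> = Y \<omega>'"
  by (rule path_filt_agree_fun[OF bbm_measurable[OF assms(1)] assms(3,4)]) (use assms(2,5) in auto)

lemma cond_known:
  assumes \<gamma>: "\<gamma> \<in> adm" and t: "r \<le> t" "t \<le> s" and Y: "Y \<in> bbm (F r t)" and \<omega>: "\<omega> \<in> paths kd r T"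
  shows "cond r \<gamma> s Y \<omega> = Y \<omega>"
proof (rule cond_past[OF subset r0 \<gamma> _ \<omega>])
  obtain c where "\<And>\<omega>. \<omega> \<in> paths kd r T \<Longrightarrow> ereal c \<le> Y \<omega>" using Y unfolding bbm_def by auto
  from this[OF \<omega>] show "Y \<omega> \<noteq> - \<infinity>" by auto
  show "Y \<omega>1 = Y \<omega>2"
    if "\<omega>1 \<in> paths kd r T" "\<omega>2 \<in> paths kd r T" "\<And>v. r \<le> v \<Longrightarrow> v \<le> s \<Longrightarrow> \<omega>1 v = \<omega>2 v" for \<omega>1 \<omega>2
    by (rule past_of_bbm[OF Y t(2) that(1,2)]) (rule that(3))
qed (use t in simp)

lemma gain_bbm:
  assumes "\<gamma> \<in> adm" "r \<le> s" "s \<le> t" "t \<le> T" "Y \<in> bbm (F r T)"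
  shows "G s t Y \<gamma> \<in> bbm (F r T)"
proof -
  have "(\<lambda>\<omega>. cond r \<gamma> s Y \<omega> + - pen s t \<gamma> \<omega>) \<in> bbm (F r T)"
    by (rule bbm_add[OF cond_bbm[OF subset r0 assms(1,5,2)] neg_pen_bbm[OF assms(1-4)]])
  then show ?thesis unfolding G_eq[abs_def] minus_ereal_def .
qed

lemma gain_end:
  assumes "\<gamma> \<in> adm" "r \<le> t" "t \<le> T" "Y \<in> bbm (F r t)" "\<omega> \<in> paths kd r T"
  shows "G t t Y \<gamma> \<omega> = Y \<omega>"
  unfolding G_eq using cond_known[OF assms(1,2) order_refl assms(4,5)] pen_diagonal[OF assms(1,2,3,5)] by simp

text \<open>
  Until the next node the control uses one parameter on each cell.  Locality replaces the penalty by
  that of the constant control, and the cocycle identity moves the remaining penalty inside the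
  conditional expectation.
\<close>

lemma gain_step:
  assumes \<gamma>: "\<gamma> \<in> adm" and i: "i < steps \<gamma>" "node \<gamma> i \<le> s" "s < node \<gamma> (Suc i)" and s: "s < t" "t \<le> T"
    and Y: "Y \<in> bbm (F r t)" and \<omega>: "\<omega> \<in> paths kd r T" "j \<in> idx \<gamma> i" "\<omega> \<in> cell \<gamma> i j"
  defines "v \<equiv> min (node \<gamma> (Suc i)) t"
  shows "G s t Y \<gamma> \<omega> = S (param \<gamma> i j) s v (G v t Y \<gamma>) \<omega>"
proof -
  note rules = subset r0 \<gamma>
  let ?u = "node \<gamma> (Suc i)" and ?\<theta> = "param \<gamma> i j"
  have u: "r \<le> ?u" "?u \<le> T" and rs: "r \<le> s"
    using node_bounds[OF rules, of "Suc i"] node_bounds(1)[OF rules, of i] i by auto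
  have v: "s < v" "v \<le> t" "v \<le> ?u" "r \<le> v" "v \<le> T" unfolding v_def using i s u rs by auto
  have sT: "s < T" and rt: "r \<le> t" using s rs by auto
  have \<theta>: "?\<theta> \<in> \<Theta>'" and \<theta>\<Theta>: "?\<theta> \<in> \<Theta>" using cells(5)[OF rules i(1) \<omega>(2)] subset by auto
  note E_rules = \<theta>\<Theta> r0 rs sT
  have YT: "Y \<in> bbm (F r T)" by (rule bbm_path_filt_mono[OF Y s(2)])
  have c: "cell \<gamma> i j \<in> sets (F r s)" using cells(4)[OF rules i(1) \<omega>(2)] sets_path_filt_mono[OF i(2)] by blast
  have pen1: "pen s v \<gamma> \<omega> = ereal (\<beta> ?\<theta> s v (\<omega> s))"
  proof -
    have "pen s v \<gamma> \<omega> = pen s v (constant_control ?\<theta>) \<omega>"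
    proof (rule pen_local[OF \<gamma> constant_control_in[OF \<theta>] c rs less_imp_le[OF v(1)] v(5) _ \<omega>(3)])
      fix q \<omega>' assume "s \<le> q" "q < v" "\<omega>' \<in> cell \<gamma> i j"
      then show "proc \<gamma> q \<omega>' = proc (constant_control ?\<theta>) q \<omega>'"
        using cells(6)[OF rules i(1) \<omega>(2), of q \<omega>'] i(2) v(3) by (simp add: constant_control_proc)
    qed
    then show ?thesis using pen_constant[OF \<theta> rs less_imp_le[OF v(1)] v(5) \<omega>(1)] by simp
  qed
  let ?p = "\<lambda>\<omega>'. - pen v t \<gamma> \<omega>'"
  have pb: "?p \<in> bbm (F r T)" by (rule neg_pen_bbm[OF \<gamma> v(4,2) s(2)])
  \<comment> \<open>The time \<open>v\<close> is the next node, or the terminal time \<open>t\<close> if that comes first.\<close>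
  have move: "cond r \<gamma> s Y \<omega> = E ?\<theta> r s (cond r \<gamma> v Y) \<omega> \<and> cond r \<gamma> s ?p \<omega> = E ?\<theta> r s ?p \<omega>"
  proof (cases "?u \<le> t")
    case True
    then have vu: "v = ?u" unfolding v_def by simp
    have "cond r \<gamma> s ?p \<omega> = E ?\<theta> r s (cond r \<gamma> v ?p) \<omega>"
      unfolding vu by (rule cond_step[OF rules i \<omega>]) (use pb vu in simp)
    also have "\<dots> = E ?\<theta> r s ?p \<omega>"
    proof (rule E_cong[OF E_rules _ \<omega>(1)])
      fix \<omega>' :: "'n path" assume w: "\<omega>' \<in> paths kd r T"
      show "cond r \<gamma> v ?p \<omega>' = ?p \<omega>'"
      proof (rule cond_past[OF rules v(4) w])
        show "?p \<omega>' \<noteq> - \<infinity>" using pen_not_PInf[OF \<gamma> v(4,2) s(2) w] by (cases "pen v t \<gamma> \<omega>'") auto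
        show "?p \<omega>1 = ?p \<omega>2"
          if "\<omega>1 \<in> paths kd r T" "\<omega>2 \<in> paths kd r T" "\<And>q. r \<le> q \<Longrightarrow> q \<le> v \<Longrightarrow> \<omega>1 q = \<omega>2 q" for \<omega>1 \<omega>2
          using pen_past[OF \<gamma> v(4,2) s(2) that(1,2)] that(3) by simp
      qed
    qed
    finally show ?thesis using cond_step[OF rules i \<omega> YT] vu by simp
  next
    case False
    then have vt: "v = t" unfolding v_def by simp
    have tu: "t \<le> ?u" using False by simp
    have "cond r \<gamma> s Y \<omega> = E ?\<theta> r s (cond r \<gamma> ?u Y) \<omega>" by (rule cond_step[OF rules i \<omega> YT])
    also have "\<dots> = E ?\<theta> r s (cond r \<gamma> v Y) \<omega>"
      by (rule E_cong[OF E_rules _ \<omega>(1)]) (simp add: cond_known[OF \<gamma> rt tu Y] vt cond_known[OF \<gamma> rt order_refl Y])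
    finally have 1: "cond r \<gamma> s Y \<omega> = E ?\<theta> r s (cond r \<gamma> v Y) \<omega>" .
    have p0: "?p \<omega>' = 0" if "\<omega>' \<in> paths kd r T" for \<omega>'
      unfolding vt using pen_diagonal[OF \<gamma> rt s(2) that] by simp
    have "cond r \<gamma> s ?p \<omega> = ?p \<omega>"
      by (rule cond_past[OF rules rs \<omega>(1)]) (simp_all add: p0 \<omega>(1))
    moreover have "E ?\<theta> r s ?p \<omega> = ?p \<omega>"
      by (rule E_past[OF E_rules bbm_measurable[OF pb] \<omega>(1)]) (simp_all add: p0 \<omega>(1))
    ultimately show ?thesis using 1 by simp
  qed
  have cb: "cond r \<gamma> v Y \<in> bbm (F r T)" by (rule cond_bbm[OF rules YT v(4)])
  have "E ?\<theta> r s (G v t Y \<gamma>) \<omega> = E ?\<theta> r s (\<lambda>\<omega>'. cond r \<gamma> v Y \<omega>' + ?p \<omega>') \<omega>"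
    unfolding G_eq[abs_def] minus_ereal_def ..
  also have "\<dots> = E ?\<theta> r s (cond r \<gamma> v Y) \<omega> + E ?\<theta> r s ?p \<omega>" by (rule E_add[OF E_rules cb pb \<omega>(1)])
  finally have e: "E ?\<theta> r s (G v t Y \<gamma>) \<omega> = cond r \<gamma> s Y \<omega> + cond r \<gamma> s ?p \<omega>" using move by simp
  have "cond r \<gamma> s ?p \<omega> \<noteq> - \<infinity>" using move E_not_MInf[OF E_rules pb \<omega>(1)] by simp
  then show ?thesis
    unfolding S_def e unfolding G_eq pen_cocycle[OF \<gamma> rs less_imp_le[OF v(1)] v(2) s(2) \<omega>(1)] pen1
    by (cases "cond r \<gamma> s ?p \<omega>"; cases "cond r \<gamma> s Y \<omega>") auto
qed

lemma node_interval:
  assumes \<gamma>: "\<gamma> \<in> adm" and s: "r \<le> s" "s < T"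
  shows "\<exists>i<steps \<gamma>. node \<gamma> i \<le> s \<and> s < node \<gamma> (Suc i)"
proof -
  note rules = subset r0 \<gamma>
  define k where "k = (LEAST k. s < node \<gamma> k)"
  have ex: "s < node \<gamma> (steps \<gamma>)" using node_last[OF rules] s by simp
  have k: "s < node \<gamma> k" unfolding k_def by (rule LeastI[of "\<lambda>k. s < node \<gamma> k", OF ex])
  have kle: "k \<le> steps \<gamma>" unfolding k_def by (rule Least_le[of "\<lambda>k. s < node \<gamma> k", OF ex])
  have "k \<noteq> 0" using k node_first[OF rules] s by (metis not_le)
  then obtain i where i: "k = Suc i" by (cases k) auto
  have "\<not> s < node \<gamma> i" using not_less_Least[of i "\<lambda>k. s < node \<gamma> k"] i unfolding k_def by simp
  then show ?thesis using k kle i by (intro exI[of _ i]) auto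
qed

text \<open>
  Backward induction over the nodes of the control: each of its steps is a step \<open>S\<close>
  of one parameter, and \<open>V\<close> is a supermartingale for all of them.
\<close>

lemma gain_le_V:
  assumes \<tau>: "\<tau> 0 = T" "\<And>i. r \<le> \<tau> i" "finite (range \<tau>)"
    and t: "r \<le> t" "t \<le> T" and Y: "Y \<in> cyl r \<tau> t" and \<gamma>: "\<gamma> \<in> adm"
    and s: "r \<le> s" "s \<le> t" and \<omega>: "\<omega> \<in> paths kd r T"
  shows "G s t Y \<gamma> \<omega> \<le> V Y t s \<omega>"
  using s \<omega>
proof (induction "card {i. i \<le> steps \<gamma> \<and> s < node \<gamma> i}" arbitrary: s \<omega> rule: less_induct)
  case less
  note rules = subset r0 \<gamma>
  have Yt: "Y \<in> bbm (F r t)" by (rule cyl_bbm[OF Y \<tau>(2) t(1)])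
  have YT: "Y \<in> bbm (F r T)" by (rule bbm_path_filt_mono[OF Yt t(2)])
  show ?case
  proof (cases "s = t")
    case True
    then show ?thesis using gain_end[OF \<gamma> t Yt less.prems(3)] V_end[OF \<tau> t Y] by simp
  next
    case False
    then have st: "s < t" using less.prems by simp
    have sT: "s < T" using st t by simp
    obtain i where i: "i < steps \<gamma>" "node \<gamma> i \<le> s" "s < node \<gamma> (Suc i)"
      using node_interval[OF \<gamma> less.prems(1) sT] by blast
    obtain j where j: "j \<in> idx \<gamma> i" "\<omega> \<in> cell \<gamma> i j"
      using cells(3)[OF rules i(1)] less.prems(3) by blast
    define v where "v = min (node \<gamma> (Suc i)) t"
    have v: "s < v" "v \<le> t" "r \<le> v" "v \<le> T" unfolding v_def using i st t less.prems by auto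
    have \<theta>: "param \<gamma> i j \<in> \<Theta>'" using cells(5)[OF rules i(1) j(1)] .
    have le: "G v t Y \<gamma> \<omega>' \<le> V Y t v \<omega>'" if w: "\<omega>' \<in> paths kd r T" for \<omega>'
    proof (cases "v = t")
      case True
      then show ?thesis using gain_end[OF \<gamma> t Yt w] V_end[OF \<tau> t Y] by simp
    next
      case False
      then have vu: "v = node \<gamma> (Suc i)" unfolding v_def by (auto simp: min_def split: if_splits)
      have "{k. k \<le> steps \<gamma> \<and> v < node \<gamma> k} \<subset> {k. k \<le> steps \<gamma> \<and> s < node \<gamma> k}"
      proof
        show "{k. k \<le> steps \<gamma> \<and> v < node \<gamma> k} \<subseteq> {k. k \<le> steps \<gamma> \<and> s < node \<gamma> k}" using v(1) by auto
        have "Suc i \<in> {k. k \<le> steps \<gamma> \<and> s < node \<gamma> k}" "Suc i \<notin> {k. k \<le> steps \<gamma> \<and> v < node \<gamma> k}"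
          using i vu by auto
        then show "{k. k \<le> steps \<gamma> \<and> v < node \<gamma> k} \<noteq> {k. k \<le> steps \<gamma> \<and> s < node \<gamma> k}" by blast
      qed
      then have "card {k. k \<le> steps \<gamma> \<and> v < node \<gamma> k} < card {k. k \<le> steps \<gamma> \<and> s < node \<gamma> k}"
        by (intro psubset_card_mono) auto
      then show ?thesis by (rule less.hyps) (use v w in auto)
    qed
    have "G s t Y \<gamma> \<omega> = S (param \<gamma> i j) s v (G v t Y \<gamma>) \<omega>"
      unfolding v_def by (rule gain_step[OF \<gamma> i st t(2) Yt less.prems(3) j])
    also have "\<dots> \<le> S (param \<gamma> i j) s v (V Y t v) \<omega>"
      by (rule S_mono[OF \<theta> less.prems(1) v(1,4) gain_bbm[OF \<gamma> v(3,2) t(2) YT] V_bbm[OF \<tau> t Y v(3,2)] le less.prems(3)])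
    also have "\<dots> \<le> V Y t s \<omega>" by (rule V_super[OF \<tau> t Y \<theta> less.prems(1) v(1,2) less.prems(3)])
    finally show ?thesis .
  qed
qed

end

section \<open>Optimal feedback strategies\<close>

text \<open>
  A choice that depends on the set alone, so that the same index denotes the same parameter for
  all initial times.
\<close>

definition enum_set :: "'a set \<Rightarrow> 'a list" where
  "enum_set J = (SOME xs. set xs = J)"

lemma set_enum_set: "finite J \<Longrightarrow> set (enum_set J) = J"
  unfolding enum_set_def by (rule someI_ex) (rule finite_list)

context penalized_family
begin

text \<open>
  The first maximizing parameter at time \<open>g\<close>. Indices start at 1, the only index of a
  control at its initial time.
\<close>

definition best :: "('n path \<Rightarrow> ereal) \<Rightarrow> real \<Rightarrow> ('n, 'e) bmap set \<Rightarrow> real set \<Rightarrow> real \<Rightarrow> 'n path \<Rightarrow> nat" where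
  "best Y t J D g \<omega> = (LEAST j. j \<in> {1..length (enum_set J)} \<and>
     S (enum_set J ! (j - 1)) g (next_node D t g) (val Y t J D (next_node D t g)) \<omega> = val Y t J D g \<omega>)"

lemma cyl_start:
  assumes "W \<in> cyl r \<tau> r" "\<And>i. r \<le> \<tau> i" "\<omega> \<in> paths kd r T" "\<omega>' \<in> paths kd r T" "\<omega> r = \<omega>' r"
  shows "W \<omega> = W \<omega>'"
proof -
  obtain f where f: "\<And>\<omega>. \<omega> \<in> paths kd r T \<Longrightarrow> W \<omega> = f (\<lambda>i. \<omega> (min (\<tau> i) r))"
    using cylE[OF assms(1)] by blast
  have "min (\<tau> i) r = r" for i using assms(2)[of i] by simp
  then show ?thesis using f assms(3-5) by simp
qed

context
  fixes \<tau> :: "nat \<Rightarrow> real" and t :: real and Y :: "'n path \<Rightarrow> ereal" and J D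
  assumes \<tau>: "\<tau> 0 = T" "\<And>i. r \<le> \<tau> i" "finite (range \<tau>)"
    and t: "r \<le> t" "t \<le> T" and Y: "Y \<in> cyl r \<tau> t" and JD: "(J, D) \<in> strategies"
begin

lemma strategy_parts: "J \<noteq> {}" "J \<subseteq> \<Theta>'" "finite D" "finite J"
  using JD unfolding strategies_def by auto

lemma enum_in: "j \<in> {1..length (enum_set J)} \<Longrightarrow> enum_set J ! (j - 1) \<in> \<Theta>'"
  using nth_mem[of "j - 1" "enum_set J"] set_enum_set[OF strategy_parts(4)] strategy_parts(2) by auto

lemma enum_nonempty: "0 < length (enum_set J)"
  using set_enum_set[OF strategy_parts(4)] strategy_parts(1) by auto

lemma best_cyl:
  assumes g: "r \<le> g" "g < t" and j: "j \<in> {1..length (enum_set J)}"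
  shows "S (enum_set J ! (j - 1)) g (next_node D t g) (val Y t J D (next_node D t g)) \<in> cyl r \<tau> g"
proof -
  note n = next_node[OF strategy_parts(3) g(2)]
  have "next_node D t g \<le> T" "r \<le> next_node D t g" using n(1,2) t g by auto
  then show ?thesis
    using S_cyl[OF enum_in[OF j] \<tau> g(1) n(1)] val_cyl[OF \<tau> t Y strategy_parts(1-3) _ n(2)] by blast
qed

lemma best:
  assumes g: "r \<le> g" "g < t" and \<omega>: "\<omega> \<in> paths kd r T"
  shows "best Y t J D g \<omega> \<in> {1..length (enum_set J)}"
    and "S (enum_set J ! (best Y t J D g \<omega> - 1)) g (next_node D t g) (val Y t J D (next_node D t g)) \<omega> = val Y t J D g \<omega>"
proof -
  let ?h = "next_node D t g"
  let ?f = "\<lambda>\<theta>. S \<theta> g ?h (val Y t J D ?h) \<omega>"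
  let ?Q = "\<lambda>j. j \<in> {1..length (enum_set J)} \<and> ?f (enum_set J ! (j - 1)) = val Y t J D g \<omega>"
  have "val Y t J D g \<omega> = Sup (?f ` J)"
    unfolding val_step[OF strategy_parts(3) g(2)] R_def ..
  also have "\<dots> = Max (?f ` J)" using strategy_parts by (intro Max_Sup[symmetric]) auto
  also have "\<dots> \<in> ?f ` J" using strategy_parts by (intro Max_in) auto
  finally obtain \<theta> where \<theta>: "\<theta> \<in> J" "val Y t J D g \<omega> = ?f \<theta>" by blast
  then obtain k where "k < length (enum_set J)" "enum_set J ! k = \<theta>"
    using set_enum_set[OF strategy_parts(4)] by (metis in_set_conv_nth)
  then have "?Q (Suc k)" using \<theta>(2) by auto
  then have "?Q (best Y t J D g \<omega>)" unfolding best_def by (rule LeastI[of ?Q])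
  then show "best Y t J D g \<omega> \<in> {1..length (enum_set J)}"
    "S (enum_set J ! (best Y t J D g \<omega> - 1)) g ?h (val Y t J D ?h) \<omega> = val Y t J D g \<omega>" by blast+
qed

text \<open>
  The first index for which two functions measurable for the past of \<open>g\<close> are equal.
\<close>

lemma best_measurable:
  assumes g: "r \<le> g" "g < t"
  shows "best Y t J D g \<in> measurable (F r g) (count_space UNIV)"
  unfolding best_def[abs_def]
proof (rule measurable_Least)
  fix j :: nat
  let ?f = "S (enum_set J ! (j - 1)) g (next_node D t g) (val Y t J D (next_node D t g))"
  have gt: "g \<le> t" using g by simp
  show "Measurable.pred (F r g) (\<lambda>\<omega>. j \<in> {1..length (enum_set J)} \<and> ?f \<omega> = val Y t J D g \<omega>)"
  proof (cases "j \<in> {1..length (enum_set J)}")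
    case True
    have "?f \<in> borel_measurable (F r g)"
      by (rule bbm_measurable[OF cyl_bbm[OF best_cyl[OF g True] \<tau>(2) g(1)]])
    moreover have "val Y t J D g \<in> borel_measurable (F r g)"
      by (rule bbm_measurable[OF cyl_bbm[OF val_cyl[OF \<tau> t Y strategy_parts(1-3) g(1) gt] \<tau>(2) g(1)]])
    ultimately have "{\<omega> \<in> space (F r g). ?f \<omega> = val Y t J D g \<omega>} \<in> sets (F r g)" by (rule borel_measurable_eq)
    then show ?thesis using True by (simp add: pred_def)
  next
    case False
    then have "(\<lambda>\<omega>. j \<in> {1..length (enum_set J)} \<and> ?f \<omega> = val Y t J D g \<omega>) = (\<lambda>_. False)" by blast
    then show ?thesis by simp
  qed
qed

lemma best_start:
  assumes "r < t" "\<omega> \<in> paths kd r T" "\<omega>' \<in> paths kd r T" "\<omega> r = \<omega>' r"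
  shows "best Y t J D r \<omega> = best Y t J D r \<omega>'"
proof -
  have v: "val Y t J D r \<omega> = val Y t J D r \<omega>'"
    by (rule cyl_start[OF val_cyl[OF \<tau> t Y strategy_parts(1-3) order_refl t(1)] \<tau>(2) assms(2-4)])
  have "(j \<in> {1..length (enum_set J)} \<and>
      S (enum_set J ! (j - 1)) r (next_node D t r) (val Y t J D (next_node D t r)) \<omega> = val Y t J D r \<omega>)
    = (j \<in> {1..length (enum_set J)} \<and>
      S (enum_set J ! (j - 1)) r (next_node D t r) (val Y t J D (next_node D t r)) \<omega>' = val Y t J D r \<omega>')" for j
    using cyl_start[OF best_cyl[OF order_refl assms(1)] \<tau>(2) assms(2-4)] v by auto
  then show ?thesis unfolding best_def by simp
qed

end

end

context penalty_setup
begin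

lemma Pi_eq_SUP_gain: "Pi_op kd T K \<Theta>' Z r y \<alpha> s t Y \<omega> = (SUP \<gamma>\<in>adm. G s t Y \<gamma> \<omega>)"
  unfolding Pi_op_def stable_set_def G_def by (simp add: image_image)

text \<open>
  The points \<open>r\<close> and \<open>T\<close> are the ends of the subdivision, and
  \<open>s\<close> and \<open>t\<close> delimit the part on which the parameters are optimized.
\<close>

definition strategy_nodes :: "real \<Rightarrow> real \<Rightarrow> real set \<Rightarrow> real set" where
  "strategy_nodes s t D = {d \<in> D. s < d \<and> d < t} \<union> {r, s, t, T}"

definition strategy_select ::
  "('n path \<Rightarrow> ereal) \<Rightarrow> real \<Rightarrow> ('n, 'e) bmap set \<Rightarrow> real set \<Rightarrow> real \<Rightarrow> real \<Rightarrow> 'n path \<Rightarrow> nat" where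
  "strategy_select Y t J D s g \<omega> = (if g \<noteq> r \<and> s \<le> g \<and> g < t then best Y t J D g \<omega> else 1)"

text \<open>
  At the initial time the parameter cannot depend on the path, and it is chosen for the paths
  issued from \<open>x\<close>. The last case is a default outside the range of indices.
\<close>

definition strategy_param ::
  "('n path \<Rightarrow> ereal) \<Rightarrow> real \<Rightarrow> ('n, 'e) bmap set \<Rightarrow> real set \<Rightarrow> real \<Rightarrow> real ^ 'n \<Rightarrow> real \<Rightarrow> nat \<Rightarrow> ('n, 'e) bmap" where
  "strategy_param Y t J D s x g j =
     (if g = r \<and> s = r \<and> r < t then enum_set J ! (best Y t J D r (\<lambda>u\<in>{r..T}. x) - 1)
      else if j \<in> {1..length (enum_set J)} then enum_set J ! (j - 1) else enum_set J ! 0)"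

text \<open>The subdivision ends at \<open>e\<close>, which is \<open>t\<close> or \<open>T\<close>.\<close>

definition strategy_control ::
  "('n path \<Rightarrow> ereal) \<Rightarrow> real \<Rightarrow> ('n, 'e) bmap set \<Rightarrow> real set \<Rightarrow> real \<Rightarrow> real ^ 'n \<Rightarrow> real \<Rightarrow> ('n, 'e) control" where
  "strategy_control Y t J D s x e = feedback_control kd T r e (strategy_nodes s t D) (length (enum_set J))
     (strategy_param Y t J D s x) (strategy_select Y t J D s)"

context
  fixes \<tau> :: "nat \<Rightarrow> real" and s t :: real and Y :: "'n path \<Rightarrow> ereal"
  assumes \<tau>: "\<tau> 0 = T" "\<And>i. r \<le> \<tau> i" "finite (range \<tau>)"
    and s: "r \<le> s" "s \<le> t" and t: "t \<le> T" and Y: "Y \<in> cyl r \<tau> t"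
begin

lemma r_le_t: "r \<le> t" using s by simp

lemmas Y_rules = \<tau> r_le_t t Y

lemma Y_bbm: "Y \<in> bbm (F r t)" "Y \<in> bbm (F r T)"
  using cyl_bbm[OF Y \<tau>(2) r_le_t] bbm_path_filt_mono[OF _ t] by blast+

context
  fixes J D assumes JD: "(J, D) \<in> strategies"
begin

lemma strategy_nodes:
  "finite (strategy_nodes s t D)" "r \<in> strategy_nodes s t D" "s \<in> strategy_nodes s t D"
  "t \<in> strategy_nodes s t D" "T \<in> strategy_nodes s t D" "strategy_nodes s t D \<subseteq> {..T}"
  using JD s t rT unfolding strategy_nodes_def strategies_def by auto

lemma strategy_param_in: "strategy_param Y t J D s x g j \<in> \<Theta>'"
proof -
  have "best Y t J D r (\<lambda>u\<in>{r..T}. x) \<in> {1..length (enum_set J)}" if "r < t"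
    by (rule best(1)[OF Y_rules JD order_refl that constant_in_paths])
  then show ?thesis
    unfolding strategy_param_def
    using enum_in[OF Y_rules JD] enum_in[OF Y_rules JD, of 1] enum_nonempty[OF Y_rules JD] by auto
qed

lemma strategy_control_in:
  assumes "e = t \<or> e = T"
  shows "strategy_control Y t J D s x e \<in> controls kd T \<Theta>' r e"
  unfolding strategy_control_def
proof (rule feedback_control_in_controls[OF r0 _ _ strategy_nodes(1,2) _ strategy_nodes(6) subset strategy_param_in])
  show "r \<le> e" "e \<le> T" "e \<in> strategy_nodes s t D" using assms r_le_t t rT strategy_nodes by auto
  fix d assume d: "d \<in> strategy_nodes s t D" "r \<le> d"
  show "strategy_select Y t J D s d \<in> measurable (F r d) (count_space UNIV)"
  proof (cases "d \<noteq> r \<and> s \<le> d \<and> d < t")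
    case True
    then have "strategy_select Y t J D s d = best Y t J D d" by (auto simp: strategy_select_def fun_eq_iff)
    then show ?thesis using best_measurable[OF Y_rules JD d(2)] True by simp
  next
    case False
    then have "strategy_select Y t J D s d = (\<lambda>_. 1)" by (auto simp: strategy_select_def fun_eq_iff)
    then show ?thesis by simp
  qed
  show "strategy_select Y t J D s d \<omega> \<in> {1..length (enum_set J)}" if "\<omega> \<in> paths kd r T" for \<omega>
  proof -
    have "1 \<le> length (enum_set J)" using enum_nonempty[OF Y_rules JD] by linarith
    then show ?thesis using best(1)[OF Y_rules JD d(2) _ that] unfolding strategy_select_def by simp
  qed
qed (simp add: strategy_select_def)

lemma strategy_control_proc_eq: "proc (strategy_control Y t J D s x e) = proc (strategy_control Y t J D s x e')"
  unfolding strategy_control_def feedback_control_def by (simp add: Let_def)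

lemma strategy_param_select:
  assumes g: "s \<le> g" "g < t" and \<omega>: "\<omega> \<in> paths_from kd T r x s"
  shows "strategy_param Y t J D s x g (strategy_select Y t J D s g \<omega>) = enum_set J ! (best Y t J D g \<omega> - 1)"
proof (cases "g = r")
  case True
  then have sr: "s = r" and rt: "r < t" using g s by auto
  then have "\<omega> r = x" "\<omega> \<in> paths kd r T" using \<omega> unfolding paths_from_def by auto
  then have "best Y t J D r (\<lambda>u\<in>{r..T}. x) = best Y t J D r \<omega>"
    using rT by (intro best_start[OF Y_rules JD rt constant_in_paths]) auto
  then show ?thesis unfolding strategy_param_def using True sr rt by simp
next
  case False
  have "\<omega> \<in> paths kd r T" using \<omega> unfolding paths_from_def by auto
  then have "best Y t J D g \<omega> \<in> {1..length (enum_set J)}"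
    using g s by (intro best(1)[OF Y_rules JD]) auto
  then show ?thesis using False g unfolding strategy_param_def strategy_select_def by simp
qed

text \<open>
  The process on \<open>[s,t[\<close> involves the initial time through the selected indices only.
\<close>

lemma strategy_control_proc:
  assumes u: "s \<le> u" "u < t" and \<omega>: "\<omega> \<in> paths_from kd T r x s"
  defines "g \<equiv> Max {d \<in> insert s D. s \<le> d \<and> d \<le> u}"
  shows "proc (strategy_control Y t J D s x e) u \<omega> = (enum_set J ! (best Y t J D g \<omega> - 1)) (u, \<omega> u)"
proof -
  let ?A = "{d \<in> insert s D. s \<le> d \<and> d \<le> u}"
  have A: "finite ?A" "s \<in> ?A" using JD u unfolding strategies_def by auto
  have gA: "g \<in> ?A" unfolding g_def by (rule Max_in[OF A(1)]) (use A(2) in blast)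
  have g: "s \<le> g" "g < t" using gA u by auto
  have "Max {d \<in> strategy_nodes s t D. d \<le> u} = g"
  proof (rule Max_eqI)
    show "finite {d \<in> strategy_nodes s t D. d \<le> u}" using strategy_nodes(1) by simp
    show "g \<in> {d \<in> strategy_nodes s t D. d \<le> u}" using gA g unfolding strategy_nodes_def by auto
    fix d assume d: "d \<in> {d \<in> strategy_nodes s t D. d \<le> u}"
    show "d \<le> g"
    proof (cases "s < d")
      case True
      then have "d \<in> ?A" using d u s t unfolding strategy_nodes_def by auto
      then show ?thesis unfolding g_def by (rule Max_ge[OF A(1)])
    qed (use g in simp)
  qed
  then have "proc (strategy_control Y t J D s x e) u \<omega>
      = strategy_param Y t J D s x g (strategy_select Y t J D s g \<omega>) (u, \<omega> u)"
    unfolding strategy_control_def feedback_control_def feedback_process_def by (simp add: Let_def)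
  then show ?thesis using strategy_param_select[OF g \<omega>] by simp
qed

lemma strategy_gain_step:
  assumes g: "g \<in> strategy_nodes s t D" "s \<le> g" "g < t" and \<omega>: "\<omega> \<in> paths kd r T"
  shows "G g t Y (strategy_control Y t J D s x T) \<omega>
    = S (strategy_param Y t J D s x g (strategy_select Y t J D s g \<omega>)) g (next_node D t g)
        (G (next_node D t g) t Y (strategy_control Y t J D s x T)) \<omega>"
proof -
  let ?\<gamma> = "strategy_control Y t J D s x T" and ?h = "next_node D t g"
  have \<gamma>: "?\<gamma> \<in> adm" by (rule strategy_control_in) simp
  have D: "finite D" using JD unfolding strategies_def by simp
  note n = next_node[OF D g(3)]
  have hN: "?h \<in> strategy_nodes s t D" using n(1-3) g unfolding strategy_nodes_def by auto
  have gap: "?h \<le> d" if "d \<in> strategy_nodes s t D" "g < d" for d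
    using that n(2) n(4)[of d] g s t unfolding strategy_nodes_def by auto
  have rg: "r \<le> g" and hT: "?h \<le> T" using g s n(2) t by auto
  obtain i where i: "i < steps ?\<gamma>" "node ?\<gamma> i = g" "node ?\<gamma> (Suc i) = ?h"
    using feedback_control_consecutive[OF strategy_nodes(1) g(1) hN rg n(1) hT gap]
    unfolding strategy_control_def by blast
  obtain j where j: "j \<in> idx ?\<gamma> i" "\<omega> \<in> cell ?\<gamma> i j" using cells(3)[OF subset r0 \<gamma> i(1)] \<omega> by blast
  have j': "j = strategy_select Y t J D s g \<omega>" "param ?\<gamma> i j = strategy_param Y t J D s x g j"
    using j(2) i(2) unfolding strategy_control_def feedback_control_def by (auto simp: Let_def)
  have v: "min (node ?\<gamma> (Suc i)) t = ?h" using i(3) n(2) by simp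
  show ?thesis
    using gain_step[OF \<gamma> i(1) _ _ g(3) t Y_bbm(1) \<omega> j] i n(1) unfolding v j'(2) j'(1)[symmetric] by simp
qed

text \<open>
  Choosing a maximizing parameter at every node realizes the value of the finite problem. The
  initial time is left out, since the parameter followed there maximizes for one starting point
  only.
\<close>

lemma strategy_gain_node:
  assumes g: "g \<in> strategy_nodes s t D" "s \<le> g" "g \<le> t" "g = r \<Longrightarrow> g = t" and \<omega>: "\<omega> \<in> paths kd r T"
  shows "G g t Y (strategy_control Y t J D s x T) \<omega> = val Y t J D g \<omega>"
proof -
  let ?\<gamma> = "strategy_control Y t J D s x T"
  have \<gamma>: "?\<gamma> \<in> adm" by (rule strategy_control_in) simp
  have D: "finite D" using JD unfolding strategies_def by simp
  have "g \<in> strategy_nodes s t D \<longrightarrow> (g = r \<longrightarrow> g = t) \<longrightarrow> (\<forall>\<omega>\<in>paths kd r T. G g t Y ?\<gamma> \<omega> = val Y t J D g \<omega>)"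
    using D g(3)
  proof (induction rule: grid_induct)
    case terminal
    show ?case using gain_end[OF \<gamma> r_le_t t Y_bbm(1)] by (simp add: val_end)
  next
    case (step g')
    let ?h = "next_node D t g'"
    note n = next_node[OF D step(2)]
    have sg: "s \<le> g'" "r \<le> g'" "s < ?h" and hT: "?h \<le> T" using step(1) g(2) s n(1,2) t by auto
    show ?case
    proof (intro impI ballI)
      fix \<omega> :: "'n path" assume gN: "g' \<in> strategy_nodes s t D" and gr: "g' = r \<longrightarrow> g' = t" and \<omega>: "\<omega> \<in> paths kd r T"
      have hN: "?h \<in> strategy_nodes s t D" using n(1-3) sg unfolding strategy_nodes_def by auto
      have ih: "G ?h t Y ?\<gamma> \<omega>' = val Y t J D ?h \<omega>'" if "\<omega>' \<in> paths kd r T" for \<omega>'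
        using step(3) hN sg n(1) that by auto
      have g'r: "g' \<noteq> r" using gr step(2) by auto
      then have sel: "strategy_param Y t J D s x g' (strategy_select Y t J D s g' \<omega>) = enum_set J ! (best Y t J D g' \<omega> - 1)"
        using best(1)[OF Y_rules JD sg(2) step(2) \<omega>] sg step(2)
        unfolding strategy_param_def strategy_select_def by simp
      have "G g' t Y ?\<gamma> \<omega> = S (enum_set J ! (best Y t J D g' \<omega> - 1)) g' ?h (G ?h t Y ?\<gamma>) \<omega>"
        using strategy_gain_step[OF gN sg(1) step(2) \<omega>, of x] unfolding sel .
      also have "\<dots> = S (enum_set J ! (best Y t J D g' \<omega> - 1)) g' ?h (val Y t J D ?h) \<omega>"
        by (rule S_cong[OF enum_in[OF Y_rules JD best(1)[OF Y_rules JD sg(2) step(2) \<omega>]] sg(2) n(1) hT ih \<omega>])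
      also have "\<dots> = val Y t J D g' \<omega>" by (rule best(2)[OF Y_rules JD sg(2) step(2) \<omega>])
      finally show "G g' t Y ?\<gamma> \<omega> = val Y t J D g' \<omega>" .
    qed
  qed
  then show ?thesis using g \<omega> by blast
qed

lemma strategy_gain_start:
  assumes sr: "s = r" "r < t" and \<omega>: "\<omega> \<in> paths kd r T"
  shows "G r t Y (strategy_control Y t J D s x T) \<omega>
    = S (enum_set J ! (best Y t J D r (\<lambda>u\<in>{r..T}. x) - 1)) r (next_node D t r) (val Y t J D (next_node D t r)) \<omega>"
proof -
  let ?h = "next_node D t r" and ?\<theta> = "enum_set J ! (best Y t J D r (\<lambda>u\<in>{r..T}. x) - 1)"
  have D: "finite D" using JD unfolding strategies_def by simp
  note n = next_node[OF D sr(2)]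
  have hN: "?h \<in> strategy_nodes s t D" using n(1-3) sr unfolding strategy_nodes_def by auto
  have hT: "?h \<le> T" using n t by simp
  have \<theta>: "?\<theta> \<in> \<Theta>'"
    by (rule enum_in[OF Y_rules JD best(1)[OF Y_rules JD order_refl sr(2) constant_in_paths]])
  have "G r t Y (strategy_control Y t J D s x T) \<omega> = S ?\<theta> r ?h (G ?h t Y (strategy_control Y t J D s x T)) \<omega>"
    using strategy_gain_step[OF strategy_nodes(2) _ sr(2) \<omega>, of x] sr unfolding strategy_param_def by simp
  also have "\<dots> = S ?\<theta> r ?h (val Y t J D ?h) \<omega>"
    by (rule S_cong[OF \<theta> order_refl n(1) hT _ \<omega>]) (use strategy_gain_node[OF hN _ n(2)] n(1) sr in auto)
  finally show ?thesis .
qed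

lemma strategy_gain:
  assumes \<omega>: "\<omega> \<in> paths_from kd T r x s"
  shows "G s t Y (strategy_control Y t J D s x T) \<omega> = val Y t J D s \<omega>"
proof (cases "s = r \<and> r < t")
  case True
  have w: "\<omega> \<in> paths kd r T" "\<omega> r = x" using \<omega> True unfolding paths_from_def by auto
  have "best Y t J D r (\<lambda>u\<in>{r..T}. x) = best Y t J D r \<omega>"
    using True w rT by (intro best_start[OF Y_rules JD _ constant_in_paths]) auto
  then show ?thesis using strategy_gain_start[of \<omega> x] best(2)[OF Y_rules JD order_refl _ w(1)] True w by simp
next
  case False
  then show ?thesis
    using strategy_gain_node[OF strategy_nodes(3) order_refl s(2)] s \<omega> unfolding paths_from_def by auto
qed

text \<open>
  At the initial time all paths follow one parameter until the next node, so the gain is a step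
  \<open>S\<close> of this parameter; at later times it is the value of the finite problem.
\<close>

lemma strategy_gain_cyl: "G s t Y (strategy_control Y t J D s x T) \<in> cyl r \<tau> s"
proof (cases "s = r \<and> r < t")
  case True
  have "S (enum_set J ! (best Y t J D r (\<lambda>u\<in>{r..T}. x) - 1)) r (next_node D t r) (val Y t J D (next_node D t r)) \<in> cyl r \<tau> r"
    by (rule best_cyl[OF Y_rules JD order_refl _ best(1)[OF Y_rules JD order_refl _ constant_in_paths]]) (use True in auto)
  then show ?thesis using strategy_gain_start True by (auto elim: cyl_cong)
next
  case False
  have JD': "J \<noteq> {}" "J \<subseteq> \<Theta>'" "finite D" using JD unfolding strategies_def by auto
  have "G s t Y (strategy_control Y t J D s x T) \<omega> = val Y t J D s \<omega>" if "\<omega> \<in> paths kd r T" for \<omega>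
    using False by (intro strategy_gain_node[OF strategy_nodes(3) order_refl s(2) _ that]) (use s in auto)
  then show ?thesis by (rule cyl_cong[OF val_cyl[OF Y_rules JD' s]])
qed

end

text \<open>No control exceeds \<open>V\<close>, and every finite problem is solved by a control.\<close>

lemma Pi_eq_V:
  assumes \<omega>: "\<omega> \<in> paths kd r T"
  shows "Pi_op kd T K \<Theta>' Z r y \<alpha> s t Y \<omega> = V Y t s \<omega>"
proof (rule antisym)
  show "Pi_op kd T K \<Theta>' Z r y \<alpha> s t Y \<omega> \<le> V Y t s \<omega>"
    unfolding Pi_eq_SUP_gain by (rule SUP_least) (rule gain_le_V[OF Y_rules _ s \<omega>])
  have "val Y t J D s \<omega> \<le> Pi_op kd T K \<Theta>' Z r y \<alpha> s t Y \<omega>" if "(J, D) \<in> strategies" for J D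
  proof -
    have "\<omega> \<in> paths_from kd T r (\<omega> r) s" using \<omega> unfolding paths_from_def by simp
    then have "val Y t J D s \<omega> = G s t Y (strategy_control Y t J D s (\<omega> r) T) \<omega>"
      using strategy_gain[OF that] by simp
    also have "\<dots> \<le> Pi_op kd T K \<Theta>' Z r y \<alpha> s t Y \<omega>"
      unfolding Pi_eq_SUP_gain by (rule SUP_upper) (rule strategy_control_in[OF that], simp)
    finally show ?thesis .
  qed
  then show "V Y t s \<omega> \<le> Pi_op kd T K \<Theta>' Z r y \<alpha> s t Y \<omega>" unfolding V_def by (auto intro: SUP_least)
qed

lemma Pi_cyl: "Pi_op kd T K \<Theta>' Z r y \<alpha> s t Y \<in> cyl r \<tau> s"
  by (rule cyl_cong[OF V_cyl[OF Y_rules s] Pi_eq_V])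

lemma strategies_optimizing:
  assumes JD: "\<And>m::nat. (J m, D m) \<in> strategies"
    and inc: "\<And>m \<omega>. \<omega> \<in> paths kd r T \<Longrightarrow> val Y t (J m) (D m) s \<omega> \<le> val Y t (J (Suc m)) (D (Suc m)) s \<omega>"
    and sup: "\<And>\<omega>. \<omega> \<in> paths kd r T \<Longrightarrow> V Y t s \<omega> = (SUP m. val Y t (J m) (D m) s \<omega>)"
    and H: "cyl r \<tau> s \<subseteq> H r s"
  shows "optimizing_sequence kd T K \<Theta>' Z r y \<alpha> H s t Y x (\<lambda>m. strategy_control Y t (J m) (D m) s x T)"
  unfolding optimizing_sequence_def
proof (intro conjI allI ballI)
  fix m
  show "tagged kd T K Z r y (strategy_control Y t (J m) (D m) s x T) \<in> stable_set kd T K \<Theta>' Z r y"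
    by (rule tagged_in, rule strategy_control_in[OF JD]) simp
  have "strategy_control Y t (J m) (D m) s x t \<in> controls kd T \<Theta>' r t" by (rule strategy_control_in[OF JD]) simp
  then show "proc (strategy_control Y t (J m) (D m) s x T) \<in> proc ` controls kd T \<Theta>' r t"
    using strategy_control_proc_eq[OF JD] by blast
  show "gain kd T K Z r \<alpha> s t Y (tagged kd T K Z r y (strategy_control Y t (J m) (D m) s x T)) \<in> H r s"
    using strategy_gain_cyl[OF JD] H unfolding G_def by blast
next
  fix \<omega> assume \<omega>: "\<omega> \<in> paths_from kd T r x s"
  then have w: "\<omega> \<in> paths kd r T" unfolding paths_from_def by simp
  have eq: "gain kd T K Z r \<alpha> s t Y (tagged kd T K Z r y (strategy_control Y t (J m) (D m) s x T)) \<omega>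
      = val Y t (J m) (D m) s \<omega>" for m
    using strategy_gain[OF JD \<omega>] unfolding G_def .
  have i: "incseq (\<lambda>m. val Y t (J m) (D m) s \<omega>)" by (rule incseq_SucI) (rule inc[OF w])
  then show "incseq (\<lambda>m. gain kd T K Z r \<alpha> s t Y (tagged kd T K Z r y (strategy_control Y t (J m) (D m) s x T)) \<omega>)"
    unfolding eq .
  show "(\<lambda>m. gain kd T K Z r \<alpha> s t Y (tagged kd T K Z r y (strategy_control Y t (J m) (D m) s x T)) \<omega>)
      \<longlonglongrightarrow> Pi_op kd T K \<Theta>' Z r y \<alpha> s t Y \<omega>"
    unfolding eq Pi_eq_V[OF w] sup[OF w] by (rule LIMSEQ_SUP[OF i])
qed

lemma optimizing_sequence_exists:
  assumes "cyl r \<tau> s \<subseteq> H r s"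
  shows "\<exists>\<gamma>. optimizing_sequence kd T K \<Theta>' Z r y \<alpha> H s t Y x \<gamma>"
proof -
  obtain J D where JD: "\<And>m::nat. (J m, D m) \<in> strategies"
    "\<And>m \<omega>. \<omega> \<in> paths kd r T \<Longrightarrow> val Y t (J m) (D m) s \<omega> \<le> val Y t (J (Suc m)) (D (Suc m)) s \<omega>"
    "\<And>\<omega>. \<omega> \<in> paths kd r T \<Longrightarrow> V Y t s \<omega> = (SUP m. val Y t (J m) (D m) s \<omega>)"
    using V_sequence[OF Y_rules s] by blast
  have "optimizing_sequence kd T K \<Theta>' Z r y \<alpha> H s t Y x (\<lambda>m. strategy_control Y t (J m) (D m) s x T)"
    by (rule strategies_optimizing[of J D H x]) (fact JD assms)+
  then show ?thesis by blast
qed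

end

end

section \<open>Properties of the value operator\<close>

context penalty_setup
begin

context
  fixes s t assumes s: "r \<le> s" "s \<le> t" "t \<le> T"
begin

lemma gain_le_Pi: "\<gamma> \<in> adm \<Longrightarrow> G s t Y \<gamma> \<omega> \<le> Pi_op kd T K \<Theta>' Z r y \<alpha> s t Y \<omega>"
  unfolding Pi_eq_SUP_gain by (rule SUP_upper)

lemma Pi_mono:
  assumes "Y1 \<in> bbm (F r T)" "Y2 \<in> bbm (F r T)" "\<And>\<omega>. \<omega> \<in> paths kd r T \<Longrightarrow> Y1 \<omega> \<le> Y2 \<omega>" "\<omega> \<in> paths kd r T"
  shows "Pi_op kd T K \<Theta>' Z r y \<alpha> s t Y1 \<omega> \<le> Pi_op kd T K \<Theta>' Z r y \<alpha> s t Y2 \<omega>"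
  unfolding Pi_eq_SUP_gain G_eq
proof (rule SUP_mono)
  fix \<gamma> assume \<gamma>: "\<gamma> \<in> adm"
  have "cond r \<gamma> s Y1 \<omega> \<le> cond r \<gamma> s Y2 \<omega>"
    by (rule cond_mono[OF subset r0 \<gamma> assms(1,2,3) s(1) assms(4)])
  with \<gamma> show "\<exists>\<eta>\<in>adm. cond r \<gamma> s Y1 \<omega> - pen s t \<gamma> \<omega> \<le> cond r \<eta> s Y2 \<omega> - pen s t \<eta> \<omega>"
    by (blast intro: ereal_minus_mono)
qed

lemma Pi_cong:
  assumes "Y1 \<in> bbm (F r T)" "\<And>\<omega>. \<omega> \<in> paths kd r T \<Longrightarrow> Y2 \<omega> = Y1 \<omega>" "\<omega> \<in> paths kd r T"
  shows "Pi_op kd T K \<Theta>' Z r y \<alpha> s t Y2 \<omega> = Pi_op kd T K \<Theta>' Z r y \<alpha> s t Y1 \<omega>"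
  unfolding Pi_eq_SUP_gain G_eq
  by (rule SUP_cong[OF refl]) (simp add: cond_cong[OF subset r0 _ assms(1,2) s(1) assms(3)])

text \<open>The gain of a fixed control is affine in \<open>Y\<close>.\<close>

lemma Pi_convex:
  assumes Y: "Y1 \<in> bbm (F r T)" "Y2 \<in> bbm (F r T)" and l: "0 \<le> l" "l \<le> 1" and \<omega>: "\<omega> \<in> paths kd r T"
  shows "Pi_op kd T K \<Theta>' Z r y \<alpha> s t (\<lambda>\<omega>'. ereal l * Y1 \<omega>' + ereal (1 - l) * Y2 \<omega>') \<omega>
    \<le> ereal l * Pi_op kd T K \<Theta>' Z r y \<alpha> s t Y1 \<omega> + ereal (1 - l) * Pi_op kd T K \<Theta>' Z r y \<alpha> s t Y2 \<omega>"
  unfolding Pi_eq_SUP_gain[of s t "\<lambda>\<omega>'. ereal l * Y1 \<omega>' + ereal (1 - l) * Y2 \<omega>'"]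
proof (rule SUP_least)
  fix \<gamma> assume \<gamma>: "\<gamma> \<in> adm"
  have l': "0 \<le> 1 - l" using l by simp
  note rules = subset r0 \<gamma>
  have "cond r \<gamma> s (\<lambda>\<omega>'. ereal l * Y1 \<omega>' + ereal (1 - l) * Y2 \<omega>') \<omega>
      = ereal l * cond r \<gamma> s Y1 \<omega> + ereal (1 - l) * cond r \<gamma> s Y2 \<omega>"
    using cond_add[OF rules bbm_mult[OF Y(1) l(1)] bbm_mult[OF Y(2) l'] s(1) \<omega>]
      cond_mult[OF rules Y(1) l(1) s(1) \<omega>] cond_mult[OF rules Y(2) l' s(1) \<omega>] by simp
  moreover have "ereal l * a + ereal (1 - l) * b - p = ereal l * (a - p) + ereal (1 - l) * (b - p)"
    if "a \<noteq> - \<infinity>" "b \<noteq> - \<infinity>" "p \<noteq> \<infinity>" for a b p :: ereal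
  proof (cases "l = 0 \<or> l = 1")
    case True
    then show ?thesis by (auto simp: one_ereal_def[symmetric] zero_ereal_def[symmetric])
  next
    case False
    then have "0 < l" "l < 1" using l by auto
    then show ?thesis using that by (cases a; cases b; cases p) (auto simp: algebra_simps)
  qed
  moreover have "cond r \<gamma> s W \<omega> \<noteq> - \<infinity>" if W: "W \<in> bbm (F r T)" for W
  proof -
    obtain c where "\<And>\<omega>. \<omega> \<in> paths kd r T \<Longrightarrow> ereal c \<le> cond r \<gamma> s W \<omega>"
      using cond_bbm[OF rules W s(1)] unfolding bbm_def by auto
    from this[OF \<omega>] show ?thesis by auto
  qed
  ultimately have "G s t (\<lambda>\<omega>'. ereal l * Y1 \<omega>' + ereal (1 - l) * Y2 \<omega>') \<gamma> \<omega>
      = ereal l * G s t Y1 \<gamma> \<omega> + ereal (1 - l) * G s t Y2 \<gamma> \<omega>"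
    unfolding G_eq using Y pen_not_PInf[OF \<gamma> s \<omega>] by simp
  also have "\<dots> \<le> ereal l * Pi_op kd T K \<Theta>' Z r y \<alpha> s t Y1 \<omega> + ereal (1 - l) * Pi_op kd T K \<Theta>' Z r y \<alpha> s t Y2 \<omega>"
    using l l' by (intro add_mono ereal_mult_left_mono gain_le_Pi \<gamma>) auto
  finally show "G s t (\<lambda>\<omega>'. ereal l * Y1 \<omega>' + ereal (1 - l) * Y2 \<omega>') \<gamma> \<omega>
    \<le> ereal l * Pi_op kd T K \<Theta>' Z r y \<alpha> s t Y1 \<omega> + ereal (1 - l) * Pi_op kd T K \<Theta>' Z r y \<alpha> s t Y2 \<omega>" .
qed

text \<open>Monotone convergence holds for the gain of every control, and suprema commute.\<close>

lemma Pi_continuous_from_below: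
  assumes Ys: "\<And>m::nat. Ys m \<in> bbm (F r T)" and inc: "\<And>\<omega>. \<omega> \<in> paths kd r T \<Longrightarrow> incseq (\<lambda>m. Ys m \<omega>)"
    and lim: "\<And>\<omega>. \<omega> \<in> paths kd r T \<Longrightarrow> (\<lambda>m. Ys m \<omega>) \<longlonglongrightarrow> Y \<omega>" and \<omega>: "\<omega> \<in> paths kd r T"
  shows "incseq (\<lambda>m. Pi_op kd T K \<Theta>' Z r y \<alpha> s t (Ys m) \<omega>)"
    and "(\<lambda>m. Pi_op kd T K \<Theta>' Z r y \<alpha> s t (Ys m) \<omega>) \<longlonglongrightarrow> Pi_op kd T K \<Theta>' Z r y \<alpha> s t Y \<omega>"
proof -
  have step: "Ys m \<omega>' \<le> Ys (Suc m) \<omega>'" if "\<omega>' \<in> paths kd r T" for m \<omega>' using inc[OF that] by (rule incseq_SucD)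
  have YS: "Y \<omega>' = (SUP m. Ys m \<omega>')" if "\<omega>' \<in> paths kd r T" for \<omega>'
    using LIMSEQ_unique[OF lim[OF that] LIMSEQ_SUP[OF inc[OF that]]] .
  show i: "incseq (\<lambda>m. Pi_op kd T K \<Theta>' Z r y \<alpha> s t (Ys m) \<omega>)"
    by (rule incseq_SucI) (rule Pi_mono[OF Ys Ys step \<omega>])
  have "G s t Y \<gamma> \<omega> = (SUP m. G s t (Ys m) \<gamma> \<omega>)" if \<gamma>: "\<gamma> \<in> adm" for \<gamma>
  proof -
    note rules = subset r0 \<gamma>
    have "cond r \<gamma> s Y \<omega> = cond r \<gamma> s (\<lambda>\<omega>'. SUP m. Ys m \<omega>') \<omega>"
      by (rule cond_cong[OF rules bbm_SUP[OF Ys] YS s(1) \<omega>])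
    also have "\<dots> = (SUP m. cond r \<gamma> s (Ys m) \<omega>)" by (rule cond_SUP[OF rules _ _ s(1) \<omega>]) (use Ys step in auto)
    finally show ?thesis
      unfolding G_eq using pen_not_PInf[OF \<gamma> s \<omega>] by (simp add: SUP_ereal_minus_left)
  qed
  then have "Pi_op kd T K \<Theta>' Z r y \<alpha> s t Y \<omega> = (SUP \<gamma>\<in>adm. SUP m. G s t (Ys m) \<gamma> \<omega>)"
    unfolding Pi_eq_SUP_gain by (intro SUP_cong) auto
  also have "\<dots> = (SUP m. Pi_op kd T K \<Theta>' Z r y \<alpha> s t (Ys m) \<omega>)"
    unfolding Pi_eq_SUP_gain by (rule SUP_commute)
  finally show "(\<lambda>m. Pi_op kd T K \<Theta>' Z r y \<alpha> s t (Ys m) \<omega>) \<longlonglongrightarrow> Pi_op kd T K \<Theta>' Z r y \<alpha> s t Y \<omega>"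
    using LIMSEQ_SUP[OF i] by simp
qed

end

lemma Pi_dynamic_programming:
  assumes \<tau>: "\<tau> 0 = T" "\<And>i. r \<le> \<tau> i" "finite (range \<tau>)"
    and s: "r \<le> s" "s \<le> t" "t \<le> u" "u \<le> T" and Y: "Y \<in> cyl r \<tau> u" and \<omega>: "\<omega> \<in> paths kd r T"
  shows "Pi_op kd T K \<Theta>' Z r y \<alpha> s u Y \<omega>
    = Pi_op kd T K \<Theta>' Z r y \<alpha> s t (Pi_op kd T K \<Theta>' Z r y \<alpha> t u Y) \<omega>"
proof -
  have rt: "r \<le> t" and tT: "t \<le> T" and ru: "r \<le> u" and su: "s \<le> u" using s by auto
  have W: "V Y u t \<in> cyl r \<tau> t" by (rule V_cyl[OF \<tau> ru s(4) Y rt s(3)])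
  have "Pi_op kd T K \<Theta>' Z r y \<alpha> s u Y \<omega> = V Y u s \<omega>" by (rule Pi_eq_V[OF \<tau> s(1) su s(4) Y \<omega>])
  also have "\<dots> = V (V Y u t) t s \<omega>" by (rule V_dynamic_programming[OF \<tau> s Y \<omega>])
  also have "\<dots> = Pi_op kd T K \<Theta>' Z r y \<alpha> s t (V Y u t) \<omega>"
    by (rule Pi_eq_V[symmetric, OF \<tau> s(1,2) tT W \<omega>])
  also have "\<dots> = Pi_op kd T K \<Theta>' Z r y \<alpha> s t (Pi_op kd T K \<Theta>' Z r y \<alpha> t u Y) \<omega>"
    by (rule Pi_cong[symmetric, OF s(1,2) tT cyl_bbm_terminal[OF W \<tau>(2) rt tT] _ \<omega>])
       (rule Pi_eq_V[OF \<tau> rt s(3,4) Y])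
  finally show ?thesis .
qed

end

section \<open>The two classes of functions as cylinder functions\<close>

lemma lscb_compose_continuous_map:
  assumes "lsc_bounded_below X f" "continuous_map Y X h"
  shows "lsc_bounded_below Y (\<lambda>x. f (h x))"
proof -
  have h: "h x \<in> topspace X" if "x \<in> topspace Y" for x
    using assms(2) that by (auto simp: continuous_map_def)
  have "openin Y {x \<in> topspace Y. a < f (h x)}" for a
  proof -
    have "openin X {x \<in> topspace X. a < f x}" using assms(1) unfolding lsc_bounded_below_def by blast
    from openin_continuous_map_preimage[OF assms(2) this]
    show ?thesis by (rule back_subst[of "openin Y"]) (use h in auto)
  qed
  then show ?thesis using assms(1) h unfolding lsc_bounded_below_def by blast
qed

context martingale_family
begin

lemma L_hat_eq_cyl:
  assumes "u \<le> T"
  shows "L_hat kd T r u = cyl r (\<lambda>_. T) u"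
proof (intro equalityI subsetI)
  fix W :: "'n path \<Rightarrow> ereal" assume "W \<in> L_hat kd T r u"
  then obtain f where f: "lscb f" "\<forall>\<omega>\<in>paths kd r T. W \<omega> = f (\<omega> u)" unfolding L_hat_def by blast
  have "lscb (\<lambda>x::nat \<Rightarrow> real ^ 'n. f (x 0))" by (intro lscb_compose[OF f(1)] continuous_on_product_coordinates)
  then show "W \<in> cyl r (\<lambda>_. T) u"
    unfolding cyl_def using f(2) assms by (auto simp: min_absorb2 intro!: exI[of _ "\<lambda>x. f (x 0)"])
next
  fix W :: "'n path \<Rightarrow> ereal" assume "W \<in> cyl r (\<lambda>_. T) u"
  then obtain f where f: "lscb f" "\<And>\<omega>. \<omega> \<in> paths kd r T \<Longrightarrow> W \<omega> = f (\<lambda>i::nat. \<omega> (min T u))" by (rule cylE) blast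
  have "lscb (\<lambda>x::real ^ 'n. f (\<lambda>i. x))"
    by (intro lscb_compose[OF f(1)] continuous_on_coordinatewise_then_product continuous_intros)
  then show "W \<in> L_hat kd T r u"
    unfolding L_hat_def using f(2) assms by (auto simp: min_absorb2 intro!: exI[of _ "\<lambda>x. f (\<lambda>i. x)"])
qed

lemma position_cyl: "lscb f \<Longrightarrow> t \<le> T \<Longrightarrow> (\<lambda>\<omega>. f (\<omega> t)) \<in> cyl r (\<lambda>_. T) t"
  using L_hat_eq_cyl[of t r] unfolding L_hat_def by blast

lemma W_hat_in_cyl:
  assumes "Y \<in> W_hat kd T r t" "r \<le> t" "t \<le> T"
  obtains \<tau> where "\<tau> 0 = T" "\<And>i. r \<le> \<tau> i" "finite (range \<tau>)" "Y \<in> cyl r \<tau> t"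
proof -
  obtain k \<sigma> f where \<sigma>: "\<sigma> ` {..<k} \<subseteq> {r..t}" and f: "lsc_bounded_below (product_topology (\<lambda>_. euclidean) {..<k::nat}) f"
    and Y: "\<forall>\<omega>\<in>paths kd r T. Y \<omega> = f (\<lambda>i\<in>{..<k}. \<omega> (\<sigma> i))"
    using assms(1) unfolding W_hat_def by blast
  \<comment> \<open>The index 0 is reserved for the current position.\<close>
  define \<tau> where "\<tau> i = (if 1 \<le> i \<and> i \<le> k then \<sigma> (i - 1) else T)" for i
  have \<sigma>': "r \<le> \<sigma> i" "\<sigma> i \<le> t" if "i < k" for i using \<sigma> that by auto
  have "range \<tau> \<subseteq> insert T (\<sigma> ` {..<k})" unfolding \<tau>_def by auto
  then have fin: "finite (range \<tau>)" by (rule finite_subset) simp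
  have "continuous_map euclidean (product_topology (\<lambda>_. euclidean) {..<k}) (\<lambda>x::nat \<Rightarrow> real ^ 'n. \<lambda>i\<in>{..<k}. x (Suc i))"
    unfolding continuous_map_componentwise
    by (auto simp: continuous_map_iff_continuous2 intro!: continuous_on_product_coordinates)
  from lscb_compose_continuous_map[OF f this]
  have "lscb (\<lambda>x. f (\<lambda>i\<in>{..<k}. x (Suc i)))" .
  moreover have "Y \<omega> = f (\<lambda>i\<in>{..<k}. \<omega> (min (\<tau> (Suc i)) t))" if "\<omega> \<in> paths kd r T" for \<omega>
  proof -
    have "(\<lambda>i\<in>{..<k}. \<omega> (min (\<tau> (Suc i)) t)) = (\<lambda>i\<in>{..<k}. \<omega> (\<sigma> i))"
      using \<sigma>' by (auto simp: \<tau>_def min_absorb1 fun_eq_iff)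
    with Y that show ?thesis by simp
  qed
  ultimately have "Y \<in> cyl r \<tau> t"
    unfolding cyl_def mem_Collect_eq by (intro exI[of _ "\<lambda>x. f (\<lambda>i\<in>{..<k}. x (Suc i))"]) blast
  moreover have "r \<le> \<tau> i" for i using \<sigma>'(1)[of "i - 1"] assms(2,3) by (auto simp: \<tau>_def)
  ultimately show thesis using that[of \<tau>] fin by (simp add: \<tau>_def)
qed

lemma cyl_subset_W_hat:
  assumes \<tau>: "\<And>i. r \<le> \<tau> i" "finite (range \<tau>)" and u: "r \<le> u"
  shows "cyl r \<tau> u \<subseteq> W_hat kd T r u"
proof
  fix W :: "'n path \<Rightarrow> ereal" assume "W \<in> cyl r \<tau> u"
  then obtain f where f: "lscb f" and W: "\<And>\<omega>. \<omega> \<in> paths kd r T \<Longrightarrow> W \<omega> = f (\<lambda>i. \<omega> (min (\<tau> i) u))" by (rule cylE) blast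
  define A where "A = range (\<lambda>i. min (\<tau> i) u)"
  have "A = (\<lambda>v. min v u) ` range \<tau>" unfolding A_def by auto
  then have A: "finite A" using \<tau>(2) by simp
  define L where "L = sorted_list_of_set A"
  define k where "k = length L"
  have L: "set L = A" "sorted_wrt (<) L" unfolding L_def using A by auto
  have "\<forall>i. \<exists>j. j < k \<and> L ! j = min (\<tau> i) u"
    using L(1) unfolding k_def A_def by (metis in_set_conv_nth rangeI)
  \<comment> \<open>\<open>p i\<close> is the rank of the \<open>i\<close>-th observation time stopped at \<open>u\<close>.\<close>
  then obtain p where p: "\<And>i. p i < k" "\<And>i. L ! p i = min (\<tau> i) u" by metis
  have "continuous_map (product_topology (\<lambda>_. euclidean) {..<k}) (product_topology (\<lambda>_. euclidean) UNIV)
      (\<lambda>(x::nat \<Rightarrow> real ^ 'n) i. x (p i))"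
    unfolding continuous_map_componentwise_UNIV using p(1) by (auto intro!: continuous_map_product_projection)
  then have "continuous_map (product_topology (\<lambda>_. euclidean) {..<k}) euclidean (\<lambda>(x::nat \<Rightarrow> real ^ 'n) i. x (p i))"
    by (simp only: euclidean_product_topology)
  from lscb_compose_continuous_map[OF f this]
  have f': "lsc_bounded_below (product_topology (\<lambda>_. euclidean) {..<k}) (\<lambda>x. f (\<lambda>i. x (p i)))" .
  have "W \<omega> = f (\<lambda>i. (\<lambda>j\<in>{..<k}. \<omega> (L ! j)) (p i))" if "\<omega> \<in> paths kd r T" for \<omega>
    using W[OF that] p by simp
  moreover have "1 \<le> k" using p(1)[of 0] by simp
  moreover have "strict_mono_on {..<k} ((!) L)"
    using L(2) unfolding k_def by (auto simp: strict_mono_on_def sorted_wrt_iff_nth_less)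
  moreover have "(!) L ` {..<k} \<subseteq> {r..u}"
  proof -
    have "(!) L ` {..<k} \<subseteq> A" using L(1) unfolding k_def by auto
    also have "A \<subseteq> {r..u}" unfolding A_def using \<tau>(1) u by auto
    finally show ?thesis .
  qed
  ultimately show "W \<in> W_hat kd T r u"
    unfolding W_hat_def mem_Collect_eq using f'
    by (intro exI[of _ k] exI[of _ "(!) L"] exI[of _ "\<lambda>x. f (\<lambda>i. x (p i))"]) blast
qed

text \<open>
  A function of either class is a cylinder function for some observation times, and the cylinder
  functions for these times at all other times \<open>u\<close> stay in the class.
\<close>

lemma hat_class_cyl:
  assumes H: "H = W_hat kd T \<or> H = L_hat kd T" and Y: "Y \<in> H r t" and t: "r \<le> t" "t \<le> T"
  obtains \<tau> where "\<tau> 0 = T" "\<And>i. r \<le> \<tau> i" "finite (range \<tau>)" "Y \<in> cyl r \<tau> t"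
    "\<And>u. r \<le> u \<Longrightarrow> u \<le> T \<Longrightarrow> cyl r \<tau> u \<subseteq> H r u"
  using H
proof
  assume W: "H = W_hat kd T"
  obtain \<tau> where \<tau>: "\<tau> 0 = T" "\<And>i. r \<le> \<tau> i" "finite (range \<tau>)" "Y \<in> cyl r \<tau> t"
    using W_hat_in_cyl[OF Y[unfolded W] t] by blast
  from that[OF this] show thesis using cyl_subset_W_hat[OF \<tau>(2,3)] W by simp
next
  assume L: "H = L_hat kd T"
  show thesis by (rule that[of "\<lambda>_. T"]) (use Y t L L_hat_eq_cyl in auto)
qed

end

section \<open>Independence of the initial time\<close>

text \<open>
  For a function of the terminal position the finite problems after time \<open>r\<close> do not see the path
  before \<open>r\<close>: the problem started at an earlier time \<open>q\<close> has the same values and the same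
  maximizing parameters, read off the path after time \<open>r\<close>.
\<close>

context penalized_family
begin

context
  fixes q assumes q: "penalized_family kd T K \<Theta> Z \<Theta>' \<beta> q" "q \<le> r"
begin

interpretation q: penalized_family kd T K \<Theta> Z \<Theta>' \<beta> q by (rule q(1))

lemma S_change_base:
  assumes \<theta>: "\<theta> \<in> \<Theta>'" and g: "r \<le> g" "g < u" "u \<le> T" and \<omega>: "\<omega> \<in> paths kd q T"
    and W: "W \<in> bbm (F q T)" "W' \<in> bbm (F r T)"
    and WW: "\<And>\<omega>. \<omega> \<in> paths kd q T \<Longrightarrow> W \<omega> = W' (restrict \<omega> {r..T})"
  shows "penalized_family.S kd T K Z \<beta> q \<theta> g u W \<omega> = S \<theta> g u W' (restrict \<omega> {r..T})"
proof -
  have "\<theta> \<in> \<Theta>" "g < T" using \<theta> \<Theta>'_subset g by auto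
  from E_change_base[OF this(1) q.r_nonneg q(2) g(1) this(2) \<omega> W[THEN bbm_measurable] WW]
  show ?thesis using g unfolding q.S_def S_def by simp
qed

context
  fixes f :: "real ^ 'n \<Rightarrow> ereal" and t assumes f: "lscb f" and t: "r \<le> t" "t \<le> T"
begin

lemma val_change_base:
  assumes JD: "(J, D) \<in> strategies" and g: "r \<le> g" "g \<le> t" and \<omega>: "\<omega> \<in> paths kd q T"
  shows "penalized_family.val kd T K Z \<beta> q (\<lambda>\<omega>. f (\<omega> t)) t J D g \<omega>
    = val (\<lambda>\<omega>. f (\<omega> t)) t J D g (restrict \<omega> {r..T})"
proof -
  have J: "J \<noteq> {}" "J \<subseteq> \<Theta>'" and D: "finite D" using JD unfolding strategies_def by auto
  have qt: "q \<le> t" and rT: "r \<le> T" using q(2) t by auto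
  have "\<forall>\<omega>\<in>paths kd q T. q.val (\<lambda>\<omega>. f (\<omega> t)) t J D g \<omega> = val (\<lambda>\<omega>. f (\<omega> t)) t J D g (restrict \<omega> {r..T})"
    using D g(2)
  proof (induction rule: grid_induct)
    case terminal
    then show ?case using t by (simp add: q.val_end val_end)
  next
    case (step g')
    let ?h = "next_node D t g'"
    note n = next_node[OF D step(2)]
    have g': "r \<le> g'" "q \<le> g'" using step(1) g q(2) by auto
    have h: "r \<le> ?h" "q \<le> ?h" "?h \<le> T" using g' n(1,2) t by auto
    have W: "q.val (\<lambda>\<omega>. f (\<omega> t)) t J D ?h \<in> bbm (F q T)"
      by (rule q.val_bbm[OF refl _ _ qt t(2) position_cyl[OF f t(2)] J D h(2) n(2)]) (use rT q(2) in auto)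
    have W': "val (\<lambda>\<omega>. f (\<omega> t)) t J D ?h \<in> bbm (F r T)"
      by (rule val_bbm[OF refl _ _ t position_cyl[OF f t(2)] J D h(1) n(2)]) (use rT in auto)
    show ?case
    proof
      fix \<omega> :: "'n path" assume \<omega>: "\<omega> \<in> paths kd q T"
      have "q.S \<theta> g' ?h (q.val (\<lambda>\<omega>. f (\<omega> t)) t J D ?h) \<omega>
          = S \<theta> g' ?h (val (\<lambda>\<omega>. f (\<omega> t)) t J D ?h) (restrict \<omega> {r..T})" if "\<theta> \<in> J" for \<theta>
      proof (rule S_change_base[OF _ g'(1) n(1) h(3) \<omega> W W'])
        show "\<theta> \<in> \<Theta>'" using that J by blast
      qed (rule step(3)[rule_format])
      then show "q.val (\<lambda>\<omega>. f (\<omega> t)) t J D g' \<omega> = val (\<lambda>\<omega>. f (\<omega> t)) t J D g' (restrict \<omega> {r..T})"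
        unfolding q.val_step[OF D step(2)] val_step[OF D step(2)] q.R_def R_def by simp
    qed
  qed
  with \<omega> show ?thesis by blast
qed

lemma best_change_base:
  assumes JD: "(J, D) \<in> strategies" and g: "r \<le> g" "g < t" and \<omega>: "\<omega> \<in> paths kd q T"
  shows "penalized_family.best kd T K Z \<beta> q (\<lambda>\<omega>. f (\<omega> t)) t J D g \<omega>
    = best (\<lambda>\<omega>. f (\<omega> t)) t J D g (restrict \<omega> {r..T})"
proof -
  have J: "J \<noteq> {}" "J \<subseteq> \<Theta>'" and D: "finite D" and fJ: "finite J" using JD unfolding strategies_def by auto
  let ?h = "next_node D t g"
  note n = next_node[OF D g(2)]
  have qt: "q \<le> t" and rT: "r \<le> T" and gt: "g \<le> t" using q(2) t g by auto
  have h: "r \<le> ?h" "q \<le> ?h" "?h \<le> T" using g q(2) n(1,2) t by auto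
  have W: "q.val (\<lambda>\<omega>. f (\<omega> t)) t J D ?h \<in> bbm (F q T)"
    by (rule q.val_bbm[OF refl _ _ qt t(2) position_cyl[OF f t(2)] J D h(2) n(2)]) (use rT q(2) in auto)
  have W': "val (\<lambda>\<omega>. f (\<omega> t)) t J D ?h \<in> bbm (F r T)"
    by (rule val_bbm[OF refl _ _ t position_cyl[OF f t(2)] J D h(1) n(2)]) (use rT in auto)
  have S: "q.S (enum_set J ! (j - 1)) g ?h (q.val (\<lambda>\<omega>. f (\<omega> t)) t J D ?h) \<omega>
      = S (enum_set J ! (j - 1)) g ?h (val (\<lambda>\<omega>. f (\<omega> t)) t J D ?h) (restrict \<omega> {r..T})"
    if j: "j \<in> {1..length (enum_set J)}" for j
  proof (rule S_change_base[OF _ g(1) n(1) h(3) \<omega> W W'])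
    have "enum_set J ! (j - 1) \<in> set (enum_set J)" using j by (intro nth_mem) auto
    then show "enum_set J ! (j - 1) \<in> \<Theta>'" using set_enum_set[OF fJ] J by auto
  qed (rule val_change_base[OF JD h(1) n(2)])
  show ?thesis
    unfolding q.best_def best_def val_change_base[OF JD g(1) gt \<omega>]
    by (rule arg_cong[of _ _ Least], rule ext, rule conj_cong[OF refl]) (simp only: S)
qed

lemma V_change_base:
  assumes g: "r \<le> g" "g \<le> t" and \<omega>: "\<omega> \<in> paths kd q T"
  shows "penalized_family.V kd T K Z \<Theta>' \<beta> q (\<lambda>\<omega>. f (\<omega> t)) t g \<omega>
    = V (\<lambda>\<omega>. f (\<omega> t)) t g (restrict \<omega> {r..T})"
  unfolding q.V_def V_def
  by (rule SUP_cong[OF refl]) (use val_change_base[OF _ g \<omega>] in auto)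

end

end

text \<open>
  The finite problems are chosen once, for the initial time \<open>r\<close>, and \<open>g\<close>
  records the feedback rule of their maximizing parameters; started at any earlier time
  \<open>q\<close> the strategies of these problems follow the same rule.
\<close>

lemma common_optimizing_sequence:
  assumes f: "lscb f" and t: "r \<le> t" "t \<le> T"
  shows "\<exists>g :: nat \<Rightarrow> real \<Rightarrow> 'n path \<Rightarrow> 'e. \<forall>q \<alpha>. 0 \<le> q \<and> q \<le> r \<and> Feller_penalty_with kd T K \<Theta>' Z q y \<alpha> \<beta> \<longrightarrow>
    (\<forall>x. \<exists>\<gamma>. optimizing_sequence kd T K \<Theta>' Z q y \<alpha> (L_hat kd T) r t (\<lambda>\<omega>. f (\<omega> t)) x \<gamma> \<and>
       (\<forall>m. \<forall>u\<in>{r..<t}. \<forall>\<omega>\<in>paths_from kd T q x r. proc (\<gamma> m) u \<omega> = g m u (restrict \<omega> {r..T})))"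
proof -
  let ?Y = "\<lambda>\<omega>::'n path. f (\<omega> t)"
  have \<tau>: "r \<le> T" "finite (range (\<lambda>_::nat. T))" using t by auto
  obtain J D where JD: "\<And>m::nat. (J m, D m) \<in> strategies"
    and inc: "\<And>m \<omega>. \<omega> \<in> paths kd r T \<Longrightarrow> val ?Y t (J m) (D m) r \<omega> \<le> val ?Y t (J (Suc m)) (D (Suc m)) r \<omega>"
    and sup: "\<And>\<omega>. \<omega> \<in> paths kd r T \<Longrightarrow> V ?Y t r \<omega> = (SUP m. val ?Y t (J m) (D m) r \<omega>)"
    by (rule V_sequence[where \<tau> = "\<lambda>_. T", OF refl \<tau> t position_cyl[OF f t(2)] order_refl t(1)]) blast
  define node_before where "node_before m u = Max {d \<in> insert r (D m). r \<le> d \<and> d \<le> u}" for m u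
  define g where "g m u \<omega> = (enum_set (J m) ! (best ?Y t (J m) (D m) (node_before m u) \<omega> - 1)) (u, \<omega> u)"
    for m u and \<omega> :: "'n path"
  have node_before: "r \<le> node_before m u" "node_before m u < t" if "u \<in> {r..<t}" for m u
  proof -
    have "node_before m u \<in> {d \<in> insert r (D m). r \<le> d \<and> d \<le> u}"
      unfolding node_before_def
      by (rule Max_in) (use that JD[of m] in \<open>auto simp: strategies_def\<close>)
    with that show "r \<le> node_before m u" "node_before m u < t" by auto
  qed
  show ?thesis
  proof (intro exI[of _ g] allI impI)
    fix q \<alpha> x assume q: "0 \<le> q \<and> q \<le> r \<and> Feller_penalty_with kd T K \<Theta>' Z q y \<alpha> \<beta>"
    then have qr: "q \<le> r" by blast
    interpret q: penalty_setup kd T K \<Theta> Z \<Theta>' \<beta> q y \<alpha>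
      by unfold_locales (use q \<tau> \<Theta>'_subset \<Theta>'_nonempty in auto)
    have fam: "penalized_family kd T K \<Theta> Z \<Theta>' \<beta> q" by unfold_locales
    note base = val_change_base[OF fam qr f t JD order_refl t(1)]
    have restr: "restrict \<omega> {r..T} \<in> paths kd r T" if "\<omega> \<in> paths kd q T" for \<omega> :: "'n path"
      using restrict_in_paths[OF that qr order_refl] .
    have JDq: "(J m, D m) \<in> q.strategies" for m using JD unfolding q.strategies_def strategies_def .
    have qT: "\<And>i::nat. q \<le> T" using qr \<tau> by simp
    have "optimizing_sequence kd T K \<Theta>' Z q y \<alpha> (L_hat kd T) r t ?Y x
        (\<lambda>m. q.strategy_control ?Y t (J m) (D m) r x T)"
    proof (rule q.strategies_optimizing[where \<tau> = "\<lambda>_. T", OF refl qT \<tau>(2) qr t position_cyl[OF f t(2)]])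
      show "(J m, D m) \<in> q.strategies" for m by (rule JDq)
      fix \<omega> :: "'n path" assume \<omega>: "\<omega> \<in> paths kd q T"
      show "q.val ?Y t (J m) (D m) r \<omega> \<le> q.val ?Y t (J (Suc m)) (D (Suc m)) r \<omega>" for m
        unfolding base[OF \<omega>] by (rule inc[OF restr[OF \<omega>]])
      show "q.V ?Y t r \<omega> = (SUP m. q.val ?Y t (J m) (D m) r \<omega>)"
        unfolding base[OF \<omega>] V_change_base[OF fam qr f t order_refl t(1) \<omega>] by (rule sup[OF restr[OF \<omega>]])
    next
      show "cyl q (\<lambda>_. T) r \<subseteq> L_hat kd T q r"
        using L_hat_eq_cyl[OF \<tau>(1)] by simp
    qed
    moreover have "proc (q.strategy_control ?Y t (J m) (D m) r x T) u \<omega> = g m u (restrict \<omega> {r..T})"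
      if u: "u \<in> {r..<t}" and \<omega>: "\<omega> \<in> paths_from kd T q x r" for m u \<omega>
    proof -
      have u': "r \<le> u" "u < t" "u \<le> T" using u t by auto
      have \<omega>': "\<omega> \<in> paths kd q T" using \<omega> unfolding paths_from_def by simp
      show ?thesis
        unfolding g_def node_before_def
          q.strategy_control_proc[where \<tau> = "\<lambda>_. T", OF refl qT \<tau>(2) qr t position_cyl[OF f t(2)] JDq u'(1,2) \<omega>]
          best_change_base[OF fam qr f t JD node_before[OF u, unfolded node_before_def] \<omega>']
        using u' by simp
    qed
    ultimately show "\<exists>\<gamma>. optimizing_sequence kd T K \<Theta>' Z q y \<alpha> (L_hat kd T) r t ?Y x \<gamma> \<and>
       (\<forall>m. \<forall>u\<in>{r..<t}. \<forall>\<omega>\<in>paths_from kd T q x r. proc (\<gamma> m) u \<omega> = g m u (restrict \<omega> {r..T}))"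
      by blast
  qed
qed

end

section \<open>Lower semicontinuity, dynamic programming and optimal controls\<close>

theorem theorem6p6:
  fixes kd :: path_kind and T r s t :: real and y :: "real ^ 'n::finite"
    and K :: "'k set"
    and \<Theta> :: "('n, 'e::{topological_space, zero}) bmap set"
    and Z :: "('n, 'e) bmap \<Rightarrow> ('k, 'n) mart_problem"
    and \<Gamma> :: "real \<times> (real ^ 'n) \<Rightarrow> 'e set"
    and \<alpha> :: "('n, 'e) penalty_family"
    and H :: "real \<Rightarrow> real \<Rightarrow> ('n path \<Rightarrow> ereal) set"
  defines "\<Theta>\<Gamma> \<equiv> Theta_of \<Theta> \<Gamma>"
  defines "\<Psi> \<equiv> Pi_op kd T K \<Theta>\<Gamma> Z r y \<alpha>"
  assumes "0 < T" and "0 \<le> r" and "r \<le> s" and "s \<le> t" and "t \<le> T"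
    and "Theta_hypothesis kd T K \<Theta> Z"
    and "Feller_property kd T K \<Theta> Z"
    and "multivalued_Borel \<Gamma>"
    and "\<Theta>\<Gamma> \<noteq> {}"
    and "Feller_penalty kd T K \<Theta>\<Gamma> Z r y \<alpha>"
    and "H = W_hat kd T \<or> H = L_hat kd T"
  \<comment> \<open>Last conjunct: one sequence \<open>g\<close> of processes on \<open>[s,t[\<close>, functions of the path on
    \<open>[s,T]\<close>, serves all initial times \<open>q \<le> s\<close>, for penalties sharing the same \<open>\<beta>\<close>.\<close>
  shows
    "(\<forall>Y\<in>H r t. \<Psi> s t Y \<in> H r s \<and>
       (\<forall>x. \<exists>\<gamma>. optimizing_sequence kd T K \<Theta>\<Gamma> Z r y \<alpha> H s t Y x \<gamma>)) \<and>
     (\<forall>Y\<in>H r t. \<Psi> s t Y \<in> H r s) \<and>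
      (\<forall>Y1\<in>H r t. \<forall>Y2\<in>H r t. \<forall>l\<in>{0..1}. \<forall>\<omega>\<in>paths kd r T.
         \<Psi> s t (\<lambda>\<omega>'. ereal l * Y1 \<omega>' + ereal (1 - l) * Y2 \<omega>') \<omega>
           \<le> ereal l * \<Psi> s t Y1 \<omega> + ereal (1 - l) * \<Psi> s t Y2 \<omega>) \<and>
      (\<forall>Y1\<in>H r t. \<forall>Y2\<in>H r t. (\<forall>\<omega>\<in>paths kd r T. Y1 \<omega> \<le> Y2 \<omega>) \<longrightarrow>
         (\<forall>\<omega>\<in>paths kd r T. \<Psi> s t Y1 \<omega> \<le> \<Psi> s t Y2 \<omega>)) \<and>
      (\<forall>Ys. \<forall>Y\<in>H r t. (\<forall>m::nat. Ys m \<in> H r t) \<and>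
         (\<forall>\<omega>\<in>paths kd r T. incseq (\<lambda>m. Ys m \<omega>) \<and> (\<lambda>m. Ys m \<omega>) \<longlonglongrightarrow> Y \<omega>) \<longrightarrow>
         (\<forall>\<omega>\<in>paths kd r T. incseq (\<lambda>m. \<Psi> s t (Ys m) \<omega>) \<and>
            (\<lambda>m. \<Psi> s t (Ys m) \<omega>) \<longlonglongrightarrow> \<Psi> s t Y \<omega>)) \<and>
     (\<forall>u. t \<le> u \<and> u \<le> T \<longrightarrow> (\<forall>Y\<in>H r u. \<forall>\<omega>\<in>paths kd r T.
      \<Psi> s u Y \<omega> = \<Psi> s t (\<Psi> t u Y) \<omega>)) \<and>
     (\<forall>\<alpha>' \<beta> f. (\<forall>q\<in>{0..s}. Feller_penalty_with kd T K \<Theta>\<Gamma> Z q y (\<alpha>' q) \<beta>) \<and>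
      lsc_bounded_below euclidean f \<longrightarrow>
      (\<exists>g :: nat \<Rightarrow> real \<Rightarrow> 'n path \<Rightarrow> 'e. \<forall>q\<in>{0..s}. \<forall>x. \<exists>\<gamma>.
         optimizing_sequence kd T K \<Theta>\<Gamma> Z q y (\<alpha>' q) (L_hat kd T) s t (\<lambda>\<omega>. f (\<omega> t)) x \<gamma> \<and>
         (\<forall>m. \<forall>u\<in>{s..<t}. \<forall>\<omega>\<in>paths_from kd T q x s.
            proc (\<gamma> m) u \<omega> = g m u (restrict \<omega> {s..T}))))"
proof -
  obtain \<beta> where \<beta>: "Feller_penalty_with kd T K \<Theta>\<Gamma> Z r y \<alpha> \<beta>"
    using assms(12) unfolding Feller_penalty_def by blast
  have sub: "\<Theta>\<Gamma> \<subseteq> \<Theta>" unfolding \<Theta>\<Gamma>_def Theta_of_def by blast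
  have T: "r \<le> t" "s \<le> T" "r \<le> T" using assms by auto
  interpret penalty_setup kd T K \<Theta> Z \<Theta>\<Gamma> \<beta> r y \<alpha>
    by unfold_locales (use assms \<beta> sub T in auto)
  note bounds = \<open>r \<le> s\<close> \<open>s \<le> t\<close> \<open>t \<le> T\<close>
  have rep: thesis
    if "Y \<in> H r u" "r \<le> u" "u \<le> T" "\<And>\<tau>. \<tau> 0 = T \<Longrightarrow> (\<And>i. r \<le> \<tau> i) \<Longrightarrow> finite (range \<tau>) \<Longrightarrow> Y \<in> cyl r \<tau> u \<Longrightarrow>
      (\<And>v. r \<le> v \<Longrightarrow> v \<le> T \<Longrightarrow> cyl r \<tau> v \<subseteq> H r v) \<Longrightarrow> thesis" for Y u thesis
    using hat_class_cyl[OF assms(13) that(1-3)] that(4) by blast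
  have bbm: "Y \<in> bbm (F r T)" if "Y \<in> H r t" for Y
    by (rule rep[OF that T(1) bounds(3)]) (rule cyl_bbm_terminal[OF _ _ T(1) bounds(3)])
  have value_in: "\<Psi> s t Y \<in> H r s" and optimal: "\<exists>\<gamma>. optimizing_sequence kd T K \<Theta>\<Gamma> Z r y \<alpha> H s t Y x \<gamma>"
    if Y: "Y \<in> H r t" for Y x
  proof (atomize(full), rule rep[OF Y T(1) bounds(3)])
    fix \<tau> :: "nat \<Rightarrow> real"
    assume \<tau>: "\<tau> 0 = T" "\<And>i. r \<le> \<tau> i" "finite (range \<tau>)" and c: "Y \<in> cyl r \<tau> t"
      and H: "\<And>v. r \<le> v \<Longrightarrow> v \<le> T \<Longrightarrow> cyl r \<tau> v \<subseteq> H r v"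
    note H = H[OF bounds(1) T(2)]
    show "\<Psi> s t Y \<in> H r s \<and> (\<exists>\<gamma>. optimizing_sequence kd T K \<Theta>\<Gamma> Z r y \<alpha> H s t Y x \<gamma>)"
      unfolding \<Psi>_def
      using Pi_cyl[OF \<tau> bounds c] H optimizing_sequence_exists[where H = H, OF \<tau> bounds c H] by blast
  qed
  have convex: "\<Psi> s t (\<lambda>\<omega>'. ereal l * Y1 \<omega>' + ereal (1 - l) * Y2 \<omega>') \<omega>
      \<le> ereal l * \<Psi> s t Y1 \<omega> + ereal (1 - l) * \<Psi> s t Y2 \<omega>"
    if "Y1 \<in> H r t" "Y2 \<in> H r t" "l \<in> {0..1}" "\<omega> \<in> paths kd r T" for Y1 Y2 l \<omega>
    unfolding \<Psi>_def by (rule Pi_convex[OF bounds bbm[OF that(1)] bbm[OF that(2)] _ _ that(4)]) (use that(3) in auto)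
  have monotone: "\<Psi> s t Y1 \<omega> \<le> \<Psi> s t Y2 \<omega>"
    if "Y1 \<in> H r t" "Y2 \<in> H r t" "\<forall>\<omega>\<in>paths kd r T. Y1 \<omega> \<le> Y2 \<omega>" "\<omega> \<in> paths kd r T" for Y1 Y2 \<omega>
    unfolding \<Psi>_def by (rule Pi_mono[OF bounds bbm[OF that(1)] bbm[OF that(2)] _ that(4)]) (use that(3) in auto)
  have continuous: "incseq (\<lambda>m. \<Psi> s t (Ys m) \<omega>) \<and> (\<lambda>m. \<Psi> s t (Ys m) \<omega>) \<longlonglongrightarrow> \<Psi> s t Y \<omega>"
    if Ys: "\<And>m::nat. Ys m \<in> H r t" and lim: "\<forall>\<omega>\<in>paths kd r T. incseq (\<lambda>m. Ys m \<omega>) \<and> (\<lambda>m. Ys m \<omega>) \<longlonglongrightarrow> Y \<omega>"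
      and \<omega>: "\<omega> \<in> paths kd r T" for Ys Y \<omega>
    unfolding \<Psi>_def
  proof
    show "incseq (\<lambda>m. Pi_op kd T K \<Theta>\<Gamma> Z r y \<alpha> s t (Ys m) \<omega>)"
      by (rule Pi_continuous_from_below(1)[OF bounds _ _ _ \<omega>, of Ys Y]) (use bbm[OF Ys] lim in auto)
    show "(\<lambda>m. Pi_op kd T K \<Theta>\<Gamma> Z r y \<alpha> s t (Ys m) \<omega>) \<longlonglongrightarrow> Pi_op kd T K \<Theta>\<Gamma> Z r y \<alpha> s t Y \<omega>"
      by (rule Pi_continuous_from_below(2)[OF bounds _ _ _ \<omega>, of Ys Y]) (use bbm[OF Ys] lim in auto)
  qed
  have semigroup: "\<Psi> s u Y \<omega> = \<Psi> s t (\<Psi> t u Y) \<omega>"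
    if u: "t \<le> u" "u \<le> T" and Y: "Y \<in> H r u" and \<omega>: "\<omega> \<in> paths kd r T" for u Y \<omega>
  proof -
    have "r \<le> u" using T(1) u by simp
    show ?thesis
      unfolding \<Psi>_def
      by (rule rep[OF Y \<open>r \<le> u\<close> u(2)]) (rule Pi_dynamic_programming[OF _ _ _ bounds(1,2) u _ \<omega>])
  qed
  have common: "\<exists>g :: nat \<Rightarrow> real \<Rightarrow> 'n path \<Rightarrow> 'e. \<forall>q\<in>{0..s}. \<forall>x. \<exists>\<gamma>.
         optimizing_sequence kd T K \<Theta>\<Gamma> Z q y (\<alpha>' q) (L_hat kd T) s t (\<lambda>\<omega>. f (\<omega> t)) x \<gamma> \<and>
         (\<forall>m. \<forall>u\<in>{s..<t}. \<forall>\<omega>\<in>paths_from kd T q x s.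
            proc (\<gamma> m) u \<omega> = g m u (restrict \<omega> {s..T}))"
    if \<alpha>': "\<forall>q\<in>{0..s}. Feller_penalty_with kd T K \<Theta>\<Gamma> Z q y (\<alpha>' q) \<beta>'" and f: "lscb f" for \<alpha>' \<beta>' f
  proof -
    have s0: "0 \<le> s" using assms by simp
    interpret base: penalty_setup kd T K \<Theta> Z \<Theta>\<Gamma> \<beta>' s y "\<alpha>' s"
      by unfold_locales (use \<alpha>' sub nonempty T s0 in auto)
    obtain g :: "nat \<Rightarrow> real \<Rightarrow> 'n path \<Rightarrow> 'e" where
      g: "\<forall>q \<alpha>. 0 \<le> q \<and> q \<le> s \<and> Feller_penalty_with kd T K \<Theta>\<Gamma> Z q y \<alpha> \<beta>' \<longrightarrow>
        (\<forall>x. \<exists>\<gamma>. optimizing_sequence kd T K \<Theta>\<Gamma> Z q y \<alpha> (L_hat kd T) s t (\<lambda>\<omega>. f (\<omega> t)) x \<gamma> \<and>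
          (\<forall>m. \<forall>u\<in>{s..<t}. \<forall>\<omega>\<in>paths_from kd T q x s. proc (\<gamma> m) u \<omega> = g m u (restrict \<omega> {s..T})))"
      using base.common_optimizing_sequence[OF f bounds(2,3)] by (rule exE)
    show ?thesis
    proof (intro exI[of _ g] ballI allI)
      fix q x assume "q \<in> {0..s}"
      with \<alpha>' have "0 \<le> q \<and> q \<le> s \<and> Feller_penalty_with kd T K \<Theta>\<Gamma> Z q y (\<alpha>' q) \<beta>'" by auto
      from g[rule_format, OF this, of x]
      show "\<exists>\<gamma>. optimizing_sequence kd T K \<Theta>\<Gamma> Z q y (\<alpha>' q) (L_hat kd T) s t (\<lambda>\<omega>. f (\<omega> t)) x \<gamma> \<and>
         (\<forall>m. \<forall>u\<in>{s..<t}. \<forall>\<omega>\<in>paths_from kd T q x s. proc (\<gamma> m) u \<omega> = g m u (restrict \<omega> {s..T}))" .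
    qed
  qed
  show ?thesis
    by (intro conjI ballI allI impI; (elim conjE)?)
       (rule value_in optimal convex monotone continuous[THEN conjunct1] continuous[THEN conjunct2] semigroup common; (assumption | blast))+
qed

end
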